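(* Let $\mathbf{C}$ and $\mathbf{D}$ be sets, and $\mathbf{f}:\mathbf{C}\to\mathbf{D}$ a map. The $4$-polygraph $\mathbf{PFonct}[\mathbf{f}]$ is $3$-convergent and the free $(4,2)$-category $\mathbf{PFonct}[\mathbf{f}]^{*(2)}$ is $3$-coherent.
   Context: **Higher categories and polygraphs.** All $n$-categories are strict and globular; $\star_i$ is composition along $i$-cells, written in diagrammatic order; a lower-dimensional cell occurring in a composite stands for its identity. An $(n,p)$-category is an $n$-category in which every $(i+1)$-cell is invertible for $\star_i$, for all $i\ge p$. An $n$-polygraph $\Sigma$ consists of sets $\Sigma_0,\dots,\Sigma_n$ of generating cells, where inductively $\Sigma_{k+1}$ comes with source and target maps into parallel $k$-cells of the free $k$-category $\Sigma_k^*$ generated by the generating cells of dimension $\le k$, and $\Sigma_{k+1}^*$ is obtained by freely adjoining $\Sigma_{k+1}$. The free $(n,p)$-category $\Sigma^{*(p)}$ generated by $\Sigma$ is obtained by adjoining moreover inverses of all generating cells of dimension $>p$. **Rewriting.** Let $\Sigma$ be a $4$-polygraph. For $2$-cells $u,v\in\Sigma_2^*$ write $u\to_3^* v$ if there is a $3$-cell $u\Rrightarrow v$ in $\Sigma_3^*$. $\Sigma$ is $3$-terminating if $\to_3^*$ is a well-founded (partial) ordering; it is $3$-confluent if for all $3$-cells $A,B\in\Sigma_3^*$ with the same source there are $A',B'\in\Sigma_3^*$ such that $A\star_2 A'$ and $B\star_2 B'$ are defined and have the same target; it is $3$-convergent if both hold. A $4$-category is $3$-coherent if for every pair $(f,g)$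 of parallel $3$-cells (same source, same target) there is a $4$-cell $f\to g$. **The $4$-polygraph $\mathbf{BiCat}[\mathbf{C}]$.** Its generating cells, for all $a,b,c,d,e\in\mathbf{C}$, are: Dimension 0: the elements of $\mathbf{C}$. Dimension 1: $e_{a,b}:a\to b$. Dimension 2: $m_{a,b,c}: e_{a,b}\star_0 e_{b,c}\Rightarrow e_{a,c}$ and $i_a: 1_a\Rightarrow e_{a,a}$. Dimension 3: $\alpha_{a,b,c,d}: (m_{a,b,c}\star_0 e_{c,d})\star_1 m_{a,c,d}\Rrightarrow (e_{a,b}\star_0 m_{b,c,d})\star_1 m_{a,b,d}$; $\lambda_{a,b}:(i_a\star_0 e_{a,b})\star_1 m_{a,a,b}\Rrightarrow e_{a,b}$; $\rho_{a,b}:(e_{a,b}\star_0 i_b)\star_1 m_{a,b,b}\Rrightarrow e_{a,b}$. Dimension 4: $\pi_{a,b,c,d,e}$ with source $$\big((\alpha_{a,b,c,d}\star_0 e_{d,e})\star_1 m_{a,d,e}\big)\star_2\big((e_{a,b}\star_0 m_{b,c,d}\star_0 e_{d,e})\star_1\alpha_{a,b,d,e}\big)\star_2\big((e_{a,b}\star_0\alpha_{b,c,d,e})\star_1 m_{a,b,e}\big)$$ and target $$\big((m_{a,b,c}\star_0 e_{c,d}\star_0 e_{d,e})\star_1\alpha_{a,c,d,e}\big)\star_2\big((e_{a,b}\star_0 e_{b,c}\star_0 m_{c,d,e})\star_1\alpha_{a,b,c,e}\big);$$ and $\kappa_{a,b,c}$ with source $\big((e_{a,b}\star_0 i_b\star_0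 e_{b,c})\star_1\alpha_{a,b,b,c}\big)\star_2\big((e_{a,b}\star_0\lambda_{b,c})\star_1 m_{a,b,c}\big)$ and target $(\rho_{a,b}\star_0 e_{b,c})\star_1 m_{a,b,c}$. **The $4$-polygraph $\mathbf{PFonct}[\mathbf{f}]$.** It contains the (disjoint) union of $\mathbf{BiCat}[\mathbf{C}]$ (generators $e,m,i,\alpha,\lambda,\rho,\pi,\kappa$) and $\mathbf{BiCat}[\mathbf{D}]$ (generators written $e',m',i',\alpha',\lambda',\rho',\pi',\kappa'$), together with the following generators, for all $a,b,c,d\in\mathbf{C}$. Write $fa$ for $\mathbf{f}(a)$. Dimension 1: $u_a:a\to fa$. Dimension 2: $\varphi_{a,b}: e_{a,b}\star_0 u_b\Rightarrow u_a\star_0 e'_{fa,fb}$. Dimension 3: $\mu_{a,b,c}:(m_{a,b,c}\star_0 u_c)\star_1\varphi_{a,c}\Rrightarrow (e_{a,b}\star_0\varphi_{b,c})\star_1(\varphi_{a,b}\star_0 e'_{fb,fc})\star_1(u_a\star_0 m'_{fa,fb,fc})$; $\nu_a:(i_a\star_0 u_a)\star_1\varphi_{a,a}\Rrightarrow u_a\star_0 i'_{fa}$. Dimension 4 (the orientation of these $4$-cells is immaterial, since they are inverted in the free $(4,2)$-category): - a $4$-cell with source $$\big((\alpha_{a,b,c,d}\star_0 u_d)\star_1\varphi_{a,d}\big)\star_2\big((e_{a,b}\star_0 m_{b,c,d}\star_0 u_d)\star_1\mu_{a,b,d}\big)\star_2\big((e_{a,b}\star_0\mu_{b,c,d})\star_1(\varphi_{a,b}\star_0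 e'_{fb,fd})\star_1(u_a\star_0 m'_{fa,fb,fd})\big)$$ and target $$\big((m_{a,b,c}\star_0 e_{c,d}\star_0 u_d)\star_1\mu_{a,c,d}\big)\star_2\big((e_{a,b}\star_0 e_{b,c}\star_0\varphi_{c,d})\star_1(\mu_{a,b,c}\star_0 e'_{fc,fd})\star_1(u_a\star_0 m'_{fa,fc,fd})\big)$$ $$\star_2\big((e_{a,b}\star_0 e_{b,c}\star_0\varphi_{c,d})\star_1(e_{a,b}\star_0\varphi_{b,c}\star_0 e'_{fc,fd})\star_1(\varphi_{a,b}\star_0 e'_{fb,fc}\star_0 e'_{fc,fd})\star_1(u_a\star_0\alpha'_{fa,fb,fc,fd})\big);$$ - a $4$-cell with source $$\big((e_{a,b}\star_0 i_b\star_0 u_b)\star_1\mu_{a,b,b}\big)\star_2\big((e_{a,b}\star_0\nu_b)\star_1(\varphi_{a,b}\star_0 e'_{fb,fb})\star_1(u_a\star_0 m'_{fa,fb,fb})\big)\star_2\big(\varphi_{a,b}\star_1(u_a\star_0\rho'_{fa,fb})\big)$$ and target $(\rho_{a,b}\star_0 u_b)\star_1\varphi_{a,b}$; - a $4$-cell with source $$\big((i_a\star_0 e_{a,b}\star_0 u_b)\star_1\mu_{a,a,b}\big)\star_2\big(\varphi_{a,b}\star_1(\nu_a\star_0 e'_{fa,fb})\star_1(u_a\star_0 m'_{fa,fa,fb})\big)\star_2\big(\varphi_{a,b}\star_1(u_a\star_0\lambda'_{fa,fb})\big)$$ and target $(\lambda_{a,b}\star_0 u_b)\star_1\varphi_{a,b}$.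 *)

theory Defs
  imports "HOL-Library.FuncSet"
begin

text \<open>
  Cells of free strict \<open>n\<close>-categories are classes of expressions. \<open>Gen k g\<close> is a generating
  \<open>k\<close>-cell, \<open>Inv k g\<close> its formal inverse for composition along \<open>(k - 1)\<close>-cells, \<open>Idt x\<close> the
  identity \<open>(k + 1)\<close>-cell of a \<open>k\<close>-cell \<open>x\<close>, and \<open>Cmp i x y\<close> the composite along \<open>i\<close>-cells,
  in diagrammatic order, of two cells of the same dimension.
\<close>

datatype 'g expr =
    Gen nat 'g
  | Inv nat 'g
  | Idt "'g expr"
  | Cmp nat "'g expr" "'g expr"

primrec cdim :: "'g expr \<Rightarrow> nat" where
  "cdim (Gen k g) = k"
| "cdim (Inv k g) = k"
| "cdim (Idt x) = Suc (cdim x)"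
| "cdim (Cmp i x y) = cdim x"

text \<open>\<open>gsrc S k\<close> and \<open>gtgt S k\<close> are only meaningful on \<open>gens S k\<close> with \<open>k > 0\<close>.\<close>

record 'g polygraph_data =
  gens :: "nat \<Rightarrow> 'g set"
  gsrc :: "nat \<Rightarrow> 'g \<Rightarrow> 'g expr"
  gtgt :: "nat \<Rightarrow> 'g \<Rightarrow> 'g expr"

primrec src :: "'g polygraph_data \<Rightarrow> 'g expr \<Rightarrow> 'g expr" where
  "src S (Gen k g) = gsrc S k g"
| "src S (Inv k g) = gtgt S k g"
| "src S (Idt x) = x"
| "src S (Cmp i x y) = (if Suc i = cdim x then src S x else Cmp i (src S x) (src S y))"

primrec tgt :: "'g polygraph_data \<Rightarrow> 'g expr \<Rightarrow> 'g expr" where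
  "tgt S (Gen k g) = gtgt S k g"
| "tgt S (Inv k g) = gsrc S k g"
| "tgt S (Idt x) = x"
| "tgt S (Cmp i x y) = (if Suc i = cdim x then tgt S y else Cmp i (tgt S x) (tgt S y))"

definition src_at :: "'g polygraph_data \<Rightarrow> nat \<Rightarrow> 'g expr \<Rightarrow> 'g expr" where
  "src_at S i x = (src S ^^ (cdim x - i)) x"

definition tgt_at :: "'g polygraph_data \<Rightarrow> nat \<Rightarrow> 'g expr \<Rightarrow> 'g expr" where
  "tgt_at S i x = (tgt S ^^ (cdim x - i)) x"

definition pad :: "nat \<Rightarrow> 'g expr \<Rightarrow> 'g expr" where
  "pad m x = (Idt ^^ m) x"

inductive cat_axiom :: "'g polygraph_data \<Rightarrow> 'g expr \<Rightarrow> 'g expr \<Rightarrow> bool" for S where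
  assoc: "cat_axiom S (Cmp i (Cmp i x y) z) (Cmp i x (Cmp i y z))"
| unit_left: "cat_axiom S (Cmp i (pad (cdim x - i) (src_at S i x)) x) x"
| unit_right: "cat_axiom S (Cmp i x (pad (cdim x - i) (tgt_at S i x))) x"
| exchange: "i < j \<Longrightarrow> cat_axiom S (Cmp i (Cmp j x y) (Cmp j z w)) (Cmp j (Cmp i x z) (Cmp i y w))"
| id_comp: "cat_axiom S (Idt (Cmp i x y)) (Cmp i (Idt x) (Idt y))"
| inverse_right: "cat_axiom S (Cmp k (Gen (Suc k) g) (Inv (Suc k) g)) (Idt (gsrc S (Suc k) g))"
| inverse_left: "cat_axiom S (Cmp k (Inv (Suc k) g) (Gen (Suc k) g)) (Idt (gtgt S (Suc k) g))"

text \<open>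
  \<open>cell S p x\<close>: \<open>x\<close> is a well-formed expression in which only generators of dimension \<open>> p\<close> are
  formally inverted. \<open>eqv S p\<close> is the least congruence on these containing the axioms of strict
  categories. The two are defined simultaneously since composability in dimension \<open>k\<close> is
  equality, i.e. \<open>eqv\<close>, in lower dimension. All rules for cells of dimension \<open>k\<close> involve
  only generators of dimension \<open>\<le> k\<close>.
\<close>

inductive cell :: "'g polygraph_data \<Rightarrow> nat \<Rightarrow> 'g expr \<Rightarrow> bool"
  and eqv :: "'g polygraph_data \<Rightarrow> nat \<Rightarrow> 'g expr \<Rightarrow> 'g expr \<Rightarrow> bool"
  for S p where
  cell_gen: "g \<in> gens S k \<Longrightarrow> cell S p (Gen k g)"
| cell_inv: "g \<in> gens S k \<Longrightarrow> p < k \<Longrightarrow> cell S p (Inv k g)"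
| cell_id: "cell S p x \<Longrightarrow> cell S p (Idt x)"
| cell_comp: "cell S p x \<Longrightarrow> cell S p y \<Longrightarrow> cdim x = cdim y \<Longrightarrow> i < cdim x \<Longrightarrow>
    eqv S p (tgt_at S i x) (src_at S i y) \<Longrightarrow> cell S p (Cmp i x y)"
| eqv_refl: "cell S p x \<Longrightarrow> eqv S p x x"
| eqv_sym: "eqv S p x y \<Longrightarrow> eqv S p y x"
| eqv_trans: "eqv S p x y \<Longrightarrow> eqv S p y z \<Longrightarrow> eqv S p x z"
| eqv_id: "eqv S p x y \<Longrightarrow> eqv S p (Idt x) (Idt y)"
| eqv_comp: "eqv S p x x' \<Longrightarrow> eqv S p y y' \<Longrightarrow> cell S p (Cmp i x y) \<Longrightarrow>
    cell S p (Cmp i x' y') \<Longrightarrow> eqv S p (Cmp i x y) (Cmp i x' y')"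
| eqv_axiom: "cat_axiom S x y \<Longrightarrow> cell S p x \<Longrightarrow> cell S p y \<Longrightarrow> eqv S p x y"

definition parallel :: "'g polygraph_data \<Rightarrow> nat \<Rightarrow> 'g expr \<Rightarrow> 'g expr \<Rightarrow> bool" where
  "parallel S p x y \<longleftrightarrow> cdim x = cdim y \<and>
    (0 < cdim x \<longrightarrow> eqv S p (src S x) (src S y) \<and> eqv S p (tgt S x) (tgt S y))"

definition well_typed :: "'g polygraph_data \<Rightarrow> nat \<Rightarrow> nat \<Rightarrow> bool" where
  "well_typed S p m \<longleftrightarrow> (\<forall>k<m. \<forall>g\<in>gens S (Suc k).
     cell S p (gsrc S (Suc k) g) \<and> cdim (gsrc S (Suc k) g) = k \<and>
     cell S p (gtgt S (Suc k) g) \<and> cdim (gtgt S (Suc k) g) = k \<and>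
     parallel S p (gsrc S (Suc k) g) (gtgt S (Suc k) g))"

text \<open>
  In dimension \<open>k \<le> n\<close> the expressions with \<open>cell S n\<close> contain no formal inverse, so
  they represent the cells of the free \<open>k\<close>-category on the generators of dimension \<open>\<le> k\<close>.
\<close>

definition polygraph :: "nat \<Rightarrow> 'g polygraph_data \<Rightarrow> bool" where
  "polygraph n S \<longleftrightarrow> (\<forall>k>n. gens S k = {}) \<and> well_typed S n n"

text \<open>
  Globular \<open>n\<close>-categories: \<open>source C k\<close> and \<open>target C k\<close> map \<open>(k + 1)\<close>-cells to \<open>k\<close>-cells,
  \<open>ident C k\<close> maps \<open>k\<close>-cells to \<open>(k + 1)\<close>-cells, and \<open>cmp C k i\<close> composes two \<open>k\<close>-cells along
  \<open>i\<close>-cells.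
\<close>

record 'x ncat =
  cells :: "nat \<Rightarrow> 'x set"
  source :: "nat \<Rightarrow> 'x \<Rightarrow> 'x"
  target :: "nat \<Rightarrow> 'x \<Rightarrow> 'x"
  ident :: "nat \<Rightarrow> 'x \<Rightarrow> 'x"
  cmp :: "nat \<Rightarrow> nat \<Rightarrow> 'x \<Rightarrow> 'x \<Rightarrow> 'x"

primrec isource :: "'x ncat \<Rightarrow> nat \<Rightarrow> nat \<Rightarrow> 'x \<Rightarrow> 'x" where
  "isource C i 0 x = x"
| "isource C i (Suc k) x = (if i \<le> k then isource C i k (source C k x) else x)"

primrec itarget :: "'x ncat \<Rightarrow> nat \<Rightarrow> nat \<Rightarrow> 'x \<Rightarrow> 'x" where
  "itarget C i 0 x = x"
| "itarget C i (Suc k) x = (if i \<le> k then itarget C i k (target C k x) else x)"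

primrec iident :: "'x ncat \<Rightarrow> nat \<Rightarrow> nat \<Rightarrow> 'x \<Rightarrow> 'x" where
  "iident C i 0 x = x"
| "iident C i (Suc k) x = (if i \<le> k then ident C k (iident C i k x) else x)"

definition composable :: "'x ncat \<Rightarrow> nat \<Rightarrow> nat \<Rightarrow> 'x \<Rightarrow> 'x \<Rightarrow> bool" where
  "composable C k i x y \<longleftrightarrow> i < k \<and> x \<in> cells C k \<and> y \<in> cells C k \<and> itarget C i k x = isource C i k y"

locale strict_ncategory =
  fixes n :: nat and C :: "'x ncat"
  assumes cells_dim: "x \<in> cells C k \<Longrightarrow> k \<le> n"
    and source_cell: "x \<in> cells C (Suc k) \<Longrightarrow> source C k x \<in> cells C k"
    and target_cell: "x \<in> cells C (Suc k) \<Longrightarrow> target C k x \<in> cells C k"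
    and globular_source: "x \<in> cells C (Suc (Suc k)) \<Longrightarrow>
      source C k (target C (Suc k) x) = source C k (source C (Suc k) x)"
    and globular_target: "x \<in> cells C (Suc (Suc k)) \<Longrightarrow>
      target C k (source C (Suc k) x) = target C k (target C (Suc k) x)"
    and ident_cell: "x \<in> cells C k \<Longrightarrow> k < n \<Longrightarrow> ident C k x \<in> cells C (Suc k)"
    and source_ident: "x \<in> cells C k \<Longrightarrow> k < n \<Longrightarrow> source C k (ident C k x) = x"
    and target_ident: "x \<in> cells C k \<Longrightarrow> k < n \<Longrightarrow> target C k (ident C k x) = x"
    and cmp_cell: "composable C k i x y \<Longrightarrow> cmp C k i x y \<in> cells C k"
    and source_cmp: "composable C (Suc k) i x y \<Longrightarrow> source C k (cmp C (Suc k) i x y) =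
      (if i = k then source C k x else cmp C k i (source C k x) (source C k y))"
    and target_cmp: "composable C (Suc k) i x y \<Longrightarrow> target C k (cmp C (Suc k) i x y) =
      (if i = k then target C k y else cmp C k i (target C k x) (target C k y))"
    and cmp_assoc: "composable C k i x y \<Longrightarrow> composable C k i y z \<Longrightarrow>
      cmp C k i (cmp C k i x y) z = cmp C k i x (cmp C k i y z)"
    and cmp_unit_left: "x \<in> cells C k \<Longrightarrow> i < k \<Longrightarrow>
      cmp C k i (iident C i k (isource C i k x)) x = x"
    and cmp_unit_right: "x \<in> cells C k \<Longrightarrow> i < k \<Longrightarrow>
      cmp C k i x (iident C i k (itarget C i k x)) = x"
    and cmp_exchange: "i < j \<Longrightarrow> composable C k j x y \<Longrightarrow> composable C k j z w \<Longrightarrow>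
      composable C k i x z \<Longrightarrow> composable C k i y w \<Longrightarrow>
      cmp C k i (cmp C k j x y) (cmp C k j z w) = cmp C k j (cmp C k i x z) (cmp C k i y w)"
    and ident_cmp: "composable C k i x y \<Longrightarrow> k < n \<Longrightarrow>
      ident C k (cmp C k i x y) = cmp C (Suc k) i (ident C k x) (ident C k y)"

locale np_category = strict_ncategory n C for n :: nat and C :: "'x ncat" +
  fixes p :: nat
  assumes invertible: "p \<le> k \<Longrightarrow> x \<in> cells C (Suc k) \<Longrightarrow>
    \<exists>y \<in> cells C (Suc k). source C k y = target C k x \<and> target C k y = source C k x \<and>
      cmp C (Suc k) k x y = ident C k (source C k x) \<and>
      cmp C (Suc k) k y x = ident C k (target C k x)"

definition eclass :: "'g polygraph_data \<Rightarrow> nat \<Rightarrow> 'g expr \<Rightarrow> 'g expr set" where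
  "eclass S p x = {y. eqv S p x y}"

text \<open>
  The operations are given on classes by representatives; for a polygraph \<open>S\<close> they are well
  defined and yield an \<open>(n, p)\<close>-category, see \<open>free_np_category\<close> below.
\<close>

definition free_npcat :: "nat \<Rightarrow> nat \<Rightarrow> 'g polygraph_data \<Rightarrow> 'g expr set ncat" where
  "free_npcat n p S = \<lparr>
     cells = (\<lambda>k. {eclass S p x |x. cell S p x \<and> cdim x = k \<and> k \<le> n}),
     source = (\<lambda>k X. \<Union>x\<in>X. eclass S p (src S x)),
     target = (\<lambda>k X. \<Union>x\<in>X. eclass S p (tgt S x)),
     ident = (\<lambda>k X. \<Union>x\<in>X. eclass S p (Idt x)),
     cmp = (\<lambda>k i X Y. \<Union>x\<in>X. \<Union>y\<in>Y. eclass S p (Cmp i x y)) \<rparr>"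

definition free_ncat :: "nat \<Rightarrow> 'g polygraph_data \<Rightarrow> 'g expr set ncat" where
  "free_ncat n S = free_npcat n n S"

definition rewrites3 :: "'g polygraph_data \<Rightarrow> ('g expr set \<times> 'g expr set) set" where
  "rewrites3 S = {(u, v). u \<in> cells (free_ncat 3 S) 2 \<and> v \<in> cells (free_ncat 3 S) 2 \<and>
     (\<exists>A \<in> cells (free_ncat 3 S) 3. source (free_ncat 3 S) 2 A = u \<and> target (free_ncat 3 S) 2 A = v)}"

text \<open>
  \<open>(u, v) \<in> rewrites3 S\<close> means \<open>u \<rightarrow>\<^sup>* v\<close>, read as \<open>u \<ge> v\<close>; the order is therefore the
  converse relation.
\<close>

definition three_terminating :: "'g polygraph_data \<Rightarrow> bool" where
  "three_terminating S \<longleftrightarrow>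
     partial_order_on (cells (free_ncat 3 S) 2) ((rewrites3 S)\<inverse>) \<and> wf ((rewrites3 S)\<inverse> - Id)"

definition three_confluent :: "'g polygraph_data \<Rightarrow> bool" where
  "three_confluent S \<longleftrightarrow> (let T = free_ncat 3 S in
     \<forall>A \<in> cells T 3. \<forall>B \<in> cells T 3. source T 2 A = source T 2 B \<longrightarrow>
       (\<exists>A' \<in> cells T 3. \<exists>B' \<in> cells T 3. composable T 3 2 A A' \<and> composable T 3 2 B B' \<and>
          target T 2 (cmp T 3 2 A A') = target T 2 (cmp T 3 2 B B')))"

definition three_convergent :: "'g polygraph_data \<Rightarrow> bool" where
  "three_convergent S \<longleftrightarrow> three_terminating S \<and> three_confluent S"

definition three_coherent :: "'x ncat \<Rightarrow> bool" where
  "three_coherent T \<longleftrightarrow> (\<forall>f \<in> cells T 3. \<forall>g \<in> cells T 3.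
     source T 2 f = source T 2 g \<and> target T 2 f = target T 2 g \<longrightarrow>
     (\<exists>h \<in> cells T 4. source T 3 h = f \<and> target T 3 h = g))"

text \<open>Composition in which a lower-dimensional cell stands for its iterated identity.\<close>

definition wcmp :: "nat \<Rightarrow> 'g expr \<Rightarrow> 'g expr \<Rightarrow> 'g expr" where
  "wcmp i x y = Cmp i (pad (cdim y - cdim x) x) (pad (cdim x - cdim y) y)"

abbreviation star0 (infixl "\<star>\<^sub>0" 75) where "x \<star>\<^sub>0 y \<equiv> wcmp 0 x y"
abbreviation star1 (infixl "\<star>\<^sub>1" 73) where "x \<star>\<^sub>1 y \<equiv> wcmp 1 x y"
abbreviation star2 (infixl "\<star>\<^sub>2" 71) where "x \<star>\<^sub>2 y \<equiv> wcmp 2 x y"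

datatype 'c bicat_gen =
    ObG 'c
  | EG 'c 'c
  | MG 'c 'c 'c
  | IG 'c
  | AlphaG 'c 'c 'c 'c
  | LambdaG 'c 'c
  | RhoG 'c 'c
  | PiG 'c 'c 'c 'c 'c
  | KappaG 'c 'c 'c

definition bicat_gens :: "'c set \<Rightarrow> nat \<Rightarrow> 'c bicat_gen set" where
  "bicat_gens C k =
    (if k = 0 then {ObG a |a. a \<in> C}
     else if k = 1 then {EG a b |a b. a \<in> C \<and> b \<in> C}
     else if k = 2 then {MG a b c |a b c. a \<in> C \<and> b \<in> C \<and> c \<in> C} \<union> {IG a |a. a \<in> C}
     else if k = 3 then
       {AlphaG a b c d |a b c d. a \<in> C \<and> b \<in> C \<and> c \<in> C \<and> d \<in> C} \<union>
       {LambdaG a b |a b. a \<in> C \<and> b \<in> C} \<union> {RhoG a b |a b. a \<in> C \<and> b \<in> C}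
     else if k = 4 then
       {PiG a b c d e |a b c d e. a \<in> C \<and> b \<in> C \<and> c \<in> C \<and> d \<in> C \<and> e \<in> C} \<union>
       {KappaG a b c |a b c. a \<in> C \<and> b \<in> C \<and> c \<in> C}
     else {})"

text \<open>
  The argument \<open>h\<close> embeds the generators of the bicategory polygraph into those of a larger
  polygraph.
\<close>

abbreviation "obj_c h a \<equiv> Gen 0 (h (ObG a))"
abbreviation "e_c h a b \<equiv> Gen 1 (h (EG a b))"
abbreviation "m_c h a b c \<equiv> Gen 2 (h (MG a b c))"
abbreviation "i_c h a \<equiv> Gen 2 (h (IG a))"
abbreviation "alpha_c h a b c d \<equiv> Gen 3 (h (AlphaG a b c d))"
abbreviation "lambda_c h a b \<equiv> Gen 3 (h (LambdaG a b))"
abbreviation "rho_c h a b \<equiv> Gen 3 (h (RhoG a b))"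

primrec bicat_src :: "('c bicat_gen \<Rightarrow> 'g) \<Rightarrow> 'c bicat_gen \<Rightarrow> 'g expr" where
  "bicat_src h (EG a b) = obj_c h a"
| "bicat_src h (MG a b c) = e_c h a b \<star>\<^sub>0 e_c h b c"
| "bicat_src h (IG a) = Idt (obj_c h a)"
| "bicat_src h (AlphaG a b c d) = (m_c h a b c \<star>\<^sub>0 e_c h c d) \<star>\<^sub>1 m_c h a c d"
| "bicat_src h (LambdaG a b) = (i_c h a \<star>\<^sub>0 e_c h a b) \<star>\<^sub>1 m_c h a a b"
| "bicat_src h (RhoG a b) = (e_c h a b \<star>\<^sub>0 i_c h b) \<star>\<^sub>1 m_c h a b b"
| "bicat_src h (PiG a b c d e) =
    ((alpha_c h a b c d \<star>\<^sub>0 e_c h d e) \<star>\<^sub>1 m_c h a d e) \<star>\<^sub>2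
    ((e_c h a b \<star>\<^sub>0 m_c h b c d \<star>\<^sub>0 e_c h d e) \<star>\<^sub>1 alpha_c h a b d e) \<star>\<^sub>2
    ((e_c h a b \<star>\<^sub>0 alpha_c h b c d e) \<star>\<^sub>1 m_c h a b e)"
| "bicat_src h (KappaG a b c) =
    ((e_c h a b \<star>\<^sub>0 i_c h b \<star>\<^sub>0 e_c h b c) \<star>\<^sub>1 alpha_c h a b b c) \<star>\<^sub>2
    ((e_c h a b \<star>\<^sub>0 lambda_c h b c) \<star>\<^sub>1 m_c h a b c)"

primrec bicat_tgt :: "('c bicat_gen \<Rightarrow> 'g) \<Rightarrow> 'c bicat_gen \<Rightarrow> 'g expr" where
  "bicat_tgt h (EG a b) = obj_c h b"
| "bicat_tgt h (MG a b c) = e_c h a c"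
| "bicat_tgt h (IG a) = e_c h a a"
| "bicat_tgt h (AlphaG a b c d) = (e_c h a b \<star>\<^sub>0 m_c h b c d) \<star>\<^sub>1 m_c h a b d"
| "bicat_tgt h (LambdaG a b) = Idt (e_c h a b)"
| "bicat_tgt h (RhoG a b) = Idt (e_c h a b)"
| "bicat_tgt h (PiG a b c d e) =
    ((m_c h a b c \<star>\<^sub>0 e_c h c d \<star>\<^sub>0 e_c h d e) \<star>\<^sub>1 alpha_c h a c d e) \<star>\<^sub>2
    ((e_c h a b \<star>\<^sub>0 e_c h b c \<star>\<^sub>0 m_c h c d e) \<star>\<^sub>1 alpha_c h a b c e)"
| "bicat_tgt h (KappaG a b c) = (rho_c h a b \<star>\<^sub>0 e_c h b c) \<star>\<^sub>1 m_c h a b c"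

definition BiCat :: "'c set \<Rightarrow> 'c bicat_gen polygraph_data" where
  "BiCat C = \<lparr> gens = bicat_gens C,
     gsrc = (\<lambda>k. bicat_src (\<lambda>g. g)), gtgt = (\<lambda>k. bicat_tgt (\<lambda>g. g)) \<rparr>"

text \<open>
  \<open>AlphaMuG\<close>, \<open>RhoMuG\<close> and \<open>LambdaMuG\<close> are the three coherence \<open>4\<close>-cells relating \<open>\<mu>\<close> and \<open>\<nu>\<close>
  to \<open>\<alpha>\<close>, \<open>\<rho>\<close> and \<open>\<lambda>\<close>.
\<close>

datatype ('c, 'd) pf_gen =
    InC "'c bicat_gen"
  | InD "'d bicat_gen"
  | UG 'c
  | PhiG 'c 'c
  | MuG 'c 'c 'c
  | NuG 'c
  | AlphaMuG 'c 'c 'c 'c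
  | RhoMuG 'c 'c
  | LambdaMuG 'c 'c

abbreviation "u_c a \<equiv> Gen 1 (UG a)"
abbreviation "phi_c a b \<equiv> Gen 2 (PhiG a b)"
abbreviation "mu_c a b c \<equiv> Gen 3 (MuG a b c)"
abbreviation "nu_c a \<equiv> Gen 3 (NuG a)"

primrec pf_src :: "('c \<Rightarrow> 'd) \<Rightarrow> ('c, 'd) pf_gen \<Rightarrow> ('c, 'd) pf_gen expr" where
  "pf_src f (InC g) = bicat_src InC g"
| "pf_src f (InD g) = bicat_src InD g"
| "pf_src f (UG a) = obj_c InC a"
| "pf_src f (PhiG a b) = e_c InC a b \<star>\<^sub>0 u_c b"
| "pf_src f (MuG a b c) = (m_c InC a b c \<star>\<^sub>0 u_c c) \<star>\<^sub>1 phi_c a c"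
| "pf_src f (NuG a) = (i_c InC a \<star>\<^sub>0 u_c a) \<star>\<^sub>1 phi_c a a"
| "pf_src f (AlphaMuG a b c d) =
    ((alpha_c InC a b c d \<star>\<^sub>0 u_c d) \<star>\<^sub>1 phi_c a d) \<star>\<^sub>2
    ((e_c InC a b \<star>\<^sub>0 m_c InC b c d \<star>\<^sub>0 u_c d) \<star>\<^sub>1 mu_c a b d) \<star>\<^sub>2
    ((e_c InC a b \<star>\<^sub>0 mu_c b c d) \<star>\<^sub>1 (phi_c a b \<star>\<^sub>0 e_c InD (f b) (f d))
      \<star>\<^sub>1 (u_c a \<star>\<^sub>0 m_c InD (f a) (f b) (f d)))"
| "pf_src f (RhoMuG a b) =
    ((e_c InC a b \<star>\<^sub>0 i_c InC b \<star>\<^sub>0 u_c b) \<star>\<^sub>1 mu_c a b b) \<star>\<^sub>2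
    ((e_c InC a b \<star>\<^sub>0 nu_c b) \<star>\<^sub>1 (phi_c a b \<star>\<^sub>0 e_c InD (f b) (f b))
      \<star>\<^sub>1 (u_c a \<star>\<^sub>0 m_c InD (f a) (f b) (f b))) \<star>\<^sub>2
    (phi_c a b \<star>\<^sub>1 (u_c a \<star>\<^sub>0 rho_c InD (f a) (f b)))"
| "pf_src f (LambdaMuG a b) =
    ((i_c InC a \<star>\<^sub>0 e_c InC a b \<star>\<^sub>0 u_c b) \<star>\<^sub>1 mu_c a a b) \<star>\<^sub>2
    (phi_c a b \<star>\<^sub>1 (nu_c a \<star>\<^sub>0 e_c InD (f a) (f b)) \<star>\<^sub>1 (u_c a \<star>\<^sub>0 m_c InD (f a) (f a) (f b))) \<star>\<^sub>2
    (phi_c a b \<star>\<^sub>1 (u_c a \<star>\<^sub>0 lambda_c InD (f a) (f b)))"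

primrec pf_tgt :: "('c \<Rightarrow> 'd) \<Rightarrow> ('c, 'd) pf_gen \<Rightarrow> ('c, 'd) pf_gen expr" where
  "pf_tgt f (InC g) = bicat_tgt InC g"
| "pf_tgt f (InD g) = bicat_tgt InD g"
| "pf_tgt f (UG a) = obj_c InD (f a)"
| "pf_tgt f (PhiG a b) = u_c a \<star>\<^sub>0 e_c InD (f a) (f b)"
| "pf_tgt f (MuG a b c) =
    (e_c InC a b \<star>\<^sub>0 phi_c b c) \<star>\<^sub>1 (phi_c a b \<star>\<^sub>0 e_c InD (f b) (f c)) \<star>\<^sub>1 (u_c a \<star>\<^sub>0 m_c InD (f a) (f b) (f c))"
| "pf_tgt f (NuG a) = u_c a \<star>\<^sub>0 i_c InD (f a)"
| "pf_tgt f (AlphaMuG a b c d) =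
    ((m_c InC a b c \<star>\<^sub>0 e_c InC c d \<star>\<^sub>0 u_c d) \<star>\<^sub>1 mu_c a c d) \<star>\<^sub>2
    ((e_c InC a b \<star>\<^sub>0 e_c InC b c \<star>\<^sub>0 phi_c c d) \<star>\<^sub>1 (mu_c a b c \<star>\<^sub>0 e_c InD (f c) (f d))
      \<star>\<^sub>1 (u_c a \<star>\<^sub>0 m_c InD (f a) (f c) (f d))) \<star>\<^sub>2
    ((e_c InC a b \<star>\<^sub>0 e_c InC b c \<star>\<^sub>0 phi_c c d) \<star>\<^sub>1 (e_c InC a b \<star>\<^sub>0 phi_c b c \<star>\<^sub>0 e_c InD (f c) (f d))
      \<star>\<^sub>1 (phi_c a b \<star>\<^sub>0 e_c InD (f b) (f c) \<star>\<^sub>0 e_c InD (f c) (f d))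
      \<star>\<^sub>1 (u_c a \<star>\<^sub>0 alpha_c InD (f a) (f b) (f c) (f d)))"
| "pf_tgt f (RhoMuG a b) = (rho_c InC a b \<star>\<^sub>0 u_c b) \<star>\<^sub>1 phi_c a b"
| "pf_tgt f (LambdaMuG a b) = (lambda_c InC a b \<star>\<^sub>0 u_c b) \<star>\<^sub>1 phi_c a b"

definition pf_new_gens :: "'c set \<Rightarrow> nat \<Rightarrow> ('c, 'd) pf_gen set" where
  "pf_new_gens C k =
    (if k = 1 then {UG a |a. a \<in> C}
     else if k = 2 then {PhiG a b |a b. a \<in> C \<and> b \<in> C}
     else if k = 3 then {MuG a b c |a b c. a \<in> C \<and> b \<in> C \<and> c \<in> C} \<union> {NuG a |a. a \<in> C}
     else if k = 4 then
       {AlphaMuG a b c d |a b c d. a \<in> C \<and> b \<in> C \<and> c \<in> C \<and> d \<in> C} \<union>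
       {RhoMuG a b |a b. a \<in> C \<and> b \<in> C} \<union> {LambdaMuG a b |a b. a \<in> C \<and> b \<in> C}
     else {})"

definition PFonct :: "'c set \<Rightarrow> 'd set \<Rightarrow> ('c \<Rightarrow> 'd) \<Rightarrow> ('c, 'd) pf_gen polygraph_data" where
  "PFonct C D f = \<lparr>
     gens = (\<lambda>k. InC ` gens (BiCat C) k \<union> InD ` gens (BiCat D) k \<union> pf_new_gens C k),
     gsrc = (\<lambda>k. pf_src f), gtgt = (\<lambda>k. pf_tgt f) \<rparr>"


inductive_cases cell_GenE: "cell S p (Gen k g)"
inductive_cases cell_InvE: "cell S p (Inv k g)"
inductive_cases cell_IdtE: "cell S p (Idt x)"
inductive_cases cell_CmpE: "cell S p (Cmp i x y)"

lemma cell_Gen_iff: "cell S p (Gen k g) \<longleftrightarrow> g \<in> gens S k"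
  by (auto intro: cell_gen elim: cell_GenE)
lemma cell_Idt_iff: "cell S p (Idt x) \<longleftrightarrow> cell S p x"
  by (auto intro: cell_id elim: cell_IdtE)
lemma cell_Cmp_iff: "cell S p (Cmp i x y) \<longleftrightarrow> cell S p x \<and> cell S p y \<and> cdim x = cdim y \<and>
    i < cdim x \<and> eqv S p (tgt_at S i x) (src_at S i y)"
  by (auto intro: cell_comp elim: cell_CmpE)

lemma cdim_pad [simp]: "cdim (pad m x) = m + cdim x"
  unfolding pad_def by (induction m) auto

lemma pad_0 [simp]: "pad 0 x = x" and pad_Suc [simp]: "pad (Suc m) x = Idt (pad m x)"
  by (auto simp: pad_def)

lemma src_at_ge [simp]: "cdim x \<le> i \<Longrightarrow> src_at S i x = x"
  and tgt_at_ge [simp]: "cdim x \<le> i \<Longrightarrow> tgt_at S i x = x"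
  by (auto simp: src_at_def tgt_at_def)

lemma src_at_step: "cdim (src S x) = cdim x - 1 \<Longrightarrow> i < cdim x \<Longrightarrow> src_at S i x = src_at S i (src S x)"
  unfolding src_at_def by (metis Suc_diff_Suc diff_commute diff_Suc_eq_diff_pred funpow_Suc_right o_apply)

lemma tgt_at_step: "cdim (tgt S x) = cdim x - 1 \<Longrightarrow> i < cdim x \<Longrightarrow> tgt_at S i x = tgt_at S i (tgt S x)"
  unfolding tgt_at_def by (metis Suc_diff_Suc diff_commute diff_Suc_eq_diff_pred funpow_Suc_right o_apply)

lemma cell_mono:
  shows "cell S p x \<Longrightarrow> q \<le> p \<Longrightarrow> cell S q x" and "eqv S p y z \<Longrightarrow> q \<le> p \<Longrightarrow> eqv S q y z"
  by (induction rule: cell_eqv.inducts) (auto intro: cell_eqv.intros)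

lemma well_typed_mono: "well_typed S p m \<Longrightarrow> q \<le> p \<Longrightarrow> l \<le> m \<Longrightarrow> well_typed S q l"
  unfolding well_typed_def parallel_def by (meson cell_mono order_less_le_trans)

lemma eqv_cellD: assumes "eqv S p x y" shows "cell S p x" and "cell S p y"
proof -
  have "(cell S p w \<longrightarrow> True) \<and> (eqv S p x y \<longrightarrow> cell S p x \<and> cell S p y)" for w
    by (induction rule: cell_eqv.induct) (auto intro: cell_eqv.intros)
  with assms show "cell S p x" and "cell S p y" by auto
qed

lemma cell_pad: "cell S p x \<Longrightarrow> cell S p (pad m x)"
  by (induction m) (auto intro: cell_id)
lemma eqv_pad: "eqv S p x y \<Longrightarrow> eqv S p (pad m x) (pad m y)"
  by (induction m) (auto intro: eqv_id)

lemma src_at_pad [simp]: "src_at S (cdim x) (pad m x) = x" and tgt_at_pad [simp]: "tgt_at S (cdim x) (pad m x) = x"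
proof -
  have "(src S ^^ m) (pad m x) = x" "(tgt S ^^ m) (pad m x) = x"
    by (induction m) (simp_all add: funpow_Suc_right del: funpow.simps)
  then show "src_at S (cdim x) (pad m x) = x" and "tgt_at S (cdim x) (pad m x) = x"
    by (auto simp: src_at_def tgt_at_def)
qed

definition good_cell :: "'g polygraph_data \<Rightarrow> nat \<Rightarrow> 'g expr \<Rightarrow> bool" where
  "good_cell S p x \<longleftrightarrow> (0 < cdim x \<longrightarrow>
     cell S p (src S x) \<and> Suc (cdim (src S x)) = cdim x \<and>
     cell S p (tgt S x) \<and> Suc (cdim (tgt S x)) = cdim x \<and>
     parallel S p (src S x) (tgt S x))"

definition good_eqv :: "'g polygraph_data \<Rightarrow> nat \<Rightarrow> 'g expr \<Rightarrow> 'g expr \<Rightarrow> bool" where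
  "good_eqv S p x y \<longleftrightarrow> cdim x = cdim y \<and>
     (0 < cdim x \<longrightarrow> eqv S p (src S x) (src S y) \<and> eqv S p (tgt S x) (tgt S y))"

lemma parallel_sym: "parallel S p x y \<Longrightarrow> parallel S p y x"
  unfolding parallel_def by (metis eqv_sym)

lemma parallel_trans: "parallel S p x y \<Longrightarrow> parallel S p y z \<Longrightarrow> parallel S p x z"
  unfolding parallel_def by (metis eqv_trans)

definition dims_ok :: "'g polygraph_data \<Rightarrow> bool" where
  "dims_ok S \<longleftrightarrow> (\<forall>k. \<forall>g\<in>gens S (Suc k). cdim (gsrc S (Suc k) g) = k \<and> cdim (gtgt S (Suc k) g) = k)"

lemma boundary_aux:
  assumes wt: "well_typed S p m" and dims: "dims_ok S"
  shows "d \<le> m \<Longrightarrow> (\<forall>x. cell S p x \<longrightarrow> cdim x = d \<longrightarrow> good_cell S p x) \<and>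
     (\<forall>x y. eqv S p x y \<longrightarrow> cdim x = d \<or> cdim y = d \<longrightarrow> good_eqv S p x y)"
proof (induction d rule: less_induct)
  case (less d)
  have IHc: "good_cell S p x" if "cell S p x" "cdim x < d" for x
    using less.IH[of "cdim x"] less.prems that by auto
  have IHe: "good_eqv S p x y" if "eqv S p x y" "cdim x < d \<or> cdim y < d" for x y
    using less.IH[of "cdim x"] less.IH[of "cdim y"] less.prems that by auto
  have at_aux: "cdim y = cdim x \<and> cell S p (src_at S i x) \<and> cell S p (tgt_at S i x) \<and>
      cdim (src_at S i x) = i \<and> cdim (tgt_at S i x) = i \<and>
      eqv S p (src_at S i x) (src_at S i y) \<and> eqv S p (tgt_at S i x) (tgt_at S i y)"
    if "eqv S p x y" "i \<le> cdim x" "cdim x = e" "e < d" for x y i e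
    using that
  proof (induction e arbitrary: x y)
    case 0
    then show ?case using IHe[of x y] eqv_cellD[of S p x y] by (auto simp: good_eqv_def)
  next
    case (Suc e)
    note c = eqv_cellD[OF Suc.prems(1)]
    have dy: "cdim y = Suc e" using IHe[OF Suc.prems(1)] Suc.prems by (auto simp: good_eqv_def)
    show ?case
    proof (cases "i = Suc e")
      case True
      then show ?thesis using c dy Suc.prems by auto
    next
      case False
      then have i: "i \<le> e" using Suc.prems by auto
      have gx: "good_cell S p x" "good_cell S p y" using IHc c dy Suc.prems by auto
      have ge: "good_eqv S p x y" using IHe Suc.prems by auto
      have s: "src_at S i x = src_at S i (src S x)" "src_at S i y = src_at S i (src S y)"
        "tgt_at S i x = tgt_at S i (tgt S x)" "tgt_at S i y = tgt_at S i (tgt S y)"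
        using gx dy Suc.prems i by (auto simp: good_cell_def intro!: src_at_step tgt_at_step)
      show ?thesis unfolding s
        using Suc.IH[of "src S x" "src S y"] Suc.IH[of "tgt S x" "tgt S y"] ge gx Suc.prems i dy
        by (auto simp: good_eqv_def good_cell_def)
    qed
  qed
  have at_src: "src_at S i x = src_at S i (src S x)" "src_at S i (tgt S x) = src_at S i (tgt S x)"
    if "good_cell S p x" "i < cdim x" for x i
    using that by (auto simp: good_cell_def intro!: src_at_step)
  have at_tgt: "tgt_at S i x = tgt_at S i (tgt S x)"
    if "good_cell S p x" "i < cdim x" for x i
    using that by (auto simp: good_cell_def intro!: tgt_at_step)
  have glob: "eqv S p (src_at S i (src S x)) (src_at S i (tgt S x)) \<and>
     eqv S p (tgt_at S i (src S x)) (tgt_at S i (tgt S x))"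
    if g: "good_cell S p x" and d: "cdim x \<le> d" and i: "Suc i < cdim x" for x i
  proof -
    have par: "parallel S p (src S x) (tgt S x)" and c: "cell S p (src S x)" "cell S p (tgt S x)"
      and dm: "Suc (cdim (src S x)) = cdim x" "Suc (cdim (tgt S x)) = cdim x"
      using g i by (auto simp: good_cell_def)
    have gg: "good_cell S p (src S x)" "good_cell S p (tgt S x)" using IHc c dm d by auto
    have pe: "eqv S p (src S (src S x)) (src S (tgt S x))" "eqv S p (tgt S (src S x)) (tgt S (tgt S x))"
      using par dm i by (auto simp: parallel_def)
    have dm2: "Suc (cdim (src S (src S x))) = cdim (src S x)" "Suc (cdim (tgt S (src S x))) = cdim (src S x)"
      using gg dm i by (auto simp: good_cell_def)
    have s: "src_at S i (src S x) = src_at S i (src S (src S x))"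
       "src_at S i (tgt S x) = src_at S i (src S (tgt S x))"
       "tgt_at S i (src S x) = tgt_at S i (tgt S (src S x))"
       "tgt_at S i (tgt S x) = tgt_at S i (tgt S (tgt S x))"
      using at_src at_tgt gg dm i by auto
    show ?thesis unfolding s using at_aux[OF pe(1), of i] at_aux[OF pe(2), of i] dm dm2 d i by auto
  qed
  have main: "(cell S p w \<longrightarrow> cdim w = d \<longrightarrow> good_cell S p w) \<and>
      (eqv S p u v \<longrightarrow> cdim u = d \<or> cdim v = d \<longrightarrow> good_eqv S p u v)" for u v w
  proof (induction rule: cell_eqv.induct)
    case (cell_gen g k)
    then show ?case using wt less.prems
      by (cases k) (auto simp: well_typed_def good_cell_def)
  next
    case (cell_inv g k)
    then show ?case using wt less.prems
      by (cases k) (auto simp: well_typed_def good_cell_def parallel_sym)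
  next
    case (cell_id x)
    then show ?case by (auto simp: good_cell_def parallel_def intro!: eqv_refl
        dest!: IHc[of x])
  next
    case (cell_comp x y i)
    show ?case
    proof
      assume dC: "cdim (Cmp i x y) = d"
      then have dx: "cdim x = d" "cdim y = d" using cell_comp by auto
      with cell_comp have g: "good_cell S p x" "good_cell S p y" by auto
      have i: "i < d" using cell_comp dx by auto
      note gx = g(1)[unfolded good_cell_def] and gy = g(2)[unfolded good_cell_def]
      show "good_cell S p (Cmp i x y)"
      proof (cases "Suc i = d")
        case True
        have e: "eqv S p (tgt S x) (src S y)"
          using cell_comp True dx at_src[OF g(2), of i] at_tgt[OF g(1), of i] gx gy by auto
        have ge: "good_eqv S p (tgt S x) (src S y)" using IHe[OF e] gx dx i by auto
        have par: "parallel S p (src S x) (tgt S y)"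
        proof -
          have "parallel S p (src S x) (tgt S x)" "parallel S p (tgt S x) (src S y)" "parallel S p (src S y) (tgt S y)"
            using gx gy ge dx i by (auto simp: parallel_def good_eqv_def)
          then show ?thesis by (meson parallel_trans)
        qed
        show ?thesis using True dx gx gy par by (auto simp: good_cell_def)
      next
        case False
        then have i': "Suc i < d" using i by auto
        have e: "eqv S p (tgt_at S i (tgt S x)) (src_at S i (src S y))"
          using cell_comp dx i at_src[OF g(2), of i] at_tgt[OF g(1), of i] by auto
        have gl: "eqv S p (src_at S i (src S y)) (src_at S i (tgt S y))"
           "eqv S p (tgt_at S i (src S x)) (tgt_at S i (tgt S x))"
          using glob[OF g(1), of i] glob[OF g(2), of i] dx i' by auto
        have cs: "cell S p (Cmp i (src S x) (src S y))" "cell S p (Cmp i (tgt S x) (tgt S y))"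
          using gx gy dx i' e gl by (auto simp: cell_Cmp_iff intro: eqv_trans)
        have gg: "good_cell S p (src S x)" "good_cell S p (tgt S x)" "good_cell S p (src S y)" "good_cell S p (tgt S y)"
          using IHc gx gy dx i by auto
        have par: "parallel S p (Cmp i (src S x) (src S y)) (Cmp i (tgt S x) (tgt S y))"
        proof -
          have px: "eqv S p (src S (src S x)) (src S (tgt S x))" "eqv S p (tgt S (src S x)) (tgt S (tgt S x))"
            "eqv S p (src S (src S y)) (src S (tgt S y))" "eqv S p (tgt S (src S y)) (tgt S (tgt S y))"
            using gx gy dx i' unfolding parallel_def by auto
          have gc: "good_cell S p (Cmp i (src S x) (src S y))" "good_cell S p (Cmp i (tgt S x) (tgt S y))"
            using IHc cs gx gy dx i by auto
          show ?thesis using px gc gx gy dx i'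
            by (auto simp: parallel_def good_cell_def intro!: eqv_comp split: if_splits)
        qed
        show ?thesis using cs par gx gy dx i False by (auto simp: good_cell_def)
      qed
    qed
  next
    case (eqv_refl x)
    then show ?case by (auto simp: good_eqv_def good_cell_def intro: cell_eqv.eqv_refl)
  next
    case (eqv_sym x y)
    then show ?case by (auto simp: good_eqv_def intro: cell_eqv.eqv_sym)
  next
    case (eqv_trans x y z)
    have "good_eqv S p x z" if "good_eqv S p x y" "good_eqv S p y z"
      using that unfolding good_eqv_def by (metis cell_eqv.eqv_trans)
    moreover have "cdim x = cdim y" if "good_eqv S p x y" for x y
      using that by (simp add: good_eqv_def)
    ultimately show ?case using eqv_trans.IH by metis
  next
    case (eqv_id x y)
    then show ?case using IHe[of x y] by (auto simp: good_eqv_def)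
  next
    case (eqv_comp x x' y y' i)
    show ?case
    proof
      assume "cdim (Cmp i x y) = d \<or> cdim (Cmp i x' y') = d"
      then have dx: "cdim x = d \<or> cdim x' = d" by auto
      have dd: "cdim x = cdim y" "cdim x' = cdim y'" "i < cdim x" using eqv_comp by (auto simp: cell_Cmp_iff)
      have ge: "good_eqv S p x x'" "good_eqv S p y y'" using eqv_comp dx dd by auto
      then have dx: "cdim x = d" "cdim x' = d" "cdim y = d" "cdim y' = d" using dx dd by (auto simp: good_eqv_def)
      then have gc: "good_cell S p (Cmp i x y)" "good_cell S p (Cmp i x' y')" using eqv_comp by auto
      show "good_eqv S p (Cmp i x y) (Cmp i x' y')"
        using ge gc dx dd by (auto simp: good_eqv_def good_cell_def intro!: cell_eqv.eqv_comp split: if_splits)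
    qed
  next
    case (eqv_axiom l r)
    have two: "good_cell S p l \<and> cdim l = d \<or> good_cell S p r \<and> cdim r = d \<Longrightarrow> cdim l = cdim r \<Longrightarrow>
      good_cell S p l \<and> good_cell S p r \<and> cdim l = d \<and> cdim r = d"
      using eqv_axiom by auto
    show ?case
    proof
      assume D: "cdim l = d \<or> cdim r = d"
      from eqv_axiom(1) show "good_eqv S p l r"
      proof cases
        case (assoc i x y z)
        have dd: "cdim x = cdim y" "cdim y = cdim z" "i < cdim x" using eqv_axiom assoc by (auto simp: cell_Cmp_iff)
        then have g: "good_cell S p l" "good_cell S p r" "cdim x = d" using D eqv_axiom assoc by auto
        show ?thesis
          using g dd unfolding assoc by (auto simp: good_eqv_def good_cell_def intro!: cell_eqv.eqv_refl
              cell_eqv.eqv_axiom cat_axiom.assoc split: if_splits)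
      next
        case (unit_left i)
        have dd: "cdim (pad (cdim r - i) (src_at S i r)) = cdim r" "i < cdim r"
          using eqv_axiom unit_left by (auto simp: cell_Cmp_iff)
        then have D: "cdim r = d" using D unit_left by auto
        have g: "good_cell S p l" "good_cell S p r" using D dd eqv_axiom unit_left by auto
        note gr = g(2)[unfolded good_cell_def]
        show ?thesis
        proof (cases "Suc i = d")
          case True
          then have "cdim r - i = Suc 0" using D by auto
          then have *: "l = Cmp i (Idt (src S r)) r" 
            unfolding unit_left using at_src[OF g(2), of i] gr D True by auto
          show ?thesis using gr D True unfolding * by (auto simp: good_eqv_def intro!: cell_eqv.eqv_refl)
        next
          case False
          then obtain e where e: "cdim r - i = Suc e" and i': "Suc i < d" using dd D by (metis Suc_diff_Suc Suc_lessI)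
          let ?u = "src_at S i r"
          have l: "l = Cmp i (Idt (pad e ?u)) r" using unit_left e by auto
          have du: "cdim ?u = i" using dd e by auto
          have e0: "e \<noteq> 0" using e i' D by auto
          have es: "e = cdim (src S r) - i" "e = cdim (tgt S r) - i" using gr D e dd by auto
          have us: "src_at S i (src S r) = ?u" using at_src[OF g(2), of i] dd by auto
          have ut: "eqv S p (src_at S i (src S r)) (src_at S i (tgt S r))" using glob[OF g(2), of i] D i' by auto
          have cl: "cell S p (Cmp i (pad e ?u) (src S r))" "cell S p (Cmp i (pad e ?u) (tgt S r))"
            using g(1) D du dd False e e0 i' unfolding l by (auto simp: good_cell_def)
          have du2: "cdim (src_at S i (tgt S r)) = i"
            using at_aux[OF ut[unfolded us], of i] ut IHe[OF ut] du us i' by (auto simp: good_eqv_def)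
          have cu: "cell S p (src_at S i (tgt S r))" using ut eqv_cellD by blast
          have cr: "cell S p (Cmp i (pad e (src_at S i (tgt S r))) (tgt S r))"
            using cl(2) du du2 gr D cu dd e tgt_at_pad[of S "src_at S i (tgt S r)" e]
            by (auto simp: cell_Cmp_iff intro!: cell_pad cell_eqv.eqv_refl)
          have 1: "eqv S p (Cmp i (pad e ?u) (src S r)) (src S r)"
            using cat_axiom.unit_left[of S i "src S r"] cl gr D dd unfolding us es(1)[symmetric]
            by (auto intro!: cell_eqv.eqv_axiom)
          have "eqv S p (Cmp i (pad e (src_at S i (tgt S r))) (tgt S r)) (tgt S r)"
            using cat_axiom.unit_left[of S i "tgt S r"] cr gr D dd unfolding es(2)[symmetric]
            by (auto intro!: cell_eqv.eqv_axiom)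
          moreover have "eqv S p (Cmp i (pad e ?u) (tgt S r)) (Cmp i (pad e (src_at S i (tgt S r))) (tgt S r))"
            using ut cl cr gr D dd unfolding us by (auto intro!: cell_eqv.eqv_comp eqv_pad cell_eqv.eqv_refl)
          ultimately have 2: "eqv S p (Cmp i (pad e ?u) (tgt S r)) (tgt S r)" by (meson cell_eqv.eqv_trans)
          show ?thesis using 1 2 D du e e0 i' unfolding l by (auto simp: good_eqv_def)
        qed
      next
        case (unit_right i)
        have dd: "cdim (pad (cdim r - i) (tgt_at S i r)) = cdim r" "i < cdim r"
          using eqv_axiom unit_right by (auto simp: cell_Cmp_iff)
        then have D: "cdim r = d" using D unit_right by auto
        have g: "good_cell S p l" "good_cell S p r" using D dd eqv_axiom unit_right by auto
        note gr = g(2)[unfolded good_cell_def]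
        show ?thesis
        proof (cases "Suc i = d")
          case True
          then have "cdim r - i = Suc 0" using D by auto
          then have *: "l = Cmp i r (Idt (tgt S r))" 
            unfolding unit_right using at_tgt[OF g(2), of i] gr D True by auto
          show ?thesis using gr D True unfolding * by (auto simp: good_eqv_def intro!: cell_eqv.eqv_refl)
        next
          case False
          then obtain e where e: "cdim r - i = Suc e" and i': "Suc i < d" using dd D by (metis Suc_diff_Suc Suc_lessI)
          let ?u = "tgt_at S i r"
          have l: "l = Cmp i r (Idt (pad e ?u))" using unit_right e by auto
          have du: "cdim ?u = i" using dd e by auto
          have e0: "e \<noteq> 0" using e i' D by auto
          have es: "e = cdim (src S r) - i" "e = cdim (tgt S r) - i" using gr D e dd by auto
          have us: "tgt_at S i (tgt S r) = ?u" using at_tgt[OF g(2), of i] dd by auto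
          have ut: "eqv S p (tgt_at S i (tgt S r)) (tgt_at S i (src S r))"
            using glob[OF g(2), of i] D i' by (auto intro: cell_eqv.eqv_sym)
          have cl: "cell S p (Cmp i (tgt S r) (pad e ?u))" "cell S p (Cmp i (src S r) (pad e ?u))"
            using g(1) D du dd False e e0 i' unfolding l by (auto simp: good_cell_def)
          have du2: "cdim (tgt_at S i (src S r)) = i"
            using at_aux[OF ut[unfolded us], of i] ut IHe[OF ut] du us i' by (auto simp: good_eqv_def)
          have cu: "cell S p (tgt_at S i (src S r))" using ut eqv_cellD by blast
          have cr: "cell S p (Cmp i (src S r) (pad e (tgt_at S i (src S r))))"
            using cl(2) du du2 gr D cu dd e src_at_pad[of S "tgt_at S i (src S r)" e]
            by (auto simp: cell_Cmp_iff intro!: cell_pad cell_eqv.eqv_refl)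
          have 1: "eqv S p (Cmp i (tgt S r) (pad e ?u)) (tgt S r)"
            using cat_axiom.unit_right[of S i "tgt S r"] cl gr D dd unfolding us es(2)[symmetric]
            by (auto intro!: cell_eqv.eqv_axiom)
          have "eqv S p (Cmp i (src S r) (pad e (tgt_at S i (src S r)))) (src S r)"
            using cat_axiom.unit_right[of S i "src S r"] cr gr D dd unfolding es(1)[symmetric]
            by (auto intro!: cell_eqv.eqv_axiom)
          moreover have "eqv S p (Cmp i (src S r) (pad e ?u)) (Cmp i (src S r) (pad e (tgt_at S i (src S r))))"
            using ut cl cr gr D dd unfolding us by (auto intro!: cell_eqv.eqv_comp eqv_pad cell_eqv.eqv_refl)
          ultimately have 2: "eqv S p (Cmp i (src S r) (pad e ?u)) (src S r)" by (meson cell_eqv.eqv_trans)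
          show ?thesis using 1 2 D du e e0 i' unfolding l by (auto simp: good_eqv_def)
        qed
      next
        case (exchange i j x y z w)
        have dd: "cdim x = cdim y" "cdim y = cdim z" "cdim z = cdim w" "j < cdim x"
          using eqv_axiom exchange by (auto simp: cell_Cmp_iff)
        then have g: "good_cell S p l" "good_cell S p r" "cdim x = d" using D eqv_axiom exchange by auto
        show ?thesis
        proof (cases "Suc j = d")
          case True
          then have "i \<noteq> j" "Suc i \<noteq> d" using exchange(3) by simp_all
          then show ?thesis using True g dd unfolding exchange(1,2)
            by (simp add: good_eqv_def good_cell_def cell_eqv.eqv_refl)
        next
          case False
          then have "Suc i \<noteq> d" using exchange(3) g(3) dd by simp
          then show ?thesis using False g dd exchange(3) unfolding exchange(1,2)
            by (simp add: good_eqv_def good_cell_def cell_eqv.eqv_axiom cat_axiom.exchange)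
        qed
      next
        case (id_comp i x y)
        then show ?thesis using eqv_axiom by (auto simp: good_eqv_def cell_Cmp_iff cell_Idt_iff intro!: cell_eqv.eqv_refl)
      next
        case (inverse_right k g)
        then have "g \<in> gens S (Suc k)" "cell S p (gsrc S (Suc k) g)"
          using eqv_axiom by (auto simp: cell_Cmp_iff cell_Idt_iff elim: cell_GenE)
        then show ?thesis using inverse_right dims
          by (auto simp: good_eqv_def dims_ok_def intro!: cell_eqv.eqv_refl)
      next
        case (inverse_left k g)
        then have "g \<in> gens S (Suc k)" "cell S p (gtgt S (Suc k) g)"
          using eqv_axiom by (auto simp: cell_Cmp_iff cell_Idt_iff elim: cell_GenE)
        then show ?thesis using inverse_left dims
          by (auto simp: good_eqv_def dims_ok_def intro!: cell_eqv.eqv_refl)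
      qed
    qed
  qed
  then show ?case by blast
qed

locale typed_data =
  fixes S :: "'g polygraph_data" and p m :: nat
  assumes wt: "well_typed S p m" and dims: "dims_ok S"
begin

abbreviation "ceqv \<equiv> eqv S p"

lemma good_cellI: "cell S p x \<Longrightarrow> cdim x \<le> m \<Longrightarrow> good_cell S p x"
  using boundary_aux[OF wt dims, of "cdim x"] by blast

lemma good_eqvI: "ceqv x y \<Longrightarrow> cdim x \<le> m \<Longrightarrow> good_eqv S p x y"
  using boundary_aux[OF wt dims, of "cdim x"] by blast

lemma eqv_dim: "ceqv x y \<Longrightarrow> cdim x \<le> m \<Longrightarrow> cdim y = cdim x"
  using good_eqvI[of x y] by (simp add: good_eqv_def)

lemma bd_cell:
  assumes "cell S p x" "cdim x \<le> m" "0 < cdim x"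
  shows "cell S p (src S x)" "cell S p (tgt S x)" "cdim (src S x) = cdim x - 1" "cdim (tgt S x) = cdim x - 1"
  using good_cellI[OF assms(1,2)] assms(3) by (auto simp: good_cell_def)

lemma bd_glob:
  assumes "cell S p x" "cdim x \<le> m" "1 < cdim x"
  shows "ceqv (src S (src S x)) (src S (tgt S x))" "ceqv (tgt S (src S x)) (tgt S (tgt S x))"
  using good_cellI[OF assms(1,2)] assms(3) by (auto simp: good_cell_def parallel_def)

lemma at_Suc:
  assumes "cell S p x" "cdim x \<le> m" "i < cdim x"
  shows "src_at S i x = src_at S i (src S x)" "tgt_at S i x = tgt_at S i (tgt S x)"
  using bd_cell[OF assms(1,2)] assms(3) by (auto intro!: src_at_step tgt_at_step)

lemma at_cell:
  assumes "cell S p x" "cdim x \<le> m" "i \<le> cdim x"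
  shows "cell S p (src_at S i x) \<and> cell S p (tgt_at S i x) \<and> cdim (src_at S i x) = i \<and> cdim (tgt_at S i x) = i"
  using assms
proof (induction "cdim x - i" arbitrary: x)
  case (Suc d)
  then show ?case using bd_cell[of x] at_Suc[of x i] Suc.hyps(1)[of "src S x"] Suc.hyps(1)[of "tgt S x"] by auto
qed auto

lemma at_eqv:
  assumes "ceqv x y" "cdim x \<le> m" "i \<le> cdim x"
  shows "ceqv (src_at S i x) (src_at S i y) \<and> ceqv (tgt_at S i x) (tgt_at S i y)"
  using assms
proof (induction "cdim x - i" arbitrary: x y)
  case 0 then show ?case using eqv_dim[of x y] by auto
next
  case (Suc d)
  have c: "cell S p x" "cell S p y" "cdim y = cdim x" using Suc eqv_cellD eqv_dim by blast+
  then show ?case using Suc.prems Suc.hyps(2) bd_cell[of x] good_eqvI[of x y] at_Suc[of x i] at_Suc[of y i]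
       Suc.hyps(1)[of "src S x" "src S y"] Suc.hyps(1)[of "tgt S x" "tgt S y"] by (auto simp: good_eqv_def)
qed

lemma at_at:
  assumes "i \<le> j" "j \<le> cdim x" "cell S p x" "cdim x \<le> m"
  shows "src_at S i (src_at S j x) = src_at S i x \<and> tgt_at S i (tgt_at S j x) = tgt_at S i x"
  using assms
proof (induction "cdim x - j" arbitrary: x)
  case (Suc d)
  then show ?case using bd_cell[of x] at_Suc[of x i] at_Suc[of x j] Suc.hyps(1)[of "src S x"] Suc.hyps(1)[of "tgt S x"] by auto
qed auto

lemma at_glob:
  assumes "i < j" "j \<le> cdim x" "cell S p x" "cdim x \<le> m"
  shows "ceqv (src_at S i (tgt_at S j x)) (src_at S i x) \<and> ceqv (tgt_at S i (src_at S j x)) (tgt_at S i x)"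
  using assms
proof (induction "cdim x - j" arbitrary: x)
  case 0 then show ?case using at_cell[of x i] by (auto intro: eqv_refl)
next
  case (Suc d)
  have b: "cell S p (src S x)" "cell S p (tgt S x)" "cdim (src S x) = cdim x - 1" "cdim (tgt S x) = cdim x - 1"
    using bd_cell[of x] Suc by auto
  have g: "ceqv (src S (src S x)) (src S (tgt S x))" "ceqv (tgt S (src S x)) (tgt S (tgt S x))"
    using bd_glob[of x] Suc by auto
  have s: "src_at S i (src S x) = src_at S i (src S (src S x))" "src_at S i (tgt S x) = src_at S i (src S (tgt S x))"
    "tgt_at S i (src S x) = tgt_at S i (tgt S (src S x))" "tgt_at S i (tgt S x) = tgt_at S i (tgt S (tgt S x))"
    using at_Suc[of "src S x" i] at_Suc[of "tgt S x" i] b Suc by auto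
  have dd: "cdim (src S (src S x)) = cdim x - 2" "cdim (tgt S (src S x)) = cdim x - 2"
    using bd_cell[of "src S x"] b Suc by auto
  have e: "ceqv (src_at S i (src S x)) (src_at S i (tgt S x))" "ceqv (tgt_at S i (src S x)) (tgt_at S i (tgt S x))"
    unfolding s using at_eqv[OF g(1), of i] at_eqv[OF g(2), of i] dd Suc by auto
  have 1: "ceqv (src_at S i (tgt_at S j x)) (src_at S i (tgt S x))"
    using Suc.hyps(1)[of "tgt S x"] at_Suc[of x j] b Suc by auto
  have 2: "ceqv (tgt_at S i (src_at S j x)) (tgt_at S i (src S x))"
    using Suc.hyps(1)[of "src S x"] at_Suc[of x j] b Suc by auto
  have "src_at S i x = src_at S i (src S x)" "tgt_at S i x = tgt_at S i (tgt S x)"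
    using at_Suc[of x i] Suc by auto
  then show ?case using e 1 2 by (metis eqv_sym eqv_trans)
qed

lemma at_Cmp_low:
  assumes "cell S p (Cmp i x y)" "cdim x \<le> m" "j \<le> i"
  shows "src_at S j (Cmp i x y) = src_at S j x \<and> tgt_at S j (Cmp i x y) = tgt_at S j y"
  using assms
proof (induction "cdim x" arbitrary: x y)
  case 0 then show ?case by (auto simp: cell_Cmp_iff)
next
  case (Suc d)
  have c: "cell S p x" "cell S p y" "cdim x = cdim y" "i < cdim x" using Suc.prems by (auto simp: cell_Cmp_iff)
  have b: "cell S p (src S (Cmp i x y))" "cell S p (tgt S (Cmp i x y))"
    using bd_cell[OF Suc.prems(1)] Suc.prems c by auto
  have s: "src_at S j (Cmp i x y) = src_at S j (src S (Cmp i x y))"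
    "tgt_at S j (Cmp i x y) = tgt_at S j (tgt S (Cmp i x y))"
    "src_at S j x = src_at S j (src S x)" "tgt_at S j y = tgt_at S j (tgt S y)"
    using at_Suc[OF Suc.prems(1)] at_Suc[of x j] at_Suc[of y j] Suc.prems c by auto
  show ?case
  proof (cases "Suc i = cdim x")
    case True then show ?thesis unfolding s using c by auto
  next
    case False
    then show ?thesis unfolding s using Suc.hyps(1)[of "src S x" "src S y"] Suc.hyps(1)[of "tgt S x" "tgt S y"]
      b Suc bd_cell[of x] c by auto
  qed
qed

lemma at_Cmp_high:
  assumes "cell S p (Cmp i x y)" "cdim x \<le> m" "i < j"
  shows "src_at S j (Cmp i x y) = Cmp i (src_at S j x) (src_at S j y) \<and>
    tgt_at S j (Cmp i x y) = Cmp i (tgt_at S j x) (tgt_at S j y)"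
  using assms
proof (induction "cdim x - j" arbitrary: x y)
  case 0 then show ?case by (auto simp: cell_Cmp_iff)
next
  case (Suc d)
  have c: "cell S p x" "cell S p y" "cdim x = cdim y" "i < cdim x" using Suc.prems by (auto simp: cell_Cmp_iff)
  have b: "cell S p (src S (Cmp i x y))" "cell S p (tgt S (Cmp i x y))"
    using bd_cell[OF Suc.prems(1)] Suc.prems c by auto
  have s: "src_at S j (Cmp i x y) = src_at S j (src S (Cmp i x y))"
    "tgt_at S j (Cmp i x y) = tgt_at S j (tgt S (Cmp i x y))"
    "src_at S j x = src_at S j (src S x)" "tgt_at S j y = tgt_at S j (tgt S y)"
    "src_at S j y = src_at S j (src S y)" "tgt_at S j x = tgt_at S j (tgt S x)"
    using at_Suc[OF Suc.prems(1)] at_Suc[of x j] at_Suc[of y j] Suc.prems Suc.hyps c by auto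
  have "Suc i \<noteq> cdim x" using Suc by auto
  then show ?case unfolding s using Suc.hyps(1)[of "src S x" "src S y"] Suc.hyps(1)[of "tgt S x" "tgt S y"]
      b Suc bd_cell[of x] c by auto
qed

lemma eqv_Cmp:
  assumes "ceqv x x'" "ceqv y y'" "cell S p (Cmp i x y)" "cdim x \<le> m"
  shows "ceqv (Cmp i x y) (Cmp i x' y')"
proof (rule eqv_comp[OF assms(1-3)])
  have c: "cdim x = cdim y" "i < cdim x" "ceqv (tgt_at S i x) (src_at S i y)" using assms(3) by (auto simp: cell_Cmp_iff)
  then show "cell S p (Cmp i x' y')"
    using at_eqv[OF assms(1), of i] at_eqv[OF assms(2), of i] eqv_cellD[OF assms(1)] eqv_cellD[OF assms(2)]
      eqv_dim[OF assms(1)] eqv_dim[OF assms(2)] assms(4)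
    by (auto simp: cell_Cmp_iff) (metis eqv_sym eqv_trans)
qed

lemma cell_bd_Cmp:
  assumes "cell S p (Cmp i x y)" "cdim x \<le> m" "i < j" "j \<le> cdim x"
  shows "cell S p (Cmp i (src_at S j x) (src_at S j y))" "cell S p (Cmp i (tgt_at S j x) (tgt_at S j y))"
  using at_cell[OF assms(1), of j] at_Cmp_high[OF assms(1-3)] assms by auto

lemma assoc_cell:
  assumes "cell S p (Cmp i (Cmp i x y) z)" "cdim x \<le> m"
  shows "cell S p (Cmp i x (Cmp i y z))"
proof -
  have c: "cell S p (Cmp i x y)" using assms by (simp add: cell_Cmp_iff)
  have "cell S p (Cmp i y z)" using assms c at_Cmp_low[OF c, of i] by (auto simp: cell_Cmp_iff)
  then show ?thesis using c at_Cmp_low[of i y z i] assms(2) by (auto simp: cell_Cmp_iff)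
qed

lemma assoc_cell':
  assumes "cell S p (Cmp i x (Cmp i y z))" "cdim x \<le> m"
  shows "cell S p (Cmp i (Cmp i x y) z)"
proof -
  have c: "cell S p (Cmp i y z)" and d: "cdim x = cdim y" using assms by (simp_all add: cell_Cmp_iff)
  have "cell S p (Cmp i x y)" using assms c at_Cmp_low[OF c, of i] by (auto simp: cell_Cmp_iff)
  then show ?thesis using c at_Cmp_low[of i x y i] assms(2) by (auto simp: cell_Cmp_iff)
qed

lemma eqv_assoc: "cell S p (Cmp i (Cmp i x y) z) \<Longrightarrow> cdim x \<le> m \<Longrightarrow> ceqv (Cmp i (Cmp i x y) z) (Cmp i x (Cmp i y z))"
  by (intro eqv_axiom cat_axiom.assoc assoc_cell) auto

lemma exchange_cell:
  assumes "cell S p (Cmp i (Cmp j x y) (Cmp j z w))" "i < j" "cdim x \<le> m"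
  shows "cell S p (Cmp j (Cmp i x z) (Cmp i y w))"
proof -
  have c: "cell S p (Cmp j x y)" "cell S p (Cmp j z w)" and d: "cdim x = cdim z" and
    e: "ceqv (tgt_at S i (Cmp j x y)) (src_at S i (Cmp j z w))"
    using assms by (simp_all add: cell_Cmp_iff)
  have xy: "cell S p x" "cell S p y" "cdim x = cdim y" "j < cdim x" "ceqv (tgt_at S j x) (src_at S j y)"
    "cell S p z" "cell S p w" "cdim z = cdim w" "ceqv (tgt_at S j z) (src_at S j w)"
    using c by (auto simp: cell_Cmp_iff)
  have e': "ceqv (tgt_at S i y) (src_at S i z)"
    using e at_Cmp_low[OF c(1), of i] at_Cmp_low[OF c(2), of i] assms d by auto
  have gl: "ceqv (tgt_at S i x) (tgt_at S i y)"
  proof -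
    have "ceqv (tgt_at S i (tgt_at S j x)) (tgt_at S i (src_at S j y))"
      using at_eqv[OF xy(5), of i] at_cell[OF xy(1), of j] assms xy by auto
    then show ?thesis using at_at[of i j x] at_glob[of i j y] assms xy by (auto intro: eqv_trans)
  qed
  have gs: "ceqv (src_at S i z) (src_at S i w)"
  proof -
    have "ceqv (src_at S i (tgt_at S j z)) (src_at S i (src_at S j w))"
      using at_eqv[OF xy(9), of i] at_cell[OF xy(6), of j] assms xy d by auto
    then show ?thesis using at_at[of i j w] at_glob[of i j z] assms xy d by (auto intro: eqv_trans eqv_sym)
  qed
  have cc: "cell S p (Cmp i x z)" "cell S p (Cmp i y w)"
    using xy d e' gl gs assms by (auto simp: cell_Cmp_iff intro: eqv_trans)
  have "ceqv (Cmp i (tgt_at S j x) (tgt_at S j z)) (Cmp i (src_at S j y) (src_at S j w))"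
    using xy d assms at_cell[of x j]
    by (intro eqv_Cmp cell_bd_Cmp cc) auto
  then show ?thesis using cc xy d at_Cmp_high[OF cc(1), of j] at_Cmp_high[OF cc(2), of j] assms
    by (auto simp: cell_Cmp_iff)
qed

lemma eqv_exchange:
  "cell S p (Cmp i (Cmp j x y) (Cmp j z w)) \<Longrightarrow> i < j \<Longrightarrow> cdim x \<le> m \<Longrightarrow>
   ceqv (Cmp i (Cmp j x y) (Cmp j z w)) (Cmp j (Cmp i x z) (Cmp i y w))"
  by (rule eqv_axiom[OF cat_axiom.exchange _ exchange_cell])

lemma unit_left_cell:
  assumes "cell S p x" "i < cdim x" "cdim x \<le> m" shows "cell S p (Cmp i (pad (cdim x - i) (src_at S i x)) x)"
  using at_cell[of x i] tgt_at_pad[of S "src_at S i x" "cdim x - i"] assms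
  by (auto simp: cell_Cmp_iff intro!: cell_pad eqv_refl)

lemma unit_right_cell:
  assumes "cell S p x" "i < cdim x" "cdim x \<le> m" shows "cell S p (Cmp i x (pad (cdim x - i) (tgt_at S i x)))"
  using at_cell[of x i] src_at_pad[of S "tgt_at S i x" "cdim x - i"] assms
  by (auto simp: cell_Cmp_iff intro!: cell_pad eqv_refl)

lemma eqv_unit_left: "cell S p x \<Longrightarrow> i < cdim x \<Longrightarrow> cdim x \<le> m \<Longrightarrow> ceqv (Cmp i (pad (cdim x - i) (src_at S i x)) x) x"
  by (intro eqv_axiom cat_axiom.unit_left unit_left_cell)

lemma eqv_unit_right: "cell S p x \<Longrightarrow> i < cdim x \<Longrightarrow> cdim x \<le> m \<Longrightarrow> ceqv (Cmp i x (pad (cdim x - i) (tgt_at S i x))) x"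
  by (intro eqv_axiom cat_axiom.unit_right unit_right_cell)

lemma id_comp_cell:
  assumes "cell S p (Cmp i x y)" "cdim x < m" shows "cell S p (Cmp i (Idt x) (Idt y))"
  using assms at_Suc[of "Idt x" i] at_Suc[of "Idt y" i]
  by (auto simp: cell_Cmp_iff cell_Idt_iff)

lemma eqv_id_comp: "cell S p (Cmp i x y) \<Longrightarrow> cdim x < m \<Longrightarrow> ceqv (Idt (Cmp i x y)) (Cmp i (Idt x) (Idt y))"
  by (intro eqv_axiom cat_axiom.id_comp id_comp_cell cell_id)

end

context typed_data begin

abbreviation "cls \<equiv> eclass S p"
abbreviation "F \<equiv> free_npcat m p S"

lemma cls_eq: "ceqv x y \<Longrightarrow> cls x = cls y"
  unfolding eclass_def by (auto intro: eqv_sym eqv_trans)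

lemma cls_eq_iff: "cell S p x \<Longrightarrow> cls x = cls y \<longleftrightarrow> ceqv x y"
  using eqv_refl[of S p x] cls_eq[of x y] eqv_sym[of S p y x] by (auto simp: eclass_def)

lemma cls_self: "cell S p x \<Longrightarrow> x \<in> cls x"
  by (auto simp: eclass_def intro: eqv_refl)

lemma cells_iff: "X \<in> cells F k \<longleftrightarrow> (\<exists>x. X = cls x \<and> cell S p x \<and> cdim x = k \<and> k \<le> m)"
  by (auto simp: free_npcat_def)

lemma Union_cls:
  assumes "cell S p x" "\<And>y. ceqv x y \<Longrightarrow> g y = g x"
  shows "(\<Union>y\<in>cls x. g y) = g x"
proof -
  have "(\<Union>y\<in>cls x. g y) = (\<Union>y\<in>cls x. g x)"
    using assms(2) by (intro SUP_cong) (simp_all add: eclass_def)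
  then show ?thesis using cls_self[OF assms(1)] by auto
qed

lemma source_cls:
  assumes "cell S p x" "0 < cdim x" "cdim x \<le> m" shows "source F k (cls x) = cls (src S x)"
proof -
  have "cls (src S y) = cls (src S x)" if "ceqv x y" for y
    using good_eqvI[OF that assms(3)] assms(2) cls_eq[of "src S x" "src S y"] by (simp add: good_eqv_def)
  from Union_cls[of x "\<lambda>y. cls (src S y)", OF assms(1) this] show ?thesis by (simp add: free_npcat_def)
qed

lemma target_cls:
  assumes "cell S p x" "0 < cdim x" "cdim x \<le> m" shows "target F k (cls x) = cls (tgt S x)"
proof -
  have "cls (tgt S y) = cls (tgt S x)" if "ceqv x y" for y
    using good_eqvI[OF that assms(3)] assms(2) cls_eq[of "tgt S x" "tgt S y"] by (simp add: good_eqv_def)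
  from Union_cls[of x "\<lambda>y. cls (tgt S y)", OF assms(1) this] show ?thesis by (simp add: free_npcat_def)
qed

lemma ident_cls: assumes "cell S p x" shows "ident F k (cls x) = cls (Idt x)"
proof -
  have "cls (Idt y) = cls (Idt x)" if "ceqv x y" for y
    using cls_eq[OF eqv_id[OF that]] by simp
  from Union_cls[of x "\<lambda>y. cls (Idt y)", OF assms this] show ?thesis by (simp add: free_npcat_def)
qed

lemma cmp_cls:
  assumes "cell S p (Cmp i x y)" "cdim x \<le> m" shows "cmp F k i (cls x) (cls y) = cls (Cmp i x y)"
proof -
  have c: "cell S p x" "cell S p y" using assms by (auto simp: cell_Cmp_iff)
  have e: "cls (Cmp i x' y') = cls (Cmp i x y)" if "ceqv x x'" "ceqv y y'" for x' y'
    using eqv_Cmp[OF that assms] by (simp add: cls_eq)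
  have u: "(\<Union>z\<in>cls y. cls (Cmp i x' z)) = cls (Cmp i x y)" if "ceqv x x'" for x'
    using e[OF that] cls_self[OF c(2)] by (auto simp: eclass_def[of S p y])
  have "(\<Union>x'\<in>cls x. \<Union>z\<in>cls y. cls (Cmp i x' z)) = cls (Cmp i x y)"
    using u cls_self[OF c(1)] by (auto simp: eclass_def[of S p x])
  then show ?thesis by (simp add: free_npcat_def)
qed

lemma isource_cls: "cell S p x \<Longrightarrow> cdim x = k \<Longrightarrow> k \<le> m \<Longrightarrow> i \<le> k \<Longrightarrow> isource F i k (cls x) = cls (src_at S i x)"
proof (induction k arbitrary: x)
  case (Suc k)
  then show ?case using bd_cell[of x] at_Suc[of x i] by (auto simp: source_cls)
qed auto

lemma itarget_cls: "cell S p x \<Longrightarrow> cdim x = k \<Longrightarrow> k \<le> m \<Longrightarrow> i \<le> k \<Longrightarrow> itarget F i k (cls x) = cls (tgt_at S i x)"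
proof (induction k arbitrary: x)
  case (Suc k)
  then show ?case using bd_cell[of x] at_Suc[of x i] by (auto simp: target_cls)
qed auto

lemma iident_cls: "cell S p x \<Longrightarrow> cdim x = i \<Longrightarrow> i \<le> k \<Longrightarrow> iident F i k (cls x) = cls (pad (k - i) x)"
proof (induction k)
  case (Suc k)
  show ?case
  proof (cases "i \<le> k")
    case True then show ?thesis using Suc cell_pad[of S p x "k - i"] by (auto simp: ident_cls Suc_diff_le)
  next
    case False then show ?thesis using Suc by auto
  qed
qed auto

lemma composable_cls:
  "composable F k i X Y \<longleftrightarrow> (\<exists>x y. X = cls x \<and> Y = cls y \<and> cell S p (Cmp i x y) \<and> cdim x = k \<and> k \<le> m)"
proof
  assume "composable F k i X Y"
  then obtain x y where "i < k" "X = cls x" "cell S p x" "cdim x = k" "k \<le> m" "Y = cls y" "cell S p y" "cdim y = k"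
    "itarget F i k X = isource F i k Y"
    unfolding composable_def cells_iff by blast
  then have "cell S p (Cmp i x y)"
    using at_cell[of x i] by (auto simp: cell_Cmp_iff isource_cls itarget_cls cls_eq_iff)
  then show "\<exists>x y. X = cls x \<and> Y = cls y \<and> cell S p (Cmp i x y) \<and> cdim x = k \<and> k \<le> m"
    using \<open>X = _\<close> \<open>Y = _\<close> \<open>cdim x = k\<close> \<open>k \<le> m\<close> by blast
next
  assume "\<exists>x y. X = cls x \<and> Y = cls y \<and> cell S p (Cmp i x y) \<and> cdim x = k \<and> k \<le> m"
  then obtain x y where *: "X = cls x" "Y = cls y" "cell S p (Cmp i x y)" "cdim x = k" "k \<le> m" by blast
  then have c: "cell S p x" "cell S p y" "cdim y = k" "i < k" "ceqv (tgt_at S i x) (src_at S i y)"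
    by (auto simp: cell_Cmp_iff)
  have "X \<in> cells F k" unfolding cells_iff using c * by (intro exI[of _ x]) simp
  moreover have "Y \<in> cells F k" unfolding cells_iff using c * by (intro exI[of _ y]) simp
  moreover have "itarget F i k X = isource F i k Y"
    using * c by (simp add: isource_cls itarget_cls cls_eq)
  ultimately show "composable F k i X Y" using c by (simp add: composable_def)
qed

lemma composable_cls': 
  assumes "cell S p x" "cdim x = k" "k \<le> m" "composable F k i (cls x) (cls y)" "cell S p y"
  shows "cell S p (Cmp i x y)"
proof -
  from assms(4) obtain x' y' where *: "cls x = cls x'" "cls y = cls y'" "cell S p (Cmp i x' y')" "cdim x' = k" "k \<le> m"
    unfolding composable_cls by blast
  then have "ceqv x' x" "ceqv y' y" using assms by (auto simp: cls_eq_iff intro: eqv_sym)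
  then show ?thesis using eqv_Cmp[of x' x y' y i] * eqv_cellD by blast
qed


lemma cellsE:
  assumes "X \<in> cells F k"
  obtains x where "X = cls x" "cell S p x" "cdim x = k" "k \<le> m"
  using assms unfolding cells_iff by blast

lemma cellsI: "cell S p x \<Longrightarrow> cdim x = k \<Longrightarrow> k \<le> m \<Longrightarrow> cls x \<in> cells F k"
  unfolding cells_iff by blast

lemma composableE:
  assumes "composable F k i X Y"
  obtains x y where "X = cls x" "Y = cls y" "cell S p (Cmp i x y)" "cdim x = k" "k \<le> m"
     "cell S p x" "cell S p y" "cdim y = k" "i < k"
  using assms unfolding composable_cls by (metis cell_Cmp_iff)

lemma free_source_target:
  assumes "X \<in> cells F (Suc k)"
  shows "source F k X \<in> cells F k" "target F k X \<in> cells F k"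
proof -
  obtain x where x: "X = cls x" "cell S p x" "cdim x = Suc k" "Suc k \<le> m" using assms by (rule cellsE)
  show "source F k X \<in> cells F k" using x bd_cell[of x] by (simp add: source_cls cellsI)
  show "target F k X \<in> cells F k" using x bd_cell[of x] by (simp add: target_cls cellsI)
qed

lemma free_globular:
  assumes "X \<in> cells F (Suc (Suc k))"
  shows "source F k (target F (Suc k) X) = source F k (source F (Suc k) X)"
    "target F k (source F (Suc k) X) = target F k (target F (Suc k) X)"
proof -
  obtain x where x: "X = cls x" "cell S p x" "cdim x = Suc (Suc k)" "Suc (Suc k) \<le> m" using assms by (rule cellsE)
  have g: "cls (src S (src S x)) = cls (src S (tgt S x))" "cls (tgt S (src S x)) = cls (tgt S (tgt S x))"
    using bd_glob[of x] x by (simp_all add: cls_eq)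
  show "source F k (target F (Suc k) X) = source F k (source F (Suc k) X)"
    "target F k (source F (Suc k) X) = target F k (target F (Suc k) X)"
    using x bd_cell[of x] g by (simp_all add: source_cls target_cls)
qed

lemma free_ident:
  assumes "X \<in> cells F k" "k < m"
  shows "ident F k X \<in> cells F (Suc k)" "source F k (ident F k X) = X" "target F k (ident F k X) = X"
proof -
  obtain x where x: "X = cls x" "cell S p x" "cdim x = k" "k \<le> m" using assms(1) by (rule cellsE)
  show "ident F k X \<in> cells F (Suc k)" "source F k (ident F k X) = X" "target F k (ident F k X) = X"
    using x assms(2) by (simp_all add: ident_cls cell_id source_cls target_cls cellsI)
qed

lemma free_cmp_cell:
  assumes "composable F k i X Y"
  shows "cmp F k i X Y \<in> cells F k"
proof -
  obtain x y where xy: "X = cls x" "Y = cls y" "cell S p (Cmp i x y)" "cdim x = k" "k \<le> m"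
    using assms by (rule composableE)
  then show ?thesis by (simp add: cmp_cls cellsI)
qed

lemma free_source_target_cmp:
  assumes "composable F (Suc k) i X Y"
  shows "source F k (cmp F (Suc k) i X Y) =
       (if i = k then source F k X else cmp F k i (source F k X) (source F k Y))"
    "target F k (cmp F (Suc k) i X Y) =
       (if i = k then target F k Y else cmp F k i (target F k X) (target F k Y))"
proof -
  obtain x y where xy: "X = cls x" "Y = cls y" "cell S p (Cmp i x y)" "cdim x = Suc k" "Suc k \<le> m"
    "cell S p x" "cell S p y" "cdim y = Suc k" "i < Suc k"
    using assms by (rule composableE)
  have b: "cell S p (src S (Cmp i x y))" "cell S p (tgt S (Cmp i x y))"
    using bd_cell[OF xy(3)] xy by simp_all
  show "source F k (cmp F (Suc k) i X Y) =
       (if i = k then source F k X else cmp F k i (source F k X) (source F k Y))"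
    "target F k (cmp F (Suc k) i X Y) =
       (if i = k then target F k Y else cmp F k i (target F k X) (target F k Y))"
    using xy b bd_cell[of x] by (auto simp: source_cls target_cls cmp_cls)
qed

lemma free_cmp_assoc:
  assumes "composable F k i X Y" "composable F k i Y Z"
  shows "cmp F k i (cmp F k i X Y) Z = cmp F k i X (cmp F k i Y Z)"
proof -
  obtain x y where xy: "X = cls x" "Y = cls y" "cell S p (Cmp i x y)" "cdim x = k" "k \<le> m"
    "cell S p x" "cell S p y" "cdim y = k" "i < k"
    using assms(1) by (rule composableE)
  have "Z \<in> cells F k" using assms(2) by (simp add: composable_def)
  then obtain z where z: "Z = cls z" "cell S p z" by (rule cellsE)
  have yz: "cell S p (Cmp i y z)" using composable_cls'[of y k i z] xy z assms(2) by simp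
  have c: "cell S p (Cmp i (Cmp i x y) z)"
    using xy yz at_Cmp_low[OF xy(3), of i] by (simp add: cell_Cmp_iff)
  show ?thesis using eqv_assoc[OF c] assoc_cell[OF c] xy yz c z by (simp add: cmp_cls cls_eq)
qed

lemma free_cmp_unit:
  assumes "X \<in> cells F k" "i < k"
  shows "cmp F k i (iident F i k (isource F i k X)) X = X"
    "cmp F k i X (iident F i k (itarget F i k X)) = X"
proof -
  obtain x where x: "X = cls x" "cell S p x" "cdim x = k" "k \<le> m" using assms(1) by (rule cellsE)
  show "cmp F k i (iident F i k (isource F i k X)) X = X"
    using x assms(2) unit_left_cell[of x i] eqv_unit_left[of x i] at_cell[of x i]
    by (simp add: isource_cls iident_cls cmp_cls cls_eq)
  show "cmp F k i X (iident F i k (itarget F i k X)) = X"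
    using x assms(2) unit_right_cell[of x i] eqv_unit_right[of x i] at_cell[of x i]
    by (simp add: itarget_cls iident_cls cmp_cls cls_eq)
qed

lemma free_cmp_exchange:
  assumes ij: "i < j" and c: "composable F k j X Y" "composable F k j Z W"
      "composable F k i X Z" "composable F k i Y W"
  shows "cmp F k i (cmp F k j X Y) (cmp F k j Z W) = cmp F k j (cmp F k i X Z) (cmp F k i Y W)"
proof -
  obtain a b where ab: "X = cls a" "Y = cls b" "cell S p (Cmp j a b)" "cdim a = k" "k \<le> m"
    "cell S p a" "cell S p b" "cdim b = k" "j < k"
    using c(1) by (rule composableE)
  obtain d e where de: "Z = cls d" "W = cls e" "cell S p (Cmp j d e)" "cdim d = k" "k \<le> m"
    "cell S p d" "cell S p e" "cdim e = k" "j < k"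
    using c(2) by (rule composableE)
  have ad: "cell S p (Cmp i a d)" "cell S p (Cmp i b e)"
    using composable_cls'[of a k i d] composable_cls'[of b k i e] ab de c by simp_all
  have c1: "cell S p (Cmp i (Cmp j a b) (Cmp j d e))"
  proof -
    have s: "src_at S i (Cmp j d e) = src_at S i d" "tgt_at S i (Cmp j a b) = tgt_at S i b"
      using at_Cmp_low[OF ab(3), of i] at_Cmp_low[OF de(3), of i] ij ab de by simp_all
    have "ceqv (tgt_at S j a) (src_at S j b)" using ab by (simp add: cell_Cmp_iff)
    then have "ceqv (tgt_at S i (tgt_at S j a)) (tgt_at S i (src_at S j b))"
      using at_eqv[of "tgt_at S j a" "src_at S j b" i] at_cell[of a j] ab ij by simp
    then have "ceqv (tgt_at S i a) (tgt_at S i b)"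
      using at_at[of i j a] at_glob[of i j b] ab ij by (auto intro: eqv_trans)
    moreover have "ceqv (tgt_at S i a) (src_at S i d)" using ad by (simp add: cell_Cmp_iff)
    ultimately have "ceqv (tgt_at S i b) (src_at S i d)" by (meson eqv_sym eqv_trans)
    then show ?thesis using ab de s ij by (simp add: cell_Cmp_iff)
  qed
  show ?thesis
    using eqv_exchange[OF c1 ij] exchange_cell[OF c1 ij] ab de ad c1 by (simp add: cmp_cls cls_eq)
qed

lemma free_ident_cmp:
  assumes "composable F k i X Y" "k < m"
  shows "ident F k (cmp F k i X Y) = cmp F (Suc k) i (ident F k X) (ident F k Y)"
proof -
  obtain x y where xy: "X = cls x" "Y = cls y" "cell S p (Cmp i x y)" "cdim x = k" "k \<le> m"
    "cell S p x" "cell S p y" "cdim y = k" "i < k"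
    using assms(1) by (rule composableE)
  then show ?thesis using assms(2) eqv_id_comp[of i x y] id_comp_cell[of i x y]
    by (simp add: cmp_cls ident_cls cls_eq)
qed

lemma free_ncategory: "strict_ncategory m F"
proof (unfold strict_ncategory_def, intro conjI allI impI)
  show "x \<in> cells F k \<Longrightarrow> k \<le> m" for x k unfolding cells_iff by blast
qed (fact free_source_target free_globular free_ident free_cmp_cell free_source_target_cmp
    free_cmp_assoc free_cmp_unit free_cmp_exchange free_ident_cmp)+


definition is_inverse where
  "is_inverse k x y \<longleftrightarrow> cell S p (Cmp k x y) \<and> cell S p (Cmp k y x) \<and>
     ceqv (Cmp k x y) (Idt (src S x)) \<and> ceqv (Cmp k y x) (Idt (tgt S x))"

lemma inverse_exists:
  "cell S p x \<Longrightarrow> cdim x = Suc k \<Longrightarrow> Suc k \<le> m \<Longrightarrow> p \<le> k \<Longrightarrow> \<exists>y. is_inverse k x y"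
proof (induction x)
  case (Gen l g)
  then have g: "g \<in> gens S (Suc k)" "l = Suc k" by (auto elim: cell_GenE)
  have c: "cell S p (Gen (Suc k) g)" "cell S p (Inv (Suc k) g)" using g Gen by (auto intro: cell_gen cell_inv)
  have b: "cell S p (gsrc S (Suc k) g)" "cell S p (gtgt S (Suc k) g)" "cdim (gsrc S (Suc k) g) = k" "cdim (gtgt S (Suc k) g) = k"
    using bd_cell[OF c(1)] Gen by auto
  have cc: "cell S p (Cmp k (Gen (Suc k) g) (Inv (Suc k) g))" "cell S p (Cmp k (Inv (Suc k) g) (Gen (Suc k) g))"
    using c b by (auto simp: cell_Cmp_iff src_at_def tgt_at_def intro: eqv_refl)
  show ?case unfolding is_inverse_def g(2)
    by (rule exI[of _ "Inv (Suc k) g"]) (use cc b in \<open>auto intro!: eqv_axiom intro: cat_axiom.intros cell_id\<close>)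
next
  case (Inv l g)
  then have g: "g \<in> gens S (Suc k)" "l = Suc k" by (auto elim: cell_InvE)
  have c: "cell S p (Gen (Suc k) g)" "cell S p (Inv (Suc k) g)" using g Inv by (auto intro: cell_gen cell_inv)
  have b: "cell S p (gsrc S (Suc k) g)" "cell S p (gtgt S (Suc k) g)" "cdim (gsrc S (Suc k) g) = k" "cdim (gtgt S (Suc k) g) = k"
    using bd_cell[OF c(1)] Inv by auto
  have cc: "cell S p (Cmp k (Gen (Suc k) g) (Inv (Suc k) g))" "cell S p (Cmp k (Inv (Suc k) g) (Gen (Suc k) g))"
    using c b by (auto simp: cell_Cmp_iff src_at_def tgt_at_def intro: eqv_refl)
  show ?case unfolding is_inverse_def g(2)
    by (rule exI[of _ "Gen (Suc k) g"]) (use cc b in \<open>auto intro!: eqv_axiom intro: cat_axiom.intros cell_id\<close>)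
next
  case (Idt x)
  then have c: "cell S p (Idt x)" "cdim x = k" by auto
  have "cell S p (Cmp k (Idt x) (Idt x))" "ceqv (Cmp k (Idt x) (Idt x)) (Idt x)"
    using unit_left_cell[OF c(1), of k] eqv_unit_left[OF c(1), of k] c Idt by (auto simp: src_at_def)
  then show ?case unfolding is_inverse_def by auto
next
  case (Cmp i x y)
  then have c: "cell S p x" "cell S p y" "cdim x = Suc k" "cdim y = Suc k" "i \<le> k"
    "ceqv (tgt_at S i x) (src_at S i y)" by (auto simp: cell_Cmp_iff)
  obtain x' y' where "is_inverse k x x'" "is_inverse k y y'" using Cmp c by blast
  then have inv: "cell S p (Cmp k x x')" "cell S p (Cmp k x' x)" "ceqv (Cmp k x x') (Idt (src S x))" "ceqv (Cmp k x' x) (Idt (tgt S x))"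
    "cell S p (Cmp k y y')" "cell S p (Cmp k y' y)" "ceqv (Cmp k y y') (Idt (src S y))" "ceqv (Cmp k y' y) (Idt (tgt S y))"
    by (auto simp: is_inverse_def)
  then have c': "cell S p x'" "cell S p y'" "cdim x' = Suc k" "cdim y' = Suc k" using c by (auto simp: cell_Cmp_iff)
  have tk: "tgt_at S k u = tgt S u \<and> src_at S k u = src S u" if "cdim u = Suc k" for u
    using that by (simp add: src_at_def tgt_at_def)
  have bd: "ceqv (src S x') (tgt S x)" "ceqv (tgt S x') (src S x)" "ceqv (src S y') (tgt S y)" "ceqv (tgt S y') (src S y)"
    using inv c c' by (auto simp: cell_Cmp_iff tk intro: eqv_sym)
  show ?case
  proof (cases "i = k")
    case True
    have key: "cell S p (Cmp k (Cmp k a b) (Cmp k b' a')) \<and> ceqv (Cmp k (Cmp k a b) (Cmp k b' a')) (Idt (src S a))"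
      if "cell S p (Cmp k a b)" "cell S p (Cmp k b b')" "cell S p (Cmp k a a')" "cell S p (Cmp k b' a')" "cdim a = Suc k"
        "ceqv (Cmp k b b') (Idt (src S b))" "ceqv (Cmp k a a') (Idt (src S a))" for a b a' b'
    proof -
      have ca: "cell S p a" "cell S p b" "cell S p b'" "cell S p a'" "cdim b = Suc k" "cdim b' = Suc k" "cdim a' = Suc k"
        "ceqv (tgt S a) (src S b)" "ceqv (tgt S b) (src S b')" "ceqv (tgt S b') (src S a')" "ceqv (tgt S a) (src S a')"
        using that by (auto simp: cell_Cmp_iff tk)
      have 1: "cell S p (Cmp k (Cmp k a b) (Cmp k b' a'))"
        using that ca Cmp.prems by (simp add: cell_Cmp_iff tk)
      have 2: "ceqv (Cmp k (Cmp k a b) (Cmp k b' a')) (Cmp k a (Cmp k b (Cmp k b' a')))"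
        using eqv_assoc[OF 1] ca that Cmp.prems by auto
      have 3: "cell S p (Cmp k (Cmp k b b') a')" using ca that by (simp add: cell_Cmp_iff tk)
      have 4: "ceqv (Cmp k b (Cmp k b' a')) (Cmp k (Cmp k b b') a')"
        using eqv_assoc[OF 3] ca Cmp.prems by (auto intro: eqv_sym)
      have 5: "ceqv (Cmp k (Cmp k b b') a') (Cmp k (Idt (src S b)) a')"
        using eqv_Cmp[OF that(6) eqv_refl[OF ca(4)] 3] ca Cmp.prems by auto
      have "ceqv (src S b) (src S a')" using ca by (meson eqv_sym eqv_trans)
      then have 6: "ceqv (Cmp k (Idt (src S b)) a') (Cmp k (Idt (src S a')) a')"
        using eqv_Cmp[OF eqv_id eqv_refl[OF ca(4)]] eqv_cellD(2)[OF 5] ca Cmp.prems bd_cell[of b] by auto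
      have 7: "ceqv (Cmp k (Idt (src S a')) a') a'"
        using eqv_unit_left[OF ca(4), of k] ca Cmp.prems by (simp add: tk)
      have 8: "ceqv (Cmp k b (Cmp k b' a')) a'" using 4 5 6 7 by (meson eqv_trans)
      have "ceqv (Cmp k a (Cmp k b (Cmp k b' a'))) (Cmp k a a')"
        using eqv_Cmp[OF eqv_refl[OF ca(1)] 8 eqv_cellD(2)[OF 2]] that Cmp.prems by simp
      then show ?thesis using 1 2 that(7) by (meson eqv_trans)
    qed
    have cyx: "cell S p (Cmp k y' x')"
      using c c' bd True by (auto simp: cell_Cmp_iff tk) (meson eqv_sym eqv_trans)
    have xy: "cell S p (Cmp k x y)" using Cmp.prems True by simp
    have e: "ceqv (Cmp k x' x) (Idt (src S x'))" "ceqv (Cmp k y' y) (Idt (src S y'))"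
      using inv bd by (meson eqv_id eqv_sym eqv_trans)+
    have 1: "cell S p (Cmp k (Cmp k x y) (Cmp k y' x')) \<and> ceqv (Cmp k (Cmp k x y) (Cmp k y' x')) (Idt (src S x))"
      by (rule key) (use xy inv cyx c in auto)
    have 2: "cell S p (Cmp k (Cmp k y' x') (Cmp k x y)) \<and> ceqv (Cmp k (Cmp k y' x') (Cmp k x y)) (Idt (src S y'))"
      by (rule key) (use xy inv cyx c c' e in auto)
    have 3: "ceqv (Cmp k (Cmp k y' x') (Cmp k x y)) (Idt (tgt S y))"
      using 2 bd by (meson eqv_id eqv_trans)
    show ?thesis unfolding is_inverse_def
      by (rule exI[of _ "Cmp k y' x'"]) (use 1 2 3 True c in auto)
  next
    case False
    then have i: "i < k" using c by auto
    have at: "tgt_at S i u = tgt_at S i (tgt S u)" "src_at S i u = src_at S i (src S u)" if "cell S p u" "cdim u = Suc k" for u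
      using at_Suc[of u i] that Cmp.prems i by auto
    have gl: "ceqv (tgt_at S i u) (tgt_at S i (src S u))" "ceqv (src_at S i u) (src_at S i (tgt S u))" if "cell S p u" "cdim u = Suc k" for u
      using at_glob[of i k u] that Cmp.prems i by (auto simp: tk intro: eqv_sym)
    have d: "cdim (src S u) = k" "cdim (tgt S u) = k" if "cell S p u" "cdim u = Suc k" for u
      using bd_cell[of u] that Cmp.prems by auto
    have ex: "ceqv (tgt_at S i x) (tgt_at S i x')"
      using at_eqv[OF bd(1), of i] gl[OF c'(1,3)] at[OF c(1,3)] d c c' Cmp.prems i by (metis eqv_sym eqv_trans less_imp_le Suc_leD)
    have ey: "ceqv (src_at S i y) (src_at S i y')"
      using at_eqv[OF bd(4), of i] gl[OF c'(2,4)] at[OF c(2,4)] d c c' Cmp.prems i by (metis eqv_sym eqv_trans less_imp_le Suc_leD)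
    have cx': "cell S p (Cmp i x' y')"
      using c c' i ex ey by (auto simp: cell_Cmp_iff) (meson eqv_sym eqv_trans)
    have key: "cell S p (Cmp k (Cmp i a b) (Cmp i a' b')) \<and> ceqv (Cmp k (Cmp i a b) (Cmp i a' b')) (Idt (Cmp i (src S a) (src S b)))"
      if "cell S p (Cmp i a b)" "cell S p (Cmp k a a')" "cell S p (Cmp k b b')"  "cdim a = Suc k"
        "ceqv (Cmp k b b') (Idt (src S b))" "ceqv (Cmp k a a') (Idt (src S a))" for a b a' b'
    proof -
      have ca: "cell S p a" "cell S p b" "cell S p b'" "cell S p a'" "cdim b = Suc k" "cdim b' = Suc k" "cdim a' = Suc k"
        using that by (auto simp: cell_Cmp_iff)
      have "ceqv (tgt_at S k a) (src_at S k a')" using that by (simp add: cell_Cmp_iff)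
      have ia: "cell S p (Idt (src S a))" "cell S p (Idt (src S b))"
        "cdim (Idt (src S a)) = Suc k" "cdim (Idt (src S b)) = Suc k"
        using bd_cell(1,3)[of a] bd_cell(1,3)[of b] ca that(4) Cmp.prems(3) by (simp_all add: cell_Idt_iff)
      have t: "ceqv (tgt_at S i (Cmp k a a')) (src_at S i (Cmp k b b'))"
      proof -
        have "ceqv (tgt_at S i (Cmp k a a')) (tgt_at S i (Idt (src S a)))" 
          using at_eqv[OF that(6), of i] that Cmp.prems i by auto
        moreover have "ceqv (src_at S i (Cmp k b b')) (src_at S i (Idt (src S b)))"
          using at_eqv[OF that(5), of i] ca Cmp.prems i by auto
        moreover have "tgt_at S i (Idt (src S a)) = tgt_at S i (src S a)" "src_at S i (Idt (src S b)) = src_at S i b"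
          using at(1)[OF ia(1,3)] at(2)[OF ia(2,4)] at(2)[OF ca(2,5)] by simp_all
        moreover have "ceqv (tgt_at S i a) (tgt_at S i (src S a))" using gl ca that by auto
        moreover have "ceqv (tgt_at S i a) (src_at S i b)" using that by (simp add: cell_Cmp_iff)
        ultimately show ?thesis by (metis eqv_sym eqv_trans)
      qed
      have c1: "cell S p (Cmp i (Cmp k a a') (Cmp k b b'))"
        using that ca t i by (simp add: cell_Cmp_iff)
      have 1: "ceqv (Cmp i (Cmp k a a') (Cmp k b b')) (Cmp k (Cmp i a b) (Cmp i a' b'))"
        using eqv_exchange[OF c1 i] that Cmp.prems by auto
      have 2: "ceqv (Cmp i (Cmp k a a') (Cmp k b b')) (Cmp i (Idt (src S a)) (Idt (src S b)))"
        using eqv_Cmp[OF that(6,5) c1] that Cmp.prems by auto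
      have "cell S p (Cmp i (src S a) (src S b))"
        using bd_cell[OF that(1)] that Cmp.prems i by auto
      then have 3: "ceqv (Idt (Cmp i (src S a) (src S b))) (Cmp i (Idt (src S a)) (Idt (src S b)))"
        using eqv_id_comp[of i "src S a" "src S b"] bd_cell[of a] ca that Cmp.prems by auto
      show ?thesis using 1 2 3 eqv_cellD(2)[OF 1] by (meson eqv_sym eqv_trans)
    qed
    have e: "ceqv (Cmp k x' x) (Idt (src S x'))" "ceqv (Cmp k y' y) (Idt (src S y'))"
      using inv bd by (meson eqv_id eqv_sym eqv_trans)+
    have 1: "cell S p (Cmp k (Cmp i x y) (Cmp i x' y')) \<and> ceqv (Cmp k (Cmp i x y) (Cmp i x' y')) (Idt (Cmp i (src S x) (src S y)))"
      by (rule key) (use Cmp.prems inv c in auto)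
    have 2: "cell S p (Cmp k (Cmp i x' y') (Cmp i x y)) \<and> ceqv (Cmp k (Cmp i x' y') (Cmp i x y)) (Idt (Cmp i (src S x') (src S y')))"
      by (rule key) (use cx' inv c c' e in auto)
    have "cell S p (Cmp i (src S x') (src S y'))" using eqv_cellD(2)[OF conjunct2[OF 2]] by (simp only: cell_Idt_iff)
    then have "ceqv (Cmp i (src S x') (src S y')) (Cmp i (tgt S x) (tgt S y))"
      using eqv_Cmp[OF bd(1,3)] d c' Cmp.prems by auto
    then have 3: "ceqv (Cmp k (Cmp i x' y') (Cmp i x y)) (Idt (Cmp i (tgt S x) (tgt S y)))"
      using 2 by (meson eqv_id eqv_trans)
    show ?thesis unfolding is_inverse_def
      by (rule exI[of _ "Cmp i x' y'"]) (use 1 2 3 False c in auto)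
  qed
qed

lemma free_np_category: "np_category m F p"
proof -
  interpret strict_ncategory m F by (rule free_ncategory)
  show ?thesis
  proof
    fix k x assume k: "p \<le> k" and x: "x \<in> cells F (Suc k)"
    from x obtain a where a: "x = cls a" "cell S p a" "cdim a = Suc k" "Suc k \<le> m" by (rule cellsE)
    from inverse_exists[OF a(2-4) k] obtain b where b: "is_inverse k a b" ..
    have ab: "cell S p (Cmp k a b)" "cell S p (Cmp k b a)"
      "ceqv (Cmp k a b) (Idt (src S a))" "ceqv (Cmp k b a) (Idt (tgt S a))"
      using b unfolding is_inverse_def by blast+
    have c: "cell S p b" "cdim b = Suc k"
      using ab(1) a(3) by (simp_all add: cell_Cmp_iff)
    have c': "ceqv (tgt S a) (src S b)" "ceqv (tgt S b) (src S a)"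
      using ab(1,2) a(3) c by (simp_all add: cell_Cmp_iff src_at_def tgt_at_def)
    show "\<exists>y \<in> cells F (Suc k). source F k y = target F k x \<and> target F k y = source F k x \<and>
      cmp F (Suc k) k x y = ident F k (source F k x) \<and>
      cmp F (Suc k) k y x = ident F k (target F k x)"
    proof (intro bexI conjI)
      note bda = bd_cell[of a]
      show "cls b \<in> cells F (Suc k)" using c a by (simp add: cellsI)
      show "source F k (cls b) = target F k x" "target F k (cls b) = source F k x"
        using a c cls_eq[OF c'(1)] cls_eq[OF c'(2)] by (simp_all add: source_cls target_cls)
      show "cmp F (Suc k) k x (cls b) = ident F k (source F k x)"
        "cmp F (Suc k) k (cls b) x = ident F k (target F k x)"
        using a c ab bda by (simp_all add: source_cls target_cls ident_cls cmp_cls cls_eq)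
    qed
  qed
qed
end

primrec atoms1 :: "'g expr \<Rightarrow> 'g expr list" where
  "atoms1 (Gen k g) = [Gen k g]"
| "atoms1 (Inv k g) = [Inv k g]"
| "atoms1 (Idt x) = []"
| "atoms1 (Cmp i x y) = atoms1 x @ atoms1 y"

primrec slices2 :: "'g expr \<Rightarrow> 'g expr list list" where
  "slices2 (Gen k g) = [[Gen k g]]"
| "slices2 (Inv k g) = [[Inv k g]]"
| "slices2 (Idt x) = []"
| "slices2 (Cmp i x y) = (if i = 0 then
     (case y of Idt u \<Rightarrow> map (\<lambda>s. s @ map Idt (atoms1 u)) (slices2 x)
      | _ \<Rightarrow> (case x of Idt u \<Rightarrow> map (\<lambda>s. map Idt (atoms1 u) @ s) (slices2 y) | _ \<Rightarrow> [[Cmp i x y]]))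
     else slices2 x @ slices2 y)"

definition hlist where "hlist b s = foldr (Cmp 0) s (Idt (Idt b))"
definition vlist where "vlist b ss r = foldr (\<lambda>s. Cmp 1 (hlist b s)) ss r"

context typed_data begin

definition lq :: "'g expr \<Rightarrow> 'g expr \<Rightarrow> bool" where
  "lq x y \<longleftrightarrow> (cell S p x \<and> cdim x \<le> m \<longrightarrow> ceqv x y)"

lemma lqI: "(cell S p x \<Longrightarrow> cdim x \<le> m \<Longrightarrow> ceqv x y) \<Longrightarrow> lq x y"
  by (simp add: lq_def)

lemma lqD: "lq x y \<Longrightarrow> cell S p x \<Longrightarrow> cdim x \<le> m \<Longrightarrow> ceqv x y"
  by (simp add: lq_def)

lemma lq_refl: "lq x x" by (simp add: lq_def eqv_refl)

lemma lq_trans [trans]: assumes "lq x y" "lq y z" shows "lq x z"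
proof (rule lqI)
  assume c: "cell S p x" "cdim x \<le> m"
  then have xy: "ceqv x y" using assms(1) by (simp add: lq_def)
  then have "ceqv y z" using assms(2) c eqv_cellD(2)[OF xy] eqv_dim[OF xy] by (simp add: lq_def)
  with xy show "ceqv x z" by (rule eqv_trans)
qed

lemma lq_Cmp: assumes "lq x x'" "lq y y'" shows "lq (Cmp i x y) (Cmp i x' y')"
proof (rule lqI)
  assume c: "cell S p (Cmp i x y)" "cdim (Cmp i x y) \<le> m"
  then have "ceqv x x'" "ceqv y y'" using assms by (simp_all add: lq_def cell_Cmp_iff)
  then show "ceqv (Cmp i x y) (Cmp i x' y')" using eqv_Cmp c by simp
qed

lemma lq_assoc: "lq (Cmp i (Cmp i x y) z) (Cmp i x (Cmp i y z))"
  unfolding lq_def using eqv_assoc by simp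

lemma lq_unit_left: "lq (Cmp k (Idt u) r) r" if "cdim u = k"
proof (rule lqI)
  assume c: "cell S p (Cmp k (Idt u) r)" "cdim (Cmp k (Idt u) r) \<le> m"
  then have r1: "cell S p r" "cell S p u" "cdim r = Suc k" "ceqv (tgt_at S k (Idt u)) (src_at S k r)"
    using that by (auto simp: cell_Cmp_iff cell_Idt_iff)
  have r: "cell S p r" "cell S p u" "cdim r = Suc k" "ceqv u (src S r)"
    using r1 that by (simp_all add: src_at_def tgt_at_def)
  have "ceqv (Cmp k (Idt u) r) (Cmp k (Idt (src S r)) r)"
    using eqv_Cmp[OF eqv_id[OF r(4)] eqv_refl[OF r(1)] c(1)] c(2) by simp
  moreover have "ceqv (Cmp k (Idt (src S r)) r) r"
    using eqv_unit_left[OF r(1), of k] that c r by (simp add: src_at_def)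
  ultimately show "ceqv (Cmp k (Idt u) r) r" by (rule eqv_trans)
qed

lemma lq_unit_left2: "lq (Cmp 0 (Idt (Idt u)) r) r" if "cdim u = 0"
proof (rule lqI)
  assume c: "cell S p (Cmp 0 (Idt (Idt u)) r)" "cdim (Cmp 0 (Idt (Idt u)) r) \<le> m"
  then have r: "cell S p r" "cell S p u" "cdim r = 2" "ceqv u (src_at S 0 r)"
    using that by (simp_all add: cell_Cmp_iff cell_Idt_iff tgt_at_def)
  have "ceqv (Cmp 0 (Idt (Idt u)) r) (Cmp 0 (Idt (Idt (src_at S 0 r))) r)"
    using eqv_Cmp[OF eqv_id[OF eqv_id[OF r(4)]] eqv_refl[OF r(1)] c(1)] c(2) by simp
  moreover have "ceqv (Cmp 0 (Idt (Idt (src_at S 0 r))) r) r"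
    using eqv_unit_left[OF r(1), of 0] that c r by (simp add: numeral_2_eq_2)
  ultimately show "ceqv (Cmp 0 (Idt (Idt u)) r) r" by (rule eqv_trans)
qed

lemma eqv_unit_right_eqv:
  assumes "cell S p x" "i < cdim x" "cdim x \<le> m" "ceqv (tgt_at S i x) t"
  shows "ceqv x (Cmp i x (pad (cdim x - i) t))" "cell S p (Cmp i x (pad (cdim x - i) t))"
proof -
  have "ceqv (Cmp i x (pad (cdim x - i) (tgt_at S i x))) (Cmp i x (pad (cdim x - i) t))"
    using unit_right_cell[OF assms(1-3)] assms by (intro eqv_Cmp eqv_refl eqv_pad)
  moreover have "ceqv (Cmp i x (pad (cdim x - i) (tgt_at S i x))) x"
    using assms by (intro eqv_unit_right)
  ultimately show "ceqv x (Cmp i x (pad (cdim x - i) t))" by (meson eqv_sym eqv_trans)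
  then show "cell S p (Cmp i x (pad (cdim x - i) t))" by (rule eqv_cellD)
qed

lemma lq_unit_right2: "lq x (Cmp 0 x (Idt (Idt b)))" if "cdim x = 2" "ceqv b (tgt_at S 0 x)"
proof (rule lqI)
  assume "cell S p x" "cdim x \<le> m"
  then show "ceqv x (Cmp 0 x (Idt (Idt b)))"
    using eqv_unit_right_eqv(1)[of x 0 b] that by (simp add: eqv_sym numeral_2_eq_2)
qed

lemma lq_Idt_Cmp: "lq (Idt (Cmp i x y)) (Cmp i (Idt x) (Idt y))"
  unfolding lq_def using eqv_id_comp by (simp add: cell_Idt_iff)

lemma lq_Cmp_Idt: "lq (Cmp i (Idt x) (Idt y)) (Idt (Cmp i x y))" if "i < cdim x"
proof (rule lqI)
  assume c: "cell S p (Cmp i (Idt x) (Idt y))" "cdim (Cmp i (Idt x) (Idt y)) \<le> m"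
  then have "cell S p (Cmp i x y)"
    using that at_Suc[of "Idt x" i] at_Suc[of "Idt y" i] by (auto simp: cell_Cmp_iff cell_Idt_iff)
  then show "ceqv (Cmp i (Idt x) (Idt y)) (Idt (Cmp i x y))"
    using eqv_id_comp[of i x y] c by (simp add: eqv_sym)
qed

lemma unit_Idt: 
  assumes "cell S p (Idt u)" "cdim (Idt u) \<le> m" "cdim u = k"
  shows "ceqv (Idt u) (Cmp k (Idt u) (Idt u))" "cell S p (Cmp k (Idt u) (Idt u))"
proof -
  show "ceqv (Idt u) (Cmp k (Idt u) (Idt u))"
    using eqv_unit_left[OF assms(1), of k] assms by (simp add: src_at_def eqv_sym)
  then show "cell S p (Cmp k (Idt u) (Idt u))" by (rule eqv_cellD)
qed

lemma lq_dist_right: "lq (Cmp i (Cmp j x y) (Idt u)) (Cmp j (Cmp i x (Idt u)) (Cmp i y (Idt u)))"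
  if "i < j" "cdim u = j"
proof (rule lqI)
  assume c: "cell S p (Cmp i (Cmp j x y) (Idt u))" "cdim (Cmp i (Cmp j x y) (Idt u)) \<le> m"
  then have u: "cell S p (Idt u)" "cdim (Idt u) \<le> m" "cell S p (Cmp j x y)" by (simp_all add: cell_Cmp_iff)
  have 1: "ceqv (Cmp i (Cmp j x y) (Idt u)) (Cmp i (Cmp j x y) (Cmp j (Idt u) (Idt u)))"
    using c by (intro eqv_Cmp eqv_refl unit_Idt u that) simp_all
  show "ceqv (Cmp i (Cmp j x y) (Idt u)) (Cmp j (Cmp i x (Idt u)) (Cmp i y (Idt u)))"
    using eqv_trans[OF 1 eqv_exchange[OF eqv_cellD(2)[OF 1] that(1)]] c by simp
qed

lemma lq_dist_left: "lq (Cmp i (Idt u) (Cmp j x y)) (Cmp j (Cmp i (Idt u) x) (Cmp i (Idt u) y))"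
  if "i < j" "cdim u = j"
proof (rule lqI)
  assume c: "cell S p (Cmp i (Idt u) (Cmp j x y))" "cdim (Cmp i (Idt u) (Cmp j x y)) \<le> m"
  then have u: "cell S p (Idt u)" "cdim (Idt u) \<le> m" "cell S p (Cmp j x y)" by (simp_all add: cell_Cmp_iff)
  have 1: "ceqv (Cmp i (Idt u) (Cmp j x y)) (Cmp i (Cmp j (Idt u) (Idt u)) (Cmp j x y))"
    using c by (intro eqv_Cmp eqv_refl unit_Idt u that) simp_all
  show "ceqv (Cmp i (Idt u) (Cmp j x y)) (Cmp j (Cmp i (Idt u) x) (Cmp i (Idt u) y))"
    using eqv_trans[OF 1 eqv_exchange[OF eqv_cellD(2)[OF 1] that(1)]] c by simp
qed

lemma eqv_swap:
  assumes x: "cell S p x" "cdim x = 2" "2 \<le> m" and y: "cell S p y" "cdim y = 2"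
    and e: "ceqv (tgt_at S 0 x) (src_at S 0 y)"
  shows "ceqv (Cmp 1 (Cmp 0 x (Idt (src S y))) (Cmp 0 (Idt (tgt S x)) y))
           (Cmp 1 (Cmp 0 (Idt (src S x)) y) (Cmp 0 x (Idt (tgt S y))))"
proof -
  have l: "ceqv x (Cmp 1 (Idt (src S x)) x)" "ceqv x (Cmp 1 x (Idt (tgt S x)))"
    "ceqv y (Cmp 1 (Idt (src S y)) y)" "ceqv y (Cmp 1 y (Idt (tgt S y)))"
    using eqv_unit_left[of x 1] eqv_unit_right[of x 1] eqv_unit_left[of y 1] eqv_unit_right[of y 1] x y
    by (simp_all add: eqv_sym src_at_def tgt_at_def)
  have c: "cell S p (Cmp 0 x y)" using x y e by (simp add: cell_Cmp_iff)
  have 1: "ceqv (Cmp 0 x y) (Cmp 0 (Cmp 1 x (Idt (tgt S x))) (Cmp 1 (Idt (src S y)) y))"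
    using l c x by (intro eqv_Cmp) simp_all
  have 2: "ceqv (Cmp 0 x y) (Cmp 0 (Cmp 1 (Idt (src S x)) x) (Cmp 1 y (Idt (tgt S y))))"
    using l c x by (intro eqv_Cmp) simp_all
  have 3: "ceqv (Cmp 0 x y) (Cmp 1 (Cmp 0 x (Idt (src S y))) (Cmp 0 (Idt (tgt S x)) y))"
    using eqv_trans[OF 1 eqv_exchange[OF eqv_cellD(2)[OF 1]]] x by simp
  have 4: "ceqv (Cmp 0 x y) (Cmp 1 (Cmp 0 (Idt (src S x)) y) (Cmp 0 x (Idt (tgt S y))))"
    using eqv_trans[OF 2 eqv_exchange[OF eqv_cellD(2)[OF 2]]] x bd_cell[of x] by simp
  show ?thesis using 3 4 by (meson eqv_sym eqv_trans)
qed

lemma lq_atoms1: "cdim x = Suc 0 \<Longrightarrow> lq (Cmp 0 x r) (foldr (Cmp 0) (atoms1 x) r)"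
proof (induction x arbitrary: r)
  case (Idt x) then show ?case using lq_unit_left[of x 0 r] by simp
next
  case (Cmp j x y)
  show ?case
  proof (cases "cell S p (Cmp j x y)")
    case True
    then have j: "j = 0" "cdim y = Suc 0" using Cmp.prems by (auto simp: cell_Cmp_iff)
    have "lq (Cmp 0 (Cmp 0 x y) r) (Cmp 0 x (Cmp 0 y r))" by (rule lq_assoc)
    also have "lq \<dots> (Cmp 0 x (foldr (Cmp 0) (atoms1 y) r))" using Cmp j by (intro lq_Cmp lq_refl) simp
    also have "lq \<dots> (foldr (Cmp 0) (atoms1 x) (foldr (Cmp 0) (atoms1 y) r))" using Cmp j by simp
    finally show ?thesis using j by simp
  next
    case False then show ?thesis by (auto simp: lq_def cell_Cmp_iff)
  qed
qed (auto intro: lq_refl)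

lemma eqv1I:
  assumes "cdim x = Suc 0" "cdim y = Suc 0" "atoms1 x = atoms1 y" "1 \<le> m" "cell S p x" "cell S p y" "ceqv (tgt S x) (tgt S y)"
  shows "ceqv x y"
proof -
  have 1: "ceqv x (Cmp 0 x (Idt (tgt S x)))" "ceqv y (Cmp 0 y (Idt (tgt S x)))"
    using eqv_unit_right_eqv(1)[of x 0 "tgt S x"] eqv_unit_right_eqv(1)[of y 0 "tgt S x"] assms bd_cell[of x] 
    by (simp_all add: tgt_at_def eqv_refl eqv_sym)
  have "ceqv (Cmp 0 x (Idt (tgt S x))) (foldr (Cmp 0) (atoms1 x) (Idt (tgt S x)))"
    "ceqv (Cmp 0 y (Idt (tgt S x))) (foldr (Cmp 0) (atoms1 y) (Idt (tgt S x)))"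
    using lqD[OF lq_atoms1[OF assms(1)] eqv_cellD(2)[OF 1(1)]] lqD[OF lq_atoms1[OF assms(2)] eqv_cellD(2)[OF 1(2)]] assms
    by simp_all
  then show ?thesis using 1 assms(3) by (metis eqv_sym eqv_trans)
qed

lemma lq_atoms1_Idt: "cdim u = Suc 0 \<Longrightarrow> lq (Cmp 0 (Idt u) r) (foldr (Cmp 0) (map Idt (atoms1 u)) r)"
proof (induction u arbitrary: r)
  case (Idt x) then show ?case using lq_unit_left2[of x r] by simp
next
  case (Cmp j x y)
  show ?case
  proof (cases "cell S p (Cmp j x y)")
    case True
    then have j: "j = 0" "cdim y = Suc 0" using Cmp.prems by (auto simp: cell_Cmp_iff)
    have "lq (Cmp 0 (Idt (Cmp 0 x y)) r) (Cmp 0 (Cmp 0 (Idt x) (Idt y)) r)" by (intro lq_Cmp lq_refl lq_Idt_Cmp)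
    also have "lq \<dots> (Cmp 0 (Idt x) (Cmp 0 (Idt y) r))" by (rule lq_assoc)
    also have "lq \<dots> (Cmp 0 (Idt x) (foldr (Cmp 0) (map Idt (atoms1 y)) r))" using Cmp j by (intro lq_Cmp lq_refl) simp
    also have "lq \<dots> (foldr (Cmp 0) (map Idt (atoms1 x)) (foldr (Cmp 0) (map Idt (atoms1 y)) r))" using Cmp j by simp
    finally show ?thesis using j by simp
  next
    case False then show ?thesis by (auto simp: lq_def cell_Cmp_iff cell_Idt_iff)
  qed
qed (auto intro: lq_refl)

lemma vlist_simps [simp]: "vlist b [] r = r" "vlist b (s # ss) r = Cmp 1 (hlist b s) (vlist b ss r)"
  by (simp_all add: vlist_def)

lemma vlist_append: "vlist b (ss @ ss') r = vlist b ss (vlist b ss' r)"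
  by (induction ss) auto

lemma lq_hlist_left: "cdim u = 1 \<Longrightarrow> lq (Cmp 0 (Idt u) (hlist b s)) (hlist b (map Idt (atoms1 u) @ s))"
  unfolding hlist_def using lq_atoms1_Idt[of u "foldr (Cmp 0) s (Idt (Idt b))"] by simp

lemma lq_hlist_right:
  assumes "cdim u = 1" "ceqv b (tgt S u)" "cdim b' = 0"
  shows "lq (Cmp 0 (hlist b' s) (Idt u)) (hlist b (s @ map Idt (atoms1 u)))"
proof (induction s)
  case Nil
  have "lq (Cmp 0 (Idt (Idt b')) (Idt u)) (Idt u)" using assms by (intro lq_unit_left2)
  also have "lq (Idt u) (Cmp 0 (Idt u) (Idt (Idt b)))" using assms by (intro lq_unit_right2) (simp_all add: tgt_at_def)
  also have "lq \<dots> (hlist b (map Idt (atoms1 u)))" using assms lq_atoms1_Idt by (simp add: hlist_def)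
  finally show ?case by (simp add: hlist_def)
next
  case (Cons a s)
  have "lq (Cmp 0 (Cmp 0 a (hlist b' s)) (Idt u)) (Cmp 0 a (Cmp 0 (hlist b' s) (Idt u)))" by (rule lq_assoc)
  also have "lq \<dots> (Cmp 0 a (hlist b (s @ map Idt (atoms1 u))))" using Cons by (intro lq_Cmp lq_refl)
  finally show ?case by (simp add: hlist_def)
qed

lemma lq_vlist_right:
  assumes "cdim u = 1" "ceqv b (tgt S u)" "cdim b' = 0" "cdim t = 1"
  shows "lq (Cmp 1 (Cmp 0 (vlist b' ss (Idt t)) (Idt u)) r) (vlist b (map (\<lambda>s. s @ map Idt (atoms1 u)) ss) r)"
proof (induction ss)
  case Nil
  have "lq (Cmp 1 (Cmp 0 (Idt t) (Idt u)) r) (Cmp 1 (Idt (Cmp 0 t u)) r)"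
    using assms by (intro lq_Cmp lq_refl lq_Cmp_Idt) simp
  also have "lq \<dots> r" using assms by (intro lq_unit_left) simp
  finally show ?case by simp
next
  case (Cons s ss)
  let ?R = "vlist b' ss (Idt t)"
  have "lq (Cmp 1 (Cmp 0 (Cmp 1 (hlist b' s) ?R) (Idt u)) r) (Cmp 1 (Cmp 1 (Cmp 0 (hlist b' s) (Idt u)) (Cmp 0 ?R (Idt u))) r)"
    using assms by (intro lq_Cmp lq_refl lq_dist_right) simp_all
  also have "lq \<dots> (Cmp 1 (Cmp 0 (hlist b' s) (Idt u)) (Cmp 1 (Cmp 0 ?R (Idt u)) r))" by (rule lq_assoc)
  also have "lq \<dots> (Cmp 1 (hlist b (s @ map Idt (atoms1 u))) (vlist b (map (\<lambda>s. s @ map Idt (atoms1 u)) ss) r))"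
    using Cons assms by (intro lq_Cmp lq_hlist_right)
  finally show ?case by simp
qed

lemma lq_vlist_left:
  assumes "cdim u = 1" "cdim t = 1"
  shows "lq (Cmp 1 (Cmp 0 (Idt u) (vlist b ss (Idt t))) r) (vlist b (map (\<lambda>s. map Idt (atoms1 u) @ s) ss) r)"
proof (induction ss)
  case Nil
  have "lq (Cmp 1 (Cmp 0 (Idt u) (Idt t)) r) (Cmp 1 (Idt (Cmp 0 u t)) r)"
    using assms by (intro lq_Cmp lq_refl lq_Cmp_Idt) simp
  also have "lq \<dots> r" using assms by (intro lq_unit_left) simp
  finally show ?case by simp
next
  case (Cons s ss)
  let ?R = "vlist b ss (Idt t)"
  have "lq (Cmp 1 (Cmp 0 (Idt u) (Cmp 1 (hlist b s) ?R)) r) (Cmp 1 (Cmp 1 (Cmp 0 (Idt u) (hlist b s)) (Cmp 0 (Idt u) ?R)) r)"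
    using assms by (intro lq_Cmp lq_refl lq_dist_left) simp_all
  also have "lq \<dots> (Cmp 1 (Cmp 0 (Idt u) (hlist b s)) (Cmp 1 (Cmp 0 (Idt u) ?R) r))" by (rule lq_assoc)
  also have "lq \<dots> (Cmp 1 (hlist b (map Idt (atoms1 u) @ s)) (vlist b (map (\<lambda>s. map Idt (atoms1 u) @ s) ss) r))"
    using Cons assms by (intro lq_Cmp lq_hlist_left)
  finally show ?case by simp
qed

lemma tgt0_Cmp1:
  assumes "cell S p (Cmp 1 x y)" "cdim x = 2" "2 \<le> m"
  shows "ceqv (tgt_at S 0 (Cmp 1 x y)) (tgt_at S 0 x)" "ceqv (tgt_at S 0 (Cmp 1 x y)) (tgt_at S 0 y)"
proof -
  have c: "cell S p x" "cell S p y" "cdim y = 2" "ceqv (tgt_at S 1 x) (src_at S 1 y)"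
    using assms by (simp_all add: cell_Cmp_iff)
  have 1: "tgt_at S 0 (Cmp 1 x y) = tgt_at S 0 y" using at_Cmp_low[OF assms(1)] assms by simp
  have 2: "ceqv (tgt_at S 0 (tgt_at S 1 x)) (tgt_at S 0 (src_at S 1 y))"
    using at_eqv[OF c(4), of 0] at_cell[OF c(1), of 1] assms by simp
  have 3: "tgt_at S 0 (tgt_at S 1 x) = tgt_at S 0 x" using at_at[of 0 1 x] c assms by simp
  have 4: "ceqv (tgt_at S 0 (src_at S 1 y)) (tgt_at S 0 y)" using at_glob[of 0 1 y] c assms by simp
  show "ceqv (tgt_at S 0 (Cmp 1 x y)) (tgt_at S 0 x)" using 1 2 3 4 by (metis eqv_sym eqv_trans)
  show "ceqv (tgt_at S 0 (Cmp 1 x y)) (tgt_at S 0 y)" using 1 at_cell[OF c(2), of 0] c assms by (simp add: eqv_refl)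
qed

lemma lq_slices2: "cdim x = 2 \<Longrightarrow> ceqv b (tgt_at S 0 x) \<Longrightarrow> lq (Cmp 1 x r) (vlist b (slices2 x) r)"
proof (induction x arbitrary: r b)
  case (Idt x) then show ?case using lq_unit_left[of x 1 r] by simp
next
  case (Cmp j x y)
  show ?case
  proof (cases "cell S p (Cmp j x y) \<and> 2 \<le> m")
    case True
    then have c: "j \<le> 1" "cdim x = 2" "cdim y = 2" "cell S p x" "cell S p y" using Cmp.prems by (auto simp: cell_Cmp_iff)
    have xr: "lq x (vlist (tgt_at S 0 x) (slices2 x) (Idt (tgt S x)))"
    proof (rule lqI)
      assume "cdim x \<le> m"
      then have 1: "ceqv x (Cmp 1 x (Idt (tgt S x)))"
        using eqv_unit_right[of x 1] c by (simp add: tgt_at_def eqv_sym)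
      have "ceqv (tgt_at S 0 x) (tgt_at S 0 x)" using at_cell[of x 0] c True by (intro eqv_refl) simp
      then show "ceqv x (vlist (tgt_at S 0 x) (slices2 x) (Idt (tgt S x)))"
        using lqD[OF Cmp.IH(1)[of "tgt_at S 0 x" "Idt (tgt S x)"]] eqv_cellD(2)[OF 1] 1 c True by (auto intro: eqv_trans)
    qed
    have yr: "lq y (vlist b (slices2 y) (Idt (tgt S y)))" if "ceqv b (tgt_at S 0 y)"
    proof (rule lqI)
      assume "cdim y \<le> m"
      then have 1: "ceqv y (Cmp 1 y (Idt (tgt S y)))"
        using eqv_unit_right[of y 1] c by (simp add: tgt_at_def eqv_sym)
      then show "ceqv y (vlist b (slices2 y) (Idt (tgt S y)))"
        using lqD[OF Cmp.IH(2)[of b "Idt (tgt S y)"]] eqv_cellD(2)[OF 1] that c True by (auto intro: eqv_trans)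
    qed
    show ?thesis
    proof (cases "j = 0")
      case False
      then have j: "j = 1" using c by simp
      have bb: "ceqv b (tgt_at S 0 x)" "ceqv b (tgt_at S 0 y)"
        using tgt0_Cmp1[of x y] True Cmp.prems c unfolding j by (auto intro: eqv_trans)
      have "lq (Cmp 1 (Cmp 1 x y) r) (Cmp 1 x (Cmp 1 y r))" by (rule lq_assoc)
      also have "lq \<dots> (Cmp 1 x (vlist b (slices2 y) r))" using Cmp.IH(2) bb c by (intro lq_Cmp lq_refl) simp
      also have "lq \<dots> (vlist b (slices2 x) (vlist b (slices2 y) r))" using Cmp.IH(1) bb c by simp
      finally show ?thesis using j by (simp add: vlist_append)
    next
      case True0: True
      have b: "ceqv b (tgt_at S 0 y)" using at_Cmp_low[of 0 x y 0] True True0 Cmp.prems by simp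
      have opaque: "lq (Cmp 1 (Cmp j x y) r) (vlist b [[Cmp j x y]] r)"
        using Cmp.prems by (simp add: hlist_def) (intro lq_Cmp lq_refl lq_unit_right2, simp_all)
      consider (right) u where "y = Idt u" | (left) u where "x = Idt u" "\<nexists>v. y = Idt v" 
        | (none) "\<nexists>u. x = Idt u" "\<nexists>u. y = Idt u" by blast
      then show ?thesis
      proof cases
        case right
        have "lq (Cmp 1 (Cmp j x y) r) (Cmp 1 (Cmp 0 (vlist (tgt_at S 0 x) (slices2 x) (Idt (tgt S x))) (Idt u)) r)"
          unfolding True0 right by (intro lq_Cmp lq_refl xr)
        also have "lq \<dots> (vlist b (map (\<lambda>s. s @ map Idt (atoms1 u)) (slices2 x)) r)"
          using c right at_cell[of x 0] bd_cell[of x] True b by (intro lq_vlist_right) (simp_all add: tgt_at_def)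
        finally show ?thesis using right True0 by simp
      next
        case left
        have "lq (Cmp 1 (Cmp j x y) r) (Cmp 1 (Cmp 0 (Idt u) (vlist b (slices2 y) (Idt (tgt S y)))) r)"
          unfolding True0 left by (intro lq_Cmp lq_refl yr b)
        also have "lq \<dots> (vlist b (map (\<lambda>s. map Idt (atoms1 u) @ s) (slices2 y)) r)"
          using c left bd_cell[of y] True by (intro lq_vlist_left) simp_all
        finally show ?thesis using left True0 by (cases y) auto
      next
        case none
        then have "slices2 (Cmp j x y) = [[Cmp j x y]]" using True0 by (cases x; cases y) auto
        then show ?thesis using opaque by simp
      qed
    qed
  next
    case False then show ?thesis using Cmp.prems by (auto simp: lq_def cell_Cmp_iff)
  qed
next
  case (Gen k g)
  then show ?case by (simp add: hlist_def) (intro lq_Cmp lq_refl lq_unit_right2, simp_all)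
next
  case (Inv k g)
  then show ?case by (simp add: hlist_def) (intro lq_Cmp lq_refl lq_unit_right2, simp_all)
qed

lemma eqv2I:
  assumes "cdim x = 2" "cdim y = 2" "slices2 x = slices2 y" "2 \<le> m" "cell S p x" "cell S p y" "ceqv (tgt S x) (tgt S y)"
  shows "ceqv x y"
proof -
  have 1: "ceqv x (Cmp 1 x (Idt (tgt S x)))" "ceqv y (Cmp 1 y (Idt (tgt S x)))"
    using eqv_unit_right_eqv(1)[of x 1 "tgt S x"] eqv_unit_right_eqv(1)[of y 1 "tgt S x"] assms bd_cell[of x] 
    by (simp_all add: tgt_at_def eqv_refl eqv_sym)
  let ?b = "tgt_at S 0 x"
  have "tgt_at S 0 x = tgt_at S 0 (tgt S x)" "tgt_at S 0 y = tgt_at S 0 (tgt S y)"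
    using at_Suc[of x 0] at_Suc[of y 0] assms by simp_all
  then have b: "ceqv ?b (tgt_at S 0 x)" "ceqv ?b (tgt_at S 0 y)"
    using at_eqv[OF assms(7), of 0] bd_cell[of x] at_cell[of x 0] assms by (simp_all add: eqv_refl)
  have "ceqv (Cmp 1 x (Idt (tgt S x))) (vlist ?b (slices2 x) (Idt (tgt S x)))"
    "ceqv (Cmp 1 y (Idt (tgt S x))) (vlist ?b (slices2 y) (Idt (tgt S x)))"
    using lqD[OF lq_slices2[OF assms(1) b(1)] eqv_cellD(2)[OF 1(1)]] lqD[OF lq_slices2[OF assms(2) b(2)] eqv_cellD(2)[OF 1(2)]] assms
    by simp_all
  then show ?thesis using 1 assms(3) by (metis eqv_sym eqv_trans)
qed

end

context typed_data begin

lemma eqv2_swap: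
  assumes st: "cdim s = 2" "cdim t = 2" "2 \<le> m" "cell S p s" "cell S p t" "ceqv (tgt S s) (tgt S t)"
    and xy: "cdim x = 2" "cdim y = 2" "cell S p x" "cell S p y" "ceqv (tgt_at S 0 x) (src_at S 0 y)"
    and mid: "cell S p (Cmp 1 u (Cmp 1 (Cmp 1 (Cmp 0 x (Idt (src S y))) (Cmp 0 (Idt (tgt S x)) y)) v))"
      "ceqv (tgt S s) (tgt S v)"
    and N: "slices2 s = slices2 u @ slices2 (Cmp 0 x (Idt (src S y))) @ slices2 (Cmp 0 (Idt (tgt S x)) y) @ slices2 v"
      "slices2 t = slices2 u @ slices2 (Cmp 0 (Idt (src S x)) y) @ slices2 (Cmp 0 x (Idt (tgt S y))) @ slices2 v"
  shows "ceqv s t"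
proof -
  let ?l = "Cmp 1 (Cmp 0 x (Idt (src S y))) (Cmp 0 (Idt (tgt S x)) y)"
  let ?r = "Cmp 1 (Cmp 0 (Idt (src S x)) y) (Cmp 0 x (Idt (tgt S y)))"
  have lr: "ceqv ?l ?r" using st xy by (intro eqv_swap)
  have c1: "cell S p u" "cell S p (Cmp 1 ?l v)" "cdim u = 2"
    using mid(1)[unfolded cell_Cmp_iff[of S p 1 u]] xy(1) by auto
  then have c: "cell S p u" "cell S p v" "cell S p (Cmp 1 ?l v)" "cdim u = 2" "cdim v = 2"
    using c1(2)[unfolded cell_Cmp_iff[of S p 1 _ v]] xy(1) by auto
  have e1: "ceqv (Cmp 1 ?l v) (Cmp 1 ?r v)" using c xy st by (intro eqv_Cmp[OF lr eqv_refl]) simp_all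
  have e2: "ceqv (Cmp 1 u (Cmp 1 ?l v)) (Cmp 1 u (Cmp 1 ?r v))"
    using mid c st by (intro eqv_Cmp[OF eqv_refl e1]) simp_all
  have tv: "ceqv (tgt S t) (tgt S v)" using eqv_trans[OF eqv_sym[OF st(6)] mid(2)] .
  have cr: "cell S p (Cmp 1 u (Cmp 1 ?r v))" using e2 by (rule eqv_cellD)
  have tv': "tgt S (Cmp 1 u (Cmp 1 ?l v)) = tgt S v" "tgt S (Cmp 1 u (Cmp 1 ?r v)) = tgt S v"
    using c xy bd_cell[of x] st by simp_all
  have n1: "slices2 (Cmp 1 a b) = slices2 a @ slices2 b" for a b :: "'g expr" by simp
  have s: "ceqv s (Cmp 1 u (Cmp 1 ?l v))"
  proof (rule eqv2I)
    show "slices2 s = slices2 (Cmp 1 u (Cmp 1 ?l v))" unfolding N n1 by simp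
    show "ceqv (tgt S s) (tgt S (Cmp 1 u (Cmp 1 ?l v)))" unfolding tv' by (rule mid(2))
    show "cdim (Cmp 1 u (Cmp 1 ?l v)) = 2" using c by simp
  qed (rule st mid)+
  have t: "ceqv t (Cmp 1 u (Cmp 1 ?r v))"
  proof (rule eqv2I)
    show "slices2 t = slices2 (Cmp 1 u (Cmp 1 ?r v))" unfolding N n1 by simp
    show "ceqv (tgt S t) (tgt S (Cmp 1 u (Cmp 1 ?r v)))" unfolding tv' by (rule tv)
    show "cdim (Cmp 1 u (Cmp 1 ?r v)) = 2" using c by simp
  qed (rule st cr)+
  show ?thesis using s e2 t by (meson eqv_sym eqv_trans)
qed

end

definition good_bd where
  "good_bd S p k s t \<longleftrightarrow> cell S p s \<and> cdim s = k \<and> cell S p t \<and> cdim t = k \<and> parallel S p s t"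

lemma well_typed_Suc:
  "well_typed S p m \<Longrightarrow> (\<And>g. g \<in> gens S (Suc m) \<Longrightarrow> good_bd S p m (gsrc S (Suc m) g) (gtgt S (Suc m) g)) \<Longrightarrow>
    well_typed S p (Suc m)"
  unfolding well_typed_def good_bd_def by (metis less_Suc_eq)

lemma well_typed_0: "well_typed S p 0" by (simp add: well_typed_def)

locale bicat_in = 
  fixes S :: "'g polygraph_data" and p :: nat and C :: "'c set" and h :: "'c bicat_gen \<Rightarrow> 'g"
  assumes dims: "dims_ok S"
    and h_gens: "\<And>k g. g \<in> bicat_gens C k \<Longrightarrow> h g \<in> gens S k"
    and h_src: "\<And>k g. gsrc S k (h g) = bicat_src h g" "\<And>k g. gtgt S k (h g) = bicat_tgt h g"
begin

lemma h_gen_simps: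
  "a \<in> C \<Longrightarrow> h (ObG a) \<in> gens S 0"
  "a \<in> C \<Longrightarrow> b \<in> C \<Longrightarrow> h (EG a b) \<in> gens S (Suc 0)"
  "a \<in> C \<Longrightarrow> b \<in> C \<Longrightarrow> c \<in> C \<Longrightarrow> h (MG a b c) \<in> gens S (Suc (Suc 0))"
  "a \<in> C \<Longrightarrow> h (IG a) \<in> gens S (Suc (Suc 0))"
  "a \<in> C \<Longrightarrow> b \<in> C \<Longrightarrow> c \<in> C \<Longrightarrow> d \<in> C \<Longrightarrow> h (AlphaG a b c d) \<in> gens S (Suc (Suc (Suc 0)))"
  "a \<in> C \<Longrightarrow> b \<in> C \<Longrightarrow> h (LambdaG a b) \<in> gens S (Suc (Suc (Suc 0)))"
  "a \<in> C \<Longrightarrow> b \<in> C \<Longrightarrow> h (RhoG a b) \<in> gens S (Suc (Suc (Suc 0)))"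
  by (rule h_gens; simp add: bicat_gens_def)+

lemmas chk = h_gen_simps h_src cell_Gen_iff cell_Idt_iff cell_Cmp_iff src_at_def tgt_at_def wcmp_def
  eval_nat_numeral parallel_def good_bd_def eqv_refl

lemma bd1: "g \<in> bicat_gens C 1 \<Longrightarrow> good_bd S p 0 (bicat_src h g) (bicat_tgt h g)"
  by (auto simp: bicat_gens_def chk)

lemma bd2: 
  assumes "well_typed S p 1" "g \<in> bicat_gens C 2"
  shows "good_bd S p 1 (bicat_src h g) (bicat_tgt h g)"
proof -
  interpret t: typed_data S p 1 using assms dims by unfold_locales
  from assms(2) consider (m) a b c where "g = MG a b c" "a \<in> C" "b \<in> C" "c \<in> C" | (i) a where "g = IG a" "a \<in> C"
    by (auto simp: bicat_gens_def)
  then show ?thesis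
    by cases (simp_all add: chk)
qed

lemma bd3: 
  assumes "well_typed S p 2" "g \<in> bicat_gens C 3"
  shows "good_bd S p 2 (bicat_src h g) (bicat_tgt h g)"
proof -
  interpret t: typed_data S p 2 using assms dims by unfold_locales
  from assms(2) consider (a) a b c d where "g = AlphaG a b c d" "a \<in> C" "b \<in> C" "c \<in> C" "d \<in> C"
    | (l) a b where "g = LambdaG a b" "a \<in> C" "b \<in> C"
    | (r) a b where "g = RhoG a b" "a \<in> C" "b \<in> C"
    by (auto simp: bicat_gens_def)
  then show ?thesis
    by cases (simp_all add: chk t.eqv1I atoms1.simps)
qed

lemma bd4: 
  assumes "well_typed S p 3" "g \<in> bicat_gens C 4"
  shows "good_bd S p 3 (bicat_src h g) (bicat_tgt h g)"
proof -
  interpret t: typed_data S p 3 using assms dims by unfold_locales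
  from assms(2) consider (p) a b c d e where "g = PiG a b c d e" "a \<in> C" "b \<in> C" "c \<in> C" "d \<in> C" "e \<in> C"
    | (k) a b c where "g = KappaG a b c" "a \<in> C" "b \<in> C" "c \<in> C"
    by (auto simp: bicat_gens_def)
  then show ?thesis
  proof cases
    case k then show ?thesis by (simp add: chk t.eqv1I t.eqv2I)
  next
    case p
    have *: "t.ceqv
       (m_c h a b c \<star>\<^sub>0 e_c h c d \<star>\<^sub>0 e_c h d e \<star>\<^sub>1 (e_c h a c \<star>\<^sub>0 m_c h c d e \<star>\<^sub>1 m_c h a c e))
       (e_c h a b \<star>\<^sub>0 e_c h b c \<star>\<^sub>0 m_c h c d e \<star>\<^sub>1 (m_c h a b c \<star>\<^sub>0 e_c h c e \<star>\<^sub>1 m_c h a c e))"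
      by (rule t.eqv2_swap[where x = "m_c h a b c" and y = "m_c h c d e"
             and u = "Idt (e_c h a b \<star>\<^sub>0 e_c h b c \<star>\<^sub>0 e_c h c d \<star>\<^sub>0 e_c h d e)" and v = "m_c h a c e"];
          use p in \<open>simp add: chk t.eqv1I t.eqv2I\<close>)
    show ?thesis
      by (insert *) (use p in \<open>simp add: chk t.eqv1I t.eqv2I\<close>)
  qed
qed
end


locale pf_typed =
  fixes C :: "'c set" and D :: "'d set" and f :: "'c \<Rightarrow> 'd" and p :: nat
  assumes f: "f \<in> C \<rightarrow> D"
begin

abbreviation "P \<equiv> PFonct C D f"

lemma dims: "dims_ok P"
  unfolding dims_ok_def PFonct_def BiCat_def
  by (auto simp: bicat_gens_def pf_new_gens_def wcmp_def eval_nat_numeral split: if_splits)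

lemma gens_P: "gens P k = InC ` bicat_gens C k \<union> InD ` bicat_gens D k \<union> pf_new_gens C k"
  and src_P: "gsrc P k g = pf_src f g" "gtgt P k g = pf_tgt f g"
  by (simp_all add: PFonct_def BiCat_def)

sublocale bC: bicat_in P p C InC
  by unfold_locales (use dims in \<open>auto simp: gens_P src_P\<close>)

sublocale bD: bicat_in P p D InD
  by unfold_locales (use dims in \<open>auto simp: gens_P src_P\<close>)

lemma new_gens_simps:
  "a \<in> C \<Longrightarrow> UG a \<in> gens P (Suc 0)"
  "a \<in> C \<Longrightarrow> b \<in> C \<Longrightarrow> PhiG a b \<in> gens P (Suc (Suc 0))"
  "a \<in> C \<Longrightarrow> b \<in> C \<Longrightarrow> c \<in> C \<Longrightarrow> MuG a b c \<in> gens P (Suc (Suc (Suc 0)))"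
  "a \<in> C \<Longrightarrow> NuG a \<in> gens P (Suc (Suc (Suc 0)))"
  by (simp_all add: gens_P pf_new_gens_def)

lemma fD: "a \<in> C \<Longrightarrow> f a \<in> D" using f by blast

lemmas chk = bC.h_gen_simps bD.h_gen_simps new_gens_simps fD src_P cell_Gen_iff cell_Idt_iff cell_Cmp_iff
  src_at_def tgt_at_def wcmp_def eval_nat_numeral parallel_def good_bd_def eqv_refl

lemma bd1: "g \<in> pf_new_gens C 1 \<Longrightarrow> good_bd P p 0 (pf_src f g) (pf_tgt f g)"
  by (auto simp: pf_new_gens_def chk)

lemma wtI:
  assumes "well_typed P p m"
    "\<And>g. g \<in> bicat_gens C (Suc m) \<Longrightarrow> good_bd P p m (bicat_src InC g) (bicat_tgt InC g)"
    "\<And>g. g \<in> bicat_gens D (Suc m) \<Longrightarrow> good_bd P p m (bicat_src InD g) (bicat_tgt InD g)"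
    "\<And>g. g \<in> pf_new_gens C (Suc m) \<Longrightarrow> good_bd P p m (pf_src f g) (pf_tgt f g)"
  shows "well_typed P p (Suc m)"
  using assms by (intro well_typed_Suc) (auto simp: gens_P src_P)

lemma wt1: "well_typed P p 1"
  using wtI[OF well_typed_0] bC.bd1 bD.bd1 bd1 by simp

lemma wt2: "well_typed P p 2"
proof -
  interpret t: typed_data P p 1 using wt1 dims by unfold_locales
  have "good_bd P p 1 (pf_src f g) (pf_tgt f g)" if "g \<in> pf_new_gens C 2" for g
    using that by (auto simp: pf_new_gens_def chk)
  then have "well_typed P p (Suc 1)"
    by (intro wtI wt1 bC.bd2 bD.bd2) (simp_all add: numeral_2_eq_2)
  then show ?thesis by (simp add: numeral_2_eq_2)
qed

lemma wt3: "well_typed P p 3"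
proof -
  interpret t: typed_data P p 2 using wt2 dims by unfold_locales
  have "good_bd P p 2 (pf_src f g) (pf_tgt f g)" if "g \<in> pf_new_gens C 3" for g
  proof -
    from that consider (m) a b c where "g = MuG a b c" "a \<in> C" "b \<in> C" "c \<in> C"
      | (n) a where "g = NuG a" "a \<in> C"
      by (auto simp: pf_new_gens_def)
    then show ?thesis by cases (simp_all add: chk t.eqv1I t.eqv2I)
  qed
  then have "well_typed P p (Suc 2)"
    by (intro wtI wt2 bC.bd3 bD.bd3) (simp_all add: numeral_3_eq_3 numeral_2_eq_2)
  then show ?thesis by (simp add: numeral_3_eq_3 numeral_2_eq_2)
qed

lemma bd4: 
  assumes "g \<in> pf_new_gens C 4"
  shows "good_bd P p 3 (pf_src f g) (pf_tgt f g)"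
proof -
  interpret t: typed_data P p 3 using wt3 dims by unfold_locales
  from assms consider (a) a b c d where "g = AlphaMuG a b c d" "a \<in> C" "b \<in> C" "c \<in> C" "d \<in> C"
    | (r) a b where "g = RhoMuG a b" "a \<in> C" "b \<in> C"
    | (l) a b where "g = LambdaMuG a b" "a \<in> C" "b \<in> C"
    by (auto simp: pf_new_gens_def)
  then show ?thesis
  proof cases
    case a
    let ?eC = "e_c InC" and ?eD = "\<lambda>a b. e_c InD (f a) (f b)" and ?mD = "\<lambda>a b c. m_c InD (f a) (f b) (f c)"
    have 1: "t.ceqv
      ((m_c InC a b c \<star>\<^sub>0 ?eC c d \<star>\<^sub>0 u_c d) \<star>\<^sub>1
       ((?eC a c \<star>\<^sub>0 phi_c c d) \<star>\<^sub>1 (phi_c a c \<star>\<^sub>0 ?eD c d) \<star>\<^sub>1 (u_c a \<star>\<^sub>0 ?mD a c d)))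
      ((?eC a b \<star>\<^sub>0 ?eC b c \<star>\<^sub>0 phi_c c d) \<star>\<^sub>1 (((m_c InC a b c \<star>\<^sub>0 u_c c) \<star>\<^sub>1 phi_c a c) \<star>\<^sub>0 ?eD c d) \<star>\<^sub>1
       (u_c a \<star>\<^sub>0 ?mD a c d))"
      by (rule t.eqv2_swap[where x = "m_c InC a b c" and y = "phi_c c d"
             and u = "Idt (?eC a b \<star>\<^sub>0 ?eC b c \<star>\<^sub>0 ?eC c d \<star>\<^sub>0 u_c d)"
             and v = "(phi_c a c \<star>\<^sub>0 ?eD c d) \<star>\<^sub>1 (u_c a \<star>\<^sub>0 ?mD a c d)"];
          use a in \<open>simp add: chk t.eqv1I t.eqv2I\<close>)
    have 2: "t.ceqv
      ((?eC a b \<star>\<^sub>0 ?eC b c \<star>\<^sub>0 phi_c c d) \<star>\<^sub>1 (?eC a b \<star>\<^sub>0 phi_c b c \<star>\<^sub>0 ?eD c d) \<star>\<^sub>1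
       (phi_c a b \<star>\<^sub>0 ?eD b c \<star>\<^sub>0 ?eD c d) \<star>\<^sub>1 (u_c a \<star>\<^sub>0 ((?eD a b \<star>\<^sub>0 ?mD b c d) \<star>\<^sub>1 ?mD a b d)))
      ((?eC a b \<star>\<^sub>0 ((?eC b c \<star>\<^sub>0 phi_c c d) \<star>\<^sub>1 (phi_c b c \<star>\<^sub>0 ?eD c d) \<star>\<^sub>1 (u_c b \<star>\<^sub>0 ?mD b c d))) \<star>\<^sub>1
       (phi_c a b \<star>\<^sub>0 ?eD b d) \<star>\<^sub>1 (u_c a \<star>\<^sub>0 ?mD a b d))"
      by (rule t.eqv2_swap[where x = "phi_c a b" and y = "?mD b c d"
             and u = "(?eC a b \<star>\<^sub>0 ?eC b c \<star>\<^sub>0 phi_c c d) \<star>\<^sub>1 (?eC a b \<star>\<^sub>0 phi_c b c \<star>\<^sub>0 ?eD c d)"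
             and v = "u_c a \<star>\<^sub>0 ?mD a b d"];
          use a in \<open>simp add: chk t.eqv1I t.eqv2I\<close>)
    show ?thesis
      by (insert 1 eqv_sym[OF 2]) (use a in \<open>simp add: chk t.eqv1I t.eqv2I\<close>)
  next
    case r
    let ?eD = "\<lambda>a b. e_c InD (f a) (f b)" and ?mD = "\<lambda>a b c. m_c InD (f a) (f b) (f c)"
    have 1: "t.ceqv
      (phi_c a b \<star>\<^sub>1 (u_c a \<star>\<^sub>0 ((?eD a b \<star>\<^sub>0 i_c InD (f b)) \<star>\<^sub>1 ?mD a b b)))
      ((e_c InC a b \<star>\<^sub>0 (u_c b \<star>\<^sub>0 i_c InD (f b))) \<star>\<^sub>1 (phi_c a b \<star>\<^sub>0 ?eD b b) \<star>\<^sub>1 (u_c a \<star>\<^sub>0 ?mD a b b))"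
      by (rule t.eqv2_swap[where x = "phi_c a b" and y = "i_c InD (f b)"
             and u = "Idt (e_c InC a b \<star>\<^sub>0 u_c b)" and v = "u_c a \<star>\<^sub>0 ?mD a b b"];
          use r in \<open>simp add: chk t.eqv1I t.eqv2I\<close>)
    show ?thesis by (insert eqv_sym[OF 1]) (use r in \<open>simp add: chk t.eqv1I t.eqv2I\<close>)
  next
    case l
    let ?eD = "\<lambda>a b. e_c InD (f a) (f b)" and ?mD = "\<lambda>a b c. m_c InD (f a) (f b) (f c)"
    have 1: "t.ceqv
      ((i_c InC a \<star>\<^sub>0 e_c InC a b \<star>\<^sub>0 u_c b) \<star>\<^sub>1
        ((e_c InC a a \<star>\<^sub>0 phi_c a b) \<star>\<^sub>1 (phi_c a a \<star>\<^sub>0 ?eD a b) \<star>\<^sub>1 (u_c a \<star>\<^sub>0 ?mD a a b)))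
      (phi_c a b \<star>\<^sub>1 (((i_c InC a \<star>\<^sub>0 u_c a) \<star>\<^sub>1 phi_c a a) \<star>\<^sub>0 ?eD a b) \<star>\<^sub>1 (u_c a \<star>\<^sub>0 ?mD a a b))"
      by (rule t.eqv2_swap[where x = "i_c InC a" and y = "phi_c a b"
             and u = "Idt (e_c InC a b \<star>\<^sub>0 u_c b)"
             and v = "(phi_c a a \<star>\<^sub>0 ?eD a b) \<star>\<^sub>1 (u_c a \<star>\<^sub>0 ?mD a a b)"];
          use l in \<open>simp add: chk t.eqv1I t.eqv2I\<close>)
    show ?thesis by (insert 1) (use l in \<open>simp add: chk t.eqv1I t.eqv2I\<close>)
  qed
qed

lemma wt4: "well_typed P p 4"
proof -
  have "well_typed P p (Suc 3)"
    by (intro wtI wt3 bC.bd4 bD.bd4 bd4) simp_all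
  then show ?thesis by simp
qed

end

theorem polygraph_PFonct:
  assumes "f \<in> C \<rightarrow> D" shows "polygraph 4 (PFonct C D f)"
proof -
  interpret pf_typed C D f 4 by unfold_locales fact
  show ?thesis unfolding polygraph_def using wt4 by (simp add: gens_P bicat_gens_def pf_new_gens_def)
qed


theorem polygraph_BiCat: "polygraph 4 (BiCat C)"
proof -
  have d: "dims_ok (BiCat C)"
    unfolding dims_ok_def BiCat_def
    by (auto simp: bicat_gens_def wcmp_def eval_nat_numeral split: if_splits)
  interpret bicat_in "BiCat C" 4 C "\<lambda>g. g"
    by unfold_locales (use d in \<open>auto simp: BiCat_def\<close>)
  have g: "gens (BiCat C) k = bicat_gens C k" for k by (simp add: BiCat_def)
  have w1: "well_typed (BiCat C) 4 (Suc 0)"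
    using bd1 by (intro well_typed_Suc well_typed_0) (simp add: g h_src)
  have w2: "well_typed (BiCat C) 4 (Suc 1)"
    using bd2 w1 by (intro well_typed_Suc) (simp_all add: g h_src numeral_2_eq_2)
  have w3: "well_typed (BiCat C) 4 (Suc 2)"
    using bd3 w2 by (intro well_typed_Suc) (simp_all add: g h_src numeral_2_eq_2 numeral_3_eq_3)
  have "well_typed (BiCat C) 4 (Suc 3)"
    using bd4 w3 by (intro well_typed_Suc) (simp_all add: g h_src eval_nat_numeral)
  then show ?thesis unfolding polygraph_def by (simp add: g bicat_gens_def)
qed

theorem free_np_category:
  assumes "polygraph n S" "p \<le> n" shows "np_category n (free_npcat n p S) p"
proof -
  have "Suc k \<le> n" if "g \<in> gens S (Suc k)" for g k
    using assms(1) that unfolding polygraph_def by (metis emptyE linorder_not_less)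
  then have "dims_ok S"
    using assms(1) unfolding dims_ok_def polygraph_def well_typed_def by (simp add: Suc_le_eq)
  moreover have "well_typed S p n"
    using assms well_typed_mono[of S n n p n] by (simp add: polygraph_def)
  ultimately interpret typed_data S p n by unfold_locales
  show ?thesis by (rule free_np_category)
qed

end

theory Submission
  imports Defs
begin

text \<open>
  Coherence and confluence both come from a normalisation of \<open>2\<close>-cells. A \<open>2\<close>-cell \<open>w\<close> acts on
  lists \<open>ws\<close> of paths, one for each generating \<open>1\<close>-cell in its source: \<open>sm w ws\<close> concatenates
  paths along \<open>m\<close>, inserts empty paths for \<open>i\<close> and applies \<open>f\<close> for \<open>\<phi>\<close>. Let \<open>qs ws\<close> be the
  \<open>2\<close>-cell which multiplies every path out by a right comb of \<open>m\<close>'s, an empty path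
  giving \<open>i\<close>. There are a composite \<open>K w ws\<close> of \<open>\<phi>\<close>'s and a \<open>3\<close>-cell
  \<open>E w ws : qs ws \<star>\<^sub>1 w \<Rrightarrow> K w ws \<star>\<^sub>1 qs (sm w ws)\<close>. A \<open>3\<close>-cell
  \<open>x : w \<Rrightarrow> w'\<close> satisfies \<open>sm w = sm w'\<close> and \<open>K w = K w'\<close>, and it satisfies
  \<open>(qs ws \<star>\<^sub>1 x) \<star>\<^sub>2 E w' ws = E w ws\<close> as soon as the \<open>4\<close>-cells are equalities. The latter needs
  a proof for generating \<open>3\<close>-cells only, where it follows from \<open>\<pi>\<close>, \<open>\<kappa>\<close> and the three cells
  for \<open>\<mu>\<close> and \<open>\<nu>\<close>, by induction on combs. If all paths have length one, then \<open>qs ws\<close> is an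
  identity. Hence \<open>w\<close> reduces to a normal form depending on the class of \<open>w\<close> modulo \<open>3\<close>-cells only, which
  gives confluence, and \<open>x\<close> is determined by \<open>E w ws\<close> and \<open>E w' ws\<close>, hence by its boundary, if
  \<open>3\<close>-cells are invertible.

  For termination, \<open>2\<close>-cells act on lists of positive numbers by \<open>(x, y) \<mapsto> 2 x + y\<close> for \<open>m\<close>, \<open>1\<close> for \<open>i\<close>
  and \<open>(x, u) \<mapsto> (u, 3 ^ x)\<close> for \<open>\<phi>\<close>; this is strictly monotone, and every generating \<open>3\<close>-cell
  decreases it.
\<close>

section \<open>Single-sorted 3-categories\<close>

text \<open>Normal forms are written down explicitly instead of being extracted from critical
  branchings. The arguments \<open>ws\<close> are arbitrary paths, although only one-edge paths
  occur at the end: in \<open>w \<star>\<^sub>1 w'\<close> the cell \<open>w'\<close> meets the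
  combs that \<open>w\<close> has produced. With this generality \<open>E\<close> is compatible with
  both compositions and is determined by its values on generating 2-cells. Generating 3-cells enter
  \<open>E\<close> in their given direction only, so \<open>E\<close> exists in the free 3-category
  and yields confluence there. Its naturality on \<alpha> and \<rho> needs unit laws that are not
  among the generating 4-cells; they are deduced from \<pi> and \<kappa> by cancellation, which
  requires invertible 3-cells. The construction is therefore carried out over an abstract congruence
  on 3-cells and used twice: with equality in the free 3-category, and with existence of a
  connecting 4-cell in the free (4,2)-category. Since one 2-cell has many expressions,
  \<open>sm\<close>, \<open>K\<close> and \<open>E\<close> each have to be shown invariant under
  \<open>eqv\<close>.\<close>

declare One_nat_def [simp del]

text \<open>A lower-dimensional cell is identified with its identity \<open>3\<close>-cell. All undefined composites are \<open>bt\<close>,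
  so that associativity needs no composability hypotheses.\<close>

locale tcat3 =
  fixes ok :: "'q \<Rightarrow> bool" and cp :: "nat \<Rightarrow> 'q \<Rightarrow> 'q \<Rightarrow> 'q" and sr tg :: "nat \<Rightarrow> 'q \<Rightarrow> 'q" and bt :: 'q
  assumes ok_cp [simp]: "i < 3 \<Longrightarrow> ok (cp i x y) \<longleftrightarrow> ok x \<and> ok y \<and> tg i x = sr i y"
    and cp_bt: "i < 3 \<Longrightarrow> \<not> ok (cp i x y) \<Longrightarrow> cp i x y = bt"
    and bt: "\<not> ok bt"
    and ok_sr [simp]: "i < 3 \<Longrightarrow> ok (sr i x) \<longleftrightarrow> ok x"
    and ok_tg [simp]: "i < 3 \<Longrightarrow> ok (tg i x) \<longleftrightarrow> ok x"
    and sr_bt: "i < 3 \<Longrightarrow> \<not> ok x \<Longrightarrow> sr i x = bt"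
    and tg_bt: "i < 3 \<Longrightarrow> \<not> ok x \<Longrightarrow> tg i x = bt"
    and sr_sr0: "i \<le> j \<Longrightarrow> j < 3 \<Longrightarrow> ok x \<Longrightarrow> sr i (sr j x) = sr i x"
    and tg_tg0: "i \<le> j \<Longrightarrow> j < 3 \<Longrightarrow> ok x \<Longrightarrow> tg i (tg j x) = tg i x"
    and sr_tg0: "i < j \<Longrightarrow> j < 3 \<Longrightarrow> ok x \<Longrightarrow> sr i (tg j x) = sr i x"
    and tg_sr0: "i < j \<Longrightarrow> j < 3 \<Longrightarrow> ok x \<Longrightarrow> tg i (sr j x) = tg i x"
    \<comment> \<open>A boundary in dimension \<open>i\<close> is an identity for composition along
      cells of dimension \<open>i\<close> and above; this is how lower-dimensional cells live among
      the 3-cells.\<close>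
    and id_up0: "i \<le> j \<Longrightarrow> j < 3 \<Longrightarrow> ok x \<Longrightarrow> sr j (sr i x) = sr i x \<and> tg j (sr i x) = sr i x
      \<and> sr j (tg i x) = tg i x \<and> tg j (tg i x) = tg i x"
    and bd_cp_low0: "j \<le> i \<Longrightarrow> i < 3 \<Longrightarrow> ok (cp i x y) \<Longrightarrow> sr j (cp i x y) = sr j x \<and> tg j (cp i x y) = tg j y"
    and bd_cp_high0: "i < j \<Longrightarrow> j < 3 \<Longrightarrow> ok (cp i x y) \<Longrightarrow>
      sr j (cp i x y) = cp i (sr j x) (sr j y) \<and> tg j (cp i x y) = cp i (tg j x) (tg j y)"
    and assoc0: "i < 3 \<Longrightarrow> ok (cp i (cp i x y) z) \<Longrightarrow> cp i (cp i x y) z = cp i x (cp i y z)"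
    and unit_l [simp]: "i < 3 \<Longrightarrow> ok x \<Longrightarrow> cp i (sr i x) x = x"
    and unit_r [simp]: "i < 3 \<Longrightarrow> ok x \<Longrightarrow> cp i x (tg i x) = x"
    and exch0: "i < j \<Longrightarrow> j < 3 \<Longrightarrow> ok (cp i (cp j x y) (cp j z w)) \<Longrightarrow>
      cp i (cp j x y) (cp j z w) = cp j (cp i x z) (cp i y w)"
begin

abbreviation C0 (infixr "\<otimes>" 75) where "x \<otimes> y \<equiv> cp 0 x y"
abbreviation C1 (infixr "\<odot>" 70) where "x \<odot> y \<equiv> cp 1 x y"
abbreviation C2 (infixr "\<bullet>" 65) where "x \<bullet> y \<equiv> cp 2 x y"

text \<open>An undefined cell has only undefined boundaries, all of them \<open>bt\<close>. Covering
  this case makes the equations unconditional simp rules.\<close>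

lemma id_up [simp]:
  assumes "i \<le> j" "j < 3"
  shows "sr j (sr i x) = sr i x" "tg j (sr i x) = sr i x" "sr j (tg i x) = tg i x" "tg j (tg i x) = tg i x"
  using id_up0[OF assms, of x] assms by (cases "ok x"; simp add: sr_bt tg_bt bt)+

lemma bd_bd [simp]:
  assumes "i < j" "j < 3"
  shows "sr i (sr j x) = sr i x" "tg i (tg j x) = tg i x" "sr i (tg j x) = sr i x" "tg i (sr j x) = tg i x"
  using assms sr_sr0[of i j x] tg_tg0[of i j x] sr_tg0[of i j x] tg_sr0[of i j x]
  by (cases "ok x"; simp add: sr_bt tg_bt bt)+

lemma bd_low [simp]:
  assumes "j < i" "i < 3" "ok x" "ok y" "tg i x = sr i y"
  shows "sr j (cp i x y) = sr j x" "tg j (cp i x y) = tg j y"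
  using assms bd_cp_low0[of j i x y] by auto

text \<open>Globularity: both lower boundaries are boundaries of the shared
  \<open>i\<close>-cell.\<close>

lemma bd_low_eq:
  assumes "j < i" "i < 3" "tg i x = sr i y"
  shows "sr j y = sr j x" "tg j x = tg j y"
  using assms bd_bd(1)[of j i y] bd_bd(3)[of j i x] bd_bd(2)[of j i x] bd_bd(4)[of j i y] by simp_all

lemma bd_same [simp]:
  assumes "i < 3" "ok x" "ok y" "tg i x = sr i y"
  shows "sr i (cp i x y) = sr i x" "tg i (cp i x y) = tg i y"
  using assms bd_cp_low0[of i i x y] by auto

text \<open>Both sides become \<open>bt\<close> at the same time, so that the equations are
  unconditional.\<close>

lemma bd_high [simp]:
  assumes "i < j" "j < 3"
  shows "sr j (cp i x y) = cp i (sr j x) (sr j y)" "tg j (cp i x y) = cp i (tg j x) (tg j y)"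
proof -
  have i: "i < 3" using assms by simp
  have ok: "ok (cp i (sr j x) (sr j y)) \<longleftrightarrow> ok (cp i x y)" "ok (cp i (tg j x) (tg j y)) \<longleftrightarrow> ok (cp i x y)"
    using assms i by simp_all
  have "sr j (cp i x y) = cp i (sr j x) (sr j y) \<and> tg j (cp i x y) = cp i (tg j x) (tg j y)"
  proof (cases "ok (cp i x y)")
    case False
    have "cp i x y = bt" by (rule cp_bt[OF i False])
    moreover have "cp i (sr j x) (sr j y) = bt" by (rule cp_bt[OF i]) (use False ok in blast)
    moreover have "cp i (tg j x) (tg j y) = bt" by (rule cp_bt[OF i]) (use False ok in blast)
    ultimately show ?thesis using assms by (simp add: sr_bt tg_bt bt)
  qed (use bd_cp_high0[OF assms] in auto)
  then show "sr j (cp i x y) = cp i (sr j x) (sr j y)" "tg j (cp i x y) = cp i (tg j x) (tg j y)" by simp_all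
qed

lemma assoc: "i < 3 \<Longrightarrow> cp i (cp i x y) z = cp i x (cp i y z)"
proof (cases "ok (cp i (cp i x y) z)")
  case False
  assume i: "i < 3"
  with False have "\<not> ok (cp i x (cp i y z))" by auto
  with False i show ?thesis by (metis cp_bt)
qed (rule assoc0)

text \<open>It suffices to match \<open>x\<close> with \<open>z\<close>: since \<open>x\<close> and
  \<open>y\<close> meet in a \<open>j\<close>-cell they share their \<open>i\<close>-target, and
  likewise \<open>z\<close> and \<open>w\<close> their \<open>i\<close>-source.\<close>

lemma exch:
  assumes "i < j" "j < 3" "ok (cp j x y)" "ok (cp j z w)" "tg i x = sr i z"
  shows "cp i (cp j x y) (cp j z w) = cp j (cp i x z) (cp i y w)"
proof (rule exch0[OF assms(1,2)])
  have "tg i x = tg i y" using assms by (intro bd_low_eq) auto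
  then show "ok (cp i (cp j x y) (cp j z w))" using assms by simp
qed

lemma unit_l': "i < 3 \<Longrightarrow> ok x \<Longrightarrow> sr i x = y \<Longrightarrow> cp i y x = x" by auto
lemma unit_r': "i < 3 \<Longrightarrow> ok x \<Longrightarrow> tg i x = y \<Longrightarrow> cp i x y = x" by auto

text \<open>\<open>idn k x\<close>: \<open>x\<close> is (the identity of) a \<open>k\<close>-cell.\<close>

definition idn :: "nat \<Rightarrow> 'q \<Rightarrow> bool" where "idn k x \<longleftrightarrow> ok x \<and> sr k x = x"

lemma idn_up: assumes "idn k x" "k \<le> j" "j < 3" shows "sr j x = x" "tg j x = x" "idn j x"
  using assms id_up[of k j x] unfolding idn_def by metis+

text \<open>Whiskering preserves composition: exchange applied to \<open>w = cp j w w\<close>, which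
  holds for a \<open>j\<close>-cell \<open>w\<close>.\<close>

lemma dist_r:
  assumes "i < j" "j < 3" "idn j w" "ok (cp j f g)" "tg i f = sr i w"
  shows "cp i (cp j f g) w = cp j (cp i f w) (cp i g w)"
proof -
  have w: "sr j w = w" "ok w" "tg j w = w" using assms idn_up[of j w j] by (auto simp: idn_def)
  then have "cp j w w = w" using assms unit_l[of j w] by simp
  then show ?thesis using exch[of i j f g w w] assms w by auto
qed

lemma dist_l:
  assumes "i < j" "j < 3" "idn j w" "ok (cp j f g)" "tg i w = sr i f"
  shows "cp i w (cp j f g) = cp j (cp i w f) (cp i w g)"
proof -
  have w: "sr j w = w" "ok w" "tg j w = w" using assms idn_up[of j w j] by (auto simp: idn_def)
  then have "cp j w w = w" using assms unit_l[of j w] by simp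
  then show ?thesis using exch[of i j w w f g] assms w by auto
qed

text \<open>Exchange after inserting identities. Together with \<open>split_r\<close> this says that
  \<open>f\<close> and \<open>g\<close>, lying side by side, may act in either order; every
  naturality and sliding lemma below is an instance.\<close>

lemma split_l:
  assumes "i < j" "j < 3" "ok (cp i f g)"
  shows "cp i f g = cp j (cp i f (sr j g)) (cp i (tg j f) g)"
proof -
  have "cp i f g = cp i (cp j f (tg j f)) (cp j (sr j g) g)" using assms by simp
  also have "\<dots> = cp j (cp i f (sr j g)) (cp i (tg j f) g)"
    using assms by (intro exch) auto
  finally show ?thesis .
qed

lemma split_r:
  assumes "i < j" "j < 3" "ok (cp i f g)"
  shows "cp i f g = cp j (cp i (sr j f) g) (cp i f (tg j g))"
proof -
  have "cp i f g = cp i (cp j (sr j f) f) (cp j g (tg j g))" using assms by simp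
  also have "\<dots> = cp j (cp i (sr j f) g) (cp i f (tg j g))"
    using assms by (intro exch) auto
  finally show ?thesis .
qed

lemma tens:
  assumes "ok (f \<odot> u)" "ok (g \<odot> v)" "tg 0 f = sr 0 g" shows "(f \<odot> u) \<otimes> (g \<odot> v) = (f \<otimes> g) \<odot> (u \<otimes> v)"
  by (intro exch) (use assms in auto)

end

section \<open>Bicategories in a 3-category\<close>

text \<open>Only boundaries are prescribed here. The equations between 3-cells come in
  \<open>bicat_coh\<close>, so that combs and their products are also available for confluence,
  where no 4-cell can be used.\<close>

locale bicat_alg = tcat3 ok cp sr tg bt
  for ok :: "'q \<Rightarrow> bool" and cp :: "nat \<Rightarrow> 'q \<Rightarrow> 'q \<Rightarrow> 'q" and sr tg :: "nat \<Rightarrow> 'q \<Rightarrow> 'q" and bt :: 'q +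
  fixes Ob :: "'o set" and ob :: "'o \<Rightarrow> 'q" and e :: "'o \<Rightarrow> 'o \<Rightarrow> 'q" and ii :: "'o \<Rightarrow> 'q"
    and m :: "'o \<Rightarrow> 'o \<Rightarrow> 'o \<Rightarrow> 'q" and al :: "'o \<Rightarrow> 'o \<Rightarrow> 'o \<Rightarrow> 'o \<Rightarrow> 'q" and la rh :: "'o \<Rightarrow> 'o \<Rightarrow> 'q"
  assumes ob0: "a \<in> Ob \<Longrightarrow> idn 0 (ob a)"
    and e0: "a \<in> Ob \<Longrightarrow> b \<in> Ob \<Longrightarrow> idn 1 (e a b) \<and> sr 0 (e a b) = ob a \<and> tg 0 (e a b) = ob b"
    and ii0: "a \<in> Ob \<Longrightarrow> idn 2 (ii a) \<and> sr 1 (ii a) = ob a \<and> tg 1 (ii a) = e a a"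
    and m0: "a \<in> Ob \<Longrightarrow> b \<in> Ob \<Longrightarrow> c \<in> Ob \<Longrightarrow>
      idn 2 (m a b c) \<and> sr 1 (m a b c) = e a b \<otimes> e b c \<and> tg 1 (m a b c) = e a c"
    and al0: "a \<in> Ob \<Longrightarrow> b \<in> Ob \<Longrightarrow> c \<in> Ob \<Longrightarrow> d \<in> Ob \<Longrightarrow> ok (al a b c d) \<and>
      sr 2 (al a b c d) = (m a b c \<otimes> e c d) \<odot> m a c d \<and> tg 2 (al a b c d) = (e a b \<otimes> m b c d) \<odot> m a b d"
    and la0: "a \<in> Ob \<Longrightarrow> b \<in> Ob \<Longrightarrow> ok (la a b) \<and> sr 2 (la a b) = (ii a \<otimes> e a b) \<odot> m a a b \<and> tg 2 (la a b) = e a b"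
    and rh0: "a \<in> Ob \<Longrightarrow> b \<in> Ob \<Longrightarrow> ok (rh a b) \<and> sr 2 (rh a b) = (e a b \<otimes> ii b) \<odot> m a b b \<and> tg 2 (rh a b) = e a b"
begin

lemma ob [simp]: assumes "a \<in> Ob" shows "ok (ob a)" "k < 3 \<Longrightarrow> sr k (ob a) = ob a" "k < 3 \<Longrightarrow> tg k (ob a) = ob a"
  using ob0[OF assms] idn_up[OF ob0[OF assms], of k] by (auto simp: idn_def)

lemma e [simp]:
  assumes "a \<in> Ob" "b \<in> Ob"
  shows "ok (e a b)" "sr 0 (e a b) = ob a" "tg 0 (e a b) = ob b" "0 < k \<Longrightarrow> k < 3 \<Longrightarrow> sr k (e a b) = e a b"
    "0 < k \<Longrightarrow> k < 3 \<Longrightarrow> tg k (e a b) = e a b"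
  using e0[OF assms] idn_up[of 1 "e a b" k] by (auto simp: idn_def)

lemma bd0I: assumes "sr 1 x = s" "tg 1 x = t"
  shows "sr 0 x = sr 0 s" "tg 0 x = tg 0 s"  "sr 0 x = sr 0 t" "tg 0 x = tg 0 t"
  unfolding assms[symmetric] by simp_all

lemma ii [simp]:
  assumes "a \<in> Ob"
  shows "ok (ii a)" "sr 1 (ii a) = ob a" "tg 1 (ii a) = e a a" "sr 2 (ii a) = ii a" "tg 2 (ii a) = ii a"
    "sr 0 (ii a) = ob a" "tg 0 (ii a) = ob a"
  using ii0[OF assms] idn_up[of 2 "ii a" 2] bd0I[of "ii a" "ob a" "e a a"] assms by (auto simp: idn_def)

lemma m [simp]:
  assumes "a \<in> Ob" "b \<in> Ob" "c \<in> Ob"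
  shows "ok (m a b c)" "sr 1 (m a b c) = e a b \<otimes> e b c" "tg 1 (m a b c) = e a c"
    "sr 2 (m a b c) = m a b c" "tg 2 (m a b c) = m a b c" "sr 0 (m a b c) = ob a" "tg 0 (m a b c) = ob c"
   
  using m0[OF assms] idn_up[of 2 "m a b c" 2] bd0I[of "m a b c" "e a b \<otimes> e b c" "e a c"] assms by (auto simp: idn_def)

lemma bd1I: assumes "sr 2 x = s" "tg 2 x = t"
  shows "sr 1 x = sr 1 s" "tg 1 x = tg 1 t" "sr 0 x = sr 0 s" "tg 0 x = tg 0 s"
  unfolding assms[symmetric] by simp_all

lemma al [simp]:
  assumes "a \<in> Ob" "b \<in> Ob" "c \<in> Ob" "d \<in> Ob"
  shows "ok (al a b c d)" "sr 2 (al a b c d) = (m a b c \<otimes> e c d) \<odot> m a c d" "tg 2 (al a b c d) = (e a b \<otimes> m b c d) \<odot> m a b d"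
    "sr 1 (al a b c d) = e a b \<otimes> e b c \<otimes> e c d" "tg 1 (al a b c d) = e a d" "sr 0 (al a b c d) = ob a" "tg 0 (al a b c d) = ob d"
   
  using al0[OF assms] bd1I[of "al a b c d" "(m a b c \<otimes> e c d) \<odot> m a c d" "(e a b \<otimes> m b c d) \<odot> m a b d"] assms
  by (auto simp: assoc)

lemma la [simp]:
  assumes "a \<in> Ob" "b \<in> Ob"
  shows "ok (la a b)" "sr 2 (la a b) = (ii a \<otimes> e a b) \<odot> m a a b" "tg 2 (la a b) = e a b"
    "sr 1 (la a b) = e a b" "tg 1 (la a b) = e a b" "sr 0 (la a b) = ob a" "tg 0 (la a b) = ob b"
   
  using la0[OF assms] bd1I[of "la a b" "(ii a \<otimes> e a b) \<odot> m a a b" "e a b"] assms unit_l'[of 0 "e a b" "ob a"] by auto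

lemma rh [simp]:
  assumes "a \<in> Ob" "b \<in> Ob"
  shows "ok (rh a b)" "sr 2 (rh a b) = (e a b \<otimes> ii b) \<odot> m a b b" "tg 2 (rh a b) = e a b"
    "sr 1 (rh a b) = e a b" "tg 1 (rh a b) = e a b" "sr 0 (rh a b) = ob a" "tg 0 (rh a b) = ob b"
   
  using rh0[OF assms] bd1I[of "rh a b" "(e a b \<otimes> ii b) \<odot> m a b b" "e a b"] assms unit_r'[of 0 "e a b" "ob b"] by auto

text \<open>The 2-cells and 3-cells in \<open>H a b\<close> are the objects and morphisms of the
  hom-categories of a bicategory with composition \<open>M\<close>, associator \<open>AL\<close> and
  unitors \<open>LA\<close> and \<open>RH\<close>. The 1-source is left free, so that combs over
  arbitrary paths are objects; \<open>M\<close> concatenates these sources.\<close>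

definition H where "H a b f \<longleftrightarrow> a \<in> Ob \<and> b \<in> Ob \<and> ok f \<and> tg 1 f = e a b"
definition M where "M a b c f g = (f \<otimes> g) \<odot> m a b c"
definition AL where "AL a b c d f g h = (f \<otimes> g \<otimes> h) \<odot> al a b c d"
definition LA where "LA a b f = f \<odot> la a b"
definition RH where "RH a b f = f \<odot> rh a b"

lemma HD:
  assumes "H a b f" shows "a \<in> Ob" "b \<in> Ob" "ok f" "tg 1 f = e a b" "sr 0 f = ob a" "tg 0 f = ob b"
  using assms bd0I[of f "sr 1 f" "e a b"] by (auto simp: H_def)

lemma H_bd [simp]: "H a b f \<Longrightarrow> H a b (sr 2 f)" "H a b f \<Longrightarrow> H a b (tg 2 f)"
  by (auto simp: H_def)

lemma H_ii [simp]: "a \<in> Ob \<Longrightarrow> H a a (ii a)" and H_e [simp]: "a \<in> Ob \<Longrightarrow> b \<in> Ob \<Longrightarrow> H a b (e a b)"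
  by (auto simp: H_def)

lemma H_comp [simp]: "H a b f \<Longrightarrow> ok (f \<bullet> g) \<Longrightarrow> H a b (f \<bullet> g)" "H a b g \<Longrightarrow> ok (f \<bullet> g) \<Longrightarrow> H a b (f \<bullet> g)"
  using bd_low_eq(2)[of 1 2 f g] by (auto simp: H_def)

lemma M_simps [simp]:
  assumes "H a b f" "H b c g"
  shows "H a c (M a b c f g)" "ok (M a b c f g)" "sr 2 (M a b c f g) = M a b c (sr 2 f) (sr 2 g)"
    "tg 2 (M a b c f g) = M a b c (tg 2 f) (tg 2 g)" "sr 1 (M a b c f g) = sr 1 f \<otimes> sr 1 g"
  using HD[OF assms(1)] HD[OF assms(2)] by (auto simp: M_def H_def)

lemma M_comp:
  assumes "H a b f" "ok (f \<bullet> f')" "H b c g" "ok (g \<bullet> g')"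
  shows "M a b c (f \<bullet> f') (g \<bullet> g') = M a b c f g \<bullet> M a b c f' g'"
proof -
  note f = HD[OF assms(1)] HD[OF assms(3)]
  have h: "H a b f'" "H b c g'" using assms bd_low_eq(2)[of 1 2 f f'] bd_low_eq(2)[of 1 2 g g'] by (auto simp: H_def)
  note f = f HD[OF h(1)] HD[OF h(2)]
  have "(f \<bullet> f') \<otimes> (g \<bullet> g') = (f \<otimes> g) \<bullet> (f' \<otimes> g')" using assms f by (intro exch) auto
  then show ?thesis unfolding M_def using assms f
    by (simp, intro dist_r) (auto simp: idn_def)
qed

lemma M_comp_l:
  assumes "H a b f" "ok (f \<bullet> f')" "H b c g" "sr 2 g = g" shows "M a b c (f \<bullet> f') g = M a b c f g \<bullet> M a b c f' g"
proof -
  have "tg 2 g = g" using id_up(2)[of 2 2 g] assms by simp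
  then have "g \<bullet> g = g" "ok (g \<bullet> g)" using assms unit_l[of 2 g] HD[OF assms(3)] by auto
  then show ?thesis using M_comp[OF assms(1-3), of g] by simp
qed

lemma M_comp_r:
  assumes "H a b f" "sr 2 f = f" "H b c g" "ok (g \<bullet> g')" shows "M a b c f (g \<bullet> g') = M a b c f g \<bullet> M a b c f g'"
proof -
  have "tg 2 f = f" using id_up(2)[of 2 2 f] assms by simp
  then have "f \<bullet> f = f" "ok (f \<bullet> f)" using assms unit_l[of 2 f] HD[OF assms(1)] by auto
  then show ?thesis using M_comp[OF assms(1) _ assms(3-4), of f] by simp
qed

text \<open>Nested products are put into the form "all inputs in parallel, then a cell on the edges
  \<open>e\<close>". In this form an axiom for edges extends to arbitrary inputs by
  whiskering.\<close>

lemma MM_l: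
  assumes "H a b f" "H b c g" "H c d h"
  shows "M a c d (M a b c f g) h = (f \<otimes> g \<otimes> h) \<odot> (m a b c \<otimes> e c d) \<odot> m a c d"
proof -
  note f = HD[OF assms(1)] HD[OF assms(2)] HD[OF assms(3)]
  have "((f \<otimes> g) \<odot> m a b c) \<otimes> (h \<odot> e c d) = ((f \<otimes> g) \<otimes> h) \<odot> (m a b c \<otimes> e c d)"
    using f by (intro exch) auto
  moreover have "h \<odot> e c d = h" using f by (intro unit_r') auto
  ultimately show ?thesis by (simp add: M_def assoc)
qed

lemma MM_r:
  assumes "H a b f" "H b c g" "H c d h"
  shows "M a b d f (M b c d g h) = (f \<otimes> g \<otimes> h) \<odot> (e a b \<otimes> m b c d) \<odot> m a b d"
proof -
  note f = HD[OF assms(1)] HD[OF assms(2)] HD[OF assms(3)]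
  have "(f \<odot> e a b) \<otimes> ((g \<otimes> h) \<odot> m b c d) = (f \<otimes> (g \<otimes> h)) \<odot> (e a b \<otimes> m b c d)"
    using f by (intro exch) auto
  moreover have "f \<odot> e a b = f" using f by (intro unit_r') auto
  ultimately show ?thesis by (simp add: M_def assoc)
qed

lemma AL_simps [simp]:
  assumes "H a b f" "H b c g" "H c d h"
  shows "ok (AL a b c d f g h)" "H a d (AL a b c d f g h)"
    "sr 2 (AL a b c d f g h) = M a c d (M a b c (sr 2 f) (sr 2 g)) (sr 2 h)"
    "tg 2 (AL a b c d f g h) = M a b d (tg 2 f) (M b c d (tg 2 g) (tg 2 h))"
  using HD[OF assms(1)] HD[OF assms(2)] HD[OF assms(3)] assms by (auto simp: AL_def MM_l MM_r H_def)

text \<open>On 3-cells \<open>AL\<close> is the diagonal of the naturality square of the associator.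
  The two equations cut \<open>(f \<otimes> g \<otimes> h) \<odot> al\<close> in its two possible
  orders and give the two sides of the square.\<close>

lemma AL_nat:
  assumes "H a b f" "H b c g" "H c d h"
  shows "AL a b c d f g h = M a c d (M a b c f g) h \<bullet> AL a b c d (tg 2 f) (tg 2 g) (tg 2 h)"
    "AL a b c d f g h = AL a b c d (sr 2 f) (sr 2 g) (sr 2 h) \<bullet> M a b d f (M b c d g h)"
proof -
  note f = HD[OF assms(1)] HD[OF assms(2)] HD[OF assms(3)]
  have ok: "ok ((f \<otimes> g \<otimes> h) \<odot> al a b c d)" using f by auto
  show "AL a b c d f g h = M a c d (M a b c f g) h \<bullet> AL a b c d (tg 2 f) (tg 2 g) (tg 2 h)"
    using split_l[OF _ _ ok, of 2] f unfolding AL_def MM_l[OF assms] by simp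
  show "AL a b c d f g h = AL a b c d (sr 2 f) (sr 2 g) (sr 2 h) \<bullet> M a b d f (M b c d g h)"
    using split_r[OF _ _ ok, of 2] f unfolding AL_def MM_r[OF assms] by simp
qed

lemma Mi_l:
  assumes "H a b f" shows "M a a b (ii a) f = f \<odot> (ii a \<otimes> e a b) \<odot> m a a b"
proof -
  note f = HD[OF assms]
  have "(ob a \<odot> ii a) \<otimes> (f \<odot> e a b) = (ob a \<otimes> f) \<odot> (ii a \<otimes> e a b)" using f by (intro exch) auto
  moreover have "ob a \<odot> ii a = ii a" "f \<odot> e a b = f" "ob a \<otimes> f = f" using f by (auto intro: unit_l' unit_r')
  ultimately show ?thesis by (simp add: M_def assoc)
qed

lemma Mi_r:
  assumes "H a b f" shows "M a b b f (ii b) = f \<odot> (e a b \<otimes> ii b) \<odot> m a b b"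
proof -
  note f = HD[OF assms]
  have "(f \<odot> e a b) \<otimes> (ob b \<odot> ii b) = (f \<otimes> ob b) \<odot> (e a b \<otimes> ii b)" using f by (intro exch) auto
  moreover have "ob b \<odot> ii b = ii b" "f \<odot> e a b = f" "f \<otimes> ob b = f" using f by (auto intro: unit_l' unit_r')
  ultimately show ?thesis by (simp add: M_def assoc)
qed

lemma LA_simps [simp]:
  assumes "H a b f"
  shows "ok (LA a b f)" "H a b (LA a b f)" "sr 2 (LA a b f) = M a a b (ii a) (sr 2 f)" "tg 2 (LA a b f) = tg 2 f"
  using HD[OF assms] assms by (auto simp: LA_def Mi_l H_def intro: unit_r')

lemma RH_simps [simp]:
  assumes "H a b f"
  shows "ok (RH a b f)" "H a b (RH a b f)" "sr 2 (RH a b f) = M a b b (sr 2 f) (ii b)" "tg 2 (RH a b f) = tg 2 f"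
  using HD[OF assms] assms by (auto simp: RH_def Mi_r H_def intro: unit_r')

lemma LA_nat:
  assumes "H a b f"
  shows "LA a b f = M a a b (ii a) f \<bullet> LA a b (tg 2 f)" "LA a b f = LA a b (sr 2 f) \<bullet> f"
proof -
  note f = HD[OF assms]
  have ok: "ok (f \<odot> la a b)" using f by auto
  show "LA a b f = M a a b (ii a) f \<bullet> LA a b (tg 2 f)"
    using split_l[OF _ _ ok, of 2] f unfolding LA_def Mi_l[OF assms] by simp
  show "LA a b f = LA a b (sr 2 f) \<bullet> f"
    using split_r[OF _ _ ok, of 2] f unit_r'[of 1 f "e a b"] unfolding LA_def by simp
qed

lemma RH_nat:
  assumes "H a b f"
  shows "RH a b f = M a b b f (ii b) \<bullet> RH a b (tg 2 f)" "RH a b f = RH a b (sr 2 f) \<bullet> f"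
proof -
  note f = HD[OF assms]
  have ok: "ok (f \<odot> rh a b)" using f by auto
  show "RH a b f = M a b b f (ii b) \<bullet> RH a b (tg 2 f)"
    using split_l[OF _ _ ok, of 2] f unfolding RH_def Mi_r[OF assms] by simp
  show "RH a b f = RH a b (sr 2 f) \<bullet> f"
    using split_r[OF _ _ ok, of 2] f unit_r'[of 1 f "e a b"] unfolding RH_def by simp
qed

section \<open>Paths, right combs and the product of two combs\<close>

fun pth where
  "pth a [] = ob a"
| "pth a (b # p) = e a b \<otimes> pth b p"

text \<open>A nonempty comb stops at its last edge and not at a unit. Hence a one-edge comb is an
  identity and concatenation leaves no trailing unit to remove.\<close>

fun cmb where
  "cmb a [] = ii a"
| "cmb a (b # p) = (if p = [] then e a b else M a b (last p) (e a b) (cmb b p))"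

text \<open>The 3-cell from the product of two combs to the comb of the concatenated path: one
  associator for each multiplication in the first comb, a unitor if a path is empty. For a single
  edge \<open>b\<close> and nonempty \<open>q\<close> the product already is the comb, so that the
  value is an identity.\<close>

fun A where
  "A a [] q = LA a (last (a # q)) (cmb a q)"
| "A a (b # p) q = (if q = [] then RH a (last (b # p)) (cmb a (b # p))
     else if p = [] then cmb a (b # q)
     else AL a b (last p) (last q) (e a b) (cmb b p) (cmb (last p) q) \<bullet> M a b (last q) (e a b) (A b p q))"

lemma pth [simp]:
  assumes "a \<in> Ob" "set p \<subseteq> Ob"
  shows "ok (pth a p)" "sr 0 (pth a p) = ob a" "tg 0 (pth a p) = ob (last (a # p))"
    "0 < k \<Longrightarrow> k < 3 \<Longrightarrow> sr k (pth a p) = pth a p" "0 < k \<Longrightarrow> k < 3 \<Longrightarrow> tg k (pth a p) = pth a p"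
proof -
  have "ok (pth a p) \<and> sr 0 (pth a p) = ob a \<and> tg 0 (pth a p) = ob (last (a # p)) \<and> 
    (0 < k \<longrightarrow> k < 3 \<longrightarrow> sr k (pth a p) = pth a p \<and> tg k (pth a p) = pth a p)"
    using assms by (induction p arbitrary: a) auto
  then show "ok (pth a p)" "sr 0 (pth a p) = ob a" "tg 0 (pth a p) = ob (last (a # p))"
    "0 < k \<Longrightarrow> k < 3 \<Longrightarrow> sr k (pth a p) = pth a p" "0 < k \<Longrightarrow> k < 3 \<Longrightarrow> tg k (pth a p) = pth a p" by auto
qed

lemma last_in: "set p \<subseteq> Ob \<Longrightarrow> p \<noteq> [] \<Longrightarrow> last p \<in> Ob" using last_in_set[of p] by blast

lemma pth_append: "a \<in> Ob \<Longrightarrow> set p \<subseteq> Ob \<Longrightarrow> set q \<subseteq> Ob \<Longrightarrow> pth a (p @ q) = pth a p \<otimes> pth (last (a # p)) q"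
  by (induction p arbitrary: a) (auto simp: assoc intro: unit_l'[symmetric])

lemma cmb_typ:
  assumes "a \<in> Ob" "set p \<subseteq> Ob"
  shows "H a (last (a # p)) (cmb a p) \<and> sr 2 (cmb a p) = cmb a p \<and> sr 1 (cmb a p) = pth a p"
  using assms
proof (induction p arbitrary: a)
  case (Cons b p)
  then show ?case using Cons.IH[of b] by (auto intro: unit_r'[symmetric])
qed simp

lemma cmb [simp]:
  assumes "a \<in> Ob" "set p \<subseteq> Ob"
  shows "H a (last (a # p)) (cmb a p)" "sr 2 (cmb a p) = cmb a p" "sr 1 (cmb a p) = pth a p" "tg 2 (cmb a p) = cmb a p"
    "ok (cmb a p)" "tg 1 (cmb a p) = e a (last (a # p))"
    "sr 0 (cmb a p) = ob a" "tg 0 (cmb a p) = ob (last (a # p))"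
  using cmb_typ[OF assms] id_up(2)[of 2 2 "cmb a p"] HD[of a "last (a # p)" "cmb a p"] by auto

lemma cmb_H [simp]:
  assumes "a \<in> Ob" "set p \<subseteq> Ob"
  shows "p \<noteq> [] \<Longrightarrow> H a (last p) (cmb a p)"
  using cmb(1)[OF assms] by (cases p) auto

lemma A_typ:
  assumes "a \<in> Ob" "set p \<subseteq> Ob" "set q \<subseteq> Ob"
  shows "H a (last (a # p @ q)) (A a p q) \<and> sr 2 (A a p q) = M a (last (a # p)) (last (a # p @ q)) (cmb a p) (cmb (last (a # p)) q) \<and>
    tg 2 (A a p q) = cmb a (p @ q)"
  using assms
proof (induction p arbitrary: a)
  case Nil
  then show ?case using cmb(1)[of a q] by (simp del: cmb(1) split: if_splits)
next
  case (Cons b p)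
  show ?case
  proof (cases "q = []")
    case True
    then show ?thesis using Cons cmb(1)[of a "b # p"] by (simp del: cmb(1) split: if_splits)
  next
    case q: False
    show ?thesis
    proof (cases "p = []")
      case True
      then show ?thesis using Cons q by (simp add: last_in)
    next
      case False
      then show ?thesis using Cons q by (simp add: last_in)
    qed
  qed
qed

lemma A [simp]:
  assumes "a \<in> Ob" "set p \<subseteq> Ob" "set q \<subseteq> Ob"
  shows "H a (last (a # p @ q)) (A a p q)"
    "sr 2 (A a p q) = M a (last (a # p)) (last (a # p @ q)) (cmb a p) (cmb (last (a # p)) q)"
    "tg 2 (A a p q) = cmb a (p @ q)" "ok (A a p q)"
  using A_typ[OF assms] HD(3) by auto

end

section \<open>Coherence for combs\<close>

text \<open>The generating 4-cells have turned into equations. The assumption \<open>inv\<close>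
  reflects that 3-cells are invertible in a (4,2)-category; it serves to cancel 3-cells.\<close>

locale bicat_coh = bicat_alg ok cp sr tg bt Ob ob e ii m al la rh
  for ok :: "'q \<Rightarrow> bool" and cp :: "nat \<Rightarrow> 'q \<Rightarrow> 'q \<Rightarrow> 'q" and sr tg :: "nat \<Rightarrow> 'q \<Rightarrow> 'q" and bt :: 'q
    and Ob :: "'o set" and ob e ii m al la rh +
  assumes inv: "ok f \<Longrightarrow> \<exists>g. ok g \<and> f \<bullet> g = sr 2 f \<and> g \<bullet> f = tg 2 f"
    and pi: "a \<in> Ob \<Longrightarrow> b \<in> Ob \<Longrightarrow> c \<in> Ob \<Longrightarrow> d \<in> Ob \<Longrightarrow> x \<in> Ob \<Longrightarrow>
      ((al a b c d \<otimes> e d x) \<odot> m a d x) \<bullet> ((e a b \<otimes> m b c d \<otimes> e d x) \<odot> al a b d x) \<bullet> ((e a b \<otimes> al b c d x) \<odot> m a b x)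
      = ((m a b c \<otimes> e c d \<otimes> e d x) \<odot> al a c d x) \<bullet> ((e a b \<otimes> e b c \<otimes> m c d x) \<odot> al a b c x)"
    and kappa: "a \<in> Ob \<Longrightarrow> b \<in> Ob \<Longrightarrow> c \<in> Ob \<Longrightarrow>
      ((e a b \<otimes> ii b \<otimes> e b c) \<odot> al a b b c) \<bullet> ((e a b \<otimes> la b c) \<odot> m a b c) = (rh a b \<otimes> e b c) \<odot> m a b c"
begin

lemma cancel_l: assumes "f \<bullet> x = f \<bullet> y" "ok (f \<bullet> x)" "ok (f \<bullet> y)" shows "x = y"
proof -
  obtain g where g: "ok g" "f \<bullet> g = sr 2 f" "g \<bullet> f = tg 2 f" using inv[of f] assms by auto
  have f: "ok f" "tg 2 f = sr 2 x" "tg 2 f = sr 2 y" "ok x" "ok y" using assms(2,3) by simp_all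
  then have "x = (g \<bullet> f) \<bullet> x" "y = (g \<bullet> f) \<bullet> y" using g by (simp_all add: unit_l')
  then show ?thesis using assms(1) by (metis assoc[of 2] lessI numeral_3_eq_3 numeral_2_eq_2)
qed

lemma cancel_r: assumes "x \<bullet> f = y \<bullet> f" "ok (x \<bullet> f)" "ok (y \<bullet> f)" shows "x = y"
proof -
  obtain g where g: "ok g" "f \<bullet> g = sr 2 f" "g \<bullet> f = tg 2 f" using inv[of f] assms by auto
  have f: "ok f" "tg 2 x = sr 2 f" "tg 2 y = sr 2 f" "ok x" "ok y" using assms(2,3) by simp_all
  then have "x = x \<bullet> (f \<bullet> g)" "y = y \<bullet> (f \<bullet> g)" using g by (simp_all add: unit_r')
  then show ?thesis using assms(1) by (metis assoc[of 2] lessI numeral_3_eq_3 numeral_2_eq_2)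
qed

text \<open>Each side of the pentagon is the whiskered generator from the same side of
  \<open>pi\<close>, preceded by the four inputs.\<close>

lemma pent_aux:
  assumes H: "H a b w" "H b c x" "H c d y" "H d o' z"
  shows "M a d o' (AL a b c d w x y) z = (w \<otimes> x \<otimes> y \<otimes> z) \<odot> (al a b c d \<otimes> e d o') \<odot> m a d o'"
    "AL a b d o' w (M b c d x y) z = (w \<otimes> x \<otimes> y \<otimes> z) \<odot> (e a b \<otimes> m b c d \<otimes> e d o') \<odot> al a b d o'"
    "M a b o' w (AL b c d o' x y z) = (w \<otimes> x \<otimes> y \<otimes> z) \<odot> (e a b \<otimes> al b c d o') \<odot> m a b o'"
    "AL a c d o' (M a b c w x) y z = (w \<otimes> x \<otimes> y \<otimes> z) \<odot> (m a b c \<otimes> e c d \<otimes> e d o') \<odot> al a c d o'"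
    "AL a b c o' w x (M c d o' y z) = (w \<otimes> x \<otimes> y \<otimes> z) \<odot> (e a b \<otimes> e b c \<otimes> m c d o') \<odot> al a b c o'"
proof -
  note h = HD[OF H(1)] HD[OF H(2)] HD[OF H(3)] HD[OF H(4)]
  have u: "w \<odot> e a b = w" "x \<odot> e b c = x" "y \<odot> e c d = y" "z \<odot> e d o' = z" using h by (simp_all add: unit_r')
  show "M a d o' (AL a b c d w x y) z = (w \<otimes> x \<otimes> y \<otimes> z) \<odot> (al a b c d \<otimes> e d o') \<odot> m a d o'"
    unfolding M_def AL_def using tens[of "w \<otimes> x \<otimes> y" "al a b c d" z "e d o'"] h u by (simp add: assoc)
  have xyz: "((x \<otimes> y) \<odot> m b c d) \<otimes> z = (x \<otimes> y \<otimes> z) \<odot> (m b c d \<otimes> e d o')"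
    using tens[of "x \<otimes> y" "m b c d" z "e d o'"] h u by (simp add: assoc)
  show "AL a b d o' w (M b c d x y) z = (w \<otimes> x \<otimes> y \<otimes> z) \<odot> (e a b \<otimes> m b c d \<otimes> e d o') \<odot> al a b d o'"
    unfolding M_def AL_def xyz using tens[of w "e a b" "x \<otimes> y \<otimes> z" "m b c d \<otimes> e d o'"] h u by (simp add: assoc)
  show "M a b o' w (AL b c d o' x y z) = (w \<otimes> x \<otimes> y \<otimes> z) \<odot> (e a b \<otimes> al b c d o') \<odot> m a b o'"
    unfolding M_def AL_def using tens[of w "e a b" "x \<otimes> y \<otimes> z" "al b c d o'"] h u by (simp add: assoc)
  have yz: "y \<otimes> z = (y \<otimes> z) \<odot> (e c d \<otimes> e d o')" using tens[of y "e c d" z "e d o'"] h u by simp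
  have wx: "w \<otimes> x = (w \<otimes> x) \<odot> (e a b \<otimes> e b c)" using tens[of w "e a b" x "e b c"] h u by simp
  have "((w \<otimes> x) \<odot> m a b c) \<otimes> y \<otimes> z = (w \<otimes> x \<otimes> y \<otimes> z) \<odot> (m a b c \<otimes> e c d \<otimes> e d o')"
    using tens[of "w \<otimes> x" "m a b c" "y \<otimes> z" "e c d \<otimes> e d o'"] yz h by (simp add: assoc)
  then show "AL a c d o' (M a b c w x) y z = (w \<otimes> x \<otimes> y \<otimes> z) \<odot> (m a b c \<otimes> e c d \<otimes> e d o') \<odot> al a c d o'"
    unfolding M_def AL_def by (simp add: assoc)
  have "(w \<otimes> x) \<otimes> ((y \<otimes> z) \<odot> m c d o') = (w \<otimes> x \<otimes> y \<otimes> z) \<odot> (e a b \<otimes> e b c \<otimes> m c d o')"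
    using tens[of "w \<otimes> x" "e a b \<otimes> e b c" "y \<otimes> z" "m c d o'"] wx h by (simp add: assoc)
  then show "AL a b c o' w x (M c d o' y z) = (w \<otimes> x \<otimes> y \<otimes> z) \<odot> (e a b \<otimes> e b c \<otimes> m c d o') \<odot> al a b c o'"
    unfolding M_def AL_def by (simp add: assoc)
qed

text \<open>The equation \<open>pi\<close> whiskered in front by
  \<open>w \<otimes> x \<otimes> y \<otimes> z\<close>. The inputs are 2-cells, as whiskering must
  distribute over \<open>\<bullet>\<close>.\<close>

lemma pentagon:
  assumes H: "H a b w" "H b c x" "H c d y" "H d o' z"
    and i: "sr 2 w = w" "sr 2 x = x" "sr 2 y = y" "sr 2 z = z"
  shows "M a d o' (AL a b c d w x y) z \<bullet> AL a b d o' w (M b c d x y) z \<bullet> M a b o' w (AL b c d o' x y z)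
    = AL a c d o' (M a b c w x) y z \<bullet> AL a b c o' w x (M c d o' y z)"
proof -
  note h = HD[OF H(1)] HD[OF H(2)] HD[OF H(3)] HD[OF H(4)]
  let ?F = "w \<otimes> x \<otimes> y \<otimes> z" and ?e = "e a b \<otimes> e b c \<otimes> e c d \<otimes> e d o'"
  let ?Q1 = "M a d o' (AL a b c d (e a b) (e b c) (e c d)) (e d o')"
  let ?Q2 = "AL a b d o' (e a b) (M b c d (e b c) (e c d)) (e d o')"
  let ?Q3 = "M a b o' (e a b) (AL b c d o' (e b c) (e c d) (e d o'))"
  let ?Q4 = "AL a c d o' (M a b c (e a b) (e b c)) (e c d) (e d o')"
  let ?Q5 = "AL a b c o' (e a b) (e b c) (M c d o' (e c d) (e d o'))"
  have He: "H a b (e a b)" "H b c (e b c)" "H c d (e c d)" "H d o' (e d o')" using h by auto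
  \<comment> \<open>With edges as inputs the prefix is an identity. Writing the sides of
    \<open>pi\<close> in this way lets \<open>M_simps\<close> and \<open>AL_simps\<close> supply
    their boundaries.\<close>
  have Q: "?Q1 = (al a b c d \<otimes> e d o') \<odot> m a d o'" "?Q2 = (e a b \<otimes> m b c d \<otimes> e d o') \<odot> al a b d o'"
    "?Q3 = (e a b \<otimes> al b c d o') \<odot> m a b o'" "?Q4 = (m a b c \<otimes> e c d \<otimes> e d o') \<odot> al a c d o'"
    "?Q5 = (e a b \<otimes> e b c \<otimes> m c d o') \<odot> al a b c o'"
    unfolding pent_aux[OF He] by (rule unit_l'; use h in \<open>simp add: assoc\<close>)+
  have F: "idn 2 ?F" using h i by (simp add: idn_def)
  have ok: "ok (?Q1 \<bullet> ?Q2 \<bullet> ?Q3)" "ok (?Q2 \<bullet> ?Q3)" "ok (?Q4 \<bullet> ?Q5)" using He h by simp_all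
  have t: "tg 1 ?F = sr 1 ?Q1" "tg 1 ?F = sr 1 ?Q4" "tg 1 ?F = sr 1 ?Q2" unfolding Q using h by (simp_all add: assoc)
  have "?F \<odot> (?Q1 \<bullet> ?Q2 \<bullet> ?Q3) = ?F \<odot> (?Q4 \<bullet> ?Q5)"
    unfolding Q using pi[of a b c d o'] h by (simp only:)
  then have "(?F \<odot> ?Q1) \<bullet> (?F \<odot> ?Q2) \<bullet> (?F \<odot> ?Q3) = (?F \<odot> ?Q4) \<bullet> (?F \<odot> ?Q5)"
    using dist_l[OF _ _ F ok(1) t(1)] dist_l[OF _ _ F ok(2) t(3)] dist_l[OF _ _ F ok(3) t(2)] by simp
  then show ?thesis unfolding Q unfolding pent_aux[OF H] .
qed

text \<open>The equation \<open>kappa\<close> whiskered by \<open>x \<otimes> y\<close>: the unit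
  \<open>ii b\<close> consumes no input and can therefore be inserted after \<open>x\<close> and
  \<open>y\<close>.\<close>

lemma triangle:
  assumes H: "H a b x" "H b c y" and i: "sr 2 x = x" "sr 2 y = y"
  shows "AL a b b c x (ii b) y \<bullet> M a b c x (LA b c y) = M a b c (RH a b x) y"
proof -
  note h = HD[OF H(1)] HD[OF H(2)]
  have u: "x \<odot> e a b = x" "y \<odot> e b c = y" "ob b \<odot> ii b = ii b" "ob b \<otimes> y = y" "ob b \<otimes> e b c = e b c"
    using h by (simp_all add: unit_r' unit_l')
  have "ii b \<otimes> y = y \<odot> (ii b \<otimes> e b c)" using tens[of "ob b" "ii b" y "e b c"] h u by simp
  then have "x \<otimes> ii b \<otimes> y = (x \<otimes> y) \<odot> (e a b \<otimes> ii b \<otimes> e b c)"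
    using tens[of x "e a b" y "ii b \<otimes> e b c"] h u by simp
  then have 1: "AL a b b c x (ii b) y = (x \<otimes> y) \<odot> (e a b \<otimes> ii b \<otimes> e b c) \<odot> al a b b c"
    by (simp add: AL_def assoc)
  have 2: "M a b c x (LA b c y) = (x \<otimes> y) \<odot> (e a b \<otimes> la b c) \<odot> m a b c"
    using tens[of x "e a b" y "la b c"] h u by (simp add: M_def LA_def assoc)
  have 3: "M a b c (RH a b x) y = (x \<otimes> y) \<odot> (rh a b \<otimes> e b c) \<odot> m a b c"
    using tens[of x "rh a b" y "e b c"] h u by (simp add: M_def RH_def assoc)
  have k: "((e a b \<otimes> ii b \<otimes> e b c) \<odot> al a b b c) \<bullet> ((e a b \<otimes> la b c) \<odot> m a b c) = (rh a b \<otimes> e b c) \<odot> m a b c"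
    using h kappa by simp
  have "ok ((rh a b \<otimes> e b c) \<odot> m a b c)" using h by simp
  then have okk: "ok (((e a b \<otimes> ii b \<otimes> e b c) \<odot> al a b b c) \<bullet> ((e a b \<otimes> la b c) \<odot> m a b c))" unfolding k .
  show ?thesis unfolding 1 2 3 k[symmetric]
    by (rule dist_l[symmetric]) (use okk h i unit_l'[of 0 "e b c" "ob b"] in \<open>auto simp: idn_def\<close>)
qed

text \<open>Multiplication by a unit is isomorphic to the identity functor through the left unitor,
  hence faithful: naturality expresses \<open>f\<close> by \<open>M a a b (ii a) f\<close>, up to a
  cell that can be cancelled.\<close>

lemma LA_faithful:
  assumes "H a b f" "H a b g" "sr 2 f = sr 2 g" "tg 2 f = tg 2 g" "M a a b (ii a) f = M a a b (ii a) g"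
  shows "f = g"
proof (rule cancel_l)
  show "LA a b (sr 2 f) \<bullet> f = LA a b (sr 2 f) \<bullet> g"
    using LA_nat[OF assms(1)] LA_nat[OF assms(2)] assms by metis
qed (use assms HD in auto)

lemma RH_faithful:
  assumes "H a b f" "H a b g" "sr 2 f = sr 2 g" "tg 2 f = tg 2 g" "M a b b f (ii b) = M a b b g (ii b)"
  shows "f = g"
proof (rule cancel_l)
  show "RH a b (sr 2 f) \<bullet> f = RH a b (sr 2 f) \<bullet> g"
    using RH_nat[OF assms(1)] RH_nat[OF assms(2)] assms by metis
qed (use assms HD in auto)

text \<open>The two further unit triangles and the equality of the two unitors at the unit are
  redundant in a monoidal category (Kelly, 1964).\<close>

lemma kelly_l:
  assumes H: "H a b x" "H b c y" and i: "sr 2 x = x" "sr 2 y = y"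
  shows "AL a a b c (ii a) x y \<bullet> LA a c (M a b c x y) = M a b c (LA a b x) y"
proof -
  note h = HD[OF H(1)] HD[OF H(2)]
  have t: "tg 2 x = x" "tg 2 y = y" using i id_up(2)[of 2 2 x] id_up(2)[of 2 2 y] by simp_all
  let ?i = "ii a" and ?xy = "M a b c x y"
  \<comment> \<open>Another unit is multiplied on from the left. \<open>?K\<close> consists of the
    first two cells on the three-cell side of the pentagon for \<open>ii a\<close>,
    \<open>ii a\<close>, \<open>x\<close>, \<open>y\<close>; the third one is part of
    \<open>M a a c ?i ?f\<close>. Both sides are compared after \<open>?K\<close>, which is then
    cancelled.\<close>
  let ?K = "M a b c (AL a a a b ?i ?i x) y \<bullet> AL a a b c ?i (M a a b ?i x) y"
  let ?f = "AL a a b c ?i x y \<bullet> LA a c ?xy" and ?g = "M a b c (LA a b x) y"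
  have Hi: "H a a ?i" using h by simp
  have "?K \<bullet> M a a c ?i ?f = (M a b c (AL a a a b ?i ?i x) y \<bullet> AL a a b c ?i (M a a b ?i x) y \<bullet> M a a c ?i (AL a a b c ?i x y)) \<bullet> M a a c ?i (LA a c ?xy)"
    using H Hi i t h by (simp add: assoc M_comp_r)
  also have "\<dots> = AL a a b c (M a a a ?i ?i) x y \<bullet> (AL a a a c ?i ?i ?xy \<bullet> M a a c ?i (LA a c ?xy))"
    using pentagon[OF Hi Hi H] i h by (simp add: assoc)
  also have "\<dots> = AL a a b c (M a a a ?i ?i) x y \<bullet> M a a c (RH a a ?i) ?xy"
    using triangle[of a a ?i c ?xy] H i h by simp
  also have "\<dots> = AL a a b c (RH a a ?i) x y" using AL_nat(2)[of a a "RH a a ?i" b x c y] H i t h by simp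
  also have "\<dots> = M a b c (M a a b (RH a a ?i) x) y \<bullet> AL a a b c ?i x y"
    using AL_nat(1)[of a a "RH a a ?i" b x c y] H i t h by simp
  also have "M a a b (RH a a ?i) x = AL a a a b ?i ?i x \<bullet> M a a b ?i (LA a b x)"
    using triangle[of a a ?i b x] H i h by simp
  also have "M a b c (AL a a a b ?i ?i x \<bullet> M a a b ?i (LA a b x)) y \<bullet> AL a a b c ?i x y
     = M a b c (AL a a a b ?i ?i x) y \<bullet> (M a b c (M a a b ?i (LA a b x)) y \<bullet> AL a a b c ?i x y)"
    using H i t h by (simp add: assoc M_comp_l)
  also have "M a b c (M a a b ?i (LA a b x)) y \<bullet> AL a a b c ?i x y = AL a a b c ?i (LA a b x) y"
    using AL_nat(1)[of a a ?i b "LA a b x" c y] H i t h by simp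
  also have "\<dots> = AL a a b c ?i (M a a b ?i x) y \<bullet> M a a c ?i ?g"
    using AL_nat(2)[of a a ?i b "LA a b x" c y] H i t h by simp
  finally have "?K \<bullet> M a a c ?i ?f = ?K \<bullet> M a a c ?i ?g" by (simp add: assoc)
  then have "M a a c ?i ?f = M a a c ?i ?g" by (rule cancel_l) (use H i t h in simp_all)
  then show ?thesis by (rule LA_faithful[rotated -1]) (use H i t h in simp_all)
qed

lemma kelly_r:
  assumes H: "H a b x" "H b c y" and i: "sr 2 x = x" "sr 2 y = y"
  shows "AL a b c c x y (ii c) \<bullet> M a b c x (RH b c y) = RH a c (M a b c x y)"
proof -
  note h = HD[OF H(1)] HD[OF H(2)]
  have t: "tg 2 x = x" "tg 2 y = y" using i id_up(2)[of 2 2 x] id_up(2)[of 2 2 y] by simp_all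
  let ?i = "ii c" and ?xy = "M a b c x y"
  let ?f = "AL a b c c x y ?i \<bullet> M a b c x (RH b c y)" and ?g = "RH a c ?xy"
  have Hi: "H c c ?i" using h by simp
  have "M a c c ?f ?i \<bullet> AL a b c c x y ?i
      = M a c c (AL a b c c x y ?i) ?i \<bullet> (M a c c (M a b c x (RH b c y)) ?i \<bullet> AL a b c c x y ?i)"
    using H i t h by (simp add: assoc M_comp_l)
  also have "M a c c (M a b c x (RH b c y)) ?i \<bullet> AL a b c c x y ?i = AL a b c c x (RH b c y) ?i"
    using AL_nat(1)[of a b x c "RH b c y" c ?i] H i t h by simp
  also have "\<dots> = AL a b c c x (M b c c y ?i) ?i \<bullet> M a b c x (M b c c (RH b c y) ?i)"
    using AL_nat(2)[of a b x c "RH b c y" c ?i] H i t h by simp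
  also have "M b c c (RH b c y) ?i = AL b c c c y ?i ?i \<bullet> M b c c y (LA c c ?i)"
    using triangle[of b c y c ?i] H i h by simp
  also have "M a c c (AL a b c c x y ?i) ?i \<bullet> AL a b c c x (M b c c y ?i) ?i \<bullet> M a b c x (AL b c c c y ?i ?i \<bullet> M b c c y (LA c c ?i))
    = (M a c c (AL a b c c x y ?i) ?i \<bullet> AL a b c c x (M b c c y ?i) ?i \<bullet> M a b c x (AL b c c c y ?i ?i)) \<bullet> M a b c x (M b c c y (LA c c ?i))"
    using H i t h by (simp add: assoc M_comp_r)
  also have "\<dots> = AL a c c c ?xy ?i ?i \<bullet> (AL a b c c x y (M c c c ?i ?i) \<bullet> M a b c x (M b c c y (LA c c ?i)))"
    using pentagon[OF H Hi Hi] i h by (simp add: assoc)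
  also have "AL a b c c x y (M c c c ?i ?i) \<bullet> M a b c x (M b c c y (LA c c ?i)) = AL a b c c x y (LA c c ?i)"
    using AL_nat(2)[of a b x c y c "LA c c ?i"] H i t h by simp
  also have "\<dots> = M a c c ?xy (LA c c ?i) \<bullet> AL a b c c x y ?i"
    using AL_nat(1)[of a b x c y c "LA c c ?i"] H i t h by simp
  also have "AL a c c c ?xy ?i ?i \<bullet> M a c c ?xy (LA c c ?i) \<bullet> AL a b c c x y ?i
     = (AL a c c c ?xy ?i ?i \<bullet> M a c c ?xy (LA c c ?i)) \<bullet> AL a b c c x y ?i" by (simp add: assoc)
  also have "AL a c c c ?xy ?i ?i \<bullet> M a c c ?xy (LA c c ?i) = M a c c ?g ?i"
    using triangle[of a c ?xy c ?i] H i h by simp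
  finally have "M a c c ?f ?i = M a c c ?g ?i" by (rule cancel_r) (use H i t h in simp_all)
  then show ?thesis by (rule RH_faithful[rotated -1]) (use H i t h in simp_all)
qed

lemma LA_ii: assumes a: "a \<in> Ob" shows "LA a a (ii a) = RH a a (ii a)"
proof -
  let ?i = "ii a"
  \<comment> \<open>Naturality of the left unitor at the left unitor itself.\<close>
  have "M a a a ?i (LA a a ?i) \<bullet> LA a a ?i = LA a a (M a a a ?i ?i) \<bullet> LA a a ?i"
    using LA_nat[of a a "LA a a ?i"] a by simp
  then have n: "M a a a ?i (LA a a ?i) = LA a a (M a a a ?i ?i)" by (rule cancel_r) (use a in simp_all)
  \<comment> \<open>By \<open>n\<close> the left-hand sides of \<open>kelly_l\<close> and
    \<open>triangle\<close> at two units agree.\<close>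
  have "M a a a (LA a a ?i) ?i = M a a a (RH a a ?i) ?i"
    using kelly_l[of a a ?i a ?i] triangle[of a a ?i a ?i] n a by simp
  then show ?thesis by (rule RH_faithful[rotated -1]) (use a in simp_all)
qed

text \<open>For an empty \<open>p\<close> the definition of \<open>A\<close> chooses the left
  unitor; \<open>LA_ii\<close> says that this choice does not matter.\<close>

lemma A_unit_r: assumes "a \<in> Ob" "set p \<subseteq> Ob" shows "A a p [] = RH a (last (a # p)) (cmb a p)"
  using assms LA_ii by (cases p) simp_all

text \<open>Multiplying three combs to one does not depend on the bracketing. Induction on
  \<open>p\<close>: an empty \<open>p\<close> is settled by \<open>kelly_l\<close>, an empty
  \<open>q\<close> by \<open>triangle\<close>, an empty \<open>r\<close> by \<open>kelly_r\<close>;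
  for a single edge only identities have to be dropped, and longer paths use the pentagon.\<close>

lemma A_al:
  assumes "a \<in> Ob" "set p \<subseteq> Ob" "set q \<subseteq> Ob" "set r \<subseteq> Ob"
    and b: "b = last (a # p)" "c = last (b # q)" "d = last (c # r)"
  shows "M a c d (A a p q) (cmb c r) \<bullet> A a (p @ q) r
    = AL a b c d (cmb a p) (cmb b q) (cmb c r) \<bullet> M a b d (cmb a p) (A b q r) \<bullet> A a p (q @ r)"
  using assms
proof (induction p arbitrary: a b)
  case Nil
  have o: "b \<in> Ob" "c \<in> Ob" "d \<in> Ob" using Nil last_in by (auto split: if_splits)
  have H: "H a c (cmb a q)" "H c d (cmb c r)" "H a d (A a q r)" 
    using cmb(1)[of a q] cmb(1)[of c r] A(1)[of a q r] Nil o by (auto simp del: cmb A split: if_splits)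
  have la: "last (a # q @ r) = d" using Nil by simp
  have "AL a b c d (cmb a []) (cmb b q) (cmb c r) \<bullet> M a b d (cmb a []) (A b q r) \<bullet> A a [] (q @ r)
     = AL a a c d (ii a) (cmb a q) (cmb c r) \<bullet> M a a d (ii a) (A a q r) \<bullet> LA a d (cmb a (q @ r))"
    using Nil la by simp
  \<comment> \<open>Naturality of the left unitor at \<open>A a q r\<close>.\<close>
  also have "M a a d (ii a) (A a q r) \<bullet> LA a d (cmb a (q @ r)) = LA a d (M a c d (cmb a q) (cmb c r)) \<bullet> A a q r"
    using LA_nat[OF H(3)] A(2,3)[of a q r] Nil la by (simp del: A)
  also have "AL a a c d (ii a) (cmb a q) (cmb c r) \<bullet> LA a d (M a c d (cmb a q) (cmb c r)) \<bullet> A a q r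
     = M a c d (LA a c (cmb a q)) (cmb c r) \<bullet> A a q r"
    using kelly_l[OF H(1,2)] Nil o by (simp add: assoc[symmetric])
  finally show ?case using Nil by simp
next
  case (Cons x p)
  have o: "b \<in> Ob" "c \<in> Ob" "d \<in> Ob" "x \<in> Ob" using Cons.prems last_in by (auto split: if_splits)
  have H: "H a b (cmb a (x # p))" "H b c (cmb b q)" "H c d (cmb c r)" "H b d (A b q r)" "H x b (cmb x p)" "H x c (A x p q)"
    "H x d (A x p (q @ r))" "H x d (A x (p @ q) r)"
    using cmb(1)[of a "x # p"] cmb(1)[of b q] cmb(1)[of c r] A(1)[of b q r] cmb(1)[of x p] A(1)[of x p q] A(1)[of x p "q @ r"] A(1)[of x "p @ q" r] Cons.prems o
    by (auto simp del: cmb A A.simps split: if_splits)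
  show ?case
  proof (cases "q = []")
    case q: True
    then have cb: "c = b" using Cons.prems by simp
    have "AL a b c d (cmb a (x # p)) (cmb b q) (cmb c r) \<bullet> M a b d (cmb a (x # p)) (A b q r) \<bullet> A a (x # p) (q @ r)
      = (AL a b b d (cmb a (x # p)) (ii b) (cmb b r) \<bullet> M a b d (cmb a (x # p)) (LA b d (cmb b r))) \<bullet> A a (x # p) r"
      using q cb Cons.prems by (simp only: assoc) simp
    also have "\<dots> = M a b d (RH a b (cmb a (x # p))) (cmb b r) \<bullet> A a (x # p) r"
      using triangle[of a b "cmb a (x # p)" d "cmb b r"] H q cb Cons.prems o by simp
    finally show ?thesis using q cb Cons.prems by simp
  next
    case q: False
    show ?thesis
    proof (cases "r = []")
      case r: True
      then have dc: "d = c" using Cons.prems by simp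
      have "AL a b c d (cmb a (x # p)) (cmb b q) (cmb c r) \<bullet> M a b d (cmb a (x # p)) (A b q r) \<bullet> A a (x # p) (q @ r)
        = (AL a b c c (cmb a (x # p)) (cmb b q) (ii c) \<bullet> M a b c (cmb a (x # p)) (RH b c (cmb b q))) \<bullet> A a (x # p) q"
        using r dc Cons.prems A_unit_r[of b q] o by (simp only: assoc) simp
      also have "\<dots> = RH a c (M a b c (cmb a (x # p)) (cmb b q)) \<bullet> A a (x # p) q"
        using kelly_r[of a b "cmb a (x # p)" c "cmb b q"] H Cons.prems o by simp
      \<comment> \<open>Naturality of the right unitor at the product of the first two
        combs.\<close>
      also have "\<dots> = M a c c (A a (x # p) q) (ii c) \<bullet> RH a c (cmb a (x # p @ q))"
        using RH_nat[of a c "A a (x # p) q"] A(1,2,3)[of a "x # p" q] Cons.prems q by (simp del: A A.simps)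
      finally show ?thesis using r dc q Cons.prems by (simp add: A_unit_r[of a "x # p @ q", simplified])
    next
      case r: False
      let ?e = "e a x" and ?p = "cmb x p" and ?q = "cmb b q" and ?r = "cmb c r"
      show ?thesis
      proof (cases "p = []")
        case p: True
        have "M a c d (cmb a (x # q)) ?r \<bullet> A a (x # q) r = A a (x # q) r"
          by (rule unit_l') (use A(2,4)[of a "x # q" r] Cons.prems p o in \<open>simp_all del: A A.simps cmb.simps\<close>)
        moreover have "M a x d ?e (A x q r) \<bullet> M a x d ?e (cmb x (q @ r)) = M a x d ?e (A x q r)"
          by (rule unit_r') (use H A(3)[of x q r] Cons.prems p o in \<open>simp_all del: A A.simps\<close>)
        ultimately show ?thesis using p q r Cons.prems o by (simp add: assoc)
      next
        case p: False
        have l: "last p = b" "last (x # p @ q) = c" "last q = c" "last r = d" "last (p @ q) = c" "last (q @ r) = d" 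
          using p q r Cons.prems by simp_all
        have i: "sr 2 ?e = ?e" "sr 2 ?p = ?p" "sr 2 ?q = ?q" "sr 2 ?r = ?r" "tg 2 ?e = ?e" "tg 2 ?p = ?p" "tg 2 ?q = ?q" "tg 2 ?r = ?r"
          "sr 2 (A x p q) = M x b c ?p ?q" "tg 2 (A x p q) = cmb x (p @ q)" "sr 2 (A b q r) = M b c d ?q ?r" "tg 2 (A b q r) = cmb b (q @ r)"
          "sr 2 (A x p (q @ r)) = M x b d ?p (cmb b (q @ r))" "sr 2 (A x (p @ q) r) = M x c d (cmb x (p @ q)) ?r"
          using Cons.prems(1-4) o l p q r A(2,3)[of x p q] A(2,3)[of b q r] A(2)[of x p "q @ r"] A(2)[of x "p @ q" r] by simp_all
        have He: "H a x ?e" "ok ?e" using Cons.prems(1-4) o by simp_all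
        have okA: "ok (A x p q)" "ok (A b q r)" "ok (A x p (q @ r))" "ok (A x (p @ q) r)" "ok ?p" "ok ?q" "ok ?r" using H HD by blast+
        have Hpq: "H x c (cmb x (p @ q))" using cmb(1)[of x "p @ q"] Cons.prems(1-4) o l by (simp del: cmb)
        \<comment> \<open>Naturality of the associator moves the remaining products inside
          \<open>M a x d ?e\<close>, behind the leading edge, where the induction hypothesis
          applies. Then the pentagon for \<open>?e\<close>, \<open>?p\<close>, \<open>?q\<close>,
          \<open>?r\<close> regroups the associators, and naturality moves \<open>A b q r\<close>
          out again.\<close>
        have "M a c d (A a (x # p) q) ?r \<bullet> A a ((x # p) @ q) r
          = M a c d (AL a x b c ?e ?p ?q \<bullet> M a x c ?e (A x p q)) ?r \<bullet> AL a x c d ?e (cmb x (p @ q)) ?r \<bullet> M a x d ?e (A x (p @ q) r)"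
          using p q r l Cons.prems(1-4) by simp
        also have "\<dots> = M a c d (AL a x b c ?e ?p ?q) ?r \<bullet> (M a c d (M a x c ?e (A x p q)) ?r \<bullet> AL a x c d ?e (cmb x (p @ q)) ?r) \<bullet> M a x d ?e (A x (p @ q) r)"
          using H He i okA by (simp add: M_comp_l assoc)
        also have "M a c d (M a x c ?e (A x p q)) ?r \<bullet> AL a x c d ?e (cmb x (p @ q)) ?r = AL a x c d ?e (A x p q) ?r"
          using AL_nat(1)[OF He(1) H(6,3)] i by simp
        also have "\<dots> = AL a x c d ?e (M x b c ?p ?q) ?r \<bullet> M a x d ?e (M x c d (A x p q) ?r)"
          using AL_nat(2)[OF He(1) H(6,3)] i by simp
        also have "M a c d (AL a x b c ?e ?p ?q) ?r \<bullet> (AL a x c d ?e (M x b c ?p ?q) ?r \<bullet> M a x d ?e (M x c d (A x p q) ?r)) \<bullet> M a x d ?e (A x (p @ q) r)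
          = M a c d (AL a x b c ?e ?p ?q) ?r \<bullet> AL a x c d ?e (M x b c ?p ?q) ?r \<bullet> M a x d ?e (M x c d (A x p q) ?r \<bullet> A x (p @ q) r)"
          using H He i okA by (simp add: M_comp_r assoc)
        also have "M x c d (A x p q) ?r \<bullet> A x (p @ q) r
          = AL x b c d ?p ?q ?r \<bullet> M x b d ?p (A b q r) \<bullet> A x p (q @ r)"
          by (rule Cons.IH) (use Cons.prems(1-4) o l p q r in auto)
        also have "M a c d (AL a x b c ?e ?p ?q) ?r \<bullet> AL a x c d ?e (M x b c ?p ?q) ?r \<bullet> M a x d ?e (AL x b c d ?p ?q ?r \<bullet> M x b d ?p (A b q r) \<bullet> A x p (q @ r))
          = (M a c d (AL a x b c ?e ?p ?q) ?r \<bullet> AL a x c d ?e (M x b c ?p ?q) ?r \<bullet> M a x d ?e (AL x b c d ?p ?q ?r)) \<bullet> M a x d ?e (M x b d ?p (A b q r)) \<bullet> M a x d ?e (A x p (q @ r))"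
          using H He i okA by (simp add: M_comp_r assoc)
        also have "\<dots> = AL a b c d (M a x b ?e ?p) ?q ?r \<bullet> (AL a x b d ?e ?p (M b c d ?q ?r) \<bullet> M a x d ?e (M x b d ?p (A b q r))) \<bullet> M a x d ?e (A x p (q @ r))"
          using pentagon[OF He(1) H(5,2,3)] i by (simp add: assoc)
        also have "AL a x b d ?e ?p (M b c d ?q ?r) \<bullet> M a x d ?e (M x b d ?p (A b q r)) = AL a x b d ?e ?p (A b q r)"
          using AL_nat(2)[OF He(1) H(5,4)] i by simp
        also have "\<dots> = M a b d (M a x b ?e ?p) (A b q r) \<bullet> AL a x b d ?e ?p (cmb b (q @ r))"
          using AL_nat(1)[OF He(1) H(5,4)] i by simp
        finally show ?thesis using p q r l by (simp add: assoc)
      qed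
    qed
  qed
qed

end

section \<open>Pseudofunctors in a 3-category\<close>

locale pf_alg = tcat3 ok cp sr tg bt +
  C: bicat_alg ok cp sr tg bt CC obC eC iC mC alC laC rhC +
  D: bicat_alg ok cp sr tg bt DD obD eD iD mD alD laD rhD
  for ok :: "'q \<Rightarrow> bool" and cp :: "nat \<Rightarrow> 'q \<Rightarrow> 'q \<Rightarrow> 'q" and sr tg :: "nat \<Rightarrow> 'q \<Rightarrow> 'q" and bt :: 'q
    and CC :: "'c set" and obC eC iC mC alC laC rhC and DD :: "'d set" and obD eD iD mD alD laD rhD +
  fixes f :: "'c \<Rightarrow> 'd" and u :: "'c \<Rightarrow> 'q" and ph :: "'c \<Rightarrow> 'c \<Rightarrow> 'q" and mu :: "'c \<Rightarrow> 'c \<Rightarrow> 'c \<Rightarrow> 'q" and nu :: "'c \<Rightarrow> 'q"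
  assumes f [simp]: "a \<in> CC \<Longrightarrow> f a \<in> DD"
    and u0: "a \<in> CC \<Longrightarrow> idn 1 (u a) \<and> sr 0 (u a) = obC a \<and> tg 0 (u a) = obD (f a)"
    and ph0: "a \<in> CC \<Longrightarrow> b \<in> CC \<Longrightarrow> idn 2 (ph a b) \<and> sr 1 (ph a b) = eC a b \<otimes> u b \<and> tg 1 (ph a b) = u a \<otimes> eD (f a) (f b)"
    and mu0: "a \<in> CC \<Longrightarrow> b \<in> CC \<Longrightarrow> c \<in> CC \<Longrightarrow> ok (mu a b c) \<and> sr 2 (mu a b c) = (mC a b c \<otimes> u c) \<odot> ph a c \<and>
      tg 2 (mu a b c) = (eC a b \<otimes> ph b c) \<odot> (ph a b \<otimes> eD (f b) (f c)) \<odot> (u a \<otimes> mD (f a) (f b) (f c))"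
    and nu0: "a \<in> CC \<Longrightarrow> ok (nu a) \<and> sr 2 (nu a) = (iC a \<otimes> u a) \<odot> ph a a \<and> tg 2 (nu a) = u a \<otimes> iD (f a)"
begin

abbreviation "e' a b \<equiv> eD (f a) (f b)"
abbreviation "m' a b c \<equiv> mD (f a) (f b) (f c)"

lemma u [simp]:
  assumes "a \<in> CC"
  shows "ok (u a)" "sr 0 (u a) = obC a" "tg 0 (u a) = obD (f a)" "0 < k \<Longrightarrow> k < 3 \<Longrightarrow> sr k (u a) = u a"
    "0 < k \<Longrightarrow> k < 3 \<Longrightarrow> tg k (u a) = u a"
  using u0[OF assms] idn_up[of 1 "u a" k] by (auto simp: idn_def)

lemma ph [simp]:
  assumes "a \<in> CC" "b \<in> CC"
  shows "ok (ph a b)" "sr 1 (ph a b) = eC a b \<otimes> u b" "tg 1 (ph a b) = u a \<otimes> e' a b"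
    "sr 2 (ph a b) = ph a b" "tg 2 (ph a b) = ph a b" "sr 0 (ph a b) = obC a" "tg 0 (ph a b) = obD (f b)"
  using ph0[OF assms] idn_up[of 2 "ph a b" 2] C.bd0I[of "ph a b" "eC a b \<otimes> u b" "u a \<otimes> e' a b"] assms by (auto simp: idn_def)

lemma mu [simp]:
  assumes "a \<in> CC" "b \<in> CC" "c \<in> CC"
  shows "ok (mu a b c)" "sr 2 (mu a b c) = (mC a b c \<otimes> u c) \<odot> ph a c"
    "tg 2 (mu a b c) = (eC a b \<otimes> ph b c) \<odot> (ph a b \<otimes> e' b c) \<odot> (u a \<otimes> m' a b c)"
    "sr 1 (mu a b c) = eC a b \<otimes> eC b c \<otimes> u c" "tg 1 (mu a b c) = u a \<otimes> e' a c"
    "sr 0 (mu a b c) = obC a" "tg 0 (mu a b c) = obD (f c)"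
  using mu0[OF assms] C.bd1I[of "mu a b c" "(mC a b c \<otimes> u c) \<odot> ph a c" "(eC a b \<otimes> ph b c) \<odot> (ph a b \<otimes> e' b c) \<odot> (u a \<otimes> m' a b c)"] assms
  by (auto simp: assoc)

lemma nu [simp]:
  assumes "a \<in> CC"
  shows "ok (nu a)" "sr 2 (nu a) = (iC a \<otimes> u a) \<odot> ph a a" "tg 2 (nu a) = u a \<otimes> iD (f a)"
    "sr 1 (nu a) = u a" "tg 1 (nu a) = u a \<otimes> e' a a"
    "sr 0 (nu a) = obC a" "tg 0 (nu a) = obD (f a)"
  using nu0[OF assms] C.bd1I[of "nu a" "(iC a \<otimes> u a) \<odot> ph a a" "u a \<otimes> iD (f a)"] assms unit_l'[of 0 "u a" "obC a"] by auto

text \<open>With \<open>M'\<close>, the cells in \<open>H' s a b\<close> form a bicategory in which \<open>PH\<close> takes its values.\<close>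

definition H' where
  "H' s a b X \<longleftrightarrow> a \<in> CC \<and> b \<in> CC \<and> ok X \<and> tg 1 X = u a \<otimes> e' a b \<and> sr 1 X = s \<otimes> u b \<and>
     idn 1 s \<and> sr 0 s = obC a \<and> tg 0 s = obC b"

text \<open>In the product \<open>Y\<close> stands to the right of the path \<open>s\<close> over
  which \<open>X\<close> lies. No operation extracts \<open>s\<close> from the 1-source
  \<open>s \<otimes> u b\<close>, hence the extra argument.\<close>

definition M' where "M' s a b c X Y = (s \<otimes> Y) \<odot> (X \<otimes> e' b c) \<odot> (u a \<otimes> m' a b c)"
text \<open>\<open>PH\<close> is a pseudofunctor into the bicategory of the cells \<open>H'\<close>,
  and \<open>MU\<close> its comparison cell from \<open>PH\<close> of a product to the product of
  the values. \<open>AL'\<close>, \<open>LA'\<close> and \<open>RH'\<close> are the constraint cells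
  of that bicategory, taken from \<open>D\<close> below \<open>u\<close>.\<close>

definition PH where "PH a b x = (x \<otimes> u b) \<odot> ph a b"
definition MU where "MU a b c x y = (x \<otimes> y \<otimes> u c) \<odot> mu a b c"
definition AL' where "AL' s t a b c d X Y Z =
  (s \<otimes> t \<otimes> Z) \<odot> (s \<otimes> Y \<otimes> e' c d) \<odot> (X \<otimes> e' b c \<otimes> e' c d) \<odot> (u a \<otimes> alD (f a) (f b) (f c) (f d))"
definition LA' where "LA' a b X = X \<odot> (u a \<otimes> laD (f a) (f b))"
definition RH' where "RH' a b X = X \<odot> (u a \<otimes> rhD (f a) (f b))"

lemma H'D:
  assumes "H' s a b X"
  shows "a \<in> CC" "b \<in> CC" "ok X" "tg 1 X = u a \<otimes> e' a b" "sr 1 X = s \<otimes> u b" "sr 0 X = obC a" "tg 0 X = obD (f b)"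
    "ok s" "sr 0 s = obC a" "tg 0 s = obC b" "sr 1 s = s" "sr 2 s = s" "tg 1 s = s" "tg 2 s = s" "idn 1 s"
  using assms C.bd0I[of X "s \<otimes> u b" "u a \<otimes> e' a b"] idn_up[of 1 s 1] idn_up[of 1 s 2] by (auto simp: H'_def idn_def)

lemma H'_bd [simp]: "H' s a b X \<Longrightarrow> H' s a b (sr 2 X)" "H' s a b X \<Longrightarrow> H' s a b (tg 2 X)"
  by (auto simp: H'_def)

lemma H'_comp [simp]: "H' s a b X \<Longrightarrow> ok (X \<bullet> Y) \<Longrightarrow> H' s a b (X \<bullet> Y)"
  and H'_comp_right: "H' s a b X \<Longrightarrow> ok (X \<bullet> Y) \<Longrightarrow> H' s a b Y"
  using bd_low_eq[of 1 2 X Y] by (auto simp: H'_def)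

lemma M'_simps [simp]:
  assumes "H' s a b X" "H' t b c Y"
  shows "H' (s \<otimes> t) a c (M' s a b c X Y)" "ok (M' s a b c X Y)" "sr 2 (M' s a b c X Y) = M' s a b c (sr 2 X) (sr 2 Y)"
    "tg 2 (M' s a b c X Y) = M' s a b c (tg 2 X) (tg 2 Y)"
  using H'D[OF assms(1)] H'D[OF assms(2)] by (auto simp: M'_def H'_def assoc idn_def)

lemma M'_comp:
  assumes "H' s a b X" "ok (X \<bullet> X')" "H' t b c Y" "ok (Y \<bullet> Y')"
  shows "M' s a b c (X \<bullet> X') (Y \<bullet> Y') = M' s a b c X Y \<bullet> M' s a b c X' Y'"
proof -
  have h: "H' s a b X'" "H' t b c Y'" using assms H'_comp_right by blast+
  note hs = H'D[OF assms(1)] H'D(1-7)[OF assms(3)] H'D(3,4,5,6,7)[OF h(1)] H'D(3,4,5,6,7)[OF h(2)]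
  have i: "idn 2 s" "idn 2 (e' b c)" "idn 2 (u a \<otimes> m' a b c)" using hs by (simp_all add: idn_def)
  have 1: "s \<otimes> (Y \<bullet> Y') = (s \<otimes> Y) \<bullet> (s \<otimes> Y')"
    by (rule dist_l) (use assms(4) i hs in simp_all)
  have 2: "(X \<bullet> X') \<otimes> e' b c = (X \<otimes> e' b c) \<bullet> (X' \<otimes> e' b c)"
    by (rule dist_r) (use assms(2) i hs in simp_all)
  have x: "ok ((X \<otimes> e' b c) \<bullet> (X' \<otimes> e' b c))" using 2[symmetric] assms(2) hs by simp
  have y: "ok ((s \<otimes> Y) \<bullet> (s \<otimes> Y'))" using 1[symmetric] assms(4) hs by simp
  have 3: "((X \<otimes> e' b c) \<bullet> (X' \<otimes> e' b c)) \<odot> (u a \<otimes> m' a b c)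
     = ((X \<otimes> e' b c) \<odot> (u a \<otimes> m' a b c)) \<bullet> ((X' \<otimes> e' b c) \<odot> (u a \<otimes> m' a b c))"
    by (rule dist_r) (use x i hs in \<open>simp_all add: assoc\<close>)
  show ?thesis unfolding M'_def 1 2 3
    by (rule exch) (use x y i hs 3[symmetric] in \<open>simp_all add: assoc\<close>)
qed

lemma M'_comp_r:
  assumes "H' s a b X" "sr 2 X = X" "H' t b c Y" "ok (Y \<bullet> Y')" shows "M' s a b c X (Y \<bullet> Y') = M' s a b c X Y \<bullet> M' s a b c X Y'"
proof -
  have "tg 2 X = X" using id_up(2)[of 2 2 X] assms by simp
  then have "X \<bullet> X = X" "ok (X \<bullet> X)" using assms(2) unit_l[of 2 X] H'D(3)[OF assms(1)] by simp_all
  then show ?thesis using M'_comp[OF assms(1) _ assms(3-4), of X] by simp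
qed

lemma PH_simps [simp]:
  assumes "C.H a b x" "s = sr 1 x"
  shows "H' s a b (PH a b x)" "ok (PH a b x)" "sr 2 (PH a b x) = PH a b (sr 2 x)" "tg 2 (PH a b x) = PH a b (tg 2 x)"
  using C.HD[OF assms(1)] assms(2) by (auto simp: PH_def H'_def idn_def)

lemma PH_comp: assumes "C.H a b x" "ok (x \<bullet> y)" shows "PH a b (x \<bullet> y) = PH a b x \<bullet> PH a b y"
proof -
  have h: "C.H a b y" using assms bd_low_eq(2)[of 1 2 x y] by (auto simp: C.H_def)
  note h = C.HD[OF assms(1)] C.HD[OF h]
  have 1: "(x \<bullet> y) \<otimes> u b = (x \<otimes> u b) \<bullet> (y \<otimes> u b)" using assms h by (intro dist_r) (auto simp: idn_def)
  show ?thesis unfolding PH_def 1 using assms h by (intro dist_r) (auto simp: idn_def)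
qed

text \<open>\<open>W\<close> lies to the left of \<open>Y\<close>, so it can act before
  \<open>Y\<close> does, next to \<open>V\<close>. This brings all inputs to the front and leaves
  the crossings behind them.\<close>

lemma inter:
  assumes ok: "ok (V \<odot> Y)" "ok ((W \<otimes> U) \<odot> X)" and E: "idn 1 E" "idn 1 U" "tg 1 Y = U \<otimes> E" "tg 0 W = sr 0 Y"
  shows "(sr 1 W \<otimes> (V \<odot> Y)) \<odot> (((W \<otimes> U) \<odot> X) \<otimes> E) = (W \<otimes> V) \<odot> (tg 1 W \<otimes> Y) \<odot> (X \<otimes> E)"
proof -
  have h: "ok V" "ok Y" "tg 1 V = sr 1 Y" "ok W" "ok X" "sr 1 X = tg 1 W \<otimes> U" "tg 0 W = sr 0 U" "ok U" "ok E"
    "tg 0 V = tg 0 Y" "sr 0 V = sr 0 Y" "sr 1 E = E" "tg 1 U = U" "tg 1 E = E"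
    using ok E idn_up[OF E(1), of 1] idn_up[OF E(2), of 1] bd_low_eq[of 0 1 V Y] by (auto simp: idn_def)
  have "ok (U \<otimes> E)" using h(2) unfolding E(3)[symmetric] by simp
  then have UE: "tg 0 U = sr 0 E" by simp
  have X0: "tg 0 X = sr 0 E" using bd_low_eq[of 0 1 "W \<otimes> U" X] h UE by simp
  have S: "idn 1 (sr 1 W)" using h by (simp add: idn_def)
  have 1: "sr 1 W \<otimes> (V \<odot> Y) = (sr 1 W \<otimes> V) \<odot> (sr 1 W \<otimes> Y)"
    by (rule dist_l) (use S ok h E in simp_all)
  have 2: "((W \<otimes> U) \<odot> X) \<otimes> E = ((W \<otimes> U) \<otimes> E) \<odot> (X \<otimes> E)"
    by (rule dist_r) (use ok E h UE in simp_all)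
  \<comment> \<open>\<open>W\<close> slides past \<open>Y\<close>.\<close>
  have 3: "(sr 1 W \<otimes> Y) \<odot> (W \<otimes> U \<otimes> E) = (W \<otimes> sr 1 Y) \<odot> (tg 1 W \<otimes> Y)"
    using split_l[of 0 1 W Y] split_r[of 0 1 W Y] h E by simp
  have 4: "(sr 1 W \<otimes> V) \<odot> (W \<otimes> sr 1 Y) = W \<otimes> V"
    using split_r[of 0 1 W V] h E by simp
  have "(sr 1 W \<otimes> (V \<odot> Y)) \<odot> (((W \<otimes> U) \<odot> X) \<otimes> E) = (sr 1 W \<otimes> V) \<odot> ((sr 1 W \<otimes> Y) \<odot> (W \<otimes> U \<otimes> E)) \<odot> (X \<otimes> E)"
    unfolding 1 2 by (simp add: assoc)
  also have "\<dots> = ((sr 1 W \<otimes> V) \<odot> (W \<otimes> sr 1 Y)) \<odot> (tg 1 W \<otimes> Y) \<odot> (X \<otimes> E)"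
    unfolding 3 by (simp add: assoc)
  finally show ?thesis unfolding 4 .
qed

lemma M'_PH:
  assumes "C.H a b x" "C.H b c y" "s = sr 1 x"
  shows "(s \<otimes> PH b c y) \<odot> (PH a b x \<otimes> e' b c) = (x \<otimes> y \<otimes> u c) \<odot> (eC a b \<otimes> ph b c) \<odot> (ph a b \<otimes> e' b c)"
  using inter[of "y \<otimes> u c" "ph b c" x "u b" "ph a b" "e' b c"] C.HD[OF assms(1)] C.HD[OF assms(2)]
  by (simp add: assms(3) PH_def idn_def)

lemma PH_M:
  assumes "C.H a b x" "C.H b c y"
  shows "PH a c (C.M a b c x y) = (x \<otimes> y \<otimes> u c) \<odot> (mC a b c \<otimes> u c) \<odot> ph a c"
proof -
  note h = C.HD[OF assms(1)] C.HD[OF assms(2)]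
  have "((x \<otimes> y) \<odot> mC a b c) \<otimes> u c = ((x \<otimes> y) \<otimes> u c) \<odot> (mC a b c \<otimes> u c)" using h by (intro dist_r) (auto simp: idn_def)
  then show ?thesis by (simp add: PH_def C.M_def assoc)
qed

lemma MU_simps [simp]:
  assumes "C.H a b x" "C.H b c y" "s = sr 1 x"
  shows "ok (MU a b c x y)" "H' (s \<otimes> sr 1 y) a c (MU a b c x y)" "sr 2 (MU a b c x y) = PH a c (C.M a b c (sr 2 x) (sr 2 y))"
    "tg 2 (MU a b c x y) = M' s a b c (PH a b (tg 2 x)) (PH b c (tg 2 y))"
proof -
  note h = C.HD[OF assms(1)] C.HD[OF assms(2)]
  show ok: "ok (MU a b c x y)" using h by (auto simp: MU_def assoc)
  show "H' (s \<otimes> sr 1 y) a c (MU a b c x y)" using h assms(3) by (auto simp: MU_def H'_def idn_def assoc)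
  show "sr 2 (MU a b c x y) = PH a c (C.M a b c (sr 2 x) (sr 2 y))"
    unfolding PH_M[OF C.H_bd(1)[OF assms(1)] C.H_bd(1)[OF assms(2)]] using h by (simp add: MU_def)
  have s: "s = sr 1 (tg 2 x)" using assms(3) by simp
  show "tg 2 (MU a b c x y) = M' s a b c (PH a b (tg 2 x)) (PH b c (tg 2 y))"
    using M'_PH[OF C.H_bd(2)[OF assms(1)] C.H_bd(2)[OF assms(2)] s] h by (simp add: MU_def M'_def assoc[symmetric])
qed

text \<open>As for \<open>AL_nat\<close>: the whiskered \<open>mu\<close> cut in its two possible
  orders.\<close>

lemma MU_nat:
  assumes "C.H a b x" "C.H b c y" "s = sr 1 x"
  shows "MU a b c x y = PH a c (C.M a b c x y) \<bullet> MU a b c (tg 2 x) (tg 2 y)"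
    "MU a b c x y = MU a b c (sr 2 x) (sr 2 y) \<bullet> M' s a b c (PH a b x) (PH b c y)"
proof -
  note h = C.HD[OF assms(1)] C.HD[OF assms(2)]
  have ok: "ok ((x \<otimes> y \<otimes> u c) \<odot> mu a b c)" using h by (simp add: assoc)
  show "MU a b c x y = PH a c (C.M a b c x y) \<bullet> MU a b c (tg 2 x) (tg 2 y)"
    using split_l[OF _ _ ok, of 2] h unfolding MU_def PH_M[OF assms(1,2)] by simp
  have "M' s a b c (PH a b x) (PH b c y) = (x \<otimes> y \<otimes> u c) \<odot> tg 2 (mu a b c)"
    using M'_PH[OF assms] h by (simp add: M'_def assoc[of 1, symmetric])
  then show "MU a b c x y = MU a b c (sr 2 x) (sr 2 y) \<bullet> M' s a b c (PH a b x) (PH b c y)"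
    using split_r[OF _ _ ok, of 2] h unfolding MU_def by simp
qed

lemma M'M'_l:
  assumes "H' s a b X" "H' t b c Y" "H' r c d Z"
  shows "M' (s \<otimes> t) a c d (M' s a b c X Y) Z = ((s \<otimes> t \<otimes> Z) \<odot> (s \<otimes> Y \<otimes> e' c d) \<odot> (X \<otimes> e' b c \<otimes> e' c d)) \<odot>
    (u a \<otimes> ((m' a b c \<otimes> e' c d) \<odot> m' a c d))"
proof -
  note h = H'D[OF assms(1)] H'D[OF assms(2)] H'D[OF assms(3)]
  have i: "idn 1 (e' c d)" "idn 1 (u a)" using h by (simp_all add: idn_def)
  have 1: "((s \<otimes> Y) \<odot> (X \<otimes> e' b c) \<odot> (u a \<otimes> m' a b c)) \<otimes> e' c d
    = ((s \<otimes> Y) \<otimes> e' c d) \<odot> (((X \<otimes> e' b c) \<odot> (u a \<otimes> m' a b c)) \<otimes> e' c d)"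
    by (rule dist_r) (use h i in \<open>simp_all add: assoc\<close>)
  have 2: "((X \<otimes> e' b c) \<odot> (u a \<otimes> m' a b c)) \<otimes> e' c d = ((X \<otimes> e' b c) \<otimes> e' c d) \<odot> ((u a \<otimes> m' a b c) \<otimes> e' c d)"
    by (rule dist_r) (use h i in \<open>simp_all add: assoc\<close>)
  have 3: "u a \<otimes> ((m' a b c \<otimes> e' c d) \<odot> m' a c d) = (u a \<otimes> m' a b c \<otimes> e' c d) \<odot> (u a \<otimes> m' a c d)"
    by (rule dist_l) (use h i in \<open>simp_all add: assoc\<close>)
  show ?thesis unfolding M'_def 1 2 3 by (simp add: assoc)
qed

lemma M'M'_r:
  assumes "H' s a b X" "H' t b c Y" "H' r c d Z"
  shows "M' s a b d X (M' t b c d Y Z) = ((s \<otimes> t \<otimes> Z) \<odot> (s \<otimes> Y \<otimes> e' c d) \<odot> (X \<otimes> e' b c \<otimes> e' c d)) \<odot>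
    (u a \<otimes> ((e' a b \<otimes> m' b c d) \<odot> m' a b d))"
proof -
  note h = H'D[OF assms(1)] H'D[OF assms(2)] H'D[OF assms(3)]
  have i: "idn 1 s" "idn 1 (u a)" using h by (simp_all add: idn_def)
  have 1: "s \<otimes> ((t \<otimes> Z) \<odot> (Y \<otimes> e' c d) \<odot> (u b \<otimes> m' b c d))
    = (s \<otimes> t \<otimes> Z) \<odot> (s \<otimes> ((Y \<otimes> e' c d) \<odot> (u b \<otimes> m' b c d)))"
    by (rule dist_l) (use h i in \<open>simp_all add: assoc\<close>)
  have 2: "s \<otimes> ((Y \<otimes> e' c d) \<odot> (u b \<otimes> m' b c d)) = (s \<otimes> Y \<otimes> e' c d) \<odot> (s \<otimes> u b \<otimes> m' b c d)"
    by (rule dist_l) (use h i in \<open>simp_all add: assoc\<close>)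
  have 3: "u a \<otimes> ((e' a b \<otimes> m' b c d) \<odot> m' a b d) = (u a \<otimes> e' a b \<otimes> m' b c d) \<odot> (u a \<otimes> m' a b d)"
    by (rule dist_l) (use h i in \<open>simp_all add: assoc\<close>)
  \<comment> \<open>The product of \<open>Y\<close> and \<open>Z\<close> is formed to the right of
    \<open>X\<close> and slides behind it.\<close>
  have 4: "(s \<otimes> u b \<otimes> m' b c d) \<odot> (X \<otimes> e' b d) = (X \<otimes> e' b c \<otimes> e' c d) \<odot> (u a \<otimes> e' a b \<otimes> m' b c d)"
    using split_l[of 0 1 X "m' b c d"] split_r[of 0 1 X "m' b c d"] h by (simp add: assoc)
  have 5: "(s \<otimes> u b \<otimes> m' b c d) \<odot> (X \<otimes> e' b d) \<odot> z = (X \<otimes> e' b c \<otimes> e' c d) \<odot> (u a \<otimes> e' a b \<otimes> m' b c d) \<odot> z" for z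
    using arg_cong[OF 4, of "\<lambda>x. x \<odot> z"] by (simp add: assoc)
  show ?thesis unfolding M'_def 1 2 3 by (simp add: assoc 5)
qed

lemma AL'_simps [simp]:
  assumes "H' s a b X" "H' t b c Y" "H' r c d Z"
  shows "ok (AL' s t a b c d X Y Z)" "H' (s \<otimes> t \<otimes> r) a d (AL' s t a b c d X Y Z)"
    "sr 2 (AL' s t a b c d X Y Z) = M' (s \<otimes> t) a c d (M' s a b c (sr 2 X) (sr 2 Y)) (sr 2 Z)"
    "tg 2 (AL' s t a b c d X Y Z) = M' s a b d (tg 2 X) (M' t b c d (tg 2 Y) (tg 2 Z))"
proof -
  note h = H'D[OF assms(1)] H'D[OF assms(2)] H'D[OF assms(3)]
  show "ok (AL' s t a b c d X Y Z)" "H' (s \<otimes> t \<otimes> r) a d (AL' s t a b c d X Y Z)"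
    using h by (simp_all add: AL'_def H'_def assoc idn_def)
  show "sr 2 (AL' s t a b c d X Y Z) = M' (s \<otimes> t) a c d (M' s a b c (sr 2 X) (sr 2 Y)) (sr 2 Z)"
    unfolding M'M'_l[OF H'_bd(1)[OF assms(1)] H'_bd(1)[OF assms(2)] H'_bd(1)[OF assms(3)]]
    using h by (simp add: AL'_def assoc)
  show "tg 2 (AL' s t a b c d X Y Z) = M' s a b d (tg 2 X) (M' t b c d (tg 2 Y) (tg 2 Z))"
    unfolding M'M'_r[OF H'_bd(2)[OF assms(1)] H'_bd(2)[OF assms(2)] H'_bd(2)[OF assms(3)]]
    using h by (simp add: AL'_def assoc)
qed

lemma AL'_nat:
  assumes "H' s a b X" "H' t b c Y" "H' r c d Z"
  shows "AL' s t a b c d X Y Z = M' (s \<otimes> t) a c d (M' s a b c X Y) Z \<bullet> AL' s t a b c d (tg 2 X) (tg 2 Y) (tg 2 Z)"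
    "AL' s t a b c d X Y Z = AL' s t a b c d (sr 2 X) (sr 2 Y) (sr 2 Z) \<bullet> M' s a b d X (M' t b c d Y Z)"
proof -
  note h = H'D[OF assms(1)] H'D[OF assms(2)] H'D[OF assms(3)]
  let ?W = "(s \<otimes> t \<otimes> Z) \<odot> (s \<otimes> Y \<otimes> e' c d) \<odot> (X \<otimes> e' b c \<otimes> e' c d)"
  let ?a = "u a \<otimes> alD (f a) (f b) (f c) (f d)"
  have ok: "ok (?W \<odot> ?a)" using h by (simp add: assoc)
  have al: "AL' s t a b c d X Y Z = ?W \<odot> ?a" by (simp add: AL'_def assoc)
  have a: "sr 2 ?a = u a \<otimes> ((m' a b c \<otimes> e' c d) \<odot> m' a c d)" "tg 2 ?a = u a \<otimes> ((e' a b \<otimes> m' b c d) \<odot> m' a b d)"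
    using h by simp_all
  have "?W \<odot> ?a = (?W \<odot> sr 2 ?a) \<bullet> (tg 2 ?W \<odot> ?a)" by (rule split_l[OF _ _ ok]) simp_all
  then show "AL' s t a b c d X Y Z = M' (s \<otimes> t) a c d (M' s a b c X Y) Z \<bullet> AL' s t a b c d (tg 2 X) (tg 2 Y) (tg 2 Z)"
    unfolding al M'M'_l[OF assms] a using h by (simp add: AL'_def assoc)
  have "?W \<odot> ?a = (sr 2 ?W \<odot> ?a) \<bullet> (?W \<odot> tg 2 ?a)" by (rule split_r[OF _ _ ok]) simp_all
  then show "AL' s t a b c d X Y Z = AL' s t a b c d (sr 2 X) (sr 2 Y) (sr 2 Z) \<bullet> M' s a b d X (M' t b c d Y Z)"
    unfolding al M'M'_r[OF assms] a using h by (simp add: AL'_def assoc)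
qed

lemma M'i_l:
  assumes "H' s a b X" shows "M' (obC a) a a b (u a \<otimes> iD (f a)) X = X \<odot> (u a \<otimes> ((iD (f a) \<otimes> e' a b) \<odot> m' a a b))"
proof -
  note h = H'D[OF assms]
  have "u a \<otimes> ((iD (f a) \<otimes> e' a b) \<odot> m' a a b) = (u a \<otimes> iD (f a) \<otimes> e' a b) \<odot> (u a \<otimes> m' a a b)"
    by (rule dist_l) (use h in \<open>simp_all add: idn_def\<close>)
  moreover have "obC a \<otimes> X = X" using h by (simp add: unit_l')
  ultimately show ?thesis by (simp add: M'_def assoc)
qed

lemma M'i_r:
  assumes "H' s a b X" shows "M' s a b b X (u b \<otimes> iD (f b)) = X \<odot> (u a \<otimes> ((e' a b \<otimes> iD (f b)) \<odot> m' a b b))"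
proof -
  note h = H'D[OF assms]
  have "u a \<otimes> ((e' a b \<otimes> iD (f b)) \<odot> m' a b b) = (u a \<otimes> e' a b \<otimes> iD (f b)) \<odot> (u a \<otimes> m' a b b)"
    by (rule dist_l) (use h in \<open>simp_all add: idn_def\<close>)
  \<comment> \<open>The unit to the right of \<open>X\<close> is created after \<open>X\<close>
    instead of before it.\<close>
  moreover have "(s \<otimes> u b \<otimes> iD (f b)) \<odot> (X \<otimes> e' b b) = (X \<otimes> obD (f b)) \<odot> (u a \<otimes> e' a b \<otimes> iD (f b))"
    using split_l[of 0 1 X "iD (f b)"] split_r[of 0 1 X "iD (f b)"] h by (simp add: assoc)
  moreover have "X \<otimes> obD (f b) = X" using h by (simp add: unit_r')
  ultimately show ?thesis by (simp add: M'_def assoc[of 1, symmetric])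
qed

lemma LA'_nat:
  assumes "H' s a b X"
  shows "LA' a b X = M' (obC a) a a b (u a \<otimes> iD (f a)) X \<bullet> LA' a b (tg 2 X)" "LA' a b X = LA' a b (sr 2 X) \<bullet> X"
proof -
  note h = H'D[OF assms]
  have ok: "ok (X \<odot> (u a \<otimes> laD (f a) (f b)))" using h by simp
  show "LA' a b X = M' (obC a) a a b (u a \<otimes> iD (f a)) X \<bullet> LA' a b (tg 2 X)"
    using split_l[OF _ _ ok, of 2] h unfolding LA'_def M'i_l[OF assms] by simp
  show "LA' a b X = LA' a b (sr 2 X) \<bullet> X"
    using split_r[OF _ _ ok, of 2] h unit_r'[of 1 X "u a \<otimes> e' a b"] unfolding LA'_def by simp
qed

lemma RH'_nat:
  assumes "H' s a b X"
  shows "RH' a b X = M' s a b b X (u b \<otimes> iD (f b)) \<bullet> RH' a b (tg 2 X)" "RH' a b X = RH' a b (sr 2 X) \<bullet> X"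
proof -
  note h = H'D[OF assms]
  have ok: "ok (X \<odot> (u a \<otimes> rhD (f a) (f b)))" using h by simp
  show "RH' a b X = M' s a b b X (u b \<otimes> iD (f b)) \<bullet> RH' a b (tg 2 X)"
    using split_l[OF _ _ ok, of 2] h unfolding RH'_def M'i_r[OF assms] by simp
  show "RH' a b X = RH' a b (sr 2 X) \<bullet> X"
    using split_r[OF _ _ ok, of 2] h unit_r'[of 1 X "u a \<otimes> e' a b"] unfolding RH'_def by simp
qed

text \<open>\<open>KK a p\<close> moves \<open>u\<close> leftwards across the path \<open>p\<close> by crossings \<open>\<phi>\<close> only.\<close>

fun KK where
  "KK a [] = u a"
| "KK a (b # p) = (eC a b \<otimes> KK b p) \<odot> (ph a b \<otimes> D.pth (f b) (map f p))"

lemma map_in: "set p \<subseteq> CC \<Longrightarrow> set (map f p) \<subseteq> DD" by auto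

lemma last_map_f: "last (f a # map f p) = f (last (a # p))" by (cases p) (simp_all add: last_map)

lemma pthD [simp]:
  assumes "a \<in> CC" "set p \<subseteq> CC"
  shows "ok (D.pth (f a) (map f p))" "sr 0 (D.pth (f a) (map f p)) = obD (f a)" "tg 0 (D.pth (f a) (map f p)) = obD (f (last (a # p)))"
    "0 < k \<Longrightarrow> k < 3 \<Longrightarrow> sr k (D.pth (f a) (map f p)) = D.pth (f a) (map f p)"
    "0 < k \<Longrightarrow> k < 3 \<Longrightarrow> tg k (D.pth (f a) (map f p)) = D.pth (f a) (map f p)"
  using D.pth[where a = "f a" and p = "map f p"] assms map_in[of p] unfolding last_map_f by simp_all

lemma KK_typ:
  assumes "a \<in> CC" "set p \<subseteq> CC"
  shows "ok (KK a p) \<and> sr 1 (KK a p) = C.pth a p \<otimes> u (last (a # p)) \<and> tg 1 (KK a p) = u a \<otimes> D.pth (f a) (map f p) \<and>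
    sr 2 (KK a p) = KK a p \<and> tg 2 (KK a p) = KK a p \<and> sr 0 (KK a p) = obC a \<and> tg 0 (KK a p) = obD (f (last (a # p)))"
  using assms
proof (induction p arbitrary: a)
  case Nil then show ?case by (simp add: unit_l' unit_r')
next
  case (Cons b p) 
  then show ?case using Cons.IH[of b] pthD[of b p] by (simp del: pthD add: assoc)
qed

lemma KK [simp]:
  assumes "a \<in> CC" "set p \<subseteq> CC"
  shows "ok (KK a p)" "sr 1 (KK a p) = C.pth a p \<otimes> u (last (a # p))" "tg 1 (KK a p) = u a \<otimes> D.pth (f a) (map f p)"
    "sr 2 (KK a p) = KK a p" "tg 2 (KK a p) = KK a p" "sr 0 (KK a p) = obC a" "tg 0 (KK a p) = obD (f (last (a # p)))"
  using KK_typ[OF assms] by simp_all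

text \<open>The cell \<open>u\<close> starts at the right end of the path, so it crosses
  \<open>q\<close> before \<open>p\<close>.\<close>

lemma KK_append:
  assumes "a \<in> CC" "set p \<subseteq> CC" "set q \<subseteq> CC" "b = last (a # p)"
  shows "KK a (p @ q) = (C.pth a p \<otimes> KK b q) \<odot> (KK a p \<otimes> D.pth (f b) (map f q))"
  using assms
proof (induction p arbitrary: a)
  case Nil
  then show ?case by (simp add: unit_l' unit_r')
next
  case (Cons x p)
  have o: "a \<in> CC" "x \<in> CC" "set p \<subseteq> CC" "set q \<subseteq> CC" "b \<in> CC" and b: "b = last (x # p)"
    using Cons.prems C.last_in[of p] by auto
  let ?P = "D.pth (f b) (map f q)"
  note K1 = KK[OF o(2,3), folded b] and K2 = KK[OF o(5,4)] and P1 = C.pth[OF o(2,3), folded b] and Q1 = pthD[OF o(5,4)]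
    and P2 = pthD[OF o(2,3), folded b]
  have i: "idn 1 (eC a x)" "idn 1 ?P" using o Q1 by (simp_all add: idn_def)
  have "KK a (x # p @ q) = (eC a x \<otimes> ((C.pth x p \<otimes> KK b q) \<odot> (KK x p \<otimes> ?P))) \<odot> (ph a x \<otimes> D.pth (f x) (map f p) \<otimes> ?P)"
    using Cons.IH[of x] o b map_in[of p] map_in[of q] by (simp add: D.pth_append[of "f x" "map f p" "map f q", unfolded last_map_f] del: last.simps)
  also have "eC a x \<otimes> ((C.pth x p \<otimes> KK b q) \<odot> (KK x p \<otimes> ?P)) = (eC a x \<otimes> C.pth x p \<otimes> KK b q) \<odot> (eC a x \<otimes> KK x p \<otimes> ?P)"
    by (rule dist_l) (use i o K1 K2 P1 P2 Q1 in \<open>simp_all del: KK C.pth pthD add: assoc\<close>)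
  finally have 1: "KK a (x # p @ q) = (eC a x \<otimes> C.pth x p \<otimes> KK b q) \<odot> (eC a x \<otimes> KK x p \<otimes> ?P) \<odot> (ph a x \<otimes> D.pth (f x) (map f p) \<otimes> ?P)"
    by (simp add: assoc)
  have "((eC a x \<otimes> KK x p) \<odot> (ph a x \<otimes> D.pth (f x) (map f p))) \<otimes> ?P = ((eC a x \<otimes> KK x p) \<otimes> ?P) \<odot> ((ph a x \<otimes> D.pth (f x) (map f p)) \<otimes> ?P)"
    by (rule dist_r) (use i o K1 K2 P1 P2 Q1 in \<open>simp_all del: KK C.pth pthD add: assoc\<close>)
  with 1 show ?case by (simp add: assoc)
qed

text \<open>The mirror image of \<open>inter\<close>: \<open>G'\<close> lies to the right of
  \<open>K\<close> and slides behind it. All crossings are then in front and all cells of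
  \<open>D\<close> behind.\<close>

lemma inter_L:
  assumes o: "a \<in> CC" "b \<in> CC" and s: "idn 1 s" "tg 0 s = obC b"
    and K: "ok K" "sr 1 K = s \<otimes> u b" "tg 1 K = u a \<otimes> sr 1 G"
    and G: "ok G" "sr 0 G = obD (f a)" "tg 0 G = obD (f b)"
    and K': "ok K'" "tg 1 K' = u b \<otimes> sr 1 G'" "sr 0 K' = obC b" and G': "ok G'" "sr 0 G' = obD (f b)"
  shows "(s \<otimes> (K' \<odot> (u b \<otimes> G'))) \<odot> ((K \<odot> (u a \<otimes> G)) \<otimes> tg 1 G')
    = ((s \<otimes> K') \<odot> (K \<otimes> sr 1 G')) \<odot> (u a \<otimes> G \<otimes> G')"
proof -
  have s': "ok s" "sr 1 s = s" "tg 1 s = s" using s idn_up[of 1 s 1] by (auto simp: idn_def)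
  have i: "idn 1 (tg 1 G')" "idn 1 (u a)" using o G' by (simp_all add: idn_def)
  have tK: "tg 0 K = obD (f b)" using C.bd0I(2)[OF K(2)] o s s' K(1) C.bd0I(4)[OF K(2,3)] G by simp
  have 1: "s \<otimes> (K' \<odot> (u b \<otimes> G')) = (s \<otimes> K') \<odot> (s \<otimes> u b \<otimes> G')"
    by (rule dist_l) (use o s s' K' G' in simp_all)
  have 2: "(K \<odot> (u a \<otimes> G)) \<otimes> tg 1 G' = (K \<otimes> tg 1 G') \<odot> ((u a \<otimes> G) \<otimes> tg 1 G')"
    by (rule dist_r) (use o i K G G' tK in simp_all)
  have 3: "(s \<otimes> u b \<otimes> G') \<odot> (K \<otimes> tg 1 G') = (K \<otimes> sr 1 G') \<odot> (u a \<otimes> sr 1 G \<otimes> G')"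
    using split_l[of 0 1 K G'] split_r[of 0 1 K G'] o s s' K G G' tK by (simp add: assoc)
  have "u a \<otimes> ((sr 1 G \<otimes> G') \<odot> (G \<otimes> tg 1 G')) = (u a \<otimes> sr 1 G \<otimes> G') \<odot> (u a \<otimes> G \<otimes> tg 1 G')"
    by (rule dist_l) (use o i G G' in simp_all)
  then have 4: "(u a \<otimes> sr 1 G \<otimes> G') \<odot> (u a \<otimes> G \<otimes> tg 1 G') = u a \<otimes> G \<otimes> G'"
    using split_r[of 0 1 G G'] G G' by simp
  have "(s \<otimes> (K' \<odot> (u b \<otimes> G'))) \<odot> ((K \<odot> (u a \<otimes> G)) \<otimes> tg 1 G')
    = (s \<otimes> K') \<odot> ((s \<otimes> u b \<otimes> G') \<odot> (K \<otimes> tg 1 G')) \<odot> (u a \<otimes> G \<otimes> tg 1 G')"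
    unfolding 1 2 by (simp add: assoc)
  also have "\<dots> = ((s \<otimes> K') \<odot> (K \<otimes> sr 1 G')) \<odot> ((u a \<otimes> sr 1 G \<otimes> G') \<odot> (u a \<otimes> G \<otimes> tg 1 G'))"
    unfolding 3 by (simp add: assoc)
  finally show ?thesis unfolding 4 .
qed

text \<open>Behind the crossings the product \<open>M'\<close> is the product of \<open>D\<close>,
  which makes results about combs in \<open>D\<close> applicable below \<open>u\<close>.
  \<open>AL'_L\<close> does the same for the associator.\<close>

lemma M'_L:
  assumes o: "a \<in> CC" "b \<in> CC" "c \<in> CC" and s: "idn 1 s" "tg 0 s = obC b"
    and K: "ok K" "sr 1 K = s \<otimes> u b" "tg 1 K = u a \<otimes> sr 1 G" and G: "D.H (f a) (f b) G"
    and K': "ok K'" "tg 1 K' = u b \<otimes> sr 1 G'" "sr 0 K' = obC b" and G': "D.H (f b) (f c) G'"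
  shows "M' s a b c (K \<odot> (u a \<otimes> G)) (K' \<odot> (u b \<otimes> G')) = ((s \<otimes> K') \<odot> (K \<otimes> sr 1 G')) \<odot> (u a \<otimes> D.M (f a) (f b) (f c) G G')"
proof -
  note g = D.HD[OF G] D.HD[OF G']
  have 1: "u a \<otimes> D.M (f a) (f b) (f c) G G' = (u a \<otimes> G \<otimes> G') \<odot> (u a \<otimes> m' a b c)"
    unfolding D.M_def by (rule dist_l) (use o g in \<open>simp_all add: idn_def\<close>)
  have 2: "(s \<otimes> (K' \<odot> (u b \<otimes> G'))) \<odot> ((K \<odot> (u a \<otimes> G)) \<otimes> e' b c)
    = ((s \<otimes> K') \<odot> (K \<otimes> sr 1 G')) \<odot> (u a \<otimes> G \<otimes> G')"
    using inter_L[OF o(1,2) s K _ _ _ K'] g by simp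
  show ?thesis unfolding 1 M'_def by (subst assoc[symmetric], simp, subst 2) (simp add: assoc)
qed

lemma AL'_L:
  assumes o: "a \<in> CC" "b \<in> CC" "c \<in> CC" "d \<in> CC" and s: "idn 1 s" "tg 0 s = obC b" and t: "idn 1 t" "tg 0 t = obC c" "sr 0 t = obC b"
    and K: "ok K" "sr 1 K = s \<otimes> u b" "tg 1 K = u a \<otimes> sr 1 G" and G: "D.H (f a) (f b) G"
    and K': "ok K'" "tg 1 K' = u b \<otimes> sr 1 G'" "sr 1 K' = t \<otimes> u c" and G': "D.H (f b) (f c) G'"
    and K'': "ok K''" "tg 1 K'' = u c \<otimes> sr 1 G''" "sr 0 K'' = obC c" and G'': "D.H (f c) (f d) G''"
  shows "AL' s t a b c d (K \<odot> (u a \<otimes> G)) (K' \<odot> (u b \<otimes> G')) (K'' \<odot> (u c \<otimes> G''))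
    = ((s \<otimes> ((t \<otimes> K'') \<odot> (K' \<otimes> sr 1 G''))) \<odot> (K \<otimes> sr 1 G' \<otimes> sr 1 G'')) \<odot> (u a \<otimes> D.AL (f a) (f b) (f c) (f d) G G' G'')"
proof -
  note g = D.HD[OF G] D.HD[OF G'] D.HD[OF G'']
  have tt: "ok t" "sr 1 t = t" "tg 1 t = t" "ok s" "sr 1 s = s" "tg 1 s = s"
    using s t idn_up[of 1 t 1] idn_up[of 1 s 1] by (auto simp: idn_def)
  let ?Q = "(t \<otimes> K'') \<odot> (K' \<otimes> sr 1 G'')"
  have k: "sr 0 K' = obC b" "tg 0 K' = obD (f c)" using C.bd0I[OF K'(3,2)] o t tt g by simp_all
  have k'': "tg 0 K'' = tg 0 G''" using C.bd0I(4)[OF refl K''(2)] o g by simp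
  have Y: "(t \<otimes> (K'' \<odot> (u c \<otimes> G''))) \<odot> ((K' \<odot> (u b \<otimes> G')) \<otimes> e' c d) = ?Q \<odot> (u b \<otimes> G' \<otimes> G'')"
    using inter_L[OF o(2,3) t(1,2) K'(1,3,2) _ _ _ K''] g by simp
  have Y': "s \<otimes> ((t \<otimes> (K'' \<odot> (u c \<otimes> G''))) \<odot> ((K' \<odot> (u b \<otimes> G')) \<otimes> e' c d))
     = (s \<otimes> t \<otimes> (K'' \<odot> (u c \<otimes> G''))) \<odot> (s \<otimes> (K' \<odot> (u b \<otimes> G')) \<otimes> e' c d)"
    by (rule dist_l) (use o s t tt K' K'' g k k'' in \<open>simp_all add: assoc\<close>)
  have Q: "ok ?Q" "tg 1 ?Q = u b \<otimes> sr 1 (G' \<otimes> G'')" "sr 0 ?Q = obC b"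
    using o s t tt K' K'' g k k'' by (simp_all add: assoc)
  have "(s \<otimes> (?Q \<odot> (u b \<otimes> G' \<otimes> G''))) \<odot> ((K \<odot> (u a \<otimes> G)) \<otimes> tg 1 (G' \<otimes> G''))
     = ((s \<otimes> ?Q) \<odot> (K \<otimes> sr 1 (G' \<otimes> G''))) \<odot> (u a \<otimes> G \<otimes> G' \<otimes> G'')"
    by (rule inter_L[OF o(1,2) s K _ _ _ Q]) (use o g in simp_all)
  then have Z: "(s \<otimes> t \<otimes> (K'' \<odot> (u c \<otimes> G''))) \<odot> (s \<otimes> (K' \<odot> (u b \<otimes> G')) \<otimes> e' c d) \<odot> ((K \<odot> (u a \<otimes> G)) \<otimes> e' b c \<otimes> e' c d)
     = ((s \<otimes> ?Q) \<odot> (K \<otimes> sr 1 G' \<otimes> sr 1 G'')) \<odot> (u a \<otimes> G \<otimes> G' \<otimes> G'')"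
    unfolding Y[symmetric] Y' using g by (simp add: assoc)
  have 1: "u a \<otimes> D.AL (f a) (f b) (f c) (f d) G G' G'' = (u a \<otimes> G \<otimes> G' \<otimes> G'') \<odot> (u a \<otimes> alD (f a) (f b) (f c) (f d))"
    unfolding D.AL_def by (rule dist_l) (use o g in \<open>simp_all add: idn_def\<close>)
  show ?thesis unfolding 1 AL'_def using arg_cong[OF Z, of "\<lambda>x. x \<odot> (u a \<otimes> alD (f a) (f b) (f c) (f d))"]
    by (simp add: assoc)
qed

lemma cmbD [simp]:
  assumes "a \<in> CC" "set p \<subseteq> CC" and b: "b = f (last (a # p))"
  shows "D.H (f a) b (D.cmb (f a) (map f p))" "sr 2 (D.cmb (f a) (map f p)) = D.cmb (f a) (map f p)"
    "sr 1 (D.cmb (f a) (map f p)) = D.pth (f a) (map f p)" "tg 2 (D.cmb (f a) (map f p)) = D.cmb (f a) (map f p)"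
    "ok (D.cmb (f a) (map f p))" "tg 1 (D.cmb (f a) (map f p)) = eD (f a) b" "sr 0 (D.cmb (f a) (map f p)) = obD (f a)"
    "tg 0 (D.cmb (f a) (map f p)) = obD b"
  using D.cmb[of "f a" "map f p"] assms map_in[of p] unfolding last_map_f by simp_all

text \<open>What \<open>PH\<close> of a comb is normalised to: crossings, then the comb of the image
  path. This is also the target of the square \<open>E\<close> for \<phi>.\<close>

definition LL where "LL a p = KK a p \<odot> (u a \<otimes> D.cmb (f a) (map f p))"

lemma LL:
  assumes "a \<in> CC" "set p \<subseteq> CC" "b = last (a # p)"
  shows "H' (C.pth a p) a b (LL a p)" "sr 2 (LL a p) = LL a p"
proof -
  have o: "b \<in> CC" using assms C.last_in[of p] by auto
  note K = KK[OF assms(1,2), folded assms(3)] and G = cmbD[OF assms(1,2) refl, folded assms(3)] and P = C.pth[OF assms(1,2), folded assms(3)]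
  show "H' (C.pth a p) a b (LL a p)" "sr 2 (LL a p) = LL a p"
    using K G P assms o by (simp_all del: cmbD KK C.pth add: LL_def H'_def idn_def unit_r' del: last.simps)
qed

lemma LL_Nil: "a \<in> CC \<Longrightarrow> LL a [] = u a \<otimes> iD (f a)"
  and LL_one: "a \<in> CC \<Longrightarrow> b \<in> CC \<Longrightarrow> LL a [b] = ph a b"
  by (simp_all add: LL_def unit_l' unit_r')

lemma M'_LL_gen:
  assumes o: "a \<in> CC" "set p \<subseteq> CC" "set q \<subseteq> CC" "b = last (a # p)" "c = last (b # q)"
    and G: "D.H (f b) (f c) G" "sr 1 G = D.pth (f b) (map f q)"
    and F: "D.H (f a) (f b) F" "sr 1 F = D.pth (f a) (map f p)"
  shows "M' (C.pth a p) a b c (KK a p \<odot> (u a \<otimes> F)) (KK b q \<odot> (u b \<otimes> G)) = KK a (p @ q) \<odot> (u a \<otimes> D.M (f a) (f b) (f c) F G)"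
proof -
  have o': "b \<in> CC" "c \<in> CC" using o C.last_in[of p] C.last_in[of q] by auto
  note K = KK[OF o(1,2), folded o(4)] and K' = KK[OF o'(1) o(3)] and P = C.pth[OF o(1,2), folded o(4)]
  show ?thesis unfolding KK_append[OF o(1-4)] G(2)[symmetric]
    by (rule M'_L) (use o(1) o' K K' P G F in \<open>simp_all del: KK C.pth add: idn_def\<close>)
qed

lemma M'_LL:
  assumes o: "a \<in> CC" "set p \<subseteq> CC" "set q \<subseteq> CC" "b = last (a # p)" "c = last (b # q)"
  shows "M' (C.pth a p) a b c (LL a p) (LL b q) = KK a (p @ q) \<odot> (u a \<otimes> D.M (f a) (f b) (f c) (D.cmb (f a) (map f p)) (D.cmb (f b) (map f q)))"
proof -
  have o': "b \<in> CC" "c \<in> CC" using o C.last_in[of p] C.last_in[of q] by auto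
  show ?thesis unfolding LL_def
    by (rule M'_LL_gen[OF o]) (use o o' in simp_all)
qed

lemma AL'_LL:
  assumes o: "a \<in> CC" "set p \<subseteq> CC" "set q \<subseteq> CC" "set r \<subseteq> CC" "b = last (a # p)" "c = last (b # q)" "d = last (c # r)"
  shows "AL' (C.pth a p) (C.pth b q) a b c d (LL a p) (LL b q) (LL c r) =
    KK a (p @ q @ r) \<odot> (u a \<otimes> D.AL (f a) (f b) (f c) (f d) (D.cmb (f a) (map f p)) (D.cmb (f b) (map f q)) (D.cmb (f c) (map f r)))"
proof -
  have o': "b \<in> CC" "c \<in> CC" "d \<in> CC" using o C.last_in[of p] C.last_in[of q] C.last_in[of r] by auto
  note K = KK[OF o(1,2), folded o(5)] and K' = KK[OF o'(1) o(3), folded o(6)] and K'' = KK[OF o'(2) o(4), folded o(7)] 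
    and P = C.pth[OF o(1,2), folded o(5)] C.pth[OF o'(1) o(3), folded o(6)]
    and G = cmbD[OF o(1,2) refl, folded o(5)] and G' = cmbD[OF o'(1) o(3) refl, folded o(6)] and G'' = cmbD[OF o'(2) o(4) refl, folded o(7)]
  have qr: "set (q @ r) \<subseteq> CC" using o by simp
  have "D.pth (f b) (map f (q @ r)) = D.pth (f b) (map f q) \<otimes> D.pth (f c) (map f r)"
    using D.pth_append[of "f b" "map f q" "map f r"] o o' map_in[of q] map_in[of r] unfolding last_map_f by simp
  then have KA: "KK a (p @ q @ r) = (C.pth a p \<otimes> ((C.pth b q \<otimes> KK c r) \<odot> (KK b q \<otimes> D.pth (f c) (map f r)))) \<odot> (KK a p \<otimes> D.pth (f b) (map f q) \<otimes> D.pth (f c) (map f r))"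
    using KK_append[OF o(1,2) qr o(5)] KK_append[OF o'(1) o(3,4,6)] by simp
  show ?thesis unfolding KA LL_def G'(3)[symmetric] G''(3)[symmetric]
    by (rule AL'_L) (use o(1) o' K K' K'' P G G' G'' in \<open>simp_all del: KK C.pth cmbD add: idn_def\<close>)
qed

text \<open>The square \<open>E\<close> for \<phi>, a 3-cell from \<open>PH\<close> of a comb to
  \<open>LL\<close>: one \<open>mu\<close> for each multiplication, \<open>nu\<close> for the empty
  path, and an identity for a single edge, whose comb is no product.\<close>

fun PHI where
  "PHI a [] = nu a"
| "PHI a (b # p) = (if p = [] then ph a b else
     MU a b (last p) (eC a b) (C.cmb b p) \<bullet> M' (eC a b) a b (last p) (ph a b) (PHI b p))"

lemma PH_e: "a \<in> CC \<Longrightarrow> b \<in> CC \<Longrightarrow> PH a b (eC a b) = ph a b" by (simp add: PH_def unit_l')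

lemma H'_ph [simp]: "a \<in> CC \<Longrightarrow> b \<in> CC \<Longrightarrow> H' (eC a b) a b (ph a b)"
  by (simp add: H'_def idn_def)

lemma PHI_typ:
  assumes "a \<in> CC" "set p \<subseteq> CC" "b = last (a # p)"
  shows "H' (C.pth a p) a b (PHI a p) \<and> sr 2 (PHI a p) = PH a b (C.cmb a p) \<and> tg 2 (PHI a p) = LL a p"
  using assms
proof (induction p arbitrary: a)
  case Nil
  then show ?case by (simp add: H'_def LL_Nil PH_def idn_def unit_l')
next
  case (Cons x p)
  show ?case
  proof (cases "p = []")
    case True
    then show ?thesis using Cons.prems by (simp add: LL_one PH_e unit_r')
  next
    case False
    have o: "x \<in> CC" "b \<in> CC" "last p = b" "b = last (x # p)" and p: "set p \<subseteq> CC" using Cons.prems False C.last_in[of p] by auto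
    note IH = Cons.IH[OF o(1) p o(4)]
    have c: "C.H x b (C.cmb x p)" using C.cmb(1)[OF o(1) p] unfolding o(4)[symmetric] .
    have "M' (C.pth a [x]) a x b (LL a [x]) (LL x p) = LL a (x # p)"
      using M'_LL[of a "[x]" p x b] Cons.prems(1) False o(1,2,3) p by (simp add: LL_def last_map)
    then have M: "M' (eC a x) a x b (ph a x) (LL x p) = LL a (x # p)" using Cons.prems o by (simp add: LL_one unit_r')
    have He: "C.H a x (eC a x)" using Cons.prems(1) o by simp
    have U: "ok (MU a x b (eC a x) (C.cmb x p))" "H' (eC a x \<otimes> C.pth x p) a b (MU a x b (eC a x) (C.cmb x p))"
      "sr 2 (MU a x b (eC a x) (C.cmb x p)) = PH a b (C.M a x b (eC a x) (C.cmb x p))"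
      "tg 2 (MU a x b (eC a x) (C.cmb x p)) = M' (eC a x) a x b (ph a x) (PH x b (C.cmb x p))"
      using MU_simps[OF He c, of "eC a x"] C.cmb(2,3,4)[OF o(1) p] Cons.prems(1) o(1) by (simp_all add: PH_e)
    have V: "ok (M' (eC a x) a x b (ph a x) (PHI x p))"
      "sr 2 (M' (eC a x) a x b (ph a x) (PHI x p)) = M' (eC a x) a x b (ph a x) (PH x b (C.cmb x p))"
      "tg 2 (M' (eC a x) a x b (ph a x) (PHI x p)) = LL a (x # p)"
      using M'_simps[OF H'_ph[OF Cons.prems(1) o(1)] IH[THEN conjunct1]] IH M Cons.prems(1) o(1) by simp_all
    show ?thesis using False o(3) H'_comp[OF U(2)] U V by simp
  qed
qed

lemma PHI:
  assumes "a \<in> CC" "set p \<subseteq> CC" "b = last (a # p)"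
  shows "H' (C.pth a p) a b (PHI a p)" "sr 2 (PHI a p) = PH a b (C.cmb a p)" "tg 2 (PHI a p) = LL a p" "ok (PHI a p)"
  using PHI_typ[OF assms] by (auto simp: H'_def)

end

section \<open>Coherence for pseudofunctors\<close>

locale pf_coh = pf_alg ok cp sr tg bt CC obC eC iC mC alC laC rhC DD obD eD iD mD alD laD rhD f u ph mu nu +
  C: bicat_coh ok cp sr tg bt CC obC eC iC mC alC laC rhC +
  D: bicat_coh ok cp sr tg bt DD obD eD iD mD alD laD rhD
  for ok :: "'q \<Rightarrow> bool" and cp :: "nat \<Rightarrow> 'q \<Rightarrow> 'q \<Rightarrow> 'q" and sr tg :: "nat \<Rightarrow> 'q \<Rightarrow> 'q" and bt :: 'q
    and CC :: "'c set" and obC eC iC mC alC laC rhC and DD :: "'d set" and obD eD iD mD alD laD rhD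
    and f :: "'c \<Rightarrow> 'd" and u ph mu nu +
  assumes almu: "a \<in> CC \<Longrightarrow> b \<in> CC \<Longrightarrow> c \<in> CC \<Longrightarrow> d \<in> CC \<Longrightarrow>
      ((alC a b c d \<otimes> u d) \<odot> ph a d) \<bullet> ((eC a b \<otimes> mC b c d \<otimes> u d) \<odot> mu a b d) \<bullet>
      ((eC a b \<otimes> mu b c d) \<odot> (ph a b \<otimes> eD (f b) (f d)) \<odot> (u a \<otimes> mD (f a) (f b) (f d)))
      = ((mC a b c \<otimes> eC c d \<otimes> u d) \<odot> mu a c d) \<bullet>
        ((eC a b \<otimes> eC b c \<otimes> ph c d) \<odot> (mu a b c \<otimes> eD (f c) (f d)) \<odot> (u a \<otimes> mD (f a) (f c) (f d))) \<bullet>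
        ((eC a b \<otimes> eC b c \<otimes> ph c d) \<odot> (eC a b \<otimes> ph b c \<otimes> eD (f c) (f d)) \<odot>
          (ph a b \<otimes> eD (f b) (f c) \<otimes> eD (f c) (f d)) \<odot> (u a \<otimes> alD (f a) (f b) (f c) (f d)))"
    and lamu: "a \<in> CC \<Longrightarrow> b \<in> CC \<Longrightarrow>
      ((iC a \<otimes> eC a b \<otimes> u b) \<odot> mu a a b) \<bullet> (ph a b \<odot> (nu a \<otimes> eD (f a) (f b)) \<odot> (u a \<otimes> mD (f a) (f a) (f b))) \<bullet>
      (ph a b \<odot> (u a \<otimes> laD (f a) (f b))) = (laC a b \<otimes> u b) \<odot> ph a b"
    and rhmu: "a \<in> CC \<Longrightarrow> b \<in> CC \<Longrightarrow>
      ((eC a b \<otimes> iC b \<otimes> u b) \<odot> mu a b b) \<bullet>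
      ((eC a b \<otimes> nu b) \<odot> (ph a b \<otimes> eD (f b) (f b)) \<odot> (u a \<otimes> mD (f a) (f b) (f b))) \<bullet>
      (ph a b \<odot> (u a \<otimes> rhD (f a) (f b))) = (rhC a b \<otimes> u b) \<odot> ph a b"
begin

text \<open>The analogue of \<open>pent_aux\<close>: the six sides of \<open>almu\<close>, each
  preceded by the inputs \<open>x\<close>, \<open>y\<close>, \<open>z\<close> beside
  \<open>u d\<close>.\<close>

lemma almu_aux:
  assumes H: "C.H a b x" "C.H b c y" "C.H c d z" and s: "s = sr 1 x" "t = sr 1 y"
  shows "PH a d (C.AL a b c d x y z) = (x \<otimes> y \<otimes> z \<otimes> u d) \<odot> (alC a b c d \<otimes> u d) \<odot> ph a d"
    "MU a b d x (C.M b c d y z) = (x \<otimes> y \<otimes> z \<otimes> u d) \<odot> (eC a b \<otimes> mC b c d \<otimes> u d) \<odot> mu a b d"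
    "M' s a b d (PH a b x) (MU b c d y z) =
      (x \<otimes> y \<otimes> z \<otimes> u d) \<odot> (eC a b \<otimes> mu b c d) \<odot> (ph a b \<otimes> e' b d) \<odot> (u a \<otimes> m' a b d)"
    "MU a c d (C.M a b c x y) z = (x \<otimes> y \<otimes> z \<otimes> u d) \<odot> (mC a b c \<otimes> eC c d \<otimes> u d) \<odot> mu a c d"
    "M' (s \<otimes> t) a c d (MU a b c x y) (PH c d z) =
      (x \<otimes> y \<otimes> z \<otimes> u d) \<odot> (eC a b \<otimes> eC b c \<otimes> ph c d) \<odot> (mu a b c \<otimes> e' c d) \<odot> (u a \<otimes> m' a c d)"
    "AL' s t a b c d (PH a b x) (PH b c y) (PH c d z) =
      (x \<otimes> y \<otimes> z \<otimes> u d) \<odot> (eC a b \<otimes> eC b c \<otimes> ph c d) \<odot> (eC a b \<otimes> ph b c \<otimes> e' c d) \<odot>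
      (ph a b \<otimes> e' b c \<otimes> e' c d) \<odot> (u a \<otimes> alD (f a) (f b) (f c) (f d))"
proof -
  note h = C.HD[OF H(1)] C.HD[OF H(2)] C.HD[OF H(3)]
  have uu: "x \<odot> eC a b = x" "z \<odot> eC c d = z" using h by (simp_all add: unit_r')
  have i: "idn 1 (u d)" "idn 1 (e' b d)" "idn 1 (e' c d)" "idn 1 (u b)" "idn 1 (u c)" "idn 1 (e' b c \<otimes> e' c d)" "idn 1 s"
    using h s by (simp_all add: idn_def)
  have "((x \<otimes> y \<otimes> z) \<odot> alC a b c d) \<otimes> u d = ((x \<otimes> y \<otimes> z) \<otimes> u d) \<odot> (alC a b c d \<otimes> u d)"
    by (rule dist_r) (use h i in simp_all)
  then show "PH a d (C.AL a b c d x y z) = (x \<otimes> y \<otimes> z \<otimes> u d) \<odot> (alC a b c d \<otimes> u d) \<odot> ph a d"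
    by (simp add: PH_def C.AL_def assoc)
  have 1: "((y \<otimes> z) \<odot> mC b c d) \<otimes> u d = ((y \<otimes> z) \<otimes> u d) \<odot> (mC b c d \<otimes> u d)"
    by (rule dist_r) (use h i in simp_all)
  show "MU a b d x (C.M b c d y z) = (x \<otimes> y \<otimes> z \<otimes> u d) \<odot> (eC a b \<otimes> mC b c d \<otimes> u d) \<odot> mu a b d"
    unfolding MU_def C.M_def 1 using tens[of x "eC a b" "(y \<otimes> z) \<otimes> u d" "mC b c d \<otimes> u d"] h uu
    by (simp add: assoc)
  have 2: "(s \<otimes> MU b c d y z) \<odot> (PH a b x \<otimes> e' b d) = (x \<otimes> y \<otimes> z \<otimes> u d) \<odot> (eC a b \<otimes> mu b c d) \<odot> (ph a b \<otimes> e' b d)"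
    using inter[of "y \<otimes> z \<otimes> u d" "mu b c d" x "u b" "ph a b" "e' b d"] h i by (simp add: s MU_def PH_def assoc)
  show "M' s a b d (PH a b x) (MU b c d y z) =
      (x \<otimes> y \<otimes> z \<otimes> u d) \<odot> (eC a b \<otimes> mu b c d) \<odot> (ph a b \<otimes> e' b d) \<odot> (u a \<otimes> m' a b d)"
    unfolding M'_def using arg_cong[OF 2, of "\<lambda>x. x \<odot> (u a \<otimes> m' a b d)"] by (simp add: assoc)
  have "((x \<otimes> y) \<odot> mC a b c) \<otimes> ((z \<otimes> u d) \<odot> (eC c d \<otimes> u d)) = ((x \<otimes> y) \<otimes> (z \<otimes> u d)) \<odot> (mC a b c \<otimes> eC c d \<otimes> u d)"
    by (rule tens) (use h in simp_all)
  moreover have "(z \<otimes> u d) \<odot> (eC c d \<otimes> u d) = z \<otimes> u d" by (rule unit_r') (use h in simp_all)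
  ultimately show "MU a c d (C.M a b c x y) z = (x \<otimes> y \<otimes> z \<otimes> u d) \<odot> (mC a b c \<otimes> eC c d \<otimes> u d) \<odot> mu a c d"
    unfolding MU_def C.M_def by (simp add: assoc)
  have "(sr 1 (x \<otimes> y) \<otimes> ((z \<otimes> u d) \<odot> ph c d)) \<odot> ((((x \<otimes> y) \<otimes> u c) \<odot> mu a b c) \<otimes> e' c d)
      = ((x \<otimes> y) \<otimes> z \<otimes> u d) \<odot> (tg 1 (x \<otimes> y) \<otimes> ph c d) \<odot> (mu a b c \<otimes> e' c d)"
    by (rule inter) (use h i in \<open>simp_all add: assoc\<close>)
  then have 3: "((s \<otimes> t) \<otimes> PH c d z) \<odot> (MU a b c x y \<otimes> e' c d) =
      (x \<otimes> y \<otimes> z \<otimes> u d) \<odot> (eC a b \<otimes> eC b c \<otimes> ph c d) \<odot> (mu a b c \<otimes> e' c d)"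
    unfolding s MU_def PH_def using h by (simp add: assoc)
  show "M' (s \<otimes> t) a c d (MU a b c x y) (PH c d z) =
      (x \<otimes> y \<otimes> z \<otimes> u d) \<odot> (eC a b \<otimes> eC b c \<otimes> ph c d) \<odot> (mu a b c \<otimes> e' c d) \<odot> (u a \<otimes> m' a c d)"
    unfolding M'_def using arg_cong[OF 3, of "\<lambda>x. x \<odot> (u a \<otimes> m' a c d)"] by (simp add: assoc)
  have p: "ok (PH b c y)" "tg 1 (PH b c y) = u b \<otimes> e' b c" "sr 0 (PH b c y) = obC b" "tg 0 (PH b c y) = obD (f c)"
     "sr 1 (PH b c y) = t \<otimes> u c" "ok (PH c d z)" "tg 1 (PH c d z) = u c \<otimes> e' c d" "sr 0 (PH c d z) = obC c" "tg 0 (PH c d z) = obD (f d)"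
    using H'D[OF PH_simps(1)[OF H(2) s(2)]] H'D[OF PH_simps(1)[OF H(3) refl]] by auto
  have "s \<otimes> ((t \<otimes> PH c d z) \<odot> (PH b c y \<otimes> e' c d)) = (s \<otimes> t \<otimes> PH c d z) \<odot> (s \<otimes> PH b c y \<otimes> e' c d)"
    by (rule dist_l) (use h i p s in \<open>simp_all add: assoc\<close>)
  moreover have "(sr 1 x \<otimes> ((y \<otimes> z \<otimes> u d) \<odot> ((eC b c \<otimes> ph c d) \<odot> (ph b c \<otimes> e' c d)))) \<odot> (((x \<otimes> u b) \<odot> ph a b) \<otimes> (e' b c \<otimes> e' c d))
    = (x \<otimes> y \<otimes> z \<otimes> u d) \<odot> (tg 1 x \<otimes> ((eC b c \<otimes> ph c d) \<odot> (ph b c \<otimes> e' c d))) \<odot> (ph a b \<otimes> e' b c \<otimes> e' c d)"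
    by (rule inter) (use h i in \<open>simp_all add: assoc\<close>)
  moreover have "eC a b \<otimes> ((eC b c \<otimes> ph c d) \<odot> (ph b c \<otimes> e' c d)) = (eC a b \<otimes> eC b c \<otimes> ph c d) \<odot> (eC a b \<otimes> ph b c \<otimes> e' c d)"
    by (rule dist_l) (use h i in \<open>simp_all add: idn_def assoc\<close>)
  ultimately have 4: "((s \<otimes> t \<otimes> PH c d z) \<odot> (s \<otimes> PH b c y \<otimes> e' c d)) \<odot> (PH a b x \<otimes> e' b c \<otimes> e' c d)
     = (x \<otimes> y \<otimes> z \<otimes> u d) \<odot> ((eC a b \<otimes> eC b c \<otimes> ph c d) \<odot> (eC a b \<otimes> ph b c \<otimes> e' c d)) \<odot> (ph a b \<otimes> e' b c \<otimes> e' c d)"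
    using M'_PH[OF H(2,3) s(2)] h(4) by (simp add: PH_def[of a b] s(1))
  show "AL' s t a b c d (PH a b x) (PH b c y) (PH c d z) =
      (x \<otimes> y \<otimes> z \<otimes> u d) \<odot> (eC a b \<otimes> eC b c \<otimes> ph c d) \<odot> (eC a b \<otimes> ph b c \<otimes> e' c d) \<odot>
      (ph a b \<otimes> e' b c \<otimes> e' c d) \<odot> (u a \<otimes> alD (f a) (f b) (f c) (f d))"
    unfolding AL'_def using arg_cong[OF 4, of "\<lambda>x. x \<odot> (u a \<otimes> alD (f a) (f b) (f c) (f d))"] by (simp add: assoc)
qed

text \<open>The associativity axiom of the pseudofunctor \<open>PH\<close>: the equation
  \<open>almu\<close> whiskered by arbitrary 2-cells in place of the edges.\<close>

lemma almu_H:
  assumes H: "C.H a b x" "C.H b c y" "C.H c d z" and s: "s = sr 1 x" "t = sr 1 y"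
    and i: "sr 2 x = x" "sr 2 y = y" "sr 2 z = z"
  shows "PH a d (C.AL a b c d x y z) \<bullet> MU a b d x (C.M b c d y z) \<bullet> M' s a b d (PH a b x) (MU b c d y z)
    = MU a c d (C.M a b c x y) z \<bullet> M' (s \<otimes> t) a c d (MU a b c x y) (PH c d z) \<bullet> AL' s t a b c d (PH a b x) (PH b c y) (PH c d z)"
proof -
  note h = C.HD[OF H(1)] C.HD[OF H(2)] C.HD[OF H(3)]
  let ?F = "x \<otimes> y \<otimes> z \<otimes> u d"
  let ?x = "eC a b" and ?y = "eC b c" and ?z = "eC c d"
  have He: "C.H a b ?x" "C.H b c ?y" "C.H c d ?z" and se: "?x = sr 1 ?x" "?y = sr 1 ?y" using h by auto
  note aux = almu_aux[OF He se]
  let ?Q1 = "PH a d (C.AL a b c d ?x ?y ?z)" and ?Q2 = "MU a b d ?x (C.M b c d ?y ?z)" and ?Q3 = "M' ?x a b d (PH a b ?x) (MU b c d ?y ?z)"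
    and ?Q4 = "MU a c d (C.M a b c ?x ?y) ?z" and ?Q5 = "M' (?x \<otimes> ?y) a c d (MU a b c ?x ?y) (PH c d ?z)"
    and ?Q6 = "AL' ?x ?y a b c d (PH a b ?x) (PH b c ?y) (PH c d ?z)"
  have Q: "?Q1 = (alC a b c d \<otimes> u d) \<odot> ph a d" "?Q2 = (eC a b \<otimes> mC b c d \<otimes> u d) \<odot> mu a b d"
    "?Q3 = (eC a b \<otimes> mu b c d) \<odot> (ph a b \<otimes> e' b d) \<odot> (u a \<otimes> m' a b d)" "?Q4 = (mC a b c \<otimes> eC c d \<otimes> u d) \<odot> mu a c d"
    "?Q5 = (eC a b \<otimes> eC b c \<otimes> ph c d) \<odot> (mu a b c \<otimes> e' c d) \<odot> (u a \<otimes> m' a c d)"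
    "?Q6 = (eC a b \<otimes> eC b c \<otimes> ph c d) \<odot> (eC a b \<otimes> ph b c \<otimes> e' c d) \<odot>
      (ph a b \<otimes> e' b c \<otimes> e' c d) \<odot> (u a \<otimes> alD (f a) (f b) (f c) (f d))"
    unfolding aux by (rule unit_l'; use h in \<open>simp add: assoc\<close>)+
  have F: "idn 2 ?F" using h i by (simp add: idn_def)
  have ty: "H' ?x a b (PH a b ?x)" "H' ?y b c (PH b c ?y)" "H' ?z c d (PH c d ?z)" "H' (?x \<otimes> ?y) a c (MU a b c ?x ?y)" "H' (?y \<otimes> ?z) b d (MU b c d ?y ?z)"
    using MU_simps(2)[OF He(1,2), of ?x] MU_simps(2)[OF He(2,3), of ?y] He h by simp_all
  have P: "ok ?Q1" "ok ?Q2" "ok ?Q3" "ok ?Q4" "ok ?Q5" "ok ?Q6"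
    using He ty h C.AL_simps[OF He] by (simp_all del: PH_simps(1) MU_simps(2))
  have T: "tg 2 ?Q1 = sr 2 ?Q2" "tg 2 ?Q2 = sr 2 ?Q3" "tg 2 ?Q4 = sr 2 ?Q5" "tg 2 ?Q5 = sr 2 ?Q6"
    using He ty h C.AL_simps[OF He] MU_simps(3,4)[OF He(1) C.M_simps(1)[OF He(2,3)], of ?x] MU_simps(3,4)[OF He(2,3), of ?y] MU_simps(3,4)[OF He(1,2), of ?x]
      MU_simps(3,4)[OF C.M_simps(1)[OF He(1,2)] He(3), of "?x \<otimes> ?y"]
    by (simp_all del: PH_simps(1) MU_simps)
  have ok: "ok (?Q1 \<bullet> ?Q2 \<bullet> ?Q3)" "ok (?Q2 \<bullet> ?Q3)" "ok (?Q4 \<bullet> ?Q5 \<bullet> ?Q6)" "ok (?Q5 \<bullet> ?Q6)"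
    using P T by simp_all
  have t: "tg 1 ?F = sr 1 ?Q1" "tg 1 ?F = sr 1 ?Q2" "tg 1 ?F = sr 1 ?Q4" "tg 1 ?F = sr 1 ?Q5" unfolding Q using h by (simp_all add: assoc)
  have "?F \<odot> (?Q1 \<bullet> ?Q2 \<bullet> ?Q3) = ?F \<odot> (?Q4 \<bullet> ?Q5 \<bullet> ?Q6)"
    unfolding Q using almu[of a b c d] h by (simp only:)
  then have "(?F \<odot> ?Q1) \<bullet> (?F \<odot> ?Q2) \<bullet> (?F \<odot> ?Q3) = (?F \<odot> ?Q4) \<bullet> (?F \<odot> ?Q5) \<bullet> (?F \<odot> ?Q6)"
    using dist_l[OF _ _ F ok(1) t(1)] dist_l[OF _ _ F ok(2) t(2)] dist_l[OF _ _ F ok(3) t(3)] dist_l[OF _ _ F ok(4) t(4)] by simp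
  then show ?thesis unfolding Q unfolding almu_aux[OF H s] .
qed

lemma ok_right: "ok (x \<bullet> y) \<Longrightarrow> ok y" by simp

text \<open>The left unit axiom of \<open>PH\<close>: \<open>lamu\<close> whiskered by
  \<open>y \<otimes> u b\<close>. As in \<open>triangle\<close>, the unit consumes no input and is
  inserted after \<open>y\<close>.\<close>

lemma lamu_H:
  assumes H: "C.H a b y" and i: "sr 2 y = y"
  shows "MU a a b (iC a) y \<bullet> M' (obC a) a a b (nu a) (PH a b y) \<bullet> LA' a b (PH a b y) = PH a b (C.LA a b y)"
proof -
  note h = C.HD[OF H]
  let ?F = "y \<otimes> u b"
  let ?Q1 = "(iC a \<otimes> eC a b \<otimes> u b) \<odot> mu a a b" and ?Q2 = "ph a b \<odot> (nu a \<otimes> e' a b) \<odot> (u a \<otimes> m' a a b)"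
    and ?Q3 = "ph a b \<odot> (u a \<otimes> laD (f a) (f b))"
  have F: "idn 2 ?F" using h i by (simp add: idn_def)
  have "(obC a \<odot> iC a) \<otimes> ((y \<otimes> u b) \<odot> (eC a b \<otimes> u b)) = (obC a \<otimes> (y \<otimes> u b)) \<odot> (iC a \<otimes> eC a b \<otimes> u b)"
    by (rule tens) (use h in simp_all)
  moreover have "(y \<otimes> u b) \<odot> (eC a b \<otimes> u b) = y \<otimes> u b" by (rule unit_r') (use h in simp_all)
  ultimately have 0: "iC a \<otimes> y \<otimes> u b = (y \<otimes> u b) \<odot> (iC a \<otimes> eC a b \<otimes> u b)"
    using h by (simp add: unit_l')
  have 1: "MU a a b (iC a) y = ?F \<odot> ?Q1" unfolding MU_def 0 by (simp add: assoc)
  have 2: "M' (obC a) a a b (nu a) (PH a b y) = ?F \<odot> ?Q2" using h by (simp add: M'_def PH_def assoc unit_l')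
  have 3: "LA' a b (PH a b y) = ?F \<odot> ?Q3" by (simp add: LA'_def PH_def assoc)
  have "((y \<odot> laC a b) \<otimes> u b) = (y \<otimes> u b) \<odot> (laC a b \<otimes> u b)" by (rule dist_r) (use h in \<open>simp_all add: idn_def\<close>)
  then have 4: "PH a b (C.LA a b y) = ?F \<odot> ((laC a b \<otimes> u b) \<odot> ph a b)" by (simp add: PH_def C.LA_def assoc)
  have l: "?Q1 \<bullet> ?Q2 \<bullet> ?Q3 = (laC a b \<otimes> u b) \<odot> ph a b" using lamu h by simp
  have "ok (?Q1 \<bullet> ?Q2 \<bullet> ?Q3)" unfolding l using h by simp
  then have ok: "ok (?Q1 \<bullet> ?Q2 \<bullet> ?Q3)" "ok (?Q2 \<bullet> ?Q3)" by (assumption, rule ok_right)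
  have t: "tg 1 ?F = sr 1 ?Q1" "tg 1 ?F = sr 1 ?Q2" using h by (simp_all add: unit_l' assoc)
  show ?thesis unfolding 1 2 3 4 l[symmetric]
    using dist_l[OF _ _ F ok(1) t(1)] dist_l[OF _ _ F ok(2) t(2)] by simp
qed

lemma rhmu_H:
  assumes H: "C.H a b y" and i: "sr 2 y = y" and s: "s = sr 1 y"
  shows "MU a b b y (iC b) \<bullet> M' s a b b (PH a b y) (nu b) \<bullet> RH' a b (PH a b y) = PH a b (C.RH a b y)"
proof -
  note h = C.HD[OF H]
  let ?F = "y \<otimes> u b"
  let ?Q1 = "(eC a b \<otimes> iC b \<otimes> u b) \<odot> mu a b b" and ?Q2 = "(eC a b \<otimes> nu b) \<odot> (ph a b \<otimes> e' b b) \<odot> (u a \<otimes> m' a b b)"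
    and ?Q3 = "ph a b \<odot> (u a \<otimes> rhD (f a) (f b))"
  have F: "idn 2 ?F" using h i by (simp add: idn_def)
  have "(y \<odot> eC a b) \<otimes> ((obC b \<otimes> u b) \<odot> (iC b \<otimes> u b)) = (y \<otimes> (obC b \<otimes> u b)) \<odot> (eC a b \<otimes> iC b \<otimes> u b)"
    by (rule tens) (use h in simp_all)
  moreover have obu: "obC b \<otimes> u b = u b" "u b \<odot> (iC b \<otimes> u b) = iC b \<otimes> u b" "y \<odot> eC a b = y"
    using h by (simp_all add: unit_l' unit_r')
  ultimately have 0: "y \<otimes> iC b \<otimes> u b = (y \<otimes> u b) \<odot> (eC a b \<otimes> iC b \<otimes> u b)" by (simp only:)
  have 1: "MU a b b y (iC b) = ?F \<odot> ?Q1" unfolding MU_def 0 by (simp add: assoc)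
  have un: "u b \<odot> nu b = nu b" by (rule unit_l') (use h in simp_all)
  have "(s \<otimes> nu b) \<odot> (PH a b y \<otimes> e' b b) = ?F \<odot> (eC a b \<otimes> nu b) \<odot> (ph a b \<otimes> e' b b)"
    using inter[of "u b" "nu b" y "u b" "ph a b" "e' b b"] h unfolding un by (simp add: s PH_def idn_def)
  from arg_cong[OF this, of "\<lambda>x. x \<odot> (u a \<otimes> m' a b b)"] have 2: "M' s a b b (PH a b y) (nu b) = ?F \<odot> ?Q2" by (simp add: M'_def assoc)
  have 3: "RH' a b (PH a b y) = ?F \<odot> ?Q3" by (simp add: RH'_def PH_def assoc)
  have "((y \<odot> rhC a b) \<otimes> u b) = (y \<otimes> u b) \<odot> (rhC a b \<otimes> u b)" by (rule dist_r) (use h in \<open>simp_all add: idn_def\<close>)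
  then have 4: "PH a b (C.RH a b y) = ?F \<odot> ((rhC a b \<otimes> u b) \<odot> ph a b)" by (simp add: PH_def C.RH_def assoc)
  have l: "?Q1 \<bullet> ?Q2 \<bullet> ?Q3 = (rhC a b \<otimes> u b) \<odot> ph a b" using rhmu h by simp
  have "ok (?Q1 \<bullet> ?Q2 \<bullet> ?Q3)" unfolding l using h by simp
  then have ok: "ok (?Q1 \<bullet> ?Q2 \<bullet> ?Q3)" "ok (?Q2 \<bullet> ?Q3)" by (assumption, rule ok_right)
  have t: "tg 1 ?F = sr 1 ?Q1" "tg 1 ?F = sr 1 ?Q2" using h obu by (simp_all add: assoc)
  show ?thesis unfolding 1 2 3 4 l[symmetric]
    using dist_l[OF _ _ F ok(1) t(1)] dist_l[OF _ _ F ok(2) t(2)] by simp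
qed

text \<open>This is the \<open>\<mu>\<close>-case of the naturality of \<open>E\<close>.\<close>

lemma PHI_mu:
  assumes "a \<in> CC" "set p \<subseteq> CC" "set q \<subseteq> CC" and b: "b = last (a # p)" "c = last (b # q)"
  shows "PH a c (C.A a p q) \<bullet> PHI a (p @ q) = MU a b c (C.cmb a p) (C.cmb b q) \<bullet>
    M' (C.pth a p) a b c (PHI a p) (PHI b q) \<bullet> (KK a (p @ q) \<odot> (u a \<otimes> D.A (f a) (map f p) (map f q)))"
  using assms
proof (induction p arbitrary: a b)
  case Nil
  have o: "a \<in> CC" "set q \<subseteq> CC" "b = a" "c \<in> CC" and c: "c = last (a # q)" using Nil C.last_in[of q] by auto
  let ?q = "C.cmb a q"
  note q = C.cmb[OF o(1,2), folded c] and P = PHI[OF o(1,2) c] and L = LL[OF o(1,2) c]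
  \<comment> \<open>The contribution of \<open>D\<close> is its left unitor, found below the
    crossings.\<close>
  have K: "KK a q \<odot> (u a \<otimes> D.A (f a) [] (map f q)) = LA' a c (LL a q)"
  proof -
    have "u a \<otimes> (D.cmb (f a) (map f q) \<odot> laD (f a) (f c)) = (u a \<otimes> D.cmb (f a) (map f q)) \<odot> (u a \<otimes> laD (f a) (f c))"
      by (rule dist_l) (use o cmbD[OF o(1,2) refl, folded c] in \<open>simp_all add: idn_def del: cmbD\<close>)
    then show ?thesis using last_map_f[of a q] c by (simp add: LA'_def LL_def D.LA_def assoc del: last.simps)
  qed
  have n: "H' (obC a) a a (nu a)" "tg 2 (nu a) = u a \<otimes> iD (f a)" "ok (nu a)"
    using PHI[OF o(1), of "[]"] o by (simp_all)
  \<comment> \<open>\<open>lamu_H\<close> replaces the unitor of \<open>C\<close> by the one of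
    \<open>D\<close>; naturality lets \<open>PHI a q\<close> pass it. Then \<open>nu a\<close> and
    \<open>PHI a q\<close> act on different factors and merge into one product.\<close>
  have "PH a c (C.A a [] q) \<bullet> PHI a ([] @ q) = (MU a a c (iC a) ?q \<bullet> M' (obC a) a a c (nu a) (PH a c ?q) \<bullet> LA' a c (PH a c ?q)) \<bullet> PHI a q"
    using lamu_H[OF q(1,2)] c by simp
  also have "\<dots> = MU a a c (iC a) ?q \<bullet> M' (obC a) a a c (nu a) (PH a c ?q) \<bullet> (LA' a c (PH a c ?q) \<bullet> PHI a q)"
    by (simp add: assoc)
  also have "LA' a c (PH a c ?q) \<bullet> PHI a q = M' (obC a) a a c (u a \<otimes> iD (f a)) (PHI a q) \<bullet> LA' a c (LL a q)"
    using LA'_nat[OF P(1)] P by simp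
  also have "MU a a c (iC a) ?q \<bullet> M' (obC a) a a c (nu a) (PH a c ?q) \<bullet> M' (obC a) a a c (u a \<otimes> iD (f a)) (PHI a q) \<bullet> LA' a c (LL a q)
     = MU a a c (iC a) ?q \<bullet> (M' (obC a) a a c (nu a) (PH a c ?q) \<bullet> M' (obC a) a a c (u a \<otimes> iD (f a)) (PHI a q)) \<bullet> LA' a c (LL a q)"
    by (simp add: assoc)
  also have "M' (obC a) a a c (nu a) (PH a c ?q) \<bullet> M' (obC a) a a c (u a \<otimes> iD (f a)) (PHI a q)
     = M' (obC a) a a c (nu a) (PHI a q)"
  proof -
    have "nu a \<bullet> (u a \<otimes> iD (f a)) = nu a" by (rule unit_r') (use n in simp_all)
    moreover have "PH a c ?q \<bullet> PHI a q = PHI a q" by (rule unit_l') (use P in simp_all)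
    ultimately show ?thesis using M'_comp[OF n(1) _ PH_simps(1)[OF q(1) refl], of "u a \<otimes> iD (f a)" "PHI a q"] n P q o by simp
  qed
  finally show ?case using o(1,3) K by simp
next
  case (Cons x p)
  have o: "a \<in> CC" "x \<in> CC" "b \<in> CC" "c \<in> CC" "set p \<subseteq> CC" "set q \<subseteq> CC" "set (x # p) \<subseteq> CC" "set (p @ q) \<subseteq> CC" and c: "c = last (b # q)" 
    and bx: "b = last (x # p)" and bb: "b = last (a # x # p)" and cpq: "c = last (x # p @ q)" using Cons.prems C.last_in[of p] C.last_in[of q] by auto
  let ?xp = "C.cmb a (x # p)" and ?q = "C.cmb b q"
  note xp = C.cmb[OF o(1,7), folded bb] and q = C.cmb[OF o(3,6), folded c] and Pxp = PHI[OF o(1,7) bb] and Pq = PHI[OF o(3,6) c]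
  show ?case
  proof (cases "q = []")
    case qe: True
    then have cb: "c = b" using c by simp
    have K: "KK a (x # p) \<odot> (u a \<otimes> D.A (f a) (map f (x # p)) []) = RH' a b (LL a (x # p))"
    proof -
      have "u a \<otimes> (D.cmb (f a) (map f (x # p)) \<odot> rhD (f a) (f b)) = (u a \<otimes> D.cmb (f a) (map f (x # p))) \<odot> (u a \<otimes> rhD (f a) (f b))"
        by (rule dist_l) (use o(1-3) cmbD[OF o(1,7) refl, folded bb] in \<open>simp_all add: idn_def del: cmbD D.cmb.simps list.map\<close>)
      moreover have "D.A (f a) (map f (x # p)) [] = D.cmb (f a) (map f (x # p)) \<odot> rhD (f a) (f b)"
        using last_map_f[of x p] bx by (simp add: D.RH_def del: last.simps D.cmb.simps)
      ultimately show ?thesis by (simp add: RH'_def LL_def assoc del: D.A.simps D.cmb.simps list.map KK.simps)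
    qed
    have n: "H' (obC b) b b (nu b)" "tg 2 (nu b) = u b \<otimes> iD (f b)" "ok (nu b)"
      using PHI[OF o(3), of "[]"] o(3) by (simp_all)
    \<comment> \<open>The same argument on the right-hand factor, with \<open>rhmu_H\<close> and the
      right unitor of \<open>D\<close>.\<close>
    have "PH a c (C.A a (x # p) q) \<bullet> PHI a ((x # p) @ q) = (MU a b b ?xp (iC b) \<bullet> M' (C.pth a (x # p)) a b b (PH a b ?xp) (nu b) \<bullet> RH' a b (PH a b ?xp)) \<bullet> PHI a (x # p)"
      using rhmu_H[OF xp(1,2) xp(3)[symmetric]] qe cb bx by (simp del: last.simps C.cmb.simps PHI.simps C.pth.simps)
    also have "\<dots> = MU a b b ?xp (iC b) \<bullet> M' (C.pth a (x # p)) a b b (PH a b ?xp) (nu b) \<bullet> (RH' a b (PH a b ?xp) \<bullet> PHI a (x # p))"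
      by (simp add: assoc del: C.cmb.simps PHI.simps C.pth.simps)
    also have "RH' a b (PH a b ?xp) \<bullet> PHI a (x # p) = M' (C.pth a (x # p)) a b b (PHI a (x # p)) (u b \<otimes> iD (f b)) \<bullet> RH' a b (LL a (x # p))"
      using RH'_nat[OF Pxp(1)] Pxp by (simp del: C.cmb.simps PHI.simps C.pth.simps)
    also have "MU a b b ?xp (iC b) \<bullet> M' (C.pth a (x # p)) a b b (PH a b ?xp) (nu b) \<bullet> M' (C.pth a (x # p)) a b b (PHI a (x # p)) (u b \<otimes> iD (f b)) \<bullet> RH' a b (LL a (x # p))
      = MU a b b ?xp (iC b) \<bullet> (M' (C.pth a (x # p)) a b b (PH a b ?xp) (nu b) \<bullet> M' (C.pth a (x # p)) a b b (PHI a (x # p)) (u b \<otimes> iD (f b))) \<bullet> RH' a b (LL a (x # p))"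
      by (simp add: assoc del: C.cmb.simps PHI.simps C.pth.simps)
    also have "M' (C.pth a (x # p)) a b b (PH a b ?xp) (nu b) \<bullet> M' (C.pth a (x # p)) a b b (PHI a (x # p)) (u b \<otimes> iD (f b))
       = M' (C.pth a (x # p)) a b b (PHI a (x # p)) (nu b)"
    proof -
      have "nu b \<bullet> (u b \<otimes> iD (f b)) = nu b" by (rule unit_r') (use n in simp_all)
      moreover have "PH a b ?xp \<bullet> PHI a (x # p) = PHI a (x # p)" by (rule unit_l') (use Pxp in \<open>simp_all del: C.cmb.simps PHI.simps C.pth.simps\<close>)
      ultimately show ?thesis
        using M'_comp[OF PH_simps(1)[OF xp(1) xp(3)[symmetric]] _ n(1), of "PHI a (x # p)" "u b \<otimes> iD (f b)"] n Pxp PH_simps(2,4)[OF xp(1) refl] xp(4) o(3)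
        by (simp del: C.cmb.simps PHI.simps C.pth.simps)
    qed
    finally show ?thesis using qe cb K by (simp del: D.A.simps C.cmb.simps(2) C.pth.simps KK.simps PHI.simps(2))
  next
    case qn: False
    have lq: "last q = c" "last (p @ q) = c" using qn c cpq by simp_all
    let ?e = "eC a x" and ?p = "C.cmb x p" and ?P = "C.pth x p"
    note pp = C.cmb[OF o(2,5), folded bx] and Pp = PHI[OF o(2,5) bx] and PP = PHI[OF o(2,8) cpq] and Aq = C.A[OF o(2,5,6), folded bx cpq]
    have He: "C.H a x ?e" "sr 2 ?e = ?e" "tg 2 ?e = ?e" "?e = sr 1 ?e" using o by simp_all
    have Hph: "H' ?e a x (ph a x)" "sr 2 (ph a x) = ph a x" "tg 2 (ph a x) = ph a x" "PH a x ?e = ph a x" using o by (simp_all add: PH_e)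
    note opq = KK[OF o(1), of "x # p @ q"]
    show ?thesis
    proof (cases "p = []")
      case p: True
      have bxx: "b = x" using p bx by simp
      have lxq: "c = last (a # x # q)" "c = last (x # q)" using qn c by simp_all
      have xq: "set (x # q) \<subseteq> CC" using o by simp
      note Pxq = PHI[OF o(1) xq lxq(1)] and cxq = C.cmb[OF o(1) xq, folded lxq(1)]
      have D1: "D.A (f a) (map f [x]) (map f q) = D.cmb (f a) (map f (x # q))" using qn by simp
      have "PH a c (C.A a [x] q) \<bullet> PHI a (x # q) = PHI a (x # q)"
        using unit_l'[of 2 "PHI a (x # q)" "PH a c (C.cmb a (x # q))"] qn Pxq by (simp del: C.cmb.simps PHI.simps)
      moreover have "PHI a (x # q) \<bullet> LL a (x # q) = PHI a (x # q)"
        by (rule unit_r') (use Pxq in \<open>simp_all del: PHI.simps\<close>)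
      then have "(MU a x c ?e (C.cmb x q) \<bullet> M' ?e a x c (ph a x) (PHI x q)) \<bullet> LL a (x # q) = PHI a (x # q)"
        using qn lq by simp
      moreover have "KK a (x # q) \<odot> (u a \<otimes> D.A (f a) (map f [x]) (map f q)) = LL a (x # q)"
        unfolding D1 LL_def ..
      ultimately show ?thesis using p bxx o(1,2) by (simp add: assoc unit_r' del: KK.simps C.A.simps D.A.simps PHI.simps(2)) (simp add: unit_r')
    next
      case p: False
      have lp: "last p = b" using p bx by simp
      let ?A' = "D.A (f x) (map f p) (map f q)"
      let ?R = "KK x (p @ q) \<odot> (u x \<otimes> ?A')"
      have Fx: "D.H (f a) (f x) (e' a x)" using o by simp
      have lfp: "last (f x # map f p @ map f q) = f c" "last (f x # map f p) = f b"
        using last_map_f[of x "p @ q"] last_map_f[of x p] bx cpq by simp_all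
      note DA = D.A[of "f x" "map f p" "map f q", unfolded lfp]
      have DA': "D.H (f x) (f c) ?A'" "sr 2 ?A' = D.M (f x) (f b) (f c) (D.cmb (f x) (map f p)) (D.cmb (f b) (map f q))"
         "tg 2 ?A' = D.cmb (f x) (map f (p @ q))"
        using DA o map_in[of p] map_in[of q] by simp_all
      have Hp: "D.H (f x) (f b) (D.cmb (f x) (map f p))" "D.H (f b) (f c) (D.cmb (f b) (map f q))"
        using cmbD(1)[OF o(2,5) refl, folded bx] cmbD(1)[OF o(3,6) refl, folded c] .
      have sA: "sr 1 ?A' = D.pth (f x) (map f (p @ q))"
      proof -
        have "sr 1 ?A' = sr 1 (sr 2 ?A')" by simp
        also have "\<dots> = D.pth (f x) (map f p) \<otimes> D.pth (f b) (map f q)"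
          unfolding DA'(2) using D.M_simps(5)[OF Hp] cmbD(3)[OF o(2,5) refl] cmbD(3)[OF o(3,6) refl] by simp
        also have "\<dots> = D.pth (f x) (map f (p @ q))"
          using D.pth_append[of "f x" "map f p" "map f q"] o map_in[of p] map_in[of q] lfp by simp
        finally show ?thesis .
      qed
      have Rty: "ok ?R" "sr 2 ?R = M' ?P x b c (LL x p) (LL b q)" "tg 2 ?R = LL x (p @ q)"
        using KK[OF o(2,8), folded cpq] D.HD[OF DA'(1)] DA'(2,3) sA o(1-4) M'_LL[OF o(2,5,6) bx c] 
        by (simp_all del: KK D.A D.cmb cmbD add: LL_def)
      have HR: "H' (?P \<otimes> C.pth b q) x c ?R"
      proof -
        have "sr 1 ?R = ?P \<otimes> C.pth b q \<otimes> u c" "tg 1 ?R = u x \<otimes> e' x c"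
          using KK[OF o(2,8), folded cpq] D.HD[OF DA'(1)] sA o(1-4) C.pth_append[OF o(2,5,6)] bx cpq by (simp_all del: KK D.A last.simps add: assoc)
        moreover have "idn 1 (?P \<otimes> C.pth b q)" "sr 0 (?P \<otimes> C.pth b q) = obC x" "tg 0 (?P \<otimes> C.pth b q) = obC c"
          using C.pth[OF o(2,5), folded bx] C.pth[OF o(3,6), folded c] o(2) by (simp_all del: C.pth add: idn_def)
        ultimately show ?thesis using Rty(1) o(2,4) by (simp add: H'_def assoc)
      qed
      have oAq: "ok (C.A x p q)" "ok ?p" "ok ?q" "ok (PHI x p)" "ok (PHI b q)" "ok (PHI x (p @ q))"
        using Aq Pp Pq PP pp q by simp_all
      have MUx: "H' (?P \<otimes> C.pth b q) x c (MU x b c ?p ?q)" "sr 2 (MU x b c ?p ?q) = PH x c (C.M x b c ?p ?q)"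
         "tg 2 (MU x b c ?p ?q) = M' ?P x b c (PH x b ?p) (PH b c ?q)" "ok (MU x b c ?p ?q)"
        using MU_simps[OF pp(1) q(1) pp(3)[symmetric]] pp q by simp_all
      have MPP: "H' (?P \<otimes> C.pth b q) x c (M' ?P x b c (PHI x p) (PHI b q))" "ok (M' ?P x b c (PHI x p) (PHI b q))"
         "sr 2 (M' ?P x b c (PHI x p) (PHI b q)) = M' ?P x b c (PH x b ?p) (PH b c ?q)" "tg 2 (M' ?P x b c (PHI x p) (PHI b q)) = M' ?P x b c (LL x p) (LL b q)"
        using M'_simps[OF Pp(1) Pq(1)] Pp Pq by simp_all
      \<comment> \<open>The pattern of \<open>A_al\<close>: naturality of \<open>MU\<close> moves
        the product of combs behind the leading edge, where the induction hypothesis applies, and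
        \<open>almu_H\<close> takes the place of the pentagon. Naturality of \<open>AL'\<close> then
        sorts the factors.\<close>
      have "PH a c (C.A a (x # p) q) \<bullet> PHI a ((x # p) @ q)
         = PH a c (C.AL a x b c ?e ?p ?q \<bullet> C.M a x c ?e (C.A x p q)) \<bullet> MU a x c ?e (C.cmb x (p @ q)) \<bullet> M' ?e a x c (ph a x) (PHI x (p @ q))"
        using p qn lp lq by simp
      also have "\<dots> = PH a c (C.AL a x b c ?e ?p ?q) \<bullet> (PH a c (C.M a x c ?e (C.A x p q)) \<bullet> MU a x c ?e (C.cmb x (p @ q))) \<bullet> M' ?e a x c (ph a x) (PHI x (p @ q))"
        using PH_comp[OF C.AL_simps(2)[OF He(1) pp(1) q(1)], of "C.M a x c ?e (C.A x p q)"] He pp q Aq by (simp add: assoc)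
      also have "PH a c (C.M a x c ?e (C.A x p q)) \<bullet> MU a x c ?e (C.cmb x (p @ q)) = MU a x c ?e (C.A x p q)"
        using MU_nat(1)[OF He(1) Aq(1) He(4)] He Aq by simp
      also have "\<dots> = MU a x c ?e (C.M x b c ?p ?q) \<bullet> M' ?e a x c (ph a x) (PH x c (C.A x p q))"
        using MU_nat(2)[OF He(1) Aq(1) He(4)] He Aq Hph by simp
      also have "PH a c (C.AL a x b c ?e ?p ?q) \<bullet> (MU a x c ?e (C.M x b c ?p ?q) \<bullet> M' ?e a x c (ph a x) (PH x c (C.A x p q))) \<bullet> M' ?e a x c (ph a x) (PHI x (p @ q))
        = PH a c (C.AL a x b c ?e ?p ?q) \<bullet> MU a x c ?e (C.M x b c ?p ?q) \<bullet> (M' ?e a x c (ph a x) (PH x c (C.A x p q)) \<bullet> M' ?e a x c (ph a x) (PHI x (p @ q)))"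
        by (simp add: assoc)
      also have "M' ?e a x c (ph a x) (PH x c (C.A x p q)) \<bullet> M' ?e a x c (ph a x) (PHI x (p @ q)) = M' ?e a x c (ph a x) (PH x c (C.A x p q) \<bullet> PHI x (p @ q))"
        by (rule M'_comp_r[symmetric, OF Hph(1,2) PH_simps(1)[OF Aq(1) refl]]) (use PH_simps[OF Aq(1) refl] PP Aq in simp_all)
      also have "PH x c (C.A x p q) \<bullet> PHI x (p @ q) = MU x b c ?p ?q \<bullet> M' ?P x b c (PHI x p) (PHI b q) \<bullet> ?R"
        by (rule Cons.IH[OF o(2,5,6) bx c])
      also have "M' ?e a x c (ph a x) (MU x b c ?p ?q \<bullet> M' ?P x b c (PHI x p) (PHI b q) \<bullet> ?R)
         = M' ?e a x c (ph a x) (MU x b c ?p ?q) \<bullet> M' ?e a x c (ph a x) (M' ?P x b c (PHI x p) (PHI b q)) \<bullet> M' ?e a x c (ph a x) ?R"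
        using M'_comp_r[OF Hph(1,2) MUx(1), of "M' ?P x b c (PHI x p) (PHI b q) \<bullet> ?R"] M'_comp_r[OF Hph(1,2) MPP(1), of ?R]
           MUx MPP Rty pp(4) q(4) by simp
      also have "PH a c (C.AL a x b c ?e ?p ?q) \<bullet> MU a x c ?e (C.M x b c ?p ?q) \<bullet> M' ?e a x c (ph a x) (MU x b c ?p ?q) \<bullet> M' ?e a x c (ph a x) (M' ?P x b c (PHI x p) (PHI b q)) \<bullet> M' ?e a x c (ph a x) ?R
         = (PH a c (C.AL a x b c ?e ?p ?q) \<bullet> MU a x c ?e (C.M x b c ?p ?q) \<bullet> M' ?e a x c (ph a x) (MU x b c ?p ?q)) \<bullet> M' ?e a x c (ph a x) (M' ?P x b c (PHI x p) (PHI b q)) \<bullet> M' ?e a x c (ph a x) ?R"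
        by (simp add: assoc)
      also have "PH a c (C.AL a x b c ?e ?p ?q) \<bullet> MU a x c ?e (C.M x b c ?p ?q) \<bullet> M' ?e a x c (ph a x) (MU x b c ?p ?q)
         = MU a b c (C.M a x b ?e ?p) ?q \<bullet> M' (?e \<otimes> ?P) a b c (MU a x b ?e ?p) (PH b c ?q) \<bullet> AL' ?e ?P a x b c (ph a x) (PH x b ?p) (PH b c ?q)"
        using almu_H[OF He(1) pp(1) q(1) He(4) pp(3)[symmetric] He(2) pp(2) q(2)] Hph(4) by simp
      also have "(MU a b c (C.M a x b ?e ?p) ?q \<bullet> M' (?e \<otimes> ?P) a b c (MU a x b ?e ?p) (PH b c ?q) \<bullet> AL' ?e ?P a x b c (ph a x) (PH x b ?p) (PH b c ?q)) \<bullet>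
           M' ?e a x c (ph a x) (M' ?P x b c (PHI x p) (PHI b q)) \<bullet> M' ?e a x c (ph a x) ?R
         = MU a b c (C.M a x b ?e ?p) ?q \<bullet> M' (?e \<otimes> ?P) a b c (MU a x b ?e ?p) (PH b c ?q) \<bullet>
            (AL' ?e ?P a x b c (ph a x) (PH x b ?p) (PH b c ?q) \<bullet> M' ?e a x c (ph a x) (M' ?P x b c (PHI x p) (PHI b q))) \<bullet> M' ?e a x c (ph a x) ?R"
        by (simp add: assoc)
      also have "AL' ?e ?P a x b c (ph a x) (PH x b ?p) (PH b c ?q) \<bullet> M' ?e a x c (ph a x) (M' ?P x b c (PHI x p) (PHI b q))
         = AL' ?e ?P a x b c (ph a x) (PHI x p) (PHI b q)"
        using AL'_nat(2)[OF Hph(1) Pp(1) Pq(1)] Hph Pp Pq by simp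
      also have "\<dots> = M' (?e \<otimes> ?P) a b c (M' ?e a x b (ph a x) (PHI x p)) (PHI b q) \<bullet> AL' ?e ?P a x b c (ph a x) (LL x p) (LL b q)"
        using AL'_nat(1)[OF Hph(1) Pp(1) Pq(1)] Hph Pp Pq by simp
      also have "MU a b c (C.M a x b ?e ?p) ?q \<bullet> M' (?e \<otimes> ?P) a b c (MU a x b ?e ?p) (PH b c ?q) \<bullet>
            (M' (?e \<otimes> ?P) a b c (M' ?e a x b (ph a x) (PHI x p)) (PHI b q) \<bullet> AL' ?e ?P a x b c (ph a x) (LL x p) (LL b q)) \<bullet> M' ?e a x c (ph a x) ?R
         = MU a b c (C.M a x b ?e ?p) ?q \<bullet> (M' (?e \<otimes> ?P) a b c (MU a x b ?e ?p) (PH b c ?q) \<bullet>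
            M' (?e \<otimes> ?P) a b c (M' ?e a x b (ph a x) (PHI x p)) (PHI b q)) \<bullet> (AL' ?e ?P a x b c (ph a x) (LL x p) (LL b q) \<bullet> M' ?e a x c (ph a x) ?R)"
        by (simp add: assoc)
      also have "M' (?e \<otimes> ?P) a b c (MU a x b ?e ?p) (PH b c ?q) \<bullet> M' (?e \<otimes> ?P) a b c (M' ?e a x b (ph a x) (PHI x p)) (PHI b q)
         = M' (C.pth a (x # p)) a b c (PHI a (x # p)) (PHI b q)"
      proof -
        have mu1: "H' (?e \<otimes> ?P) a b (MU a x b ?e ?p)" using MU_simps(2)[OF He(1) pp(1) He(4)] pp(3) by simp
        have P1: "PHI a (x # p) = MU a x b ?e ?p \<bullet> M' ?e a x b (ph a x) (PHI x p)" using p lp by simp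
        have k: "ok (MU a x b ?e ?p \<bullet> M' ?e a x b (ph a x) (PHI x p))" using Pxp(4) unfolding P1 .
        have "PH b c ?q \<bullet> PHI b q = PHI b q" by (rule unit_l') (use Pq in simp_all)
        then show ?thesis using M'_comp[OF mu1 k PH_simps(1)[OF q(1) refl], of "PHI b q"] Pq P1 PH_simps(2,4)[OF q(1) refl] q(4)
          by (simp del: PHI.simps)
      qed
      \<comment> \<open>What remains is the recursive clause of \<open>D.A\<close> for the image
        path: \<open>AL'_LL\<close> and \<open>M'_LL_gen\<close> show each factor below the same
        crossings, which then factor out.\<close>
      also have "AL' ?e ?P a x b c (ph a x) (LL x p) (LL b q) \<bullet> M' ?e a x c (ph a x) ?R = KK a ((x # p) @ q) \<odot> (u a \<otimes> D.A (f a) (map f (x # p)) (map f q))"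
      proof -
        let ?e' = "e' a x" and ?p' = "D.cmb (f x) (map f p)" and ?q' = "D.cmb (f b) (map f q)"
        have x1: "set [x] \<subseteq> CC" "x = last (a # [x])" using o by simp_all
        have px: "C.pth a [x] = ?e" "LL a [x] = ph a x" "KK a [x] \<odot> (u a \<otimes> ?e') = ph a x" using o(1,2) LL_one[of a x] by (simp_all add: unit_r' LL_def)
        have 1: "AL' ?e ?P a x b c (ph a x) (LL x p) (LL b q) = KK a (x # p @ q) \<odot> (u a \<otimes> D.AL (f a) (f x) (f b) (f c) ?e' ?p' ?q')"
          using AL'_LL[OF o(1) x1(1) o(5,6) x1(2) bx c] unfolding px by simp
        have 2: "M' ?e a x c (ph a x) ?R = KK a (x # p @ q) \<odot> (u a \<otimes> D.M (f a) (f x) (f c) ?e' ?A')"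
          using M'_LL_gen[OF o(1) x1(1) o(8) x1(2) cpq DA'(1) sA Fx] o(1,2) unfolding px by (simp add: unit_r')
        have D1: "D.A (f a) (map f (x # p)) (map f q) = D.AL (f a) (f x) (f b) (f c) ?e' ?p' ?q' \<bullet> D.M (f a) (f x) (f c) ?e' ?A'"
          using p qn lp lq by (simp add: last_map)
        have okD: "ok (D.AL (f a) (f x) (f b) (f c) ?e' ?p' ?q' \<bullet> D.M (f a) (f x) (f c) ?e' ?A')"
          using Fx Hp DA' cmbD(2,4)[OF o(2,5) refl] cmbD(2,4)[OF o(3,6) refl] o(1,2) D.HD(3)[OF DA'(1)] by simp
        have s1: "sr 1 (D.AL (f a) (f x) (f b) (f c) ?e' ?p' ?q') = D.pth (f a) (map f (x # p @ q))"
        proof -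
          have "sr 1 (D.AL (f a) (f x) (f b) (f c) ?e' ?p' ?q') = sr 1 (sr 2 (D.AL (f a) (f x) (f b) (f c) ?e' ?p' ?q'))" by simp
          also have "\<dots> = ?e' \<otimes> D.pth (f x) (map f p) \<otimes> D.pth (f b) (map f q)"
            using Fx Hp cmbD(2,3)[OF o(2,5) refl] cmbD(2,3)[OF o(3,6) refl] o(1,2) by (simp add: assoc)
          finally show ?thesis using D.pth_append[of "f x" "map f p" "map f q"] o map_in[of p] map_in[of q] lfp by simp
        qed
        have ud: "u a \<otimes> (D.AL (f a) (f x) (f b) (f c) ?e' ?p' ?q' \<bullet> D.M (f a) (f x) (f c) ?e' ?A')
          = (u a \<otimes> D.AL (f a) (f x) (f b) (f c) ?e' ?p' ?q') \<bullet> (u a \<otimes> D.M (f a) (f x) (f c) ?e' ?A')"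
          by (rule dist_l) (use okD o(1) D.HD[OF D.AL_simps(2)[OF Fx Hp]] in \<open>simp_all add: idn_def\<close>)
        have K2: "idn 2 (KK a (x # p @ q))" "tg 1 (KK a (x # p @ q)) = u a \<otimes> D.pth (f a) (map f (x # p @ q))"
          using KK[OF o(1), of "x # p @ q"] o by (simp_all del: KK KK.simps D.pth.simps list.map add: idn_def)
        have ok2: "ok ((u a \<otimes> D.AL (f a) (f x) (f b) (f c) ?e' ?p' ?q') \<bullet> (u a \<otimes> D.M (f a) (f x) (f c) ?e' ?A'))"
          unfolding ud[symmetric] using okD D.HD[OF D.AL_simps(2)[OF Fx Hp]] o(1) by simp
        show ?thesis unfolding 1 2 D1 ud append_Cons
          by (rule dist_l[symmetric, OF _ _ K2(1) ok2]) (use K2(2) s1 o(1) in \<open>simp_all del: D.pth.simps list.map\<close>)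
      qed
      finally show ?thesis using p lp by simp
    qed
  qed
qed

end

section \<open>3-cells modulo a congruence\<close>

text \<open>The \<open>3\<close>-cells modulo a congruence, with a lower-dimensional cell represented by its
  identity, form a single-sorted \<open>3\<close>-category.\<close>

locale cong3 = typed_data S p m for S :: "'g polygraph_data" and p m :: nat +
  fixes R :: "'g expr \<Rightarrow> 'g expr \<Rightarrow> bool"
  assumes m3: "3 \<le> m"
    and R_cell: "R x y \<Longrightarrow> cell S p x \<and> cell S p y \<and> cdim x = 3 \<and> cdim y = 3"
    and R_eqv: "eqv S p x y \<Longrightarrow> cdim x = 3 \<Longrightarrow> R x y"
    and R_sym: "R x y \<Longrightarrow> R y x" and R_trans: "R x y \<Longrightarrow> R y z \<Longrightarrow> R x z"
    and R_bd: "R x y \<Longrightarrow> eqv S p (src S x) (src S y) \<and> eqv S p (tgt S x) (tgt S y)"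
    and R_Cmp: "R x x' \<Longrightarrow> R y y' \<Longrightarrow> cell S p (Cmp i x y) \<Longrightarrow> R (Cmp i x y) (Cmp i x' y')"
begin

definition J where "J x = {y. R (pad (3 - cdim x) x) y}"
definition okq where "okq X \<longleftrightarrow> (\<exists>x. cell S p x \<and> cdim x = 3 \<and> X = J x)"
definition rp where "rp X = (SOME x. cell S p x \<and> cdim x = 3 \<and> X = J x)"
text \<open>The empty set is not a class, since \<open>R\<close> is reflexive on 3-cells; it serves
  as \<open>bt\<close>.\<close>

definition srq where "srq i X = (if okq X then J (src_at S i (rp X)) else {})"
definition tgq where "tgq i X = (if okq X then J (tgt_at S i (rp X)) else {})"
definition cpq where "cpq i X Y = (if okq X \<and> okq Y \<and> tgq i X = srq i Y then J (Cmp i (rp X) (rp Y)) else {})"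

lemma J_3: "cdim x = 3 \<Longrightarrow> y \<in> J x \<longleftrightarrow> R x y"
  by (simp add: J_def)

lemma J_iff3: assumes "cell S p x" "cdim x = 3" "J x = J y" "cdim y = 3" shows "R x y"
proof -
  have "x \<in> J y" using R_eqv[OF eqv_refl[OF assms(1)] assms(2)] J_3[OF assms(2)] assms(3) by blast
  then show ?thesis using J_3[OF assms(4)] R_sym by blast
qed

lemma R_J: assumes "R x y" shows "J x = J y"
proof -
  have "cdim x = 3" "cdim y = 3" using R_cell[OF assms] by simp_all
  then show ?thesis using J_3 assms R_sym R_trans by blast
qed

lemma pad_pad: "pad a (pad b x) = pad (a + b) x" by (simp add: pad_def funpow_add)

lemma J_pad: "k + cdim x \<le> 3 \<Longrightarrow> J (pad k x) = J x"
  by (simp add: J_def pad_pad)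

lemma J_Idt: "cdim x < 3 \<Longrightarrow> J (Idt x) = J x"
  using J_pad[of 1 x] by (simp add: One_nat_def)

lemma J_eqv: assumes "ceqv x y" "cdim x \<le> 3" shows "J x = J y"
proof -
  have d: "cdim y = cdim x" using eqv_dim[OF assms(1)] assms m3 by simp
  have "R (pad (3 - cdim x) x) (pad (3 - cdim x) y)" using eqv_pad[OF assms(1)] assms(2) by (intro R_eqv) simp_all
  from R_J[OF this] show ?thesis using d assms(2) J_pad[of "3 - cdim x" x] J_pad[of "3 - cdim x" y] by simp
qed

lemma okJ: assumes "cell S p x" "cdim x \<le> 3" shows "okq (J x)"
  unfolding okq_def by (rule exI[of _ "pad (3 - cdim x) x"]) (use assms cell_pad J_pad in auto)

text \<open>Below dimension 3 the congruence identifies nothing new: \<open>R\<close> preserves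
  sources up to \<open>eqv\<close>, and iterated sources undo the padding.\<close>

lemma J_faithful:
  assumes "cell S p x" "cell S p y" "cdim x = cdim y" "cdim x < 3" "J x = J y" shows "ceqv x y"
proof -
  let ?k = "3 - cdim x"
  have "J (pad ?k x) = J (pad ?k y)" using assms J_pad[of ?k x] J_pad[of ?k y] by simp
  then have "R (pad ?k x) (pad ?k y)" by (rule J_iff3[rotated 2]) (use assms cell_pad in simp_all)
  then have "ceqv (src S (pad ?k x)) (src S (pad ?k y))" using R_bd by blast
  moreover obtain j where j: "?k = Suc j" "cdim x + j = 2" using assms(4) by (cases ?k) auto
  ultimately have "ceqv (pad j x) (pad j y)" by simp
  from at_eqv[OF this, of "cdim x"] have "ceqv (src_at S (cdim x) (pad j x)) (src_at S (cdim x) (pad j y))"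
    using assms m3 j by simp
  then show ?thesis using src_at_pad[of S x j] src_at_pad[of S y j] assms(3) by simp
qed

lemma rp: assumes "okq X" shows "cell S p (rp X)" "cdim (rp X) = 3" "X = J (rp X)"
  using someI_ex[OF assms[unfolded okq_def]] unfolding rp_def by simp_all

lemma empty: "\<not> okq {}"
proof
  assume "okq {}"
  then obtain x where "cell S p x" "cdim x = 3" "{} = J x" by (auto simp: okq_def)
  moreover have "R x x" using calculation by (intro R_eqv eqv_refl)
  ultimately show False by (auto simp: J_def)
qed

lemma sr_J3:
  assumes x: "cell S p x" "cdim x = 3" and i: "i < 3"
  shows "srq i (J x) = J (src_at S i x)" "tgq i (J x) = J (tgt_at S i x)"
proof -
  have o: "okq (J x)" using x by (intro okJ) simp_all
  have r: "R (rp (J x)) x" using rp[OF o] x by (intro J_iff3) simp_all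
  have a: "src_at S i (rp (J x)) = src_at S i (src S (rp (J x)))" "src_at S i x = src_at S i (src S x)"
    "tgt_at S i (rp (J x)) = tgt_at S i (tgt S (rp (J x)))" "tgt_at S i x = tgt_at S i (tgt S x)"
    using at_Suc[of x i] at_Suc[of "rp (J x)" i] rp[OF o] x i m3 by simp_all
  have d: "cdim (src S (rp (J x))) = 2" "cdim (tgt S (rp (J x))) = 2" using bd_cell[of "rp (J x)"] rp[OF o] m3 by simp_all
  have "ceqv (src_at S i (rp (J x))) (src_at S i x)" "ceqv (tgt_at S i (rp (J x))) (tgt_at S i x)"
    unfolding a using R_bd[OF r] at_eqv[of "src S (rp (J x))" "src S x" i] at_eqv[of "tgt S (rp (J x))" "tgt S x" i] d i m3 by simp_all
  then show "srq i (J x) = J (src_at S i x)" "tgq i (J x) = J (tgt_at S i x)"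
    using at_cell[of "rp (J x)" i] rp[OF o] i m3 o by (simp_all add: srq_def tgq_def J_eqv)
qed

text \<open>\<open>J_pad\<close> is available up to dimension 3 only, whence the second
  disjunct.\<close>

lemma at_pad:
  assumes "cell S p x" "cdim x + k \<le> m" "i < cdim x + k"
  shows "J (src_at S i (pad k x)) = J (src_at S i x) \<or> 3 < cdim x + k"
    "J (tgt_at S i (pad k x)) = J (tgt_at S i x) \<or> 3 < cdim x + k"
proof -
  have "src_at S i (pad k x) = (if i < cdim x then src_at S i x else pad (i - cdim x) x) \<and>
    tgt_at S i (pad k x) = (if i < cdim x then tgt_at S i x else pad (i - cdim x) x)"
    using assms(2,3)
  proof (induction k)
    case (Suc k)
    have c: "cell S p (pad (Suc k) x)" by (rule cell_pad[OF assms(1)])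
    have "src_at S i (pad (Suc k) x) = src_at S i (pad k x)" "tgt_at S i (pad (Suc k) x) = tgt_at S i (pad k x)"
      using at_Suc[OF c, of i] Suc.prems by simp_all
    then show ?case using Suc by (cases "i = cdim x + k") auto
  qed simp
  then show "J (src_at S i (pad k x)) = J (src_at S i x) \<or> 3 < cdim x + k"
    "J (tgt_at S i (pad k x)) = J (tgt_at S i x) \<or> 3 < cdim x + k"
    using J_pad[of "i - cdim x" x] assms(3) by auto
qed

lemma sr_J:
  assumes x: "cell S p x" "cdim x \<le> 3" and i: "i < 3"
  shows "srq i (J x) = J (src_at S i x)" "tgq i (J x) = J (tgt_at S i x)"
  using sr_J3[of "pad (3 - cdim x) x" i] cell_pad[OF x(1)] J_pad[of "3 - cdim x" x] at_pad[of x "3 - cdim x" i] x i m3 by simp_all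

text \<open>Composability is a condition in dimension below 3, where \<open>J\<close> is faithful;
  it can thus be tested on any representatives.\<close>

lemma tg_sr_J:
  assumes "cell S p x" "cell S p y" "cdim x = 3" "cdim y = 3" "i < 3"
  shows "tgq i (J x) = srq i (J y) \<longleftrightarrow> cell S p (Cmp i x y)"
proof -
  have "tgq i (J x) = srq i (J y) \<longleftrightarrow> J (tgt_at S i x) = J (src_at S i y)" using assms by (simp add: sr_J)
  also have "\<dots> \<longleftrightarrow> ceqv (tgt_at S i x) (src_at S i y)"
    using J_faithful[of "tgt_at S i x" "src_at S i y"] J_eqv[of "tgt_at S i x" "src_at S i y"] at_cell[of x i] at_cell[of y i] assms m3 by auto
  finally show ?thesis using assms by (simp add: cell_Cmp_iff)
qed

lemma cp_J3:
  assumes "cell S p (Cmp i x y)" "cdim x = 3"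
  shows "cpq i (J x) (J y) = J (Cmp i x y)"
proof -
  have c: "cell S p x" "cell S p y" "cdim y = 3" "i < 3" using assms by (auto simp: cell_Cmp_iff)
  have o: "okq (J x)" "okq (J y)" using c assms(2) by (simp_all add: okJ)
  have r: "R x (rp (J x))" "R y (rp (J y))" using rp[OF o(1)] rp[OF o(2)] c assms(2) by (intro J_iff3; simp)+
  have "tgq i (J x) = srq i (J y)" using tg_sr_J[of x y i] c assms by simp
  then show ?thesis using R_J[OF R_Cmp[OF r assms(1)]] o by (simp add: cpq_def)
qed

lemma pad_Cmp:
  assumes "cell S p (Cmp i x y)" "cdim x + k \<le> m"
  shows "ceqv (pad k (Cmp i x y)) (Cmp i (pad k x) (pad k y))"
  using assms(2)
proof (induction k)
  case 0 then show ?case using assms(1) by (simp add: eqv_refl)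
next
  case (Suc k)
  have d: "cdim y = cdim x" using assms(1) by (simp add: cell_Cmp_iff)
  have IH: "ceqv (pad k (Cmp i x y)) (Cmp i (pad k x) (pad k y))" using Suc by simp
  have "ceqv (Idt (pad k (Cmp i x y))) (Idt (Cmp i (pad k x) (pad k y)))" by (rule eqv_id[OF IH])
  also have "ceqv (Idt (Cmp i (pad k x) (pad k y))) (Cmp i (Idt (pad k x)) (Idt (pad k y)))"
    using eqv_id_comp[OF eqv_cellD(2)[OF IH]] Suc.prems by simp
  finally (eqv_trans) show ?case by simp
qed

text \<open>Padding commutes with composition up to \<open>eqv\<close>, which reduces every
  dimension to the case of 3-cells.\<close>

lemma cp_J:
  assumes "cell S p (Cmp i x y)" "cdim x \<le> 3"
  shows "J (Cmp i x y) = cpq i (J x) (J y)"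
proof -
  let ?k = "3 - cdim x"
  have d: "cdim y = cdim x" using assms(1) by (simp add: cell_Cmp_iff)
  have e: "ceqv (pad ?k (Cmp i x y)) (Cmp i (pad ?k x) (pad ?k y))" using assms m3 by (intro pad_Cmp) simp_all
  have "J (Cmp i x y) = J (pad ?k (Cmp i x y))" using assms J_pad[of ?k "Cmp i x y"] by simp
  also have "\<dots> = J (Cmp i (pad ?k x) (pad ?k y))" using J_eqv[OF e] assms by simp
  also have "\<dots> = cpq i (J (pad ?k x)) (J (pad ?k y))" using cp_J3[OF eqv_cellD(2)[OF e]] assms by simp
  finally show ?thesis using J_pad[of ?k x] J_pad[of ?k y] d assms by simp
qed

lemma okE: assumes "okq X" obtains x where "X = J x" "cell S p x" "cdim x = 3"
  using assms okq_def by auto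

lemma okq_cp: assumes "i < 3" shows "okq (cpq i X Y) \<longleftrightarrow> okq X \<and> okq Y \<and> tgq i X = srq i Y"
proof
  assume "okq X \<and> okq Y \<and> tgq i X = srq i Y"
  then obtain x y where "X = J x" "cell S p x" "cdim x = 3" "Y = J y" "cell S p y" "cdim y = 3" "tgq i X = srq i Y"
    by (metis okE)
  then show "okq (cpq i X Y)" using tg_sr_J[of x y i] cp_J3[of i x y] assms okJ[of "Cmp i x y"] by simp
qed (auto simp: cpq_def empty split: if_splits)

lemma okq_sr: assumes "i < 3" shows "okq (srq i X) \<longleftrightarrow> okq X" "okq (tgq i X) \<longleftrightarrow> okq X"
proof -
  show "okq (srq i X) \<longleftrightarrow> okq X"
    using okJ[of "src_at S i (rp X)"] at_cell[of "rp X" i] rp[of X] assms m3 by (cases "okq X") (auto simp: srq_def empty)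
  show "okq (tgq i X) \<longleftrightarrow> okq X"
    using okJ[of "tgt_at S i (rp X)"] at_cell[of "rp X" i] rp[of X] assms m3 by (cases "okq X") (auto simp: tgq_def empty)
qed

lemma okq_cpE:
  assumes "okq (cpq i X Y)" "i < 3"
  obtains x y where "X = J x" "Y = J y" "cell S p (Cmp i x y)" "cell S p x" "cell S p y" "cdim x = 3" "cdim y = 3"
proof -
  obtain x y where "X = J x" "cell S p x" "cdim x = 3" "Y = J y" "cell S p y" "cdim y = 3" "tgq i X = srq i Y"
    using assms okq_cp by (metis okE)
  then show ?thesis using that[of x y] tg_sr_J[of x y i] assms by auto
qed

sublocale tcat3 okq cpq srq tgq "{}"
proof
  fix i j :: nat and x y z w
  show "i < 3 \<Longrightarrow> okq (cpq i x y) = (okq x \<and> okq y \<and> tgq i x = srq i y)" by (rule okq_cp)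
  show "i < 3 \<Longrightarrow> \<not> okq (cpq i x y) \<Longrightarrow> cpq i x y = {}" using okq_cp[of i x y] by (auto simp: cpq_def)
  show "\<not> okq {}" by (rule empty)
  show "i < 3 \<Longrightarrow> okq (srq i x) = okq x" "i < 3 \<Longrightarrow> okq (tgq i x) = okq x" by (rule okq_sr; assumption)+
  show "i < 3 \<Longrightarrow> \<not> okq x \<Longrightarrow> srq i x = {}" "i < 3 \<Longrightarrow> \<not> okq x \<Longrightarrow> tgq i x = {}" by (simp_all add: srq_def tgq_def)
next
  fix i j :: nat and x assume ij: "i \<le> j" "j < 3" and "okq x"
  then obtain a where a: "x = J a" "cell S p a" "cdim a = 3" using okE by blast
  note c = at_cell[OF a(2), of i] at_cell[OF a(2), of j] 
  show "srq i (srq j x) = srq i x" "tgq i (tgq j x) = tgq i x"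
    using a c ij m3 at_at[of i j a] by (simp_all add: sr_J)
  show "srq j (srq i x) = srq i x \<and> tgq j (srq i x) = srq i x \<and> srq j (tgq i x) = tgq i x \<and> tgq j (tgq i x) = tgq i x"
    using a c ij m3 by (simp add: sr_J)
next
  fix i j :: nat and x assume ij: "i < j" "j < 3" and "okq x"
  then obtain a where a: "x = J a" "cell S p a" "cdim a = 3" using okE by blast
  note c = at_cell[OF a(2), of i] at_cell[OF a(2), of j] 
  have g: "ceqv (src_at S i (tgt_at S j a)) (src_at S i a)" "ceqv (tgt_at S i (src_at S j a)) (tgt_at S i a)"
    using at_glob[of i j a] ij a m3 by simp_all
  have d: "cdim (src_at S i (tgt_at S j a)) = i" "cdim (tgt_at S i (src_at S j a)) = i"
    using at_cell[of "tgt_at S j a" i] at_cell[of "src_at S j a" i] c ij a m3 by simp_all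
  show "srq i (tgq j x) = srq i x" "tgq i (srq j x) = tgq i x"
    using a c ij m3 J_eqv[OF g(1)] J_eqv[OF g(2)] d by (simp_all add: sr_J)
next
  fix i j :: nat and x y assume ij: "j \<le> i" "i < 3" and "okq (cpq i x y)"
  then obtain a b where a: "x = J a" "y = J b" "cell S p (Cmp i a b)" "cell S p a" "cell S p b" "cdim a = 3" "cdim b = 3"
    using okq_cpE by blast
  show "srq j (cpq i x y) = srq j x \<and> tgq j (cpq i x y) = tgq j y"
    using a ij m3 at_Cmp_low[OF a(3), of j] by (simp add: cp_J[symmetric] sr_J)
next
  fix i j :: nat and x y assume ij: "i < j" "j < 3" and "okq (cpq i x y)"
  then obtain a b where a: "x = J a" "y = J b" "cell S p (Cmp i a b)" "cell S p a" "cell S p b" "cdim a = 3" "cdim b = 3"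
    using okq_cpE[of i x y] by auto
  show "srq j (cpq i x y) = cpq i (srq j x) (srq j y) \<and> tgq j (cpq i x y) = cpq i (tgq j x) (tgq j y)"
    using a ij m3 at_Cmp_high[OF a(3), of j] cell_bd_Cmp[OF a(3), of j] at_cell[OF a(4), of j] by (simp add: cp_J[symmetric] sr_J)
next
  fix i :: nat and x y z assume i: "i < 3" and ok: "okq (cpq i (cpq i x y) z)"
  then have "okq (cpq i x y)" "okq z" "tgq i (cpq i x y) = srq i z" using okq_cp by blast+
  then obtain a b c where a: "x = J a" "y = J b" "cell S p (Cmp i a b)" "cell S p a" "cell S p b" "cdim a = 3" "cdim b = 3"
     "z = J c" "cell S p c" "cdim c = 3" "tgq i (cpq i x y) = srq i z"
    using i by (metis okE okq_cpE)
  have 1: "cell S p (Cmp i (Cmp i a b) c)" using tg_sr_J[of "Cmp i a b" c i] a i by (simp add: cp_J[symmetric])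
  have 2: "cell S p (Cmp i a (Cmp i b c))" using assoc_cell[OF 1] a m3 by simp
  then have "cell S p (Cmp i b c)" by (simp add: cell_Cmp_iff)
  then show "cpq i (cpq i x y) z = cpq i x (cpq i y z)"
    using J_eqv[OF eqv_assoc[OF 1]] a 1 2 m3 by (simp add: cp_J[symmetric])
next
  fix i :: nat and x assume i: "i < 3" and "okq x"
  then obtain a where a: "x = J a" "cell S p a" "cdim a = 3" using okE by blast
  have c: "cell S p (Cmp i (pad (3 - i) (src_at S i a)) a)" "cell S p (Cmp i a (pad (3 - i) (tgt_at S i a)))"
    using unit_left_cell[of a i] unit_right_cell[of a i] a i m3 by simp_all
  have e: "ceqv (Cmp i (pad (3 - i) (src_at S i a)) a) a" "ceqv (Cmp i a (pad (3 - i) (tgt_at S i a))) a"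
    using eqv_unit_left[of a i] eqv_unit_right[of a i] a i m3 by simp_all
  have d: "cdim (src_at S i a) = i" "cdim (tgt_at S i a) = i" using at_cell[of a i] a i m3 by simp_all
  show "cpq i (srq i x) x = x" "cpq i x (tgq i x) = x"
    using J_eqv[OF e(1)] J_eqv[OF e(2)] cp_J[OF c(1)] cp_J[OF c(2)] a i d J_pad[of "3 - i" "src_at S i a"] J_pad[of "3 - i" "tgt_at S i a"]
    by (simp_all add: sr_J)
next
  fix i j :: nat and x y z w assume ij: "i < j" "j < 3" and ok: "okq (cpq i (cpq j x y) (cpq j z w))"
  then have o: "okq (cpq j x y)" "okq (cpq j z w)" "tgq i (cpq j x y) = srq i (cpq j z w)" using okq_cp[of i] by simp_all
  obtain a b where a: "x = J a" "y = J b" "cell S p (Cmp j a b)" "cell S p a" "cell S p b" "cdim a = 3" "cdim b = 3"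
    using okq_cpE[OF o(1) ij(2)] by blast
  obtain c d where c: "z = J c" "w = J d" "cell S p (Cmp j c d)" "cell S p c" "cell S p d" "cdim c = 3" "cdim d = 3"
    using okq_cpE[OF o(2) ij(2)] by blast
  have 1: "cell S p (Cmp i (Cmp j a b) (Cmp j c d))" using tg_sr_J[of "Cmp j a b" "Cmp j c d" i] a c ij o(3) by (simp add: cp_J[symmetric])
  have 2: "cell S p (Cmp j (Cmp i a c) (Cmp i b d))" using exchange_cell[OF 1] ij a m3 by simp
  then have "cell S p (Cmp i a c)" "cell S p (Cmp i b d)" by (simp_all add: cell_Cmp_iff)
  then show "cpq i (cpq j x y) (cpq j z w) = cpq j (cpq i x z) (cpq i y w)"
    using J_eqv[OF eqv_exchange[OF 1]] ij a c 1 2 m3 by (simp add: cp_J[symmetric])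
qed

end

section \<open>Invariants of 2-cells\<close>

context typed_data begin

lemma eqv_dim': "ceqv x y \<Longrightarrow> cdim y \<le> m \<Longrightarrow> cdim x = cdim y"
  using eqv_dim[OF eqv_sym] by simp

lemma eqv_dim_either: assumes "ceqv x y" "cdim x = d \<or> cdim y = d" "d \<le> m" shows "cdim x = d" "cdim y = d"
proof -
  have "cdim x = d \<and> cdim y = d"
    using assms(2)
  proof
    assume "cdim x = d" then show ?thesis using eqv_dim[OF assms(1)] assms(3) by simp
  next
    assume "cdim y = d" then show ?thesis using eqv_dim'[OF assms(1)] assms(3) by simp
  qed
  then show "cdim x = d" "cdim y = d" by simp_all
qed

lemma no_Cmp0: "cell S p (Cmp i x y) \<Longrightarrow> cdim x \<noteq> 0"
  by (simp add: cell_Cmp_iff)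

text \<open>Every axiom contains a composite, and composites have positive dimension; on 0-cells
  only the equivalence rules remain.\<close>

lemma eqv0: assumes "ceqv x y" "cdim x = 0" shows "x = y"
proof -
  have "(cell S p w \<longrightarrow> True) \<and> (ceqv x y \<longrightarrow> cdim x = 0 \<or> cdim y = 0 \<longrightarrow> x = y)" for w
  proof (induction rule: cell_eqv.induct)
    case (eqv_trans x y z)
    have "cdim x = 0 \<and> cdim z = 0 \<and> cdim y = 0" if "cdim x = 0 \<or> cdim z = 0"
      using that eqv_dim_either[OF eqv_trans(1), of 0, OF _ le0] eqv_dim_either[OF eqv_trans(3), of 0, OF _ le0] by metis
    then show ?case using eqv_trans(2,4) by metis
  next
    case (eqv_axiom x y)
    have c: "cell S p x" "cell S p y" using eqv_axiom by blast+
    have "cdim x \<noteq> 0 \<or> cdim y \<noteq> 0"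
      using eqv_axiom(1) c by cases (simp_all add: cell_Cmp_iff)
    then show ?case using eqv_dim_either[OF cell_eqv.eqv_axiom[OF eqv_axiom(1) c], of 0, OF _ le0] by metis
  next
    case (eqv_comp x x' y y' i)
    have "cell S p (Cmp i x y)" "cell S p (Cmp i x' y')" using eqv_comp by blast+
    then show ?case using no_Cmp0[of i x y] no_Cmp0[of i x' y'] by simp
  next
    case (eqv_sym x y) then show ?case by blast
  next
    case (eqv_id x y) show ?case by simp
  qed simp_all
  then show ?thesis using assms by blast
qed

text \<open>A 1-cell of a free category is a word in the generators. The inverse axioms would change
  the word; they are excluded by \<open>1 \<le> p\<close>.\<close>

lemma eqv1_atoms:
  assumes "ceqv x y" "cdim x = 1" "1 \<le> p" "1 \<le> m" shows "atoms1 x = atoms1 y"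
proof -
  have "(cell S p w \<longrightarrow> True) \<and> (ceqv x y \<longrightarrow> cdim x = 1 \<or> cdim y = 1 \<longrightarrow> atoms1 x = atoms1 y)" for w
  proof (induction rule: cell_eqv.induct)
    case (eqv_trans x y z)
    then show ?case using eqv_dim[of x y] eqv_dim'[of y z] assms(4) by auto
  next
    case (eqv_comp x x' y y' i)
    have d: "cdim y = cdim x" "cdim y' = cdim x'" using eqv_comp by (simp_all add: cell_Cmp_iff)
    have "cdim x = 1 \<or> cdim x' = 1 \<longrightarrow> cdim x = 1" using eqv_dim'[OF eqv_comp(1)] assms(4) by auto
    then show ?case using d eqv_comp by simp
  next
    case (eqv_axiom x y)
    have c: "cell S p x" "cell S p y" using eqv_axiom by blast+
    have e: "ceqv x y" by (rule cell_eqv.eqv_axiom[OF eqv_axiom(1) c])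
    show ?case
    proof
      assume "cdim x = 1 \<or> cdim y = 1"
      note d = eqv_dim_either[OF e this assms(4)]
      from eqv_axiom(1) show "atoms1 x = atoms1 y"
      proof cases
        case (unit_left i)
        then have "i = 0" using c d by (simp add: cell_Cmp_iff)
        then show ?thesis using unit_left d by (simp add: One_nat_def)
      next
        case (unit_right i)
        then have "i = 0" using c d by (simp add: cell_Cmp_iff)
        then show ?thesis using unit_right d by (simp add: One_nat_def)
      next
        case (exchange i j x y z w)
        then show ?thesis using c d by (simp add: cell_Cmp_iff)
      next
        case (id_comp i x y)
        then show ?thesis using c d by (simp add: cell_Cmp_iff cell_Idt_iff One_nat_def)
      next
        case (inverse_right k g)
        then have "cell S p (Inv (Suc k) g)" "k = 0" using c d by (simp_all add: cell_Cmp_iff One_nat_def)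
        then show ?thesis using assms(3) by (simp add: One_nat_def) (auto elim: cell_InvE)
      next
        case (inverse_left k g)
        then have "cell S p (Inv (Suc k) g)" "k = 0" using c d by (simp_all add: cell_Cmp_iff One_nat_def)
        then show ?thesis using assms(3) by (simp add: One_nat_def) (auto elim: cell_InvE)
      qed simp_all
    qed
  qed (use eqv0 in \<open>simp_all add: One_nat_def\<close>)
  then show ?thesis using assms by blast
qed

text \<open>Induction over equality of 2-cells. In this dimension composition is along 0-cells or
  1-cells and \<open>2 \<le> p\<close> excludes formal inverses, so each axiom becomes one or two
  concrete cases. The dimension of the middle term in \<open>trans\<close> is recovered from either
  end.\<close>

lemma eqv2_induct [consumes 2, case_names p2 m2 refl sym trans Idt Cmp assoc ul0 ul1 ur0 ur1 exch idc]:
  assumes "ceqv x y" "cdim x = 2" and p: "2 \<le> p" and m: "2 \<le> m"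
    and refl: "\<And>x. cell S p x \<Longrightarrow> cdim x = 2 \<Longrightarrow> Q x x"
    and sym: "\<And>x y. ceqv x y \<Longrightarrow> cdim x = 2 \<Longrightarrow> Q x y \<Longrightarrow> Q y x"
    and trans: "\<And>x y z. ceqv x y \<Longrightarrow> ceqv y z \<Longrightarrow> cdim x = 2 \<Longrightarrow> Q x y \<Longrightarrow> Q y z \<Longrightarrow> Q x z"
    and Idt: "\<And>x y. ceqv x y \<Longrightarrow> cdim x = 1 \<Longrightarrow> Q (Idt x) (Idt y)"
    and Cmp: "\<And>i x x' y y'. ceqv x x' \<Longrightarrow> ceqv y y' \<Longrightarrow> Q x x' \<Longrightarrow> Q y y' \<Longrightarrow> cell S p (Cmp i x y) \<Longrightarrow>
      cell S p (Cmp i x' y') \<Longrightarrow> cdim x = 2 \<Longrightarrow> i = 0 \<or> i = 1 \<Longrightarrow> Q (Cmp i x y) (Cmp i x' y')"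
    and asc: "\<And>i x y z. cell S p (Cmp i (Cmp i x y) z) \<Longrightarrow> cell S p (Cmp i x (Cmp i y z)) \<Longrightarrow> cdim x = 2 \<Longrightarrow>
      i = 0 \<or> i = 1 \<Longrightarrow> Q (Cmp i (Cmp i x y) z) (Cmp i x (Cmp i y z))"
    and ul0: "\<And>x. cell S p x \<Longrightarrow> cdim x = 2 \<Longrightarrow> Q (Cmp 0 (Idt (Idt (src_at S 0 x))) x) x"
    and ul1: "\<And>x. cell S p x \<Longrightarrow> cdim x = 2 \<Longrightarrow> Q (Cmp 1 (Idt (src S x)) x) x"
    and ur0: "\<And>x. cell S p x \<Longrightarrow> cdim x = 2 \<Longrightarrow> Q (Cmp 0 x (Idt (Idt (tgt_at S 0 x)))) x"
    and ur1: "\<And>x. cell S p x \<Longrightarrow> cdim x = 2 \<Longrightarrow> Q (Cmp 1 x (Idt (tgt S x))) x"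
    and exch: "\<And>x y z w. cell S p (Cmp 0 (Cmp 1 x y) (Cmp 1 z w)) \<Longrightarrow> cell S p (Cmp 1 (Cmp 0 x z) (Cmp 0 y w)) \<Longrightarrow>
      cdim x = 2 \<Longrightarrow> Q (Cmp 0 (Cmp 1 x y) (Cmp 1 z w)) (Cmp 1 (Cmp 0 x z) (Cmp 0 y w))"
    and idc: "\<And>x y. cell S p (Cmp 0 x y) \<Longrightarrow> cdim x = 1 \<Longrightarrow> Q (Idt (Cmp 0 x y)) (Cmp 0 (Idt x) (Idt y))"
  shows "Q x y"
proof -
  have "(cell S p w \<longrightarrow> True) \<and> (ceqv x y \<longrightarrow> cdim x = 2 \<or> cdim y = 2 \<longrightarrow> Q x y)" for w
  proof (induction rule: cell_eqv.induct)
    case (eqv_refl x) then show ?case using refl by blast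
  next
    case (eqv_sym x y)
    then have "cdim x = 2 \<or> cdim y = 2 \<Longrightarrow> cdim x = 2" using eqv_dim'[of x y] m by auto
    then show ?case using sym[of x y] eqv_sym by blast
  next
    case (eqv_trans x y z)
    have "cdim x = 2 \<and> cdim y = 2" if "cdim x = 2 \<or> cdim z = 2"
    proof (cases "cdim x = 2")
      case True then show ?thesis using eqv_dim[OF eqv_trans(1)] m by simp
    next
      case False
      then have "cdim y = 2" using that eqv_dim'[OF eqv_trans(3)] m by simp
      then show ?thesis using eqv_dim'[OF eqv_trans(1)] m by simp
    qed
    then show ?case using trans[of x y z] eqv_trans by blast
  next
    case (eqv_id x y)
    have "cdim (Idt x) = 2 \<or> cdim (Idt y) = 2 \<Longrightarrow> cdim x = 1"
      using eqv_dim'[OF eqv_id(1)] m by (auto simp: One_nat_def numeral_2_eq_2)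
    then show ?case using Idt[OF eqv_id(1)] by blast
  next
    case (eqv_comp x x' y y' i)
    show ?case
    proof
      assume "cdim (Cmp i x y) = 2 \<or> cdim (Cmp i x' y') = 2"
      then have "cdim x = 2 \<or> cdim x' = 2" by simp
      note d = eqv_dim_either[OF eqv_comp(1) this m]
      have c: "cell S p (Cmp i x y)" "cell S p (Cmp i x' y')" using eqv_comp by blast+
      have dy: "cdim y = 2" "i < 2" using c(1) d by (simp_all add: cell_Cmp_iff)
      then have "i = 0 \<or> i = 1" by auto
      then show "Q (Cmp i x y) (Cmp i x' y')" using Cmp[of x x' y y' i] eqv_comp c d dy by simp
    qed
  next
    case (eqv_axiom l r)
    have cl: "cell S p l" "cell S p r" using eqv_axiom by blast+
    have lr: "ceqv l r" by (rule cell_eqv.eqv_axiom[OF eqv_axiom(1) cl])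
    show ?case
    proof
      assume "cdim l = 2 \<or> cdim r = 2"
      note dd = eqv_dim_either[OF lr this m]
      have Cd: "cdim x = 2 \<and> (i = 0 \<or> i = 1) \<and> cell S p x \<and> cell S p y" if "l = Cmp i x y \<or> r = Cmp i x y" for i x y
      proof -
        have c: "cell S p (Cmp i x y)" "cdim x = 2" using that cl dd by auto
        then have c': "i < 2" "cell S p x" "cell S p y" by (simp_all add: cell_Cmp_iff)
        then have "i = 0 \<or> i = 1" by auto
        then show ?thesis using c c' by simp
      qed
      from eqv_axiom(1) show "Q l r"
      proof cases
        case (assoc i x y z)
        then show ?thesis using asc[of i x y z] cl dd Cd[OF disjI1[OF assoc(1)]] by simp
      next
        case (unit_left i)
        have "src_at S 1 r = src S r" using dd by (simp add: src_at_def numeral_2_eq_2 One_nat_def)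
        then have "Q (Cmp i (pad (cdim r - i) (src_at S i r)) r) r"
          using ul0[of r] ul1[of r] cl(2) dd(2) Cd[OF disjI1[OF unit_left(1)]] by (auto simp: numeral_2_eq_2 One_nat_def)
        then show ?thesis unfolding unit_left(1)[symmetric] .
      next
        case (unit_right i)
        have "tgt_at S 1 r = tgt S r" using dd by (simp add: tgt_at_def numeral_2_eq_2 One_nat_def)
        then have "Q (Cmp i r (pad (cdim r - i) (tgt_at S i r))) r"
          using ur0[of r] ur1[of r] cl(2) dd(2) Cd[OF disjI1[OF unit_right(1)]] by (auto simp: numeral_2_eq_2 One_nat_def)
        then show ?thesis unfolding unit_right(1)[symmetric] .
      next
        case (exchange i j x y z w)
        have "i = 0" "j = 1" using Cd[OF disjI1[OF exchange(1)]] Cd[OF disjI2[OF exchange(2)]] exchange(3) by auto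
        then show ?thesis using exch[of x y z w] cl exchange dd by simp
      next
        case (id_comp i x y)
        then have "i = 0" "cdim x = 1" using cl dd by (simp_all add: cell_Cmp_iff cell_Idt_iff numeral_2_eq_2 One_nat_def)
        then show ?thesis using idc[of x y] cl id_comp by (simp add: cell_Idt_iff)
      next
        case (inverse_right k g)
        then have "cell S p (Inv 2 g)" using Cd[OF disjI1[OF inverse_right(1)]] by (auto simp: numeral_2_eq_2)
        then show ?thesis using p by (auto elim: cell_InvE)
      next
        case (inverse_left k g)
        then have "cell S p (Inv 2 g)" using Cd[OF disjI1[OF inverse_left(1)]] by (auto simp: numeral_2_eq_2)
        then show ?thesis using p by (auto elim: cell_InvE)
      qed
    qed
  qed simp_all
  then show ?thesis using assms(1,2) by blast
qed

lemma atoms_bd: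
  assumes "ceqv x y" "cdim x = 2" "2 \<le> p" "2 \<le> m" shows "atoms1 (src S x) = atoms1 (src S y)" "atoms1 (tgt S x) = atoms1 (tgt S y)"
proof -
  have "ceqv (src S x) (src S y)" "ceqv (tgt S x) (tgt S y)" using good_eqvI[OF assms(1)] assms by (simp_all add: good_eqv_def)
  moreover have "cdim (src S x) = 1" "cdim (tgt S x) = 1" using bd_cell[OF eqv_cellD(1)[OF assms(1)]] assms by simp_all
  ultimately show "atoms1 (src S x) = atoms1 (src S y)" "atoms1 (tgt S x) = atoms1 (tgt S y)" using eqv1_atoms assms by simp_all
qed

lemma Cmp1_atoms:
  assumes "cell S p (Cmp 1 x y)" "cdim x = 2" "2 \<le> p" "2 \<le> m"
  shows "atoms1 (tgt S x) = atoms1 (src S y)"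
proof -
  have "cdim y = 2" "cell S p x" "ceqv (tgt_at S 1 x) (src_at S 1 y)" using assms by (simp_all add: cell_Cmp_iff)
  then have "ceqv (tgt S x) (src S y)" "cdim (tgt S x) = 1" using assms(2,4) bd_cell[of x]
    by (simp_all add: src_at_def tgt_at_def)
  then show ?thesis using eqv1_atoms assms by simp
qed

lemma cmp1_cases:
  assumes "cell S p (Cmp i x y)" "cdim x = 2"
  obtains (0) "i = 0" "cell S p x" "cell S p y" "cdim y = 2" | (1) "i = 1" "cell S p x" "cell S p y" "cdim y = 2"
proof -
  have c: "cell S p x" "cell S p y" "cdim y = 2" "i < 2" using assms by (simp_all add: cell_Cmp_iff)
  then have "i = 0 \<or> i = 1" by auto
  then show thesis using 0 1 c by blast
qed

lemma bd2_simps: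
  "cdim x = 2 \<Longrightarrow> src S (Cmp 0 x y) = Cmp 0 (src S x) (src S y)"
  "cdim x = 2 \<Longrightarrow> tgt S (Cmp 0 x y) = Cmp 0 (tgt S x) (tgt S y)"
  "cdim x = 2 \<Longrightarrow> src S (Cmp 1 x y) = src S x"
  "cdim x = 2 \<Longrightarrow> tgt S (Cmp 1 x y) = tgt S y"
  by (auto simp: One_nat_def)

end

text \<open>A \<open>2\<close>-functor on the free \<open>2\<close>-category, given on generating \<open>2\<close>-cells by functions \<open>G\<close>
  between lists with one entry for each generating \<open>1\<close>-cell in the boundary.\<close>

primrec sem :: "'g polygraph_data \<Rightarrow> ('g \<Rightarrow> 'v list \<Rightarrow> 'v list) \<Rightarrow> 'g expr \<Rightarrow> 'v list \<Rightarrow> 'v list" where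
  "sem S G (Gen k g) l = G g l"
\<comment> \<open>A default value: for \<open>2 \<le> p\<close> a 2-cell contains no formal
  inverse.\<close>
| "sem S G (Inv k g) l = l"
| "sem S G (Idt x) l = l"
| "sem S G (Cmp i x y) l = (if i = 0 then
     sem S G x (take (length (atoms1 (src S x))) l) @ sem S G y (drop (length (atoms1 (src S x))) l)
     else sem S G y (sem S G x l))"

locale sem_data = typed_data S p m for S :: "'g polygraph_data" and p m :: nat +
  fixes G :: "'g \<Rightarrow> 'v list \<Rightarrow> 'v list"
  assumes p2: "2 \<le> p" and m2: "2 \<le> m"
    and G_length: "g \<in> gens S 2 \<Longrightarrow> length l = length (atoms1 (gsrc S 2 g)) \<Longrightarrow> length (G g l) = length (atoms1 (gtgt S 2 g))"
begin

abbreviation "sm \<equiv> sem S G"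

lemma sem_length:
  "cell S p x \<Longrightarrow> cdim x = 2 \<Longrightarrow> length l = length (atoms1 (src S x)) \<Longrightarrow> length (sm x l) = length (atoms1 (tgt S x))"
proof (induction x arbitrary: l)
  case (Gen k g) then show ?case using G_length by (simp add: cell_Gen_iff)
next
  case (Inv k g) then show ?case using p2 by (auto elim: cell_InvE)
next
  case (Cmp i x y)
  have d: "cdim x = 2" using Cmp.prems by simp
  from Cmp.prems(1) d show ?case
  proof (cases rule: cmp1_cases)
    case 0
    then show ?thesis using Cmp.IH Cmp.prems(3) d by (simp add: bd2_simps)
  next
    case 1
    then show ?thesis using Cmp.IH Cmp.prems(1,3) Cmp1_atoms[of x y] p2 m2 d by (simp add: bd2_simps)
  qed
qed simp

lemma sem_eqv:
  assumes "ceqv x y" "cdim x = 2" "length l = length (atoms1 (src S x))"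
  shows "sm x l = sm y l"
proof -
  have "\<forall>l. length l = length (atoms1 (src S x)) \<longrightarrow> sm x l = sm y l"
    using assms(1,2)
  proof (induction rule: eqv2_induct)
    case (sym x y)
    then show ?case using atoms_bd[of x y] p2 m2 by simp
  next
    case (trans x y z)
    then show ?case using atoms_bd[of x y] p2 m2 by simp
  next
    case (Cmp i x x' y y')
    from Cmp(3,5) show ?case
    proof (cases rule: cmp1_cases[of i x y])
      case 0
      then show ?thesis using Cmp atoms_bd[of x x'] p2 m2 by (simp add: bd2_simps)
    next
      case 1
      then show ?thesis using Cmp atoms_bd[of x x'] sem_length[of x] Cmp1_atoms[of x y] p2 m2 by (simp add: bd2_simps)
    qed
  next
    case (assoc i x y z)
    then have d: "cdim y = 2" "cell S p x" "cell S p y" by (auto simp: cell_Cmp_iff)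
    show ?case
    proof (cases "i = 0")
      case True
      then show ?thesis using assoc d by (simp add: bd2_simps drop_take add.commute)
    qed (use assoc in simp)
  next
    case (ul1 x) then show ?case by simp
  next
    case (exch x y z w)
    have d: "cdim y = 2" "cdim z = 2" "cdim w = 2" "cell S p x" "cell S p z" "cell S p (Cmp 1 x y)"
      using exch by (auto simp: cell_Cmp_iff)
    \<comment> \<open>The list is cut at the same place before and after \<open>x\<close> and
      \<open>z\<close> act, because \<open>sm\<close> turns the length of the source into that of
      the target.\<close>
    then have "atoms1 (tgt S x) = atoms1 (src S y)" using Cmp1_atoms p2 m2 exch by simp
    then show ?case using exch d sem_length[of x] by (simp add: bd2_simps)
  next
    case (ur0 x) 
    then show ?case using sem_length[of x] by (simp add: bd2_simps)
  qed (use p2 m2 in \<open>simp_all add: bd2_simps\<close>)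
  then show ?thesis using assms(3) by blast
qed

end

section \<open>Evaluation of cells\<close>

context cong3 begin

abbreviation J0 (infixr "\<otimes>" 75) where "x \<otimes> y \<equiv> cpq 0 x y"
abbreviation J1 (infixr "\<odot>" 70) where "x \<odot> y \<equiv> cpq 1 x y"
abbreviation J2 (infixr "\<bullet>" 65) where "x \<bullet> y \<equiv> cpq 2 x y"

text \<open>Agrees with \<open>J\<close> on cells of dimension at most 3, but computes by recursion
  on every expression, so that boundaries of generators are evaluated by simplification
  alone.\<close>

primrec ev where
  "ev (Gen k g) = J (Gen k g)"
| "ev (Inv k g) = J (Inv k g)"
| "ev (Idt x) = ev x"
| "ev (Cmp i x y) = cpq i (ev x) (ev y)"

lemma ev_pad [simp]: "ev (pad k x) = ev x"
  by (induction k) simp_all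

lemma ev_wcmp [simp]: "ev (wcmp i x y) = cpq i (ev x) (ev y)"
  by (simp add: wcmp_def)

lemma J_ev: "cell S p x \<Longrightarrow> cdim x \<le> 3 \<Longrightarrow> J x = ev x"
proof (induction x)
  case (Idt x) then show ?case using J_Idt[of x] by (simp add: cell_Idt_iff)
next
  case (Cmp i x y)
  then have "cell S p x" "cell S p y" "cdim y = cdim x" by (simp_all add: cell_Cmp_iff)
  then show ?case using Cmp cp_J[of i x y] by simp
qed simp_all

lemma ok_ev: "cell S p x \<Longrightarrow> cdim x \<le> 3 \<Longrightarrow> okq (ev x)"
  using okJ[of x] J_ev[of x] by simp

lemma bd_ev:
  assumes "cell S p x" "cdim x = Suc k" "k < 3"
  shows "srq k (ev x) = ev (src S x)" "tgq k (ev x) = ev (tgt S x)"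
proof -
  have "src_at S k x = src S x" "tgt_at S k x = tgt S x" using assms by (simp_all add: src_at_def tgt_at_def)
  then show "srq k (ev x) = ev (src S x)" "tgq k (ev x) = ev (tgt S x)"
    using sr_J[of x k] assms bd_cell[of x] m3 by (simp_all add: J_ev)
qed

lemma idn_ev: assumes "cell S p x" "cdim x = k" "k < 3" shows "idn k (ev x)"
  using sr_J[of x k] okJ[of x] assms by (simp add: idn_def J_ev)

lemma ev_eqv: "ceqv x y \<Longrightarrow> cdim x \<le> 3 \<Longrightarrow> ev x = ev y"
  using J_eqv[of x y] J_ev[of x] J_ev[of y] eqv_cellD[of S p x y] eqv_dim[of x y] m3 by simp

lemma ev_faithful: "cell S p x \<Longrightarrow> cell S p y \<Longrightarrow> cdim x = cdim y \<Longrightarrow> cdim x < 3 \<Longrightarrow> ev x = ev y \<Longrightarrow> ceqv x y"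
  using J_faithful[of x y] by (simp add: J_ev)

lemma R_ev: "R x y \<Longrightarrow> ev x = ev y"
  using R_J[of x y] R_cell[of x y] by (simp add: J_ev)

lemma ev_R: "cell S p x \<Longrightarrow> cell S p y \<Longrightarrow> cdim x = 3 \<Longrightarrow> cdim y = 3 \<Longrightarrow> ev x = ev y \<Longrightarrow> R x y"
  by (rule J_iff3) (simp_all add: J_ev)

lemma gen_ev:
  assumes "g \<in> gens S (Suc k)" "k < 3"
  shows "okq (J (Gen (Suc k) g))" "srq k (J (Gen (Suc k) g)) = ev (gsrc S (Suc k) g)" "tgq k (J (Gen (Suc k) g)) = ev (gtgt S (Suc k) g)"
  using bd_ev[of "Gen (Suc k) g" k] okJ[of "Gen (Suc k) g"] assms by (simp_all add: cell_Gen_iff)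

lemma gen_idn: "g \<in> gens S k \<Longrightarrow> k < 3 \<Longrightarrow> idn k (J (Gen k g))"
  using idn_ev[of "Gen k g" k] by (simp add: cell_Gen_iff)

end

locale bicat_model = bicat_in S p C h + cong3 S p m R
  for S :: "'g polygraph_data" and p m :: nat and R and C :: "'c set" and h :: "'c bicat_gen \<Rightarrow> 'g"
begin

lemma gens_h:
  "a \<in> C \<Longrightarrow> h (ObG a) \<in> gens S 0"
  "a \<in> C \<Longrightarrow> b \<in> C \<Longrightarrow> h (EG a b) \<in> gens S (Suc 0)"
  "a \<in> C \<Longrightarrow> b \<in> C \<Longrightarrow> c \<in> C \<Longrightarrow> h (MG a b c) \<in> gens S (Suc 1)"
  "a \<in> C \<Longrightarrow> h (IG a) \<in> gens S (Suc 1)"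
  "a \<in> C \<Longrightarrow> b \<in> C \<Longrightarrow> c \<in> C \<Longrightarrow> d \<in> C \<Longrightarrow> h (AlphaG a b c d) \<in> gens S (Suc 2)"
  "a \<in> C \<Longrightarrow> b \<in> C \<Longrightarrow> h (LambdaG a b) \<in> gens S (Suc 2)"
  "a \<in> C \<Longrightarrow> b \<in> C \<Longrightarrow> h (RhoG a b) \<in> gens S (Suc 2)"
  using h_gen_simps by (simp_all add: numeral_2_eq_2 One_nat_def)

sublocale B: bicat_alg okq cpq srq tgq "{}" C "\<lambda>a. J (obj_c h a)" "\<lambda>a b. J (e_c h a b)" "\<lambda>a. J (i_c h a)"
  "\<lambda>a b c. J (m_c h a b c)" "\<lambda>a b c d. J (alpha_c h a b c d)" "\<lambda>a b. J (lambda_c h a b)" "\<lambda>a b. J (rho_c h a b)"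
proof
  fix a b c d
  have n: "Suc 0 = 1" "Suc 1 = 2" "Suc 2 = 3" by simp_all
  show "a \<in> C \<Longrightarrow> idn 0 (J (obj_c h a))" by (rule gen_idn[OF gens_h(1)]) simp_all
  show "a \<in> C \<Longrightarrow> b \<in> C \<Longrightarrow> idn 1 (J (e_c h a b)) \<and> srq 0 (J (e_c h a b)) = J (obj_c h a) \<and> tgq 0 (J (e_c h a b)) = J (obj_c h b)"
    using gen_idn[OF gens_h(2)] gen_ev[OF gens_h(2)] unfolding n by (simp add: h_src)
  show "a \<in> C \<Longrightarrow> idn 2 (J (i_c h a)) \<and> srq 1 (J (i_c h a)) = J (obj_c h a) \<and> tgq 1 (J (i_c h a)) = J (e_c h a a)"
    using gen_idn[OF gens_h(4)] gen_ev[OF gens_h(4)] unfolding n by (simp add: h_src)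
  show "a \<in> C \<Longrightarrow> b \<in> C \<Longrightarrow> c \<in> C \<Longrightarrow> idn 2 (J (m_c h a b c)) \<and> srq 1 (J (m_c h a b c)) = J (e_c h a b) \<otimes> J (e_c h b c) \<and>
    tgq 1 (J (m_c h a b c)) = J (e_c h a c)"
    using gen_idn[OF gens_h(3)] gen_ev[OF gens_h(3)] unfolding n by (simp add: h_src)
  show "a \<in> C \<Longrightarrow> b \<in> C \<Longrightarrow> c \<in> C \<Longrightarrow> d \<in> C \<Longrightarrow> okq (J (alpha_c h a b c d)) \<and>
     srq 2 (J (alpha_c h a b c d)) = (J (m_c h a b c) \<otimes> J (e_c h c d)) \<odot> J (m_c h a c d) \<and>
     tgq 2 (J (alpha_c h a b c d)) = (J (e_c h a b) \<otimes> J (m_c h b c d)) \<odot> J (m_c h a b d)"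
    using gen_ev[OF gens_h(5)] unfolding n by (simp add: h_src)
  show "a \<in> C \<Longrightarrow> b \<in> C \<Longrightarrow> okq (J (lambda_c h a b)) \<and> srq 2 (J (lambda_c h a b)) = (J (i_c h a) \<otimes> J (e_c h a b)) \<odot> J (m_c h a a b) \<and>
     tgq 2 (J (lambda_c h a b)) = J (e_c h a b)"
    using gen_ev[OF gens_h(6)] unfolding n by (simp add: h_src)
  show "a \<in> C \<Longrightarrow> b \<in> C \<Longrightarrow> okq (J (rho_c h a b)) \<and> srq 2 (J (rho_c h a b)) = (J (e_c h a b) \<otimes> J (i_c h b)) \<odot> J (m_c h a b b) \<and>
     tgq 2 (J (rho_c h a b)) = J (e_c h a b)"
    using gen_ev[OF gens_h(7)] unfolding n by (simp add: h_src)
qed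

end

context pf_typed begin

lemma gens1_cases:
  assumes "g \<in> gens P 1"
  obtains a b where "g = InC (EG a b)" "a \<in> C" "b \<in> C" | a b where "g = InD (EG a b)" "a \<in> D" "b \<in> D" | a where "g = UG a" "a \<in> C"
  using assms by (auto simp: gens_P bicat_gens_def pf_new_gens_def)

lemma gens2_cases:
  assumes "g \<in> gens P 2"
  obtains a b c where "g = InC (MG a b c)" "a \<in> C" "b \<in> C" "c \<in> C"
  | a where "g = InC (IG a)" "a \<in> C"
  | a b c where "g = InD (MG a b c)" "a \<in> D" "b \<in> D" "c \<in> D"
  | a where "g = InD (IG a)" "a \<in> D"
  | a b where "g = PhiG a b" "a \<in> C" "b \<in> C"
  using assms by (auto simp: gens_P bicat_gens_def pf_new_gens_def)

lemma gens3_cases: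
  assumes "g \<in> gens P 3"
  obtains a b c d where "g = InC (AlphaG a b c d)" "a \<in> C" "b \<in> C" "c \<in> C" "d \<in> C"
  | a b where "g = InC (LambdaG a b)" "a \<in> C" "b \<in> C"
  | a b where "g = InC (RhoG a b)" "a \<in> C" "b \<in> C"
  | a b c d where "g = InD (AlphaG a b c d)" "a \<in> D" "b \<in> D" "c \<in> D" "d \<in> D"
  | a b where "g = InD (LambdaG a b)" "a \<in> D" "b \<in> D"
  | a b where "g = InD (RhoG a b)" "a \<in> D" "b \<in> D"
  | a b c where "g = MuG a b c" "a \<in> C" "b \<in> C" "c \<in> C"
  | a where "g = NuG a" "a \<in> C"
  using assms by (auto simp: gens_P bicat_gens_def pf_new_gens_def)

lemma gens4:
  "a \<in> C \<Longrightarrow> b \<in> C \<Longrightarrow> c \<in> C \<Longrightarrow> d \<in> C \<Longrightarrow> x \<in> C \<Longrightarrow> InC (PiG a b c d x) \<in> gens P 4"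
  "a \<in> C \<Longrightarrow> b \<in> C \<Longrightarrow> c \<in> C \<Longrightarrow> InC (KappaG a b c) \<in> gens P 4"
  "a' \<in> D \<Longrightarrow> b' \<in> D \<Longrightarrow> c' \<in> D \<Longrightarrow> d' \<in> D \<Longrightarrow> x' \<in> D \<Longrightarrow> InD (PiG a' b' c' d' x') \<in> gens P 4"
  "a' \<in> D \<Longrightarrow> b' \<in> D \<Longrightarrow> c' \<in> D \<Longrightarrow> InD (KappaG a' b' c') \<in> gens P 4"
  "a \<in> C \<Longrightarrow> b \<in> C \<Longrightarrow> c \<in> C \<Longrightarrow> d \<in> C \<Longrightarrow> AlphaMuG a b c d \<in> gens P 4"
  "a \<in> C \<Longrightarrow> b \<in> C \<Longrightarrow> RhoMuG a b \<in> gens P 4"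
  "a \<in> C \<Longrightarrow> b \<in> C \<Longrightarrow> LambdaMuG a b \<in> gens P 4"
  by (auto simp: gens_P bicat_gens_def pf_new_gens_def)

end

lemma wcmp_low: "cdim x = cdim y \<Longrightarrow> wcmp i x y = Cmp i x y" by (simp add: wcmp_def)

text \<open>Covers both applications: \<open>p = 3\<close> with equality as \<open>R\<close> for
  confluence, \<open>p = 2\<close> with existence of a 4-cell as \<open>R\<close> for coherence. In
  either case formal inverses occur above dimension 2 only.\<close>

locale pf_model = pf_typed C D f p + cong3 "PFonct C D f" p m R
  for C :: "'c set" and D :: "'d set" and f :: "'c \<Rightarrow> 'd" and p m :: nat and R +
  assumes p2: "2 \<le> p"
begin

abbreviation P0 (infixr "\<otimes>" 75) where "x \<otimes> y \<equiv> cpq 0 x y"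
abbreviation P1 (infixr "\<odot>" 70) where "x \<odot> y \<equiv> cpq 1 x y"
abbreviation P2 (infixr "\<bullet>" 65) where "x \<bullet> y \<equiv> cpq 2 x y"

sublocale MC: bicat_model P p m R C InC by unfold_locales
sublocale MD: bicat_model P p m R D InD by unfold_locales

lemma gens_new:
  "a \<in> C \<Longrightarrow> UG a \<in> gens P (Suc 0)"
  "a \<in> C \<Longrightarrow> b \<in> C \<Longrightarrow> PhiG a b \<in> gens P (Suc 1)"
  "a \<in> C \<Longrightarrow> b \<in> C \<Longrightarrow> c \<in> C \<Longrightarrow> MuG a b c \<in> gens P (Suc 2)"
  "a \<in> C \<Longrightarrow> NuG a \<in> gens P (Suc 2)"
  using new_gens_simps by (simp_all add: numeral_2_eq_2 One_nat_def)

sublocale Q: pf_alg okq cpq srq tgq "{}"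
  C "\<lambda>a. J (obj_c InC a)" "\<lambda>a b. J (e_c InC a b)" "\<lambda>a. J (i_c InC a)"
  "\<lambda>a b c. J (m_c InC a b c)" "\<lambda>a b c d. J (alpha_c InC a b c d)" "\<lambda>a b. J (lambda_c InC a b)" "\<lambda>a b. J (rho_c InC a b)"
  D "\<lambda>a. J (obj_c InD a)" "\<lambda>a b. J (e_c InD a b)" "\<lambda>a. J (i_c InD a)"
  "\<lambda>a b c. J (m_c InD a b c)" "\<lambda>a b c d. J (alpha_c InD a b c d)" "\<lambda>a b. J (lambda_c InD a b)" "\<lambda>a b. J (rho_c InD a b)"
  f "\<lambda>a. J (u_c a)" "\<lambda>a b. J (phi_c a b)" "\<lambda>a b c. J (mu_c a b c)" "\<lambda>a. J (nu_c a)"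
proof
  fix a b c
  have n: "Suc 0 = 1" "Suc 1 = 2" "Suc 2 = 3" by simp_all
  show "a \<in> C \<Longrightarrow> f a \<in> D" by (rule fD)
  show "a \<in> C \<Longrightarrow> idn 1 (J (u_c a)) \<and> srq 0 (J (u_c a)) = J (obj_c InC a) \<and> tgq 0 (J (u_c a)) = J (obj_c InD (f a))"
    using gen_idn[OF gens_new(1)] gen_ev[OF gens_new(1)] unfolding n by (simp add: src_P)
  show "a \<in> C \<Longrightarrow> b \<in> C \<Longrightarrow> idn 2 (J (phi_c a b)) \<and> srq 1 (J (phi_c a b)) = J (e_c InC a b) \<otimes> J (u_c b) \<and>
    tgq 1 (J (phi_c a b)) = J (u_c a) \<otimes> J (e_c InD (f a) (f b))"
    using gen_idn[OF gens_new(2)] gen_ev[OF gens_new(2)] unfolding n by (simp add: src_P)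
  show "a \<in> C \<Longrightarrow> b \<in> C \<Longrightarrow> c \<in> C \<Longrightarrow> okq (J (mu_c a b c)) \<and>
     srq 2 (J (mu_c a b c)) = (J (m_c InC a b c) \<otimes> J (u_c c)) \<odot> J (phi_c a c) \<and>
     tgq 2 (J (mu_c a b c)) = (J (e_c InC a b) \<otimes> J (phi_c b c)) \<odot> (J (phi_c a b) \<otimes> J (e_c InD (f b) (f c))) \<odot> (J (u_c a) \<otimes> J (m_c InD (f a) (f b) (f c)))"
    using gen_ev[OF gens_new(3)] unfolding n by (simp add: src_P assoc)
  show "a \<in> C \<Longrightarrow> okq (J (nu_c a)) \<and> srq 2 (J (nu_c a)) = (J (i_c InC a) \<otimes> J (u_c a)) \<odot> J (phi_c a a) \<and>
     tgq 2 (J (nu_c a)) = J (u_c a) \<otimes> J (i_c InD (f a))"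
    using gen_ev[OF gens_new(4)] unfolding n by (simp add: src_P)
qed

end

section \<open>Normalisation\<close>

text \<open>A \<open>2\<close>-cell is evaluated on lists with one entry for each generating \<open>1\<close>-cell of its source.
  The entries for \<open>e\<close> and \<open>e'\<close> are paths \<open>a, x\<^sub>1, \<dots>, x\<^sub>n\<close>, given by \<open>a\<close> and the list of the \<open>x\<^sub>i\<close>.\<close>

datatype ('c, 'd) word = WC 'c (cpath: "'c list") | WU 'c | WD 'd (dpath: "'d list")

context pf_model begin

lemma funpow_one [simp]: "((h :: 'x \<Rightarrow> 'x) ^^ 1) x = h x"
  using funpow_Suc_right[of 0 h] funpow_0[of h] by (simp add: One_nat_def del: funpow.simps)

abbreviation "cmbC \<equiv> MC.B.cmb"
abbreviation "cmbD \<equiv> MD.B.cmb"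
abbreviation "pthC \<equiv> MC.B.pth"
abbreviation "pthD \<equiv> MD.B.pth"

text \<open>The word replaces the generating 1-cell \<open>t\<close> by a path with the same end
  points; \<open>u\<close> can only be replaced by itself.\<close>

primrec vw :: "('c, 'd) word \<Rightarrow> ('c, 'd) pf_gen expr \<Rightarrow> bool" where
  "vw (WC a q) t \<longleftrightarrow> a \<in> C \<and> set q \<subseteq> C \<and> t = e_c InC a (last (a # q))"
| "vw (WU a) t \<longleftrightarrow> a \<in> C \<and> t = u_c a"
| "vw (WD a q) t \<longleftrightarrow> a \<in> D \<and> set q \<subseteq> D \<and> t = e_c InD a (last (a # q))"

primrec qw where
  "qw (WC a q) = cmbC a q"
| "qw (WU a) = J (u_c a)"
| "qw (WD a q) = cmbD a q"

primrec lw where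
  "lw (WC a q) = pthC a q"
| "lw (WU a) = J (u_c a)"
| "lw (WD a q) = pthD a q"

abbreviation "st \<equiv> list_all2 vw"

definition tens_list where "tens_list h r ws = foldr (\<lambda>w r. h w \<otimes> r) ws r"
text \<open>The product ends with the identity of the last object, which gives the empty list a
  value and is absorbed as a unit otherwise.\<close>

definition qs where "qs s ws = tens_list qw (ev (tgt P s)) ws"
definition ls where "ls s ws = tens_list lw (ev (tgt P s)) ws"

lemma tens_list_simps [simp]: "tens_list h r [] = r" "tens_list h r (w # ws) = h w \<otimes> tens_list h r ws"
  by (simp_all add: tens_list_def)

lemma tens_list_append: "tens_list h r (vs @ ws) = tens_list h (tens_list h r ws) vs"
  by (simp add: tens_list_def)

lemma tens_list_out: "okq r \<Longrightarrow> tens_list h r ws = tens_list h (srq 0 r) ws \<otimes> r"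
  by (induction ws) (simp_all add: assoc)

lemma vw_cases:
  assumes "vw w t"
  obtains a q where "w = WC a q" "a \<in> C" "set q \<subseteq> C" "t = e_c InC a (last (a # q))"
  | a where "w = WU a" "a \<in> C" "t = u_c a"
  | a q where "w = WD a q" "a \<in> D" "set q \<subseteq> D" "t = e_c InD a (last (a # q))"
  using assms by (cases w) auto

lemma qw_typ:
  assumes "vw w t"
  shows "okq (qw w)" "srq 2 (qw w) = qw w" "srq 1 (qw w) = lw w" "tgq 1 (qw w) = ev t" "tgq 0 (qw w) = ev (tgt P t)"
    "srq 0 (qw w) = ev (src P t)"
    "okq (lw w)" "srq 1 (lw w) = lw w" "tgq 1 (lw w) = lw w" "tgq 0 (lw w) = ev (tgt P t)" "srq 0 (lw w) = ev (src P t)"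
  using assms by (cases rule: vw_cases; simp add: src_P One_nat_def[symmetric])+

lemma qs_typ:
  "cell P p s \<Longrightarrow> cdim s = 1 \<Longrightarrow> st ws (atoms1 s) \<Longrightarrow>
    okq (qs s ws) \<and> srq 2 (qs s ws) = qs s ws \<and> srq 1 (qs s ws) = ls s ws \<and> tgq 1 (qs s ws) = ev s \<and>
    srq 0 (qs s ws) = ev (src P s) \<and> tgq 0 (qs s ws) = ev (tgt P s) \<and>
    okq (ls s ws) \<and> srq 1 (ls s ws) = ls s ws \<and> tgq 1 (ls s ws) = ls s ws \<and> srq 0 (ls s ws) = ev (src P s) \<and> tgq 0 (ls s ws) = ev (tgt P s)"
proof (induction s arbitrary: ws)
  case (Gen k g)
  then obtain w where w: "ws = [w]" "vw w (Gen k g)" by (auto simp: list_all2_Cons2)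
  have c: "cell P p (tgt P (Gen k g))" "cdim (tgt P (Gen k g)) = 0" using bd_cell[OF Gen.prems(1)] Gen.prems(2) m3 by simp_all
  have "qw w \<otimes> ev (tgt P (Gen k g)) = qw w" "lw w \<otimes> ev (tgt P (Gen k g)) = lw w"
    using qw_typ[OF w(2)] by (intro unit_r'; simp)+
  then show ?case using qw_typ[OF w(2)] w unfolding qs_def ls_def by simp
next
  case (Inv k g) then show ?case using p2 by (auto elim: cell_InvE)
next
  case (Idt x)
  then have "ws = []" "cell P p x" "cdim x = 0" by (simp_all add: cell_Idt_iff One_nat_def)
  then show ?case using idn_ev[of x 0] idn_up[of 0 "ev x" 0] idn_up[of 0 "ev x" 1] idn_up[of 0 "ev x" 2]
    by (simp add: qs_def ls_def idn_def)
next
  case (Cmp i x y)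
  have i: "i = 0" "cell P p x" "cell P p y" "cdim x = 1" "cdim y = 1" "ceqv (tgt_at P 0 x) (src_at P 0 y)"
    using Cmp.prems by (auto simp: cell_Cmp_iff)
  have e: "ev (tgt P x) = ev (src P y)" using ev_eqv[OF i(6)] i bd_cell[of x] m3 by (simp add: src_at_def tgt_at_def)
  obtain us vs where w: "ws = us @ vs" "st us (atoms1 x)" "st vs (atoms1 y)"
    using Cmp.prems(3) by (auto simp: list_all2_append2)
  have d: "tgt P (Cmp i x y) = tgt P y" "src P (Cmp i x y) = src P x" using i by (simp_all add: One_nat_def)
  note X = Cmp.IH(1)[OF i(2,4) w(2)] and Y = Cmp.IH(2)[OF i(3,5) w(3)]
  have "qs (Cmp i x y) ws = qs x us \<otimes> qs y vs" "ls (Cmp i x y) ws = ls x us \<otimes> ls y vs"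
    unfolding qs_def ls_def w d tens_list_append
    using tens_list_out[of "tens_list qw (ev (tgt P y)) vs" qw us] tens_list_out[of "tens_list lw (ev (tgt P y)) vs" lw us] Y e
    unfolding qs_def ls_def by simp_all
  then show ?case using X Y e i d by simp
qed

lemma qs:
  assumes "cell P p s" "cdim s = 1" "st ws (atoms1 s)"
  shows "okq (qs s ws)" "srq 2 (qs s ws) = qs s ws" "srq 1 (qs s ws) = ls s ws" "tgq 1 (qs s ws) = ev s"
    "srq 0 (qs s ws) = ev (src P s)" "tgq 0 (qs s ws) = ev (tgt P s)"
    "okq (ls s ws)" "srq 1 (ls s ws) = ls s ws" "tgq 1 (ls s ws) = ls s ws" "srq 0 (ls s ws) = ev (src P s)" "tgq 0 (ls s ws) = ev (tgt P s)"
  using qs_typ[OF assms] by blast+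

lemma qs_Cmp:
  assumes "cell P p (Cmp 0 x y)" "cdim x = 1" "st us (atoms1 x)" "st vs (atoms1 y)"
  shows "qs (Cmp 0 x y) (us @ vs) = qs x us \<otimes> qs y vs" "ls (Cmp 0 x y) (us @ vs) = ls x us \<otimes> ls y vs"
proof -
  have i: "cell P p x" "cell P p y" "cdim y = 1" "ceqv (tgt_at P 0 x) (src_at P 0 y)"
    using assms by (auto simp: cell_Cmp_iff)
  have e: "ev (tgt P x) = ev (src P y)" using ev_eqv[OF i(4)] i assms bd_cell[of x] m3 by (simp add: src_at_def tgt_at_def)
  have d: "tgt P (Cmp 0 x y) = tgt P y" using assms by (simp add: One_nat_def)
  show "qs (Cmp 0 x y) (us @ vs) = qs x us \<otimes> qs y vs" "ls (Cmp 0 x y) (us @ vs) = ls x us \<otimes> ls y vs"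
    using tens_list_out[of "tens_list qw (ev (tgt P y)) vs" qw us] tens_list_out[of "tens_list lw (ev (tgt P y)) vs" lw us] qs[OF i(2,3) assms(4)] e
    unfolding qs_def ls_def d tens_list_append by simp_all
qed

lemma qs_eqv:
  assumes "ceqv s t" "cdim s = 1" shows "qs s ws = qs t ws" "ls s ws = ls t ws"
proof -
  have "ceqv (tgt P s) (tgt P t)" "cdim (tgt P s) = 0" using good_eqvI[OF assms(1)] assms m3 bd_cell[of s] eqv_cellD(1)[OF assms(1)] by (simp_all add: good_eqv_def)
  then show "qs s ws = qs t ws" "ls s ws = ls t ws" by (simp_all add: qs_def ls_def ev_eqv)
qed

section \<open>The squares of the generating 2-cells and their pasting\<close>

definition sm_gen :: "('c, 'd) pf_gen \<Rightarrow> ('c, 'd) word list \<Rightarrow> ('c, 'd) word list" where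
  "sm_gen g ws = (case g of
     InC h \<Rightarrow> (case h of MG a b c \<Rightarrow> [WC a (cpath (ws ! 0) @ cpath (ws ! 1))] | IG a \<Rightarrow> [WC a []] | _ \<Rightarrow> ws)
   | InD h \<Rightarrow> (case h of MG a b c \<Rightarrow> [WD a (dpath (ws ! 0) @ dpath (ws ! 1))] | IG a \<Rightarrow> [WD a []] | _ \<Rightarrow> ws)
   | PhiG a b \<Rightarrow> [WU a, WD (f a) (map f (cpath (ws ! 0)))] | _ \<Rightarrow> ws)"

definition K_gen where
  "K_gen g ws = (case g of
     InC h \<Rightarrow> (case h of MG a b c \<Rightarrow> pthC a (cpath (ws ! 0) @ cpath (ws ! 1)) | IG a \<Rightarrow> pthC a [] | _ \<Rightarrow> {})
   | InD h \<Rightarrow> (case h of MG a b c \<Rightarrow> pthD a (dpath (ws ! 0) @ dpath (ws ! 1)) | IG a \<Rightarrow> pthD a [] | _ \<Rightarrow> {})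
   | PhiG a b \<Rightarrow> Q.KK a (cpath (ws ! 0)) | _ \<Rightarrow> {})"

definition E_gen where
  "E_gen g ws = (case g of
     InC h \<Rightarrow> (case h of MG a b c \<Rightarrow> MC.B.A a (cpath (ws ! 0)) (cpath (ws ! 1)) | IG a \<Rightarrow> J (i_c InC a) | _ \<Rightarrow> {})
   | InD h \<Rightarrow> (case h of MG a b c \<Rightarrow> MD.B.A a (dpath (ws ! 0)) (dpath (ws ! 1)) | IG a \<Rightarrow> J (i_c InD a) | _ \<Rightarrow> {})
   | PhiG a b \<Rightarrow> Q.PHI a (cpath (ws ! 0)) | _ \<Rightarrow> {})"

abbreviation "sm \<equiv> sem P sm_gen"
abbreviation "ln x \<equiv> length (atoms1 (src P x))"

primrec K where
  "K (Gen k g) ws = K_gen g ws"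
| "K (Inv k g) ws = {}"
| "K (Idt x) ws = ls x ws"
| "K (Cmp i x y) ws = (if i = 0 then K x (take (ln x) ws) \<otimes> K y (drop (ln x) ws) else K x ws \<odot> K y (sm x ws))"

text \<open>\<open>E w ws\<close> is a \<open>3\<close>-cell \<open>qs ws \<star>\<^sub>1 w \<Rrightarrow> K w ws \<star>\<^sub>1 qs (sm w ws)\<close>. Squares of this shape compose
  along \<open>0\<close>- and \<open>1\<close>-cells, so that it suffices to give them on generating \<open>2\<close>-cells.\<close>

primrec E where
  "E (Gen k g) ws = E_gen g ws"
| "E (Inv k g) ws = {}"
| "E (Idt x) ws = qs x ws"
| "E (Cmp i x y) ws = (if i = 0 then E x (take (ln x) ws) \<otimes> E y (drop (ln x) ws)
     else (E x ws \<odot> ev y) \<bullet> (K x ws \<odot> E y (sm x ws)))"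

definition sq where
  "sq x ws \<longleftrightarrow> st (sm x ws) (atoms1 (tgt P x)) \<and>
     okq (K x ws) \<and> srq 2 (K x ws) = K x ws \<and> srq 1 (K x ws) = ls (src P x) ws \<and> tgq 1 (K x ws) = ls (tgt P x) (sm x ws) \<and>
     okq (E x ws) \<and> srq 2 (E x ws) = qs (src P x) ws \<odot> ev x \<and> tgq 2 (E x ws) = K x ws \<odot> qs (tgt P x) (sm x ws)"

lemma qs_one:
  assumes "vw w (Gen 1 g)" "cell P p (Gen 1 g)"
  shows "qs (Gen 1 g) [w] = qw w" "ls (Gen 1 g) [w] = lw w"
  unfolding qs_def ls_def tens_list_simps by (rule unit_r'; use qw_typ[OF assms(1)] in simp)+

text \<open>The square of \<open>m\<close> is the product \<open>A\<close> of two combs and the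
  square of \<phi> is \<open>PHI\<close>. For \<open>i\<close> nothing has to be done, since
  \<open>i\<close> is the comb of the empty path.\<close>

lemma sq_gen: assumes g: "g \<in> gens P 2" and st: "st ws (atoms1 (gsrc P 2 g))" shows "sq (Gen 2 g) ws"
proof -
  have cs: "cell P p (src P (Gen 2 g))" "cell P p (tgt P (Gen 2 g))"
    using bd_cell[of "Gen 2 g"] g m3 by (simp_all add: cell_Gen_iff)
  from g show ?thesis
  proof (cases rule: gens2_cases)
  case (1 a b c)
  then obtain w1 w2 where w: "ws = [w1, w2]" "vw w1 (e_c InC a b)" "vw w2 (e_c InC b c)"
    using st by (auto simp: src_P wcmp_low list_all2_Cons2)
  obtain q1 where q1: "w1 = WC a q1" "set q1 \<subseteq> C" "b = last (a # q1)" using w(2) by (cases rule: vw_cases) auto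
  obtain q2 where q2: "w2 = WC b q2" "set q2 \<subseteq> C" "c = last (b # q2)" using w(3) by (cases rule: vw_cases) auto
  have l: "c = last (a # q1 @ q2)" and q12: "set (q1 @ q2) \<subseteq> C" using q1 q2 by simp_all
  note A = MC.B.A[OF 1(2) q1(2) q2(2), folded q1(3) l] and cq = MC.B.cmb[OF 1(2) q12, folded l]
    and pq = MC.B.pth[OF 1(2) q12, folded l] and pp = MC.B.pth_append[OF 1(2) q1(2) q2(2), folded q1(3)]
  have vw: "vw (WC a (q1 @ q2)) (e_c InC a c)" using 1(2) q12 l by simp
  have sm: "sm (Gen 2 g) ws = [WC a (q1 @ q2)]" "K (Gen 2 g) ws = pthC a (q1 @ q2)" "E (Gen 2 g) ws = MC.B.A a q1 q2"
    using 1(1) w(1) q1(1) q2(1) by (simp_all add: sm_gen_def K_gen_def E_gen_def)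
  have s: "src P (Gen 2 g) = Cmp 0 (e_c InC a b) (e_c InC b c)" "tgt P (Gen 2 g) = e_c InC a c"
    using 1(1) by (simp_all add: src_P wcmp_low)
  have c: "cell P p (Cmp 0 (e_c InC a b) (e_c InC b c))" "cell P p (e_c InC a c)" "cell P p (e_c InC a b)" "cell P p (e_c InC b c)"
    using cs(1,2) unfolding s by (simp_all add: cell_Cmp_iff)
  have q: "qs (src P (Gen 2 g)) ws = cmbC a q1 \<otimes> cmbC b q2" "ls (src P (Gen 2 g)) ws = pthC a (q1 @ q2)"
    "qs (tgt P (Gen 2 g)) [WC a (q1 @ q2)] = cmbC a (q1 @ q2)" "ls (tgt P (Gen 2 g)) [WC a (q1 @ q2)] = pthC a (q1 @ q2)"
    unfolding s using qs_Cmp[OF c(1), of "[w1]" "[w2]"] w(2,3) qs_one[OF w(2) c(3)] qs_one[OF w(3) c(4)] qs_one[OF vw c(2)]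
    by (simp_all add: w(1) q1(1) q2(1) pp)
  have u: "pthC a (q1 @ q2) \<odot> cmbC a (q1 @ q2) = cmbC a (q1 @ q2)" by (rule unit_l') (use cq in simp_all)
  show ?thesis unfolding sq_def sm q u
    using vw A pq 1(1) unfolding s by (simp add: MC.B.M_def assoc del: MC.B.A.simps MC.B.pth last.simps)
next
  case (2 a)
  then have w: "ws = []" using st by (auto simp: src_P)
  have vw: "vw (WC a []) (e_c InC a a)" using 2(2) by simp
  have sm: "sm (Gen 2 g) ws = [WC a []]" "K (Gen 2 g) ws = J (obj_c InC a)" "E (Gen 2 g) ws = J (i_c InC a)"
    using 2(1) w(1) by (simp_all add: sm_gen_def K_gen_def E_gen_def)
  have s: "src P (Gen 2 g) = Idt (obj_c InC a)" "tgt P (Gen 2 g) = e_c InC a a"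
    using 2(1) by (simp_all add: src_P)
  have q: "qs (src P (Gen 2 g)) ws = J (obj_c InC a)" "ls (src P (Gen 2 g)) ws = J (obj_c InC a)"
    "qs (tgt P (Gen 2 g)) [WC a []] = J (i_c InC a)" "ls (tgt P (Gen 2 g)) [WC a []] = J (obj_c InC a)"
    using qs_one[OF vw cs(2)[unfolded s]] unfolding s w by (simp_all add: qs_def ls_def)
  show ?thesis unfolding sq_def sm q
    using vw 2 unfolding s by (simp add: unit_l')
next
  case (3 a b c)
  then obtain w1 w2 where w: "ws = [w1, w2]" "vw w1 (e_c InD a b)" "vw w2 (e_c InD b c)"
    using st by (auto simp: src_P wcmp_low list_all2_Cons2)
  obtain q1 where q1: "w1 = WD a q1" "set q1 \<subseteq> D" "b = last (a # q1)" using w(2) by (cases rule: vw_cases) auto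
  obtain q2 where q2: "w2 = WD b q2" "set q2 \<subseteq> D" "c = last (b # q2)" using w(3) by (cases rule: vw_cases) auto
  have l: "c = last (a # q1 @ q2)" and q12: "set (q1 @ q2) \<subseteq> D" using q1 q2 by simp_all
  note A = MD.B.A[OF 3(2) q1(2) q2(2), folded q1(3) l] and cq = MD.B.cmb[OF 3(2) q12, folded l]
    and pq = MD.B.pth[OF 3(2) q12, folded l] and pp = MD.B.pth_append[OF 3(2) q1(2) q2(2), folded q1(3)]
  have vw: "vw (WD a (q1 @ q2)) (e_c InD a c)" using 3(2) q12 l by simp
  have sm: "sm (Gen 2 g) ws = [WD a (q1 @ q2)]" "K (Gen 2 g) ws = pthD a (q1 @ q2)" "E (Gen 2 g) ws = MD.B.A a q1 q2"
    using 3(1) w(1) q1(1) q2(1) by (simp_all add: sm_gen_def K_gen_def E_gen_def)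
  have s: "src P (Gen 2 g) = Cmp 0 (e_c InD a b) (e_c InD b c)" "tgt P (Gen 2 g) = e_c InD a c"
    using 3(1) by (simp_all add: src_P wcmp_low)
  have c: "cell P p (Cmp 0 (e_c InD a b) (e_c InD b c))" "cell P p (e_c InD a c)" "cell P p (e_c InD a b)" "cell P p (e_c InD b c)"
    using cs(1,2) unfolding s by (simp_all add: cell_Cmp_iff)
  have q: "qs (src P (Gen 2 g)) ws = cmbD a q1 \<otimes> cmbD b q2" "ls (src P (Gen 2 g)) ws = pthD a (q1 @ q2)"
    "qs (tgt P (Gen 2 g)) [WD a (q1 @ q2)] = cmbD a (q1 @ q2)" "ls (tgt P (Gen 2 g)) [WD a (q1 @ q2)] = pthD a (q1 @ q2)"
    unfolding s using qs_Cmp[OF c(1), of "[w1]" "[w2]"] w(2,3) qs_one[OF w(2) c(3)] qs_one[OF w(3) c(4)] qs_one[OF vw c(2)]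
    by (simp_all add: w(1) q1(1) q2(1) pp)
  have u: "pthD a (q1 @ q2) \<odot> cmbD a (q1 @ q2) = cmbD a (q1 @ q2)" by (rule unit_l') (use cq in simp_all)
  show ?thesis unfolding sq_def sm q u
    using vw A pq 3(1) unfolding s by (simp add: MD.B.M_def assoc del: MD.B.A.simps MD.B.pth last.simps)
next
  case (4 a)
  then have w: "ws = []" using st by (auto simp: src_P)
  have vw: "vw (WD a []) (e_c InD a a)" using 4(2) by simp
  have sm: "sm (Gen 2 g) ws = [WD a []]" "K (Gen 2 g) ws = J (obj_c InD a)" "E (Gen 2 g) ws = J (i_c InD a)"
    using 4(1) w(1) by (simp_all add: sm_gen_def K_gen_def E_gen_def)
  have s: "src P (Gen 2 g) = Idt (obj_c InD a)" "tgt P (Gen 2 g) = e_c InD a a"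
    using 4(1) by (simp_all add: src_P)
  have q: "qs (src P (Gen 2 g)) ws = J (obj_c InD a)" "ls (src P (Gen 2 g)) ws = J (obj_c InD a)"
    "qs (tgt P (Gen 2 g)) [WD a []] = J (i_c InD a)" "ls (tgt P (Gen 2 g)) [WD a []] = J (obj_c InD a)"
    using qs_one[OF vw cs(2)[unfolded s]] unfolding s w by (simp_all add: qs_def ls_def)
  show ?thesis unfolding sq_def sm q
    using vw 4 unfolding s by (simp add: unit_l')
next
  case (5 a b)
  then obtain w1 w2 where w: "ws = [w1, w2]" "vw w1 (e_c InC a b)" "vw w2 (u_c b)"
    using st by (auto simp: src_P wcmp_low list_all2_Cons2)
  obtain q1 where q1: "w1 = WC a q1" "set q1 \<subseteq> C" "b = last (a # q1)" using w(2) by (cases rule: vw_cases) auto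
  have w2: "w2 = WU b" using w(3) by (cases rule: vw_cases) auto
  have l: "f b = last (f a # map f q1)" and fq: "set (map f q1) \<subseteq> D" "f a \<in> D" using q1 5 fD Q.last_map_f[of a q1] by auto
  note Ph = Q.PHI[OF 5(2) q1(2,3)] and kk = Q.KK[OF 5(2) q1(2), folded q1(3)] and pq = Q.pthD[OF 5(2) q1(2), folded q1(3)]
  have vw: "vw (WU a) (u_c a)" "vw (WD (f a) (map f q1)) (e_c InD (f a) (f b))" using 5(2) fq l by simp_all
  have sm: "sm (Gen 2 g) ws = [WU a, WD (f a) (map f q1)]" "K (Gen 2 g) ws = Q.KK a q1" "E (Gen 2 g) ws = Q.PHI a q1"
    using 5(1) w(1) q1(1) by (simp_all add: sm_gen_def K_gen_def E_gen_def)
  have s: "src P (Gen 2 g) = Cmp 0 (e_c InC a b) (u_c b)" "tgt P (Gen 2 g) = Cmp 0 (u_c a) (e_c InD (f a) (f b))"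
    using 5(1) by (simp_all add: src_P wcmp_low)
  have c: "cell P p (Cmp 0 (e_c InC a b) (u_c b))" "cell P p (Cmp 0 (u_c a) (e_c InD (f a) (f b)))" "cell P p (e_c InC a b)" "cell P p (u_c b)"
     "cell P p (u_c a)" "cell P p (e_c InD (f a) (f b))"
    using cs(1,2) unfolding s by (simp_all add: cell_Cmp_iff)
  have q: "qs (src P (Gen 2 g)) ws = cmbC a q1 \<otimes> J (u_c b)" "ls (src P (Gen 2 g)) ws = pthC a q1 \<otimes> J (u_c b)"
    "qs (tgt P (Gen 2 g)) [WU a, WD (f a) (map f q1)] = J (u_c a) \<otimes> cmbD (f a) (map f q1)"
    "ls (tgt P (Gen 2 g)) [WU a, WD (f a) (map f q1)] = J (u_c a) \<otimes> pthD (f a) (map f q1)"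
    unfolding s using qs_Cmp[OF c(1), of "[w1]" "[w2]"] w(2,3) qs_one[OF w(2) c(3)] qs_one[OF w(3) c(4)]
      qs_Cmp[OF c(2), of "[WU a]" "[WD (f a) (map f q1)]"] qs_one[OF vw(1) c(5)] qs_one[OF vw(2) c(6)] vw
    by (simp_all add: w(1) q1(1) w2)
  have st2: "st [WU a, WD (f a) (map f q1)] (atoms1 (tgt P (Gen 2 g)))" unfolding s using vw by simp
  have evg: "ev (Gen 2 g) = J (phi_c a b)" using 5(1) by simp
  have "srq 2 (Q.PHI a q1) = (cmbC a q1 \<otimes> J (u_c b)) \<odot> J (phi_c a b)" using Ph(2) by (simp add: Q.PH_def)
  then show ?thesis unfolding sq_def sm q evg
    using st2 Ph(3,4) kk by (simp add: Q.LL_def del: Q.KK Q.KK.simps last.simps)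
  qed
qed

lemma sqD:
  assumes "sq x ws"
  shows "st (sm x ws) (atoms1 (tgt P x))" "okq (K x ws)" "srq 2 (K x ws) = K x ws" "srq 1 (K x ws) = ls (src P x) ws"
    "tgq 1 (K x ws) = ls (tgt P x) (sm x ws)" "okq (E x ws)" "srq 2 (E x ws) = qs (src P x) ws \<odot> ev x"
    "tgq 2 (E x ws) = K x ws \<odot> qs (tgt P x) (sm x ws)" "tgq 2 (K x ws) = K x ws" "idn 2 (K x ws)"
  using assms id_up(2)[of 2 2 "K x ws"] unfolding sq_def by (auto simp: idn_def)

lemma bd2:
  assumes "cell P p x" "cdim x = 2"
  shows "cell P p (src P x)" "cell P p (tgt P x)" "cdim (src P x) = 1" "cdim (tgt P x) = 1"
    "okq (ev x)" "srq 1 (ev x) = ev (src P x)" "tgq 1 (ev x) = ev (tgt P x)" "srq 2 (ev x) = ev x" "idn 2 (ev x)" "tgq 2 (ev x) = ev x"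
    "ev (src P (tgt P x)) = ev (src P (src P x))" "ev (tgt P (tgt P x)) = ev (tgt P (src P x))"
proof -
  show c: "cell P p (src P x)" "cell P p (tgt P x)" "cdim (src P x) = 1" "cdim (tgt P x) = 1"
    using bd_cell[of x] assms m3 by simp_all
  show "okq (ev x)" using ok_ev assms by simp
  have d2: "cdim x = Suc 1" using assms by simp
  show "srq 1 (ev x) = ev (src P x)" "tgq 1 (ev x) = ev (tgt P x)" using bd_ev[OF assms(1) d2] by simp_all
  show i: "idn 2 (ev x)" using idn_ev[OF assms] by simp
  then show "srq 2 (ev x) = ev x" "tgq 2 (ev x) = ev x" using idn_up[OF i, of 2] by simp_all
  have e: "ceqv (src P (src P x)) (src P (tgt P x))" "ceqv (tgt P (src P x)) (tgt P (tgt P x))" using bd_glob[of x] assms m3 by simp_all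
  have d: "cdim (src P (src P x)) = 0" "cdim (tgt P (src P x)) = 0" using bd_cell[OF c(1)] c(3) m3 by simp_all
  show "ev (src P (tgt P x)) = ev (src P (src P x))" "ev (tgt P (tgt P x)) = ev (tgt P (src P x))"
    using ev_eqv[OF e(1)] ev_eqv[OF e(2)] d by simp_all
qed

lemma sq0:
  assumes "cell P p x" "cdim x = 2" "st ws (atoms1 (src P x))" "sq x ws"
  shows "srq 0 (E x ws) = ev (src P (src P x))" "tgq 0 (E x ws) = ev (tgt P (src P x))"
    "srq 0 (K x ws) = ev (src P (src P x))" "tgq 0 (K x ws) = ev (tgt P (src P x))"
    "srq 1 (E x ws) = ls (src P x) ws" "tgq 1 (E x ws) = ev (tgt P x)"
proof -
  note b = bd2[OF assms(1,2)] and s = sqD[OF assms(4)] and q = qs[OF bd2(1,3)[OF assms(1,2)] assms(3)]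
  have t: "srq 0 (E x ws) = srq 0 (srq 2 (E x ws))" "tgq 0 (E x ws) = tgq 0 (srq 2 (E x ws))" "srq 1 (E x ws) = srq 1 (srq 2 (E x ws))"
    "tgq 1 (E x ws) = tgq 1 (srq 2 (E x ws))" "srq 0 (K x ws) = srq 0 (srq 1 (K x ws))" "tgq 0 (K x ws) = tgq 0 (srq 1 (K x ws))"
    by simp_all
  have "tgq 0 (ev x) = ev (tgt P (src P x))"
    using MC.B.bd0I(2)[OF b(6,7)] bd_ev[OF b(1), of 0] b(3) by simp
  then show "srq 0 (E x ws) = ev (src P (src P x))" "tgq 0 (E x ws) = ev (tgt P (src P x))"
    "srq 0 (K x ws) = ev (src P (src P x))" "tgq 0 (K x ws) = ev (tgt P (src P x))"
    "srq 1 (E x ws) = ls (src P x) ws" "tgq 1 (E x ws) = ev (tgt P x)"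
    unfolding t s using b q by simp_all
qed

lemma Cmp0_split:
  assumes "cell P p (Cmp 0 x y)" "cdim x = 2" "st ws (atoms1 (src P (Cmp 0 x y)))"
  obtains us vs where "ws = us @ vs" "st us (atoms1 (src P x))" "st vs (atoms1 (src P y))" "length us = ln x"
    "cell P p (Cmp 0 (src P x) (src P y))" "cell P p (Cmp 0 (tgt P x) (tgt P y))"
    "ev (tgt P (src P x)) = ev (src P (src P y))"
proof -
  have i: "cdim y = 2" "cell P p x" "cell P p y" using assms by (simp_all add: cell_Cmp_iff)
  have c: "cell P p (Cmp 0 (src P x) (src P y))" "cell P p (Cmp 0 (tgt P x) (tgt P y))"
    using bd_cell[OF assms(1)] assms(2) m3 by (simp_all add: bd2_simps)
  obtain us vs where w: "ws = us @ vs" "st us (atoms1 (src P x))" "st vs (atoms1 (src P y))"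
    using assms(2,3) by (auto simp: bd2_simps list_all2_append2)
  have d: "cdim (src P x) = 1" "cdim (src P y) = 1" "cell P p (src P x)" using bd2 i assms(2) by simp_all
  then have "ceqv (tgt P (src P x)) (src P (src P y))" "cdim (tgt P (src P x)) = 0"
    using c(1) bd_cell[OF d(3)] m3 by (simp_all add: cell_Cmp_iff src_at_def tgt_at_def)
  then have "ev (tgt P (src P x)) = ev (src P (src P y))" using ev_eqv by simp
  then show thesis using that[OF w _ c] list_all2_lengthD[OF w(2)] by simp
qed

lemma Cmp1_mid:
  assumes "cell P p (Cmp 1 x y)" "cdim x = 2"
  shows "cell P p x" "cell P p y" "cdim y = 2" "ceqv (tgt P x) (src P y)" "atoms1 (tgt P x) = atoms1 (src P y)"
    "qs (tgt P x) ws = qs (src P y) ws" "ls (tgt P x) ws = ls (src P y) ws" "ev (tgt P x) = ev (src P y)"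
proof -
  show c: "cell P p x" "cell P p y" "cdim y = 2" using assms by (simp_all add: cell_Cmp_iff)
  have "ceqv (tgt_at P 1 x) (src_at P 1 y)" using assms by (simp add: cell_Cmp_iff)
  then show e: "ceqv (tgt P x) (src P y)" using c assms(2) by (simp add: src_at_def tgt_at_def)
  have d: "cdim (tgt P x) = 1" using bd2[OF c(1) assms(2)] by simp
  show "atoms1 (tgt P x) = atoms1 (src P y)" using Cmp1_atoms[OF assms] p2 m3 by simp
  show "qs (tgt P x) ws = qs (src P y) ws" "ls (tgt P x) ws = ls (src P y) ws" "ev (tgt P x) = ev (src P y)"
    using qs_eqv[OF e d] ev_eqv[OF e] d by simp_all
qed

lemma sq_cell: "cell P p x \<Longrightarrow> cdim x = 2 \<Longrightarrow> st ws (atoms1 (src P x)) \<Longrightarrow> sq x ws"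
proof (induction x arbitrary: ws)
  case (Gen k g)
  then show ?case using sq_gen[of g ws] by (simp add: cell_Gen_iff)
next
  case (Inv k g) then show ?case using p2 by (auto elim: cell_InvE)
next
  case (Idt s)
  have s: "cell P p s" "cdim s = 1" "st ws (atoms1 s)" using Idt.prems by (simp_all add: cell_Idt_iff numeral_2_eq_2 One_nat_def)
  note q = qs[OF s]
  have "qs s ws \<odot> ev s = qs s ws" by (rule unit_r') (use q in simp_all)
  moreover have "ls s ws \<odot> qs s ws = qs s ws" by (rule unit_l') (use q in simp_all)
  moreover have "srq 2 (ls s ws) = ls s ws" "tgq 2 (qs s ws) = qs s ws"
    using idn_up[of 1 "ls s ws" 2] idn_up[of 2 "qs s ws" 2] q by (simp_all add: idn_def)
  ultimately show ?case using s q by (simp add: sq_def)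
next
  case (Cmp i x y)
  have d: "cdim x = 2" using Cmp.prems by simp
  from Cmp.prems(1) d show ?case
  proof (cases rule: cmp1_cases)
    case 0
    obtain us vs where w: "ws = us @ vs" "st us (atoms1 (src P x))" "st vs (atoms1 (src P y))" "length us = ln x"
      "cell P p (Cmp 0 (src P x) (src P y))" "cell P p (Cmp 0 (tgt P x) (tgt P y))"
      "ev (tgt P (src P x)) = ev (src P (src P y))"
      using Cmp0_split[of x y ws] Cmp.prems 0 d by auto
    note X = Cmp.IH(1)[OF 0(2) d w(2)] and Y = Cmp.IH(2)[OF 0(3,4) w(3)]
    note bx = bd2[OF 0(2) d] and b_y = bd2[OF 0(3,4)] and X0 = sq0[OF 0(2) d w(2) X] and Y0 = sq0[OF 0(3,4) w(3) Y]
      and X1 = sqD[OF X] and Y1 = sqD[OF Y]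
    have e: "sm (Cmp 0 x y) ws = sm x us @ sm y vs" "K (Cmp 0 x y) ws = K x us \<otimes> K y vs" "E (Cmp 0 x y) ws = E x us \<otimes> E y vs"
      using w(1,4) by simp_all
    have q: "qs (src P (Cmp 0 x y)) ws = qs (src P x) us \<otimes> qs (src P y) vs" "ls (src P (Cmp 0 x y)) ws = ls (src P x) us \<otimes> ls (src P y) vs"
      "qs (tgt P (Cmp 0 x y)) (sm x us @ sm y vs) = qs (tgt P x) (sm x us) \<otimes> qs (tgt P y) (sm y vs)"
      "ls (tgt P (Cmp 0 x y)) (sm x us @ sm y vs) = ls (tgt P x) (sm x us) \<otimes> ls (tgt P y) (sm y vs)"
      using qs_Cmp[OF w(5) bx(3) w(2,3)] qs_Cmp[OF w(6) bx(4) X1(1) Y1(1)] w(1) d by (simp_all add: bd2_simps)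
    have oE: "okq (qs (src P x) us \<odot> ev x)" "okq (qs (src P y) vs \<odot> ev y)" "okq (K x us \<odot> qs (tgt P x) (sm x us))" "okq (K y vs \<odot> qs (tgt P y) (sm y vs))"
      using X1(2,5) Y1(2,5) bx b_y qs[OF bx(1,3) w(2)] qs[OF b_y(1,3) w(3)] qs[OF bx(2,4) X1(1)] qs[OF b_y(2,4) Y1(1)] by simp_all
    have t: "(qs (src P x) us \<odot> ev x) \<otimes> (qs (src P y) vs \<odot> ev y) = (qs (src P x) us \<otimes> qs (src P y) vs) \<odot> (ev x \<otimes> ev y)"
      "(K x us \<odot> qs (tgt P x) (sm x us)) \<otimes> (K y vs \<odot> qs (tgt P y) (sm y vs)) = (K x us \<otimes> K y vs) \<odot> (qs (tgt P x) (sm x us) \<otimes> qs (tgt P y) (sm y vs))"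
      by (rule tens; use oE X0 Y0 w(7) qs[OF bx(1,3) w(2)] qs[OF b_y(1,3) w(3)] in simp)+
    show ?thesis unfolding 0(1) sq_def e q
      using X1 Y1 X0 Y0 w(7) t d by (simp add: bd2_simps list_all2_appendI)
  next
    case 1
    note mid = Cmp1_mid[of x y, OF Cmp.prems(1)[unfolded 1(1)] d]
    have wx: "st ws (atoms1 (src P x))" using Cmp.prems(3) 1(1) d by (simp add: bd2_simps)
    note X = Cmp.IH(1)[OF mid(1) d wx] 
    have wy: "st (sm x ws) (atoms1 (src P y))" using sqD(1)[OF X] mid(5) by simp
    note Y = Cmp.IH(2)[OF mid(2,3) wy]
    note bx = bd2[OF mid(1) d] and b_y = bd2[OF mid(2,3)] and X0 = sq0[OF mid(1) d wx X] and Y0 = sq0[OF mid(2,3) wy Y]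
      and X1 = sqD[OF X, unfolded mid(6,7)] and Y1 = sqD[OF Y]
    have s: "src P (Cmp 1 x y) = src P x" "tgt P (Cmp 1 x y) = tgt P y" using d by (simp_all add: bd2_simps)
    have e: "sm (Cmp 1 x y) ws = sm y (sm x ws)" "K (Cmp 1 x y) ws = K x ws \<odot> K y (sm x ws)"
      "E (Cmp 1 x y) ws = (E x ws \<odot> ev y) \<bullet> (K x ws \<odot> E y (sm x ws))" "ev (Cmp 1 x y) = ev x \<odot> ev y" by simp_all
    show ?thesis unfolding 1(1) sq_def s e
      using X1 Y1 X0 Y0 mid(8) bx b_y by (simp add: assoc)
  qed
qed

lemma sem_data_sm_gen: "sem_data P p m sm_gen"
proof unfold_locales
  fix g and l :: "('c, 'd) word list"
  assume "g \<in> gens P 2"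
  then show "length (sm_gen g l) = length (atoms1 (gtgt P 2 g))"
    by (cases rule: gens2_cases) (simp_all add: sm_gen_def src_P wcmp_low)
qed (use p2 m3 in simp_all)

lemma sm_eqv: "ceqv x y \<Longrightarrow> cdim x = 2 \<Longrightarrow> st ws (atoms1 (src P x)) \<Longrightarrow> sm x ws = sm y ws"
  using sem_data.sem_eqv[OF sem_data_sm_gen, of x y ws] list_all2_lengthD by blast

lemma bd20:
  assumes "cell P p x" "cdim x = 2"
  shows "srq 0 (ev x) = ev (src P (src P x))" "tgq 0 (ev x) = ev (tgt P (src P x))"
  using MC.B.bd0I(1,2)[OF bd2(6,7)[OF assms]] bd_ev[OF bd2(1)[OF assms], of 0] bd2(3)[OF assms] by simp_all

lemma Cmp1_mid0:
  assumes "cell P p (Cmp 1 x y)" "cdim x = 2"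
  shows "ev (src P (src P y)) = ev (src P (src P x))" "ev (tgt P (src P y)) = ev (tgt P (src P x))"
proof -
  note mid = Cmp1_mid[OF assms]
  note b = bd2[OF mid(1) assms(2)]
  have d: "cdim (src P (tgt P x)) = 0" "cdim (tgt P (tgt P x)) = 0" using bd_cell[OF b(2)] b m3 by simp_all
  have "ceqv (src P (tgt P x)) (src P (src P y))" "ceqv (tgt P (tgt P x)) (tgt P (src P y))"
    using good_eqvI[OF mid(4)] b m3 by (simp_all add: good_eqv_def)
  then have "ev (src P (tgt P x)) = ev (src P (src P y))" "ev (tgt P (tgt P x)) = ev (tgt P (src P y))"
    using d ev_eqv by simp_all
  then show "ev (src P (src P y)) = ev (src P (src P x))" "ev (tgt P (src P y)) = ev (tgt P (src P x))"
    using b(11,12) by simp_all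
qed

section \<open>Independence of \<open>K\<close> and \<open>E\<close> from the expression of a
  2-cell\<close>

lemma KE_eqv_Cmp:
  assumes e: "ceqv x x'" "ceqv y y'"
    and Q: "\<forall>ws. st ws (atoms1 (src P x)) \<longrightarrow> K x ws = K x' ws \<and> E x ws = E x' ws"
      "\<forall>ws. st ws (atoms1 (src P y)) \<longrightarrow> K y ws = K y' ws \<and> E y ws = E y' ws"
    and c: "cell P p (Cmp i x y)" and d: "cdim x = 2" and st: "st ws (atoms1 (src P (Cmp i x y)))"
  shows "K (Cmp i x y) ws = K (Cmp i x' y') ws \<and> E (Cmp i x y) ws = E (Cmp i x' y') ws"
  using c d
proof (cases rule: cmp1_cases)
  case 0
  obtain us vs where w: "ws = us @ vs" "st us (atoms1 (src P x))" "st vs (atoms1 (src P y))" "length us = ln x"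
    using Cmp0_split[OF c[unfolded 0(1)] d st[unfolded 0(1)]] by blast
  have "ln x' = ln x" using atoms_bd[OF e(1) d] p2 m3 by simp
  then show ?thesis using 0 w Q by simp
next
  case 1
  have wx: "st ws (atoms1 (src P x))" using st d 1(1) by (simp add: bd2_simps)
  have wy: "st (sm x ws) (atoms1 (src P y))"
    using sqD(1)[OF sq_cell[OF 1(2) d wx]] Cmp1_mid(5)[of x y] c d 1(1) by simp
  have "ev y' = ev y" using ev_eqv[OF e(2)] 1(4) by simp
  moreover have "sm x' ws = sm x ws" using sm_eqv[OF e(1) d wx] by simp
  moreover have "K x' ws = K x ws" "E x' ws = E x ws" using Q(1) wx by auto
  moreover have "K y' (sm x ws) = K y (sm x ws)" "E y' (sm x ws) = E y (sm x ws)" using Q(2) wy by auto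
  ultimately show ?thesis using 1(1) by simp
qed

lemma KE_assoc:
  assumes c: "cell P p (Cmp i (Cmp i x y) z)" and c': "cell P p (Cmp i x (Cmp i y z))" and d: "cdim x = 2" and i: "i = 0 \<or> i = 1"
    and st: "st ws (atoms1 (src P (Cmp i (Cmp i x y) z)))"
  shows "K (Cmp i (Cmp i x y) z) ws = K (Cmp i x (Cmp i y z)) ws \<and> E (Cmp i (Cmp i x y) z) ws = E (Cmp i x (Cmp i y z)) ws"
proof (cases "i = 0")
  case True
  have dy: "cdim y = 2" using c d by (simp add: cell_Cmp_iff)
  show ?thesis using d dy True by (simp add: bd2_simps drop_take add.commute assoc)
next
  case False
  then have i: "i = 1" using i by simp
  have cxy: "cell P p (Cmp 1 x y)" "cell P p z" and cyz: "cell P p (Cmp 1 y z)" and dz: "cdim z = 2"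
    using c c' d i by (simp_all add: cell_Cmp_iff)
  note m1 = Cmp1_mid[OF cxy(1) d]
  note m2 = Cmp1_mid[OF cyz m1(3)]
  have wx: "st ws (atoms1 (src P x))" using st d i by (simp add: bd2_simps)
  note X = sq_cell[OF m1(1) d wx]
  have wy: "st (sm x ws) (atoms1 (src P y))" using sqD(1)[OF X] m1(5) by simp
  note Y = sq_cell[OF m1(2,3) wy]
  have wz: "st (sm y (sm x ws)) (atoms1 (src P z))" using sqD(1)[OF Y] m2(5) by simp
  note Z = sq_cell[OF cxy(2) dz wz]
  note b = bd2[OF m1(1) d] bd2[OF m1(2,3)] bd2[OF cxy(2) dz] and s = sqD[OF X, unfolded m1(6,7)] sqD[OF Y, unfolded m2(6,7)] sqD[OF Z]
    and o = sq0[OF m1(1) d wx X] sq0[OF m1(2,3) wy Y] sq0[OF cxy(2) dz wz Z]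
  have 1: "((E x ws \<odot> ev y) \<bullet> (K x ws \<odot> E y (sm x ws))) \<odot> ev z = ((E x ws \<odot> ev y) \<odot> ev z) \<bullet> ((K x ws \<odot> E y (sm x ws)) \<odot> ev z)"
    by (rule dist_r) (use b s o m1(8) m2(8) in \<open>simp_all add: assoc\<close>)
  have 2: "K x ws \<odot> ((E y (sm x ws) \<odot> ev z) \<bullet> (K y (sm x ws) \<odot> E z (sm y (sm x ws))))
     = (K x ws \<odot> E y (sm x ws) \<odot> ev z) \<bullet> (K x ws \<odot> K y (sm x ws) \<odot> E z (sm y (sm x ws)))"
    by (rule dist_l) (use b s o m1(8) m2(8) in \<open>simp_all add: assoc\<close>)
  show ?thesis unfolding i using 1 2 by (simp add: assoc)
qed

lemma KE_units:
  assumes c: "cell P p x" and d: "cdim x = 2" and st: "st ws (atoms1 (src P x))"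
  shows "K (Cmp 0 (Idt (Idt (src_at P 0 x))) x) ws = K x ws \<and> E (Cmp 0 (Idt (Idt (src_at P 0 x))) x) ws = E x ws"
    "K (Cmp 1 (Idt (src P x)) x) ws = K x ws \<and> E (Cmp 1 (Idt (src P x)) x) ws = E x ws"
    "K (Cmp 0 x (Idt (Idt (tgt_at P 0 x)))) ws = K x ws \<and> E (Cmp 0 x (Idt (Idt (tgt_at P 0 x)))) ws = E x ws"
    "K (Cmp 1 x (Idt (tgt P x))) ws = K x ws \<and> E (Cmp 1 x (Idt (tgt P x))) ws = E x ws"
proof -
  note X = sq_cell[OF c d st]
  note s = sqD[OF X] and b = bd2[OF c d] and o = sq0[OF c d st X] and q = qs[OF bd2(1,3)[OF c d] st] qs[OF bd2(2,4)[OF c d] sqD(1)[OF X]]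
  have a: "src_at P 0 x = src P (src P x)" "tgt_at P 0 x = tgt P (tgt P x)"
    using at_Suc[OF c, of 0] at_Suc[OF b(1), of 0] at_Suc[OF b(2), of 0] b d m3 bd_cell[OF b(1)] bd_cell[OF b(2)] by simp_all
  have l: "length ws = ln x" using list_all2_lengthD[OF st] .
  show "K (Cmp 0 (Idt (Idt (src_at P 0 x))) x) ws = K x ws \<and> E (Cmp 0 (Idt (Idt (src_at P 0 x))) x) ws = E x ws"
    unfolding a using s o by (simp add: qs_def ls_def unit_l')
  show "K (Cmp 0 x (Idt (Idt (tgt_at P 0 x)))) ws = K x ws \<and> E (Cmp 0 x (Idt (Idt (tgt_at P 0 x)))) ws = E x ws"
    unfolding a using s o b l by (simp add: qs_def ls_def unit_r')
  have 1: "ls (src P x) ws \<odot> K x ws = K x ws" "ls (src P x) ws \<odot> E x ws = E x ws" "(qs (src P x) ws \<odot> ev x) \<bullet> E x ws = E x ws"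
    by (rule unit_l'; use s o q in simp)+
  then show "K (Cmp 1 (Idt (src P x)) x) ws = K x ws \<and> E (Cmp 1 (Idt (src P x)) x) ws = E x ws" by simp
  have 2: "K x ws \<odot> ls (tgt P x) (sm x ws) = K x ws" "E x ws \<odot> ev (tgt P x) = E x ws" "E x ws \<bullet> (K x ws \<odot> qs (tgt P x) (sm x ws)) = E x ws"
    by (rule unit_r'; use s o q in simp)+
  then show "K (Cmp 1 x (Idt (tgt P x))) ws = K x ws \<and> E (Cmp 1 x (Idt (tgt P x))) ws = E x ws" by simp
qed

lemma KE_exch:
  assumes c: "cell P p (Cmp 0 (Cmp 1 x y) (Cmp 1 z w))" and c': "cell P p (Cmp 1 (Cmp 0 x z) (Cmp 0 y w))" and d: "cdim x = 2"
    and st: "st ws (atoms1 (src P (Cmp 0 (Cmp 1 x y) (Cmp 1 z w))))"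
  shows "K (Cmp 0 (Cmp 1 x y) (Cmp 1 z w)) ws = K (Cmp 1 (Cmp 0 x z) (Cmp 0 y w)) ws \<and>
    E (Cmp 0 (Cmp 1 x y) (Cmp 1 z w)) ws = E (Cmp 1 (Cmp 0 x z) (Cmp 0 y w)) ws"
proof -
  have c1: "cell P p (Cmp 1 x y)" "cell P p (Cmp 1 z w)" "cell P p (Cmp 0 x z)" "cell P p (Cmp 0 y w)" "cdim z = 2"
    using c c' d by (simp_all add: cell_Cmp_iff)
  note m1 = Cmp1_mid[OF c1(1) d] and m2 = Cmp1_mid[OF c1(2,5)]
  have st': "st ws (atoms1 (src P (Cmp 0 x z)))" using st d c1(5) by (simp add: bd2_simps)
  obtain us vs where l: "ws = us @ vs" "st us (atoms1 (src P x))" "st vs (atoms1 (src P z))" "length us = ln x"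
    "ev (tgt P (src P x)) = ev (src P (src P z))"
    using Cmp0_split[OF c1(3) d st'] by blast
  note X = sq_cell[OF m1(1) d l(2)] and Z = sq_cell[OF m2(1) c1(5) l(3)]
  have wy: "st (sm x us) (atoms1 (src P y))" using sqD(1)[OF X] m1(5) by simp
  have ww: "st (sm z vs) (atoms1 (src P w))" using sqD(1)[OF Z] m2(5) by simp
  note Y = sq_cell[OF m1(2,3) wy] and W = sq_cell[OF m2(2,3) ww]
  have ly: "length (sm x us) = ln y" using list_all2_lengthD[OF wy] .
  note b = bd2[OF m1(1) d] bd2[OF m1(2,3)] bd2[OF m2(1) c1(5)] bd2[OF m2(2,3)]
    and s = sqD[OF X, unfolded m1(6,7)] sqD[OF Z, unfolded m2(6,7)] sqD[OF Y] sqD[OF W]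
    and o = sq0[OF m1(1) d l(2) X] sq0[OF m2(1) c1(5) l(3) Z] sq0[OF m1(2,3) wy Y] sq0[OF m2(2,3) ww W]
  note t0 = bd20[OF m1(2,3)] bd20[OF m2(2,3)] Cmp1_mid0[OF c1(1) d] Cmp1_mid0[OF c1(2,5)]
  have kk: "(K x us \<odot> K y (sm x us)) \<otimes> (K z vs \<odot> K w (sm z vs)) = (K x us \<otimes> K z vs) \<odot> (K y (sm x us) \<otimes> K w (sm z vs))"
    by (rule tens) (use s o l(5) in simp_all)
  have e1: "(E x us \<odot> ev y) \<otimes> (E z vs \<odot> ev w) = (E x us \<otimes> E z vs) \<odot> (ev y \<otimes> ev w)"
    by (rule tens) (use s o b l(5) m1(8) m2(8) in simp_all)
  have e2: "(K x us \<odot> E y (sm x us)) \<otimes> (K z vs \<odot> E w (sm z vs)) = (K x us \<otimes> K z vs) \<odot> (E y (sm x us) \<otimes> E w (sm z vs))"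
    by (rule tens) (use s o b l(5) m1(8) m2(8) in simp_all)
  \<comment> \<open>Composition along 0-cells is first exchanged with \<open>\<bullet>\<close>;
    \<open>e1\<close> and \<open>e2\<close> then exchange it with \<open>\<odot>\<close> inside the
    two factors.\<close>
  have ee: "((E x us \<odot> ev y) \<bullet> (K x us \<odot> E y (sm x us))) \<otimes> ((E z vs \<odot> ev w) \<bullet> (K z vs \<odot> E w (sm z vs)))
    = ((E x us \<odot> ev y) \<otimes> (E z vs \<odot> ev w)) \<bullet> ((K x us \<odot> E y (sm x us)) \<otimes> (K z vs \<odot> E w (sm z vs)))"
    by (rule exch) (use s o b l(5) m1(8) m2(8) t0 in \<open>simp_all add: assoc\<close>)
  show ?thesis using kk ee unfolding e1 e2 using l(1,4) ly d m1(3) by (simp add: bd2_simps)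
qed

lemma KE_idc:
  assumes c: "cell P p (Cmp 0 x y)" and d: "cdim x = 1" and st: "st ws (atoms1 (Cmp 0 x y))"
  shows "K (Idt (Cmp 0 x y)) ws = K (Cmp 0 (Idt x) (Idt y)) ws \<and> E (Idt (Cmp 0 x y)) ws = E (Cmp 0 (Idt x) (Idt y)) ws"
proof -
  obtain us vs where w: "ws = us @ vs" "st us (atoms1 x)" "st vs (atoms1 y)"
    using st by (auto simp: list_all2_append2)
  show ?thesis using qs_Cmp[OF c d w(2,3)] w(1) list_all2_lengthD[OF w(2)] by simp
qed

text \<open>Consecutive 3-cells share their middle 2-cell up to \<open>eqv\<close> only, so
  naturality can be composed along 2-cells only after this.\<close>

lemma KE_eqv:
  assumes "ceqv x y" "cdim x = 2" "st ws (atoms1 (src P x))"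
  shows "K x ws = K y ws" "E x ws = E y ws"
proof -
  have "\<forall>ws. st ws (atoms1 (src P x)) \<longrightarrow> K x ws = K y ws \<and> E x ws = E y ws"
    using assms(1,2)
  proof (induction rule: eqv2_induct)
    case (sym x y) then show ?case using atoms_bd[of x y] p2 m3 by simp
  next
    case (trans x y z) then show ?case using atoms_bd[of x y] p2 m3 by simp
  next
    case (Idt x y) then show ?case using qs_eqv[of x y] by simp
  next
    case (Cmp i x x' y y') then show ?case using KE_eqv_Cmp[of x x' y y' i] by blast
  next
    case (assoc i x y z) then show ?case using KE_assoc by blast
  next
    case (ul0 x)
    then have "src P (Cmp 0 (Idt (Idt (src_at P 0 x))) x) = Cmp 0 (Idt (src_at P 0 x)) (src P x)"
      using at_cell[of x 0] m3 by (simp add: One_nat_def)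
    then show ?case using KE_units(1)[OF ul0] by simp
  next
    case (ul1 x) 
    then have "src P (Cmp 1 (Idt (src P x)) x) = src P x" using bd2[of x] by (simp add: bd2_simps)
    then show ?case using KE_units(2)[OF ul1] by simp
  next
    case (ur0 x)
    then show ?case using KE_units(3)[OF ur0] by (simp add: bd2_simps)
  next
    case (ur1 x)
    then show ?case using KE_units(4)[OF ur1] by (simp add: bd2_simps)
  next
    case (exch x y z w) then show ?case using KE_exch by blast
  next
    case (idc x y) then show ?case using KE_idc by simp
  qed (use p2 m3 in simp_all)
  then show "K x ws = K y ws" "E x ws = E y ws" using assms(3) by blast+
qed

section \<open>Compatibility of the squares with 3-cells\<close>

lemma bd3:
  assumes "cell P p x" "cdim x = 3"
  shows "cell P p (src P x)" "cell P p (tgt P x)" "cdim (src P x) = 2" "cdim (tgt P x) = 2"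
    "okq (ev x)" "srq 2 (ev x) = ev (src P x)" "tgq 2 (ev x) = ev (tgt P x)"
    "ceqv (src P (src P x)) (src P (tgt P x))" "ceqv (tgt P (src P x)) (tgt P (tgt P x))"
    "atoms1 (src P (tgt P x)) = atoms1 (src P (src P x))" "atoms1 (tgt P (tgt P x)) = atoms1 (tgt P (src P x))"
    "qs (src P (tgt P x)) ws = qs (src P (src P x)) ws" "ls (src P (tgt P x)) ws = ls (src P (src P x)) ws"
    "qs (tgt P (tgt P x)) ws = qs (tgt P (src P x)) ws" "ls (tgt P (tgt P x)) ws = ls (tgt P (src P x)) ws"
    "ev (src P (tgt P x)) = ev (src P (src P x))" "ev (tgt P (tgt P x)) = ev (tgt P (src P x))"
proof -
  show c: "cell P p (src P x)" "cell P p (tgt P x)" "cdim (src P x) = 2" "cdim (tgt P x) = 2"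
    using bd_cell[of x] assms m3 by simp_all
  show "okq (ev x)" using ok_ev assms by simp
  have d2: "cdim x = Suc 2" using assms by simp
  show "srq 2 (ev x) = ev (src P x)" "tgq 2 (ev x) = ev (tgt P x)" using bd_ev[OF assms(1) d2] by simp_all
  show e: "ceqv (src P (src P x)) (src P (tgt P x))" "ceqv (tgt P (src P x)) (tgt P (tgt P x))" using bd_glob[of x] assms m3 by simp_all
  have d: "cdim (src P (src P x)) = 1" "cdim (tgt P (src P x)) = 1" using bd2[OF c(1,3)] by simp_all
  show "atoms1 (src P (tgt P x)) = atoms1 (src P (src P x))" "atoms1 (tgt P (tgt P x)) = atoms1 (tgt P (src P x))"
    using eqv1_atoms[OF e(1)] eqv1_atoms[OF e(2)] d p2 m3 by simp_all
  show "qs (src P (tgt P x)) ws = qs (src P (src P x)) ws" "ls (src P (tgt P x)) ws = ls (src P (src P x)) ws"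
    "qs (tgt P (tgt P x)) ws = qs (tgt P (src P x)) ws" "ls (tgt P (tgt P x)) ws = ls (tgt P (src P x)) ws"
    "ev (src P (tgt P x)) = ev (src P (src P x))" "ev (tgt P (tgt P x)) = ev (tgt P (src P x))"
    using qs_eqv[OF e(1)] qs_eqv[OF e(2)] ev_eqv[OF e(1)] ev_eqv[OF e(2)] d by simp_all
qed

text \<open>Concatenation of lists is strictly associative and unital, and \<open>map f\<close>
  preserves it strictly. The crossings of a concatenated path decompose by \<open>KK_append\<close>,
  as \<mu> demands.\<close>

lemma sm_K_natural_gen: assumes g: "g \<in> gens P 3" and st: "st ws (atoms1 (src P (gsrc P 3 g)))"
  shows "sm (gsrc P 3 g) ws = sm (gtgt P 3 g) ws \<and> K (gsrc P 3 g) ws = K (gtgt P 3 g) ws"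
  using g
proof (cases rule: gens3_cases)
  case (1 a b c d)
  then obtain w1 w2 w3 where w: "ws = [w1, w2, w3]" "vw w1 (e_c InC a b)" "vw w2 (e_c InC b c)" "vw w3 (e_c InC c d)"
    using st by (auto simp: src_P wcmp_def list_all2_Cons2)
  obtain q1 where q1: "w1 = WC a q1" "set q1 \<subseteq> C" "b = last (a # q1)" using w(2) by (cases rule: vw_cases) auto
  obtain q2 where q2: "w2 = WC b q2" "set q2 \<subseteq> C" "c = last (b # q2)" using w(3) by (cases rule: vw_cases) auto
  obtain q3 where q3: "w3 = WC c q3" "set q3 \<subseteq> C" "d = last (c # q3)" using w(4) by (cases rule: vw_cases) auto
  have l: "c = last (a # q1 @ q2)" and q12: "set (q1 @ q2) \<subseteq> C" and q23: "set (q2 @ q3) \<subseteq> C" and q123: "set (q1 @ q2 @ q3) \<subseteq> C" using q1 q2 q3 by simp_all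
  note pp = MC.B.pth_append[OF 1(2) q12 q3(2), folded l] MC.B.pth_append[OF 1(2) q1(2) q23, folded q1(3)]
  have cs: "cell P p (e_c InC a b)" "cell P p (e_c InC c d)" using 1 bC.h_gen_simps(2) by (simp_all add: cell_Gen_iff One_nat_def)
  have u: "pthC a (q1 @ q2 @ q3) \<odot> pthC a (q1 @ q2 @ q3) = pthC a (q1 @ q2 @ q3)"
    by (rule unit_l') (use MC.B.pth[OF 1(2) q123] in simp_all)
  show ?thesis
    using 1(1) w(1) q1(1) q2(1) q3(1) u pp[symmetric] qs_one[OF w(2) cs(1)] qs_one[OF w(4) cs(2)]
    by (simp add: src_P wcmp_def sm_gen_def K_gen_def del: MC.B.pth MC.B.pth.simps)
next
  case (2 a b)
  then obtain w1 where w: "ws = [w1]" "vw w1 (e_c InC a b)"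
    using st by (auto simp: src_P wcmp_def list_all2_Cons2)
  obtain q1 where q1: "w1 = WC a q1" "set q1 \<subseteq> C" "b = last (a # q1)" using w(2) by (cases rule: vw_cases) auto
  note p1 = MC.B.pth[OF 2(2) q1(2)]
  have cs: "cell P p (e_c InC a b)" using 2 bC.h_gen_simps(2) by (simp_all add: cell_Gen_iff One_nat_def)
  have u: "pthC a q1 \<odot> pthC a q1 = pthC a q1" "J (obj_c InC a) \<otimes> pthC a q1 = pthC a q1"
    by (rule unit_l'; use p1 2(2) in simp)+
  show ?thesis
    using 2(1) w(1) q1(1) u qs_one[OF w(2) cs] by (simp add: src_P wcmp_def sm_gen_def K_gen_def del: MC.B.pth)
next
  case (3 a b)
  then obtain w1 where w: "ws = [w1]" "vw w1 (e_c InC a b)"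
    using st by (auto simp: src_P wcmp_def list_all2_Cons2)
  obtain q1 where q1: "w1 = WC a q1" "set q1 \<subseteq> C" "b = last (a # q1)" using w(2) by (cases rule: vw_cases) auto
  note p1 = MC.B.pth[OF 3(2) q1(2), folded q1(3)]
  have cs: "cell P p (e_c InC a b)" using 3 bC.h_gen_simps(2) by (simp_all add: cell_Gen_iff One_nat_def)
  have u: "pthC a q1 \<odot> pthC a q1 = pthC a q1" by (rule unit_l'; use p1 in simp)
  have u': "pthC a q1 \<otimes> J (obj_c InC b) = pthC a q1" by (rule unit_r'; use p1 3(3) in simp)
  show ?thesis
    using 3(1) w(1) q1(1) u u' qs_one[OF w(2) cs] by (simp add: src_P wcmp_def sm_gen_def K_gen_def del: MC.B.pth)
next
  case (4 a b c d)
  then obtain w1 w2 w3 where w: "ws = [w1, w2, w3]" "vw w1 (e_c InD a b)" "vw w2 (e_c InD b c)" "vw w3 (e_c InD c d)"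
    using st by (auto simp: src_P wcmp_def list_all2_Cons2)
  obtain q1 where q1: "w1 = WD a q1" "set q1 \<subseteq> D" "b = last (a # q1)" using w(2) by (cases rule: vw_cases) auto
  obtain q2 where q2: "w2 = WD b q2" "set q2 \<subseteq> D" "c = last (b # q2)" using w(3) by (cases rule: vw_cases) auto
  obtain q3 where q3: "w3 = WD c q3" "set q3 \<subseteq> D" "d = last (c # q3)" using w(4) by (cases rule: vw_cases) auto
  have l: "c = last (a # q1 @ q2)" and q12: "set (q1 @ q2) \<subseteq> D" and q23: "set (q2 @ q3) \<subseteq> D" and q123: "set (q1 @ q2 @ q3) \<subseteq> D" using q1 q2 q3 by simp_all
  note pp = MD.B.pth_append[OF 4(2) q12 q3(2), folded l] MD.B.pth_append[OF 4(2) q1(2) q23, folded q1(3)]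
  have cs: "cell P p (e_c InD a b)" "cell P p (e_c InD c d)" using 4 bD.h_gen_simps(2) by (simp_all add: cell_Gen_iff One_nat_def)
  have u: "pthD a (q1 @ q2 @ q3) \<odot> pthD a (q1 @ q2 @ q3) = pthD a (q1 @ q2 @ q3)"
    by (rule unit_l') (use MD.B.pth[OF 4(2) q123] in simp_all)
  show ?thesis
    using 4(1) w(1) q1(1) q2(1) q3(1) u pp[symmetric] qs_one[OF w(2) cs(1)] qs_one[OF w(4) cs(2)]
    by (simp add: src_P wcmp_def sm_gen_def K_gen_def del: MD.B.pth MD.B.pth.simps)
next
  case (5 a b)
  then obtain w1 where w: "ws = [w1]" "vw w1 (e_c InD a b)"
    using st by (auto simp: src_P wcmp_def list_all2_Cons2)
  obtain q1 where q1: "w1 = WD a q1" "set q1 \<subseteq> D" "b = last (a # q1)" using w(2) by (cases rule: vw_cases) auto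
  note p1 = MD.B.pth[OF 5(2) q1(2)]
  have cs: "cell P p (e_c InD a b)" using 5 bD.h_gen_simps(2) by (simp_all add: cell_Gen_iff One_nat_def)
  have u: "pthD a q1 \<odot> pthD a q1 = pthD a q1" "J (obj_c InD a) \<otimes> pthD a q1 = pthD a q1"
    by (rule unit_l'; use p1 5(2) in simp)+
  show ?thesis
    using 5(1) w(1) q1(1) u qs_one[OF w(2) cs] by (simp add: src_P wcmp_def sm_gen_def K_gen_def del: MD.B.pth)
next
  case (6 a b)
  then obtain w1 where w: "ws = [w1]" "vw w1 (e_c InD a b)"
    using st by (auto simp: src_P wcmp_def list_all2_Cons2)
  obtain q1 where q1: "w1 = WD a q1" "set q1 \<subseteq> D" "b = last (a # q1)" using w(2) by (cases rule: vw_cases) auto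
  note p1 = MD.B.pth[OF 6(2) q1(2), folded q1(3)]
  have cs: "cell P p (e_c InD a b)" using 6 bD.h_gen_simps(2) by (simp_all add: cell_Gen_iff One_nat_def)
  have u: "pthD a q1 \<odot> pthD a q1 = pthD a q1" by (rule unit_l'; use p1 in simp)
  have u': "pthD a q1 \<otimes> J (obj_c InD b) = pthD a q1" by (rule unit_r'; use p1 6(3) in simp)
  show ?thesis
    using 6(1) w(1) q1(1) u u' qs_one[OF w(2) cs] by (simp add: src_P wcmp_def sm_gen_def K_gen_def del: MD.B.pth)
next
  case (7 a b c)
  then obtain w1 w2 w3 where w: "ws = [w1, w2, w3]" "vw w1 (e_c InC a b)" "vw w2 (e_c InC b c)" "vw w3 (u_c c)"
    using st by (auto simp: src_P wcmp_def list_all2_Cons2)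
  obtain q1 where q1: "w1 = WC a q1" "set q1 \<subseteq> C" "b = last (a # q1)" using w(2) by (cases rule: vw_cases) auto
  obtain q2 where q2: "w2 = WC b q2" "set q2 \<subseteq> C" "c = last (b # q2)" using w(3) by (cases rule: vw_cases) auto
  have w3: "w3 = WU c" using w(4) by (cases rule: vw_cases) auto
  have l: "c = last (a # q1 @ q2)" "f b = last (f a # map f q1)" "f c = last (f b # map f q2)" and q12: "set (q1 @ q2) \<subseteq> C"
    using q1 q2 Q.last_map_f[of a q1] Q.last_map_f[of b q2] by simp_all
  have fD: "set (map f q1) \<subseteq> D" "set (map f q2) \<subseteq> D" "f a \<in> D" "f b \<in> D" "f c \<in> D" using q1(2) q2(2) fD 7 by auto
  have cs: "cell P p (e_c InC a b)" "cell P p (u_c c)" "cell P p (e_c InD (f b) (f c))" "cell P p (u_c a)"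
    using 7 fD bC.h_gen_simps(2) bD.h_gen_simps(2) new_gens_simps(1) by (simp_all add: cell_Gen_iff One_nat_def)
  note k12 = Q.KK[OF 7(2) q12, folded l(1)] and ka = Q.KK_append[OF 7(2) q1(2) q2(2) q1(3)]
    and k1 = Q.KK[OF 7(2) q1(2), folded q1(3)] and k2 = Q.KK[OF 7(3) q2(2), folded q2(3)]
    and d1 = Q.pthD[OF 7(2) q1(2), folded q1(3)] and d2 = Q.pthD[OF 7(3) q2(2), folded q2(3)]
  have vwD: "vw (WD (f b) (map f q2)) (e_c InD (f b) (f c))" "vw (WU a) (u_c a)" using fD l 7 by simp_all
  have u1: "(pthC a (q1 @ q2) \<otimes> J (u_c c)) \<odot> Q.KK a (q1 @ q2) = Q.KK a (q1 @ q2)"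
    by (rule unit_l') (use k12 in simp_all)
  have "pthD (f a) (map f (q1 @ q2)) = pthD (f a) (map f q1 @ map f q2)" by simp
  then have "tgq 1 (Q.KK a (q1 @ q2)) = J (u_c a) \<otimes> pthD (f a) (map f q1 @ map f q2)" using k12(3) by simp
  then have u2: "Q.KK a (q1 @ q2) \<odot> (J (u_c a) \<otimes> pthD (f a) (map f q1 @ map f q2)) = Q.KK a (q1 @ q2)"
    by (intro unit_r') (use k12(1) in simp_all)
  have K1: "K (gsrc P 3 g) ws = Q.KK a (q1 @ q2)"
    using 7(1) w(1) q1(1) q2(1) w3 u1 qs_one[OF w(4) cs(2)]
    by (simp add: src_P wcmp_def sm_gen_def K_gen_def del: Q.KK.simps MC.B.pth.simps Q.KK MC.B.pth)
  have K2: "K (gtgt P 3 g) ws = ((pthC a q1 \<otimes> Q.KK b q2) \<odot> (Q.KK a q1 \<otimes> pthD (f b) (map f q2))) \<odot> (J (u_c a) \<otimes> pthD (f a) (map f q1 @ map f q2))"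
    using 7(1) w(1) q1(1) q2(1) w3 qs_one[OF w(2) cs(1)] qs_one[OF vwD(1) cs(3)] qs_one[OF vwD(2) cs(4)]
    by (simp add: src_P wcmp_def sm_gen_def K_gen_def del: Q.KK.simps MC.B.pth.simps MD.B.pth.simps Q.KK MC.B.pth)
  have "sm (gsrc P 3 g) ws = sm (gtgt P 3 g) ws"
    using 7(1) w(1) q1(1) q2(1) w3 by (simp add: src_P wcmp_def sm_gen_def)
  then show ?thesis unfolding K1 K2 using u2 unfolding ka by simp
next
  case (8 a)
  then have w: "ws = [WU a]" using st by (auto simp: src_P wcmp_def list_all2_Cons2 elim!: vw_cases)
  have cs: "cell P p (u_c a)" "vw (WU a) (u_c a)" using 8 new_gens_simps(1) by (simp_all add: cell_Gen_iff One_nat_def)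
  have u: "J (obj_c InC a) \<otimes> J (u_c a) = J (u_c a)" "J (u_c a) \<odot> J (u_c a) = J (u_c a)" by (rule unit_l'; use 8 in simp)+
  have u': "J (u_c a) \<otimes> J (obj_c InD (f a)) = J (u_c a)" by (rule unit_r'; use 8 in simp)
  show ?thesis using 8(1) w u u' qs_one[OF cs(2,1)] by (simp add: src_P wcmp_def sm_gen_def K_gen_def)
qed

lemma sm_K_natural: "cell P p x \<Longrightarrow> cdim x = 3 \<Longrightarrow> st ws (atoms1 (src P (src P x))) \<Longrightarrow>
  sm (src P x) ws = sm (tgt P x) ws \<and> K (src P x) ws = K (tgt P x) ws"
proof (induction x arbitrary: ws)
  case (Gen k g)
  then show ?case using sm_K_natural_gen[of g ws] by (simp add: cell_Gen_iff)
next
  \<comment> \<open>Both equations are symmetric in source and target, so an inverse inherits them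
    from its generator.\<close>
  case (Inv k g)
  have k: "k = 3" "g \<in> gens P 3" using Inv.prems by (auto elim: cell_InvE)
  then have "cell P p (Gen 3 g)" by (simp add: cell_Gen_iff)
  from bd3(10)[OF this] have "st ws (atoms1 (src P (gsrc P 3 g)))" using Inv.prems k by simp
  then show ?case using sm_K_natural_gen[OF k(2)] k(1) by simp
next
  case (Idt x) then show ?case by simp
next
  case (Cmp i x y)
  have c: "cell P p x" "cell P p y" "cdim x = 3" "cdim y = 3" "i < 3" "ceqv (tgt_at P i x) (src_at P i y)"
    using Cmp.prems by (simp_all add: cell_Cmp_iff)
  note bx = bd3[OF c(1,3)] and b_y = bd3[OF c(2,4)]
  consider "i = 0" | "i = 1" | "i = 2" using c(5) by linarith
  then show ?case
  proof cases
    case 1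
    have s: "src P (Cmp i x y) = Cmp 0 (src P x) (src P y)" "tgt P (Cmp i x y) = Cmp 0 (tgt P x) (tgt P y)" using 1 c by simp_all
    have cc: "cell P p (Cmp 0 (src P x) (src P y))" using bd_cell[OF Cmp.prems(1)] Cmp.prems(2) m3 s by simp
    obtain us vs where w: "ws = us @ vs" "st us (atoms1 (src P (src P x)))" "st vs (atoms1 (src P (src P y)))" "length us = ln (src P x)"
      using Cmp0_split[OF cc bx(3) Cmp.prems(3)[unfolded s]] by blast
    have "ln (tgt P x) = ln (src P x)" using bx(10) by simp
    then show ?thesis unfolding s using w Cmp.IH(1)[OF c(1,3) w(2)] Cmp.IH(2)[OF c(2,4) w(3)] by simp
  next
    case 2
    have s: "src P (Cmp i x y) = Cmp 1 (src P x) (src P y)" "tgt P (Cmp i x y) = Cmp 1 (tgt P x) (tgt P y)" using 2 c by simp_all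
    have cc: "cell P p (Cmp 1 (src P x) (src P y))" using bd_cell[OF Cmp.prems(1)] Cmp.prems(2) m3 s by simp
    have wx: "st ws (atoms1 (src P (src P x)))" using Cmp.prems(3) bx(3) unfolding s by (simp add: bd2_simps)
    have wy: "st (sm (src P x) ws) (atoms1 (src P (src P y)))"
      using sqD(1)[OF sq_cell[OF bx(1,3) wx]] Cmp1_mid(5)[OF cc bx(3)] by simp
    show ?thesis unfolding s using Cmp.IH(1)[OF c(1,3) wx] Cmp.IH(2)[OF c(2,4) wy] by simp
  next
    case 3
    have s: "src P (Cmp i x y) = src P x" "tgt P (Cmp i x y) = tgt P y" using 3 c by simp_all
    have e: "ceqv (tgt P x) (src P y)" using c 3 by (simp add: src_at_def tgt_at_def)
    have wx: "st ws (atoms1 (src P (src P x)))" using Cmp.prems(3) unfolding s .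
    have wt: "st ws (atoms1 (src P (tgt P x)))" using wx bx(10) by simp
    have wy: "st ws (atoms1 (src P (src P y)))" using wt atoms_bd[OF e bx(4)] p2 m3 by simp
    show ?thesis unfolding s using Cmp.IH(1)[OF c(1,3) wx] Cmp.IH(2)[OF c(2,4) wy] sm_eqv[OF e bx(4) wt] KE_eqv[OF e bx(4) wt] by simp
  qed
qed

end

context pf_alg begin

text \<open>On the target of \<open>mu\<close> the definition of \<open>E\<close> treats the two
  crossings one after the other, whereas \<open>PHI_mu\<close> needs them simultaneously. The two
  cells act on neighbouring factors, so exchange converts one form into the other.\<close>

lemma M'_PHI_split:
  assumes o: "a \<in> CC" "set p \<subseteq> CC" "set q \<subseteq> CC" and b: "b = last (a # p)" "c = last (b # q)"
  shows "((C.cmb a p \<otimes> PHI b q) \<odot> (ph a b \<otimes> e' b c)) \<bullet> ((C.pth a p \<otimes> KK b q) \<odot> (PHI a p \<otimes> D.cmb (f b) (map f q)))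
    = (C.pth a p \<otimes> PHI b q) \<odot> (PHI a p \<otimes> e' b c)"
proof -
  have o': "b \<in> CC" "c \<in> CC" using o b C.last_in[of p] C.last_in[of q] by auto
  note P = PHI[OF o(1,2) b(1)] and Q = PHI[OF o'(1) o(3) b(2)]
  note hP = H'D[OF P(1)] and hQ = H'D[OF Q(1)] and cp = C.cmb[OF o(1,2), folded b(1)] and Gq = cmbD[OF o'(1) o(3) refl, folded b(2)]
    and k = KK[OF o'(1) o(3), folded b(2)] and dq = pthD[OF o'(1) o(3), folded b(2)]
  let ?X = "C.pth a p \<otimes> PHI b q" and ?Y = "PHI a p \<otimes> e' b c"
  have ok: "ok (?X \<odot> ?Y)" using hP hQ o' by (simp add: assoc)
  have 1: "?X \<odot> ?Y = (?X \<odot> srq' ?Y) \<bullet> (tgq' ?X \<odot> ?Y)" if "srq' = sr 2" "tgq' = tg 2" for srq' tgq'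
    unfolding that by (rule split_l[OF _ _ ok]) simp_all
  have "((C.cmb a p \<otimes> u b) \<odot> ph a b) \<otimes> e' b c = ((C.cmb a p \<otimes> u b) \<otimes> e' b c) \<odot> (ph a b \<otimes> e' b c)"
    by (rule dist_r) (use cp o(1) o' in \<open>simp_all add: idn_def del: C.cmb\<close>)
  then have 2: "sr 2 ?Y = (C.cmb a p \<otimes> u b \<otimes> e' b c) \<odot> (ph a b \<otimes> e' b c)"
    using P o' by (simp add: PH_def assoc)
  have 3: "?X \<odot> (C.cmb a p \<otimes> u b \<otimes> e' b c) = C.cmb a p \<otimes> PHI b q"
    using split_r[of 0 1 "C.cmb a p" "PHI b q"] hQ cp by (simp del: C.cmb)
  have "C.pth a p \<otimes> (KK b q \<odot> (u b \<otimes> D.cmb (f b) (map f q))) = (C.pth a p \<otimes> KK b q) \<odot> (C.pth a p \<otimes> u b \<otimes> D.cmb (f b) (map f q))"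
    by (rule dist_l) (use hP k Gq dq o' in \<open>simp_all add: idn_def del: KK cmbD pthD\<close>)
  then have 4: "tg 2 ?X = (C.pth a p \<otimes> KK b q) \<odot> (C.pth a p \<otimes> u b \<otimes> D.cmb (f b) (map f q))"
    using Q(3) hP by (simp add: LL_def)
  have 5: "(C.pth a p \<otimes> u b \<otimes> D.cmb (f b) (map f q)) \<odot> ?Y = PHI a p \<otimes> D.cmb (f b) (map f q)"
    using split_r[of 0 1 "PHI a p" "D.cmb (f b) (map f q)"] hP Gq by (simp add: assoc del: cmbD)
  have 6: "?X \<odot> ((C.cmb a p \<otimes> u b \<otimes> e' b c) \<odot> (ph a b \<otimes> e' b c)) = (C.cmb a p \<otimes> PHI b q) \<odot> (ph a b \<otimes> e' b c)"
    using assoc[of 1 ?X "C.cmb a p \<otimes> u b \<otimes> e' b c" "ph a b \<otimes> e' b c"] unfolding 3 by simp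
  have 7: "((C.pth a p \<otimes> KK b q) \<odot> (C.pth a p \<otimes> u b \<otimes> D.cmb (f b) (map f q))) \<odot> ?Y = (C.pth a p \<otimes> KK b q) \<odot> (PHI a p \<otimes> D.cmb (f b) (map f q))"
    using assoc[of 1 "C.pth a p \<otimes> KK b q" "C.pth a p \<otimes> u b \<otimes> D.cmb (f b) (map f q)" ?Y] unfolding 5 by simp
  show ?thesis using 1[OF refl refl] unfolding 2 4 6 7 by simp
qed

end

text \<open>What distinguishes the (4,2)-case: a generating 4-cell identifies its boundary, and
  3-cells are invertible modulo \<open>R\<close>.\<close>

locale pf_coh_model = pf_model C D f p m R
  for C :: "'c set" and D :: "'d set" and f :: "'c \<Rightarrow> 'd" and p m :: nat and R +
  assumes R4: "g \<in> gens P 4 \<Longrightarrow> R (gsrc P 4 g) (gtgt P 4 g)"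
    and invq: "okq x \<Longrightarrow> \<exists>y. okq y \<and> cpq 2 x y = srq 2 x \<and> cpq 2 y x = tgq 2 x"
begin

sublocale coh: pf_coh okq cpq srq tgq "{}"
  C "\<lambda>a. J (obj_c InC a)" "\<lambda>a b. J (e_c InC a b)" "\<lambda>a. J (i_c InC a)"
  "\<lambda>a b c. J (m_c InC a b c)" "\<lambda>a b c d. J (alpha_c InC a b c d)" "\<lambda>a b. J (lambda_c InC a b)" "\<lambda>a b. J (rho_c InC a b)"
  D "\<lambda>a. J (obj_c InD a)" "\<lambda>a b. J (e_c InD a b)" "\<lambda>a. J (i_c InD a)"
  "\<lambda>a b c. J (m_c InD a b c)" "\<lambda>a b c d. J (alpha_c InD a b c d)" "\<lambda>a b. J (lambda_c InD a b)" "\<lambda>a b. J (rho_c InD a b)"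
  f "\<lambda>a. J (u_c a)" "\<lambda>a b. J (phi_c a b)" "\<lambda>a b c. J (mu_c a b c)" "\<lambda>a. J (nu_c a)"
proof (unfold_locales, goal_cases)
  case (1 f) then show ?case by (rule invq)
next
  case (2 a b c d x) then show ?case using R_ev[OF R4[OF gens4(1)[of a b c d x]]] by (simp add: src_P assoc)
next
  case (3 a b c) then show ?case using R_ev[OF R4[OF gens4(2)[of a b c]]] by (simp add: src_P assoc)
next
  case (4 a b c d x) then show ?case using R_ev[OF R4[OF gens4(3)[of a b c d x]]] by (simp add: src_P assoc)
next
  case (5 a b c) then show ?case using R_ev[OF R4[OF gens4(4)[of a b c]]] by (simp add: src_P assoc)
next
  case (6 a b c d) then show ?case using R_ev[OF R4[OF gens4(5)[of a b c d]]] by (simp add: src_P assoc)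
next
  case (7 a b) then show ?case using R_ev[OF R4[OF gens4(7)[of a b]]] by (simp add: src_P assoc)
next
  case (8 a b) then show ?case using R_ev[OF R4[OF gens4(6)[of a b]]] by (simp add: src_P assoc)
qed

text \<open>After evaluation of both squares, \<alpha> is \<open>A_al\<close>, \<rho> is
  \<open>A_unit_r\<close> and \<mu> is \<open>PHI_mu\<close>. For \<lambda> and \<nu> the square of
  the source is by definition the whiskered generator itself.\<close>

lemma E_natural_gen: assumes g: "g \<in> gens P 3" and st: "st ws (atoms1 (src P (gsrc P 3 g)))"
  shows "cpq 2 (cpq 1 (qs (src P (gsrc P 3 g)) ws) (J (Gen 3 g))) (E (gtgt P 3 g) ws) = E (gsrc P 3 g) ws"
proof -
  have gc: "cell P p (gsrc P 3 g)" "cdim (gsrc P 3 g) = 2" using bd3(1,3)[of "Gen 3 g"] g by (simp_all add: cell_Gen_iff)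
  from g show ?thesis
  proof (cases rule: gens3_cases)
  case (1 a b c d)
  then obtain w1 w2 w3 where w: "ws = [w1, w2, w3]" "vw w1 (e_c InC a b)" "vw w2 (e_c InC b c)" "vw w3 (e_c InC c d)"
    using st by (auto simp: src_P wcmp_def list_all2_Cons2)
  obtain q1 where q1: "w1 = WC a q1" "set q1 \<subseteq> C" "b = last (a # q1)" using w(2) by (cases rule: vw_cases) auto
  obtain q2 where q2: "w2 = WC b q2" "set q2 \<subseteq> C" "c = last (b # q2)" using w(3) by (cases rule: vw_cases) auto
  obtain q3 where q3: "w3 = WC c q3" "set q3 \<subseteq> C" "d = last (c # q3)" using w(4) by (cases rule: vw_cases) auto
  have l: "c = last (a # q1 @ q2)" "d = last (b # q2 @ q3)" and q12: "set (q1 @ q2) \<subseteq> C" and q23: "set (q2 @ q3) \<subseteq> C"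
    and d12: "d = last (a # (q1 @ q2) @ q3)" and d23: "d = last (a # q1 @ q2 @ q3)" using q1 q2 q3 by simp_all
  have cs: "cell P p (e_c InC a b)" "cell P p (e_c InC b c)" "cell P p (e_c InC c d)" using 1 bC.h_gen_simps(2) by (simp_all add: cell_Gen_iff One_nat_def)
  note pp = MC.B.pth_append[OF 1(2) q12 q3(2), folded l] MC.B.pth_append[OF 1(2) q1(2) q23, folded q1(3)]
  note A12 = MC.B.A[OF 1(2) q12 q3(2), folded l(1) d12] and A23 = MC.B.A[OF 1(2) q1(2) q23, folded q1(3) d23]
  note c3 = MC.B.cmb[OF 1(4) q3(2), folded q3(3)] and c1 = MC.B.cmb[OF 1(2) q1(2), folded q1(3)] and c2 = MC.B.cmb[OF 1(3) q2(2), folded q2(3)]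
  have sA: "srq 1 (MC.B.A a (q1 @ q2) q3) = pthC a (q1 @ q2 @ q3)" "srq 1 (MC.B.A a q1 (q2 @ q3)) = pthC a (q1 @ q2 @ q3)"
    using MC.B.bd1I(1)[OF A12(2,3)] MC.B.bd1I(1)[OF A23(2,3)] MC.B.M_simps(5)[OF MC.B.cmb(1)[OF 1(2) q12, folded l(1)] c3(1)]
      MC.B.M_simps(5)[OF c1(1) MC.B.cmb(1)[OF 1(3) q23, folded l(2)]] MC.B.cmb(3)[OF 1(2) q12] MC.B.cmb(3)[OF 1(3) q23] c1(3) c3(3) pp
    by simp_all
  have u: "(pthC a (q1 @ q2) \<otimes> pthC c q3) \<odot> MC.B.A a (q1 @ q2) q3 = MC.B.A a (q1 @ q2) q3"
    "(pthC a q1 \<otimes> pthC b (q2 @ q3)) \<odot> MC.B.A a q1 (q2 @ q3) = MC.B.A a q1 (q2 @ q3)"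
    using sA unit_l'[of 1 "MC.B.A a (q1 @ q2) q3"] unit_l'[of 1 "MC.B.A a q1 (q2 @ q3)"] A12(4) A23(4) pp by simp_all
  note q = qs_one[OF w(2) cs(1)] qs_one[OF w(3) cs(2)] qs_one[OF w(4) cs(3)]
  have s: "src P (gsrc P 3 g) = Cmp 0 (Cmp 0 (e_c InC a b) (e_c InC b c)) (e_c InC c d)" using 1(1) by (simp add: src_P wcmp_def)
  have "cell P p (src P (gsrc P 3 g))" using bd2(1)[OF gc(1,2)] .
  then have cs2: "cell P p (Cmp 0 (Cmp 0 (e_c InC a b) (e_c InC b c)) (e_c InC c d))" "cell P p (Cmp 0 (e_c InC a b) (e_c InC b c))"
    unfolding s by (simp_all add: cell_Cmp_iff)
  have qc: "qs (Cmp 0 (Cmp 0 (e_c InC a b) (e_c InC b c)) (e_c InC c d)) ([w1, w2] @ [w3]) = qs (Cmp 0 (e_c InC a b) (e_c InC b c)) [w1, w2] \<otimes> qs (e_c InC c d) [w3]"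
    "qs (Cmp 0 (e_c InC a b) (e_c InC b c)) ([w1] @ [w2]) = qs (e_c InC a b) [w1] \<otimes> qs (e_c InC b c) [w2]"
    by (rule qs_Cmp(1)[OF cs2(1)]; use w(2-4) in simp) (rule qs_Cmp(1)[OF cs2(2)]; use w(2-4) in simp)
  have Q0: "qs (src P (gsrc P 3 g)) ws = cmbC a q1 \<otimes> cmbC b q2 \<otimes> cmbC c q3"
    unfolding s w(1) using qc q q1(1) q2(1) q3(1) by (simp add: assoc)
  have E1: "E (gsrc P 3 g) ws = MC.B.M a c d (MC.B.A a q1 q2) (cmbC c q3) \<bullet> MC.B.A a (q1 @ q2) q3"
    using 1(1) w(1) q1(1) q2(1) q3(1) u q by (simp add: src_P wcmp_def sm_gen_def K_gen_def E_gen_def MC.B.M_def del: MC.B.A.simps MC.B.pth.simps MC.B.pth MC.B.A)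
  have E2: "E (gtgt P 3 g) ws = MC.B.M a b d (cmbC a q1) (MC.B.A b q2 q3) \<bullet> MC.B.A a q1 (q2 @ q3)"
    using 1(1) w(1) q1(1) q2(1) q3(1) u q by (simp add: src_P wcmp_def sm_gen_def K_gen_def E_gen_def MC.B.M_def del: MC.B.A.simps MC.B.pth.simps MC.B.pth MC.B.A)
  show ?thesis unfolding Q0 E1 E2 using coh.C.A_al[OF 1(2) q1(2) q2(2) q3(2) q1(3) q2(3) q3(3)] 1(1)
    by (simp add: MC.B.AL_def assoc del: MC.B.A.simps)
next
  case (2 a b)
  then obtain w1 where w: "ws = [w1]" "vw w1 (e_c InC a b)"
    using st by (auto simp: src_P wcmp_def list_all2_Cons2)
  obtain q1 where q1: "w1 = WC a q1" "set q1 \<subseteq> C" "b = last (a # q1)" using w(2) by (cases rule: vw_cases) auto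
  have cs: "cell P p (e_c InC a b)" using 2 bC.h_gen_simps(2) by (simp_all add: cell_Gen_iff One_nat_def)
  note c1 = MC.B.cmb[OF 2(2) q1(2), folded q1(3)] and p1 = MC.B.pth[OF 2(2) q1(2)]
  have nil: "set [] \<subseteq> C" "b = last (a # [] @ q1)" "a = last (a # [])" using q1(3) by simp_all
  note Aq = MC.B.A[OF 2(2) nil(1) q1(2), folded nil(2,3)]
  note LA = MC.B.LA_simps[OF c1(1)]
  have LA0: "MC.B.A a [] q1 = MC.B.LA a b (cmbC a q1)" using q1(3) by simp
  have s1: "srq 1 (MC.B.LA a b (cmbC a q1)) = pthC a q1"
    using MC.B.bd1I(1)[OF LA(3,4)] MC.B.M_simps(5)[OF MC.B.H_ii[OF 2(2)] MC.B.H_bd(1)[OF c1(1)]] c1(2,3) 2(2) p1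
    by (simp add: unit_l')
  have u: "(J (obj_c InC a) \<otimes> pthC a q1) \<odot> MC.B.LA a b (cmbC a q1) = MC.B.LA a b (cmbC a q1)"
    using unit_l'[of 1 "MC.B.LA a b (cmbC a q1)"] unit_l'[of 0 "pthC a q1" "J (obj_c InC a)"] LA(1) s1 p1 by simp
  have u2: "MC.B.M a a b (J (i_c InC a)) (cmbC a q1) \<bullet> MC.B.LA a b (cmbC a q1) = MC.B.LA a b (cmbC a q1)"
    by (rule unit_l') (use LA c1 in simp_all)
  have u3: "MC.B.LA a b (cmbC a q1) \<bullet> cmbC a q1 = MC.B.LA a b (cmbC a q1)"
    by (rule unit_r') (use LA c1 in simp_all)
  have Q0: "qs (src P (gsrc P 3 g)) ws = cmbC a q1"
    using 2(1) qs_Cmp(1)[of "Idt (obj_c InC a)" "e_c InC a b" "[]" "[w1]"] bd2(1)[OF gc(1,2)] w q1(1) qs_one[OF w(2) cs] 2(2) c1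
    by (simp add: src_P wcmp_def) (simp add: qs_def unit_l')
  have E1: "E (gsrc P 3 g) ws = MC.B.LA a b (cmbC a q1)"
    using 2(1) w(1) q1(1) u u2 qs_one[OF w(2) cs] LA0
    by (simp add: src_P wcmp_def sm_gen_def K_gen_def E_gen_def MC.B.M_def del: MC.B.A.simps MC.B.pth MC.B.A)
  have E2: "E (gtgt P 3 g) ws = cmbC a q1"
    using 2(1) w q1(1) qs_one[OF w(2) cs] by (simp add: src_P)
  show ?thesis unfolding Q0 E1 E2 using u3 2(1) by (simp add: MC.B.LA_def)
next
  case (3 a b)
  then obtain w1 where w: "ws = [w1]" "vw w1 (e_c InC a b)"
    using st by (auto simp: src_P wcmp_def list_all2_Cons2)
  obtain q1 where q1: "w1 = WC a q1" "set q1 \<subseteq> C" "b = last (a # q1)" using w(2) by (cases rule: vw_cases) auto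
  have cs: "cell P p (e_c InC a b)" using 3 bC.h_gen_simps(2) by (simp_all add: cell_Gen_iff One_nat_def)
  note c1 = MC.B.cmb[OF 3(2) q1(2), folded q1(3)] and p1 = MC.B.pth[OF 3(2) q1(2), folded q1(3)]
  note RH = MC.B.RH_simps[OF c1(1)]
  have RH0: "MC.B.A a q1 [] = MC.B.RH a b (cmbC a q1)" using coh.C.A_unit_r[OF 3(2) q1(2)] q1(3) by simp
  have s1: "srq 1 (MC.B.RH a b (cmbC a q1)) = pthC a q1"
    using MC.B.bd1I(1)[OF RH(3,4)] MC.B.M_simps(5)[OF MC.B.H_bd(1)[OF c1(1)] MC.B.H_ii[OF 3(3)]] c1(2,3) 3(3) p1
    by (simp add: unit_r')
  have u: "(pthC a q1 \<otimes> J (obj_c InC b)) \<odot> MC.B.RH a b (cmbC a q1) = MC.B.RH a b (cmbC a q1)"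
    using unit_l'[of 1 "MC.B.RH a b (cmbC a q1)"] unit_r'[of 0 "pthC a q1" "J (obj_c InC b)"] RH(1) s1 p1 by simp
  have u2: "MC.B.M a b b (cmbC a q1) (J (i_c InC b)) \<bullet> MC.B.RH a b (cmbC a q1) = MC.B.RH a b (cmbC a q1)"
    by (rule unit_l') (use RH c1 in simp_all)
  have u3: "MC.B.RH a b (cmbC a q1) \<bullet> cmbC a q1 = MC.B.RH a b (cmbC a q1)"
    by (rule unit_r') (use RH c1 in simp_all)
  have Q0: "qs (src P (gsrc P 3 g)) ws = cmbC a q1"
    using 3(1) qs_Cmp(1)[of "e_c InC a b" "Idt (obj_c InC b)" "[w1]" "[]"] bd2(1)[OF gc(1,2)] w q1(1) qs_one[OF w(2) cs] 3(3) c1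
    by (simp add: src_P wcmp_def) (simp add: qs_def unit_r')
  have E1: "E (gsrc P 3 g) ws = MC.B.RH a b (cmbC a q1)"
    using 3(1) w(1) q1(1) u u2 qs_one[OF w(2) cs] RH0
    by (simp add: src_P wcmp_def sm_gen_def K_gen_def E_gen_def MC.B.M_def del: MC.B.A.simps MC.B.pth MC.B.A)
  have E2: "E (gtgt P 3 g) ws = cmbC a q1"
    using 3(1) w q1(1) qs_one[OF w(2) cs] by (simp add: src_P)
  show ?thesis unfolding Q0 E1 E2 using u3 3(1) by (simp add: MC.B.RH_def)
next
  case (4 a b c d)
  then obtain w1 w2 w3 where w: "ws = [w1, w2, w3]" "vw w1 (e_c InD a b)" "vw w2 (e_c InD b c)" "vw w3 (e_c InD c d)"
    using st by (auto simp: src_P wcmp_def list_all2_Cons2)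
  obtain q1 where q1: "w1 = WD a q1" "set q1 \<subseteq> D" "b = last (a # q1)" using w(2) by (cases rule: vw_cases) auto
  obtain q2 where q2: "w2 = WD b q2" "set q2 \<subseteq> D" "c = last (b # q2)" using w(3) by (cases rule: vw_cases) auto
  obtain q3 where q3: "w3 = WD c q3" "set q3 \<subseteq> D" "d = last (c # q3)" using w(4) by (cases rule: vw_cases) auto
  have l: "c = last (a # q1 @ q2)" "d = last (b # q2 @ q3)" and q12: "set (q1 @ q2) \<subseteq> D" and q23: "set (q2 @ q3) \<subseteq> D"
    and d12: "d = last (a # (q1 @ q2) @ q3)" and d23: "d = last (a # q1 @ q2 @ q3)" using q1 q2 q3 by simp_all
  have cs: "cell P p (e_c InD a b)" "cell P p (e_c InD b c)" "cell P p (e_c InD c d)" using 4 bD.h_gen_simps(2) by (simp_all add: cell_Gen_iff One_nat_def)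
  note pp = MD.B.pth_append[OF 4(2) q12 q3(2), folded l] MD.B.pth_append[OF 4(2) q1(2) q23, folded q1(3)]
  note A12 = MD.B.A[OF 4(2) q12 q3(2), folded l(1) d12] and A23 = MD.B.A[OF 4(2) q1(2) q23, folded q1(3) d23]
  note c3 = MD.B.cmb[OF 4(4) q3(2), folded q3(3)] and c1 = MD.B.cmb[OF 4(2) q1(2), folded q1(3)] and c2 = MD.B.cmb[OF 4(3) q2(2), folded q2(3)]
  have sA: "srq 1 (MD.B.A a (q1 @ q2) q3) = pthD a (q1 @ q2 @ q3)" "srq 1 (MD.B.A a q1 (q2 @ q3)) = pthD a (q1 @ q2 @ q3)"
    using MD.B.bd1I(1)[OF A12(2,3)] MD.B.bd1I(1)[OF A23(2,3)] MD.B.M_simps(5)[OF MD.B.cmb(1)[OF 4(2) q12, folded l(1)] c3(1)]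
      MD.B.M_simps(5)[OF c1(1) MD.B.cmb(1)[OF 4(3) q23, folded l(2)]] MD.B.cmb(3)[OF 4(2) q12] MD.B.cmb(3)[OF 4(3) q23] c1(3) c3(3) pp
    by simp_all
  have u: "(pthD a (q1 @ q2) \<otimes> pthD c q3) \<odot> MD.B.A a (q1 @ q2) q3 = MD.B.A a (q1 @ q2) q3"
    "(pthD a q1 \<otimes> pthD b (q2 @ q3)) \<odot> MD.B.A a q1 (q2 @ q3) = MD.B.A a q1 (q2 @ q3)"
    using sA unit_l'[of 1 "MD.B.A a (q1 @ q2) q3"] unit_l'[of 1 "MD.B.A a q1 (q2 @ q3)"] A12(4) A23(4) pp by simp_all
  note q = qs_one[OF w(2) cs(1)] qs_one[OF w(3) cs(2)] qs_one[OF w(4) cs(3)]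
  have s: "src P (gsrc P 3 g) = Cmp 0 (Cmp 0 (e_c InD a b) (e_c InD b c)) (e_c InD c d)" using 4(1) by (simp add: src_P wcmp_def)
  have "cell P p (src P (gsrc P 3 g))" using bd2(1)[OF gc(1,2)] .
  then have cs2: "cell P p (Cmp 0 (Cmp 0 (e_c InD a b) (e_c InD b c)) (e_c InD c d))" "cell P p (Cmp 0 (e_c InD a b) (e_c InD b c))"
    unfolding s by (simp_all add: cell_Cmp_iff)
  have qc: "qs (Cmp 0 (Cmp 0 (e_c InD a b) (e_c InD b c)) (e_c InD c d)) ([w1, w2] @ [w3]) = qs (Cmp 0 (e_c InD a b) (e_c InD b c)) [w1, w2] \<otimes> qs (e_c InD c d) [w3]"
    "qs (Cmp 0 (e_c InD a b) (e_c InD b c)) ([w1] @ [w2]) = qs (e_c InD a b) [w1] \<otimes> qs (e_c InD b c) [w2]"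
    by (rule qs_Cmp(1)[OF cs2(1)]; use w(2-4) in simp) (rule qs_Cmp(1)[OF cs2(2)]; use w(2-4) in simp)
  have Q0: "qs (src P (gsrc P 3 g)) ws = cmbD a q1 \<otimes> cmbD b q2 \<otimes> cmbD c q3"
    unfolding s w(1) using qc q q1(1) q2(1) q3(1) by (simp add: assoc)
  have E1: "E (gsrc P 3 g) ws = MD.B.M a c d (MD.B.A a q1 q2) (cmbD c q3) \<bullet> MD.B.A a (q1 @ q2) q3"
    using 4(1) w(1) q1(1) q2(1) q3(1) u q by (simp add: src_P wcmp_def sm_gen_def K_gen_def E_gen_def MD.B.M_def del: MD.B.A.simps MD.B.pth.simps MD.B.pth MD.B.A)
  have E2: "E (gtgt P 3 g) ws = MD.B.M a b d (cmbD a q1) (MD.B.A b q2 q3) \<bullet> MD.B.A a q1 (q2 @ q3)"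
    using 4(1) w(1) q1(1) q2(1) q3(1) u q by (simp add: src_P wcmp_def sm_gen_def K_gen_def E_gen_def MD.B.M_def del: MD.B.A.simps MD.B.pth.simps MD.B.pth MD.B.A)
  show ?thesis unfolding Q0 E1 E2 using coh.D.A_al[OF 4(2) q1(2) q2(2) q3(2) q1(3) q2(3) q3(3)] 4(1)
    by (simp add: MD.B.AL_def assoc del: MD.B.A.simps)
next
  case (5 a b)
  then obtain w1 where w: "ws = [w1]" "vw w1 (e_c InD a b)"
    using st by (auto simp: src_P wcmp_def list_all2_Cons2)
  obtain q1 where q1: "w1 = WD a q1" "set q1 \<subseteq> D" "b = last (a # q1)" using w(2) by (cases rule: vw_cases) auto
  have cs: "cell P p (e_c InD a b)" using 5 bD.h_gen_simps(2) by (simp_all add: cell_Gen_iff One_nat_def)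
  note c1 = MD.B.cmb[OF 5(2) q1(2), folded q1(3)] and p1 = MD.B.pth[OF 5(2) q1(2)]
  have nil: "set [] \<subseteq> D" "b = last (a # [] @ q1)" "a = last (a # [])" using q1(3) by simp_all
  note Aq = MD.B.A[OF 5(2) nil(1) q1(2), folded nil(2,3)]
  note LA = MD.B.LA_simps[OF c1(1)]
  have LA0: "MD.B.A a [] q1 = MD.B.LA a b (cmbD a q1)" using q1(3) by simp
  have s1: "srq 1 (MD.B.LA a b (cmbD a q1)) = pthD a q1"
    using MD.B.bd1I(1)[OF LA(3,4)] MD.B.M_simps(5)[OF MD.B.H_ii[OF 5(2)] MD.B.H_bd(1)[OF c1(1)]] c1(2,3) 5(2) p1
    by (simp add: unit_l')
  have u: "(J (obj_c InD a) \<otimes> pthD a q1) \<odot> MD.B.LA a b (cmbD a q1) = MD.B.LA a b (cmbD a q1)"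
    using unit_l'[of 1 "MD.B.LA a b (cmbD a q1)"] unit_l'[of 0 "pthD a q1" "J (obj_c InD a)"] LA(1) s1 p1 by simp
  have u2: "MD.B.M a a b (J (i_c InD a)) (cmbD a q1) \<bullet> MD.B.LA a b (cmbD a q1) = MD.B.LA a b (cmbD a q1)"
    by (rule unit_l') (use LA c1 in simp_all)
  have u3: "MD.B.LA a b (cmbD a q1) \<bullet> cmbD a q1 = MD.B.LA a b (cmbD a q1)"
    by (rule unit_r') (use LA c1 in simp_all)
  have Q0: "qs (src P (gsrc P 3 g)) ws = cmbD a q1"
    using 5(1) qs_Cmp(1)[of "Idt (obj_c InD a)" "e_c InD a b" "[]" "[w1]"] bd2(1)[OF gc(1,2)] w q1(1) qs_one[OF w(2) cs] 5(2) c1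
    by (simp add: src_P wcmp_def) (simp add: qs_def unit_l')
  have E1: "E (gsrc P 3 g) ws = MD.B.LA a b (cmbD a q1)"
    using 5(1) w(1) q1(1) u u2 qs_one[OF w(2) cs] LA0
    by (simp add: src_P wcmp_def sm_gen_def K_gen_def E_gen_def MD.B.M_def del: MD.B.A.simps MD.B.pth MD.B.A)
  have E2: "E (gtgt P 3 g) ws = cmbD a q1"
    using 5(1) w q1(1) qs_one[OF w(2) cs] by (simp add: src_P)
  show ?thesis unfolding Q0 E1 E2 using u3 5(1) by (simp add: MD.B.LA_def)
next
  case (6 a b)
  then obtain w1 where w: "ws = [w1]" "vw w1 (e_c InD a b)"
    using st by (auto simp: src_P wcmp_def list_all2_Cons2)
  obtain q1 where q1: "w1 = WD a q1" "set q1 \<subseteq> D" "b = last (a # q1)" using w(2) by (cases rule: vw_cases) auto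
  have cs: "cell P p (e_c InD a b)" using 6 bD.h_gen_simps(2) by (simp_all add: cell_Gen_iff One_nat_def)
  note c1 = MD.B.cmb[OF 6(2) q1(2), folded q1(3)] and p1 = MD.B.pth[OF 6(2) q1(2), folded q1(3)]
  note RH = MD.B.RH_simps[OF c1(1)]
  have RH0: "MD.B.A a q1 [] = MD.B.RH a b (cmbD a q1)" using coh.D.A_unit_r[OF 6(2) q1(2)] q1(3) by simp
  have s1: "srq 1 (MD.B.RH a b (cmbD a q1)) = pthD a q1"
    using MD.B.bd1I(1)[OF RH(3,4)] MD.B.M_simps(5)[OF MD.B.H_bd(1)[OF c1(1)] MD.B.H_ii[OF 6(3)]] c1(2,3) 6(3) p1
    by (simp add: unit_r')
  have u: "(pthD a q1 \<otimes> J (obj_c InD b)) \<odot> MD.B.RH a b (cmbD a q1) = MD.B.RH a b (cmbD a q1)"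
    using unit_l'[of 1 "MD.B.RH a b (cmbD a q1)"] unit_r'[of 0 "pthD a q1" "J (obj_c InD b)"] RH(1) s1 p1 by simp
  have u2: "MD.B.M a b b (cmbD a q1) (J (i_c InD b)) \<bullet> MD.B.RH a b (cmbD a q1) = MD.B.RH a b (cmbD a q1)"
    by (rule unit_l') (use RH c1 in simp_all)
  have u3: "MD.B.RH a b (cmbD a q1) \<bullet> cmbD a q1 = MD.B.RH a b (cmbD a q1)"
    by (rule unit_r') (use RH c1 in simp_all)
  have Q0: "qs (src P (gsrc P 3 g)) ws = cmbD a q1"
    using 6(1) qs_Cmp(1)[of "e_c InD a b" "Idt (obj_c InD b)" "[w1]" "[]"] bd2(1)[OF gc(1,2)] w q1(1) qs_one[OF w(2) cs] 6(3) c1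
    by (simp add: src_P wcmp_def) (simp add: qs_def unit_r')
  have E1: "E (gsrc P 3 g) ws = MD.B.RH a b (cmbD a q1)"
    using 6(1) w(1) q1(1) u u2 qs_one[OF w(2) cs] RH0
    by (simp add: src_P wcmp_def sm_gen_def K_gen_def E_gen_def MD.B.M_def del: MD.B.A.simps MD.B.pth MD.B.A)
  have E2: "E (gtgt P 3 g) ws = cmbD a q1"
    using 6(1) w q1(1) qs_one[OF w(2) cs] by (simp add: src_P)
  show ?thesis unfolding Q0 E1 E2 using u3 6(1) by (simp add: MD.B.RH_def)
next
  case (7 a b c)
  then obtain w1 w2 w3 where w: "ws = [w1, w2, w3]" "vw w1 (e_c InC a b)" "vw w2 (e_c InC b c)" "vw w3 (u_c c)"
    using st by (auto simp: src_P wcmp_def list_all2_Cons2)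
  obtain q1 where q1: "w1 = WC a q1" "set q1 \<subseteq> C" "b = last (a # q1)" using w(2) by (cases rule: vw_cases) auto
  obtain q2 where q2: "w2 = WC b q2" "set q2 \<subseteq> C" "c = last (b # q2)" using w(3) by (cases rule: vw_cases) auto
  have w3: "w3 = WU c" using w(4) by (cases rule: vw_cases) auto
  have l: "c = last (a # q1 @ q2)" "f b = last (f a # map f q1)" "f c = last (f b # map f q2)" and q12: "set (q1 @ q2) \<subseteq> C"
    using q1 q2 Q.last_map_f[of a q1] Q.last_map_f[of b q2] by simp_all
  have fD: "set (map f q1) \<subseteq> D" "set (map f q2) \<subseteq> D" "f a \<in> D" "f b \<in> D" "f c \<in> D" using q1(2) q2(2) fD 7 by auto
  have cs: "cell P p (e_c InC a b)" "cell P p (e_c InC b c)" "cell P p (u_c c)" "cell P p (e_c InD (f b) (f c))" "cell P p (u_c a)"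
    using 7 fD bC.h_gen_simps(2) bD.h_gen_simps(2) new_gens_simps(1) by (simp_all add: cell_Gen_iff One_nat_def)
  have vwD: "vw (WD (f b) (map f q2)) (e_c InD (f b) (f c))" "vw (WU a) (u_c a)" using fD l 7 by simp_all
  note q = qs_one[OF w(2) cs(1)] qs_one[OF w(3) cs(2)] qs_one[OF w(4) cs(3)] qs_one[OF vwD(1) cs(4)] qs_one[OF vwD(2) cs(5)]
  note Ph = Q.PHI[OF 7(2) q12 l(1)] and hPh = Q.H'D[OF Q.PHI(1)[OF 7(2) q12 l(1)]]
  have u: "(pthC a (q1 @ q2) \<otimes> J (u_c c)) \<odot> Q.PHI a (q1 @ q2) = Q.PHI a (q1 @ q2)"
    by (rule unit_l') (use hPh in simp_all)
  have s: "src P (gsrc P 3 g) = Cmp 0 (Cmp 0 (e_c InC a b) (e_c InC b c)) (u_c c)" using 7(1) by (simp add: src_P wcmp_def)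
  have "cell P p (src P (gsrc P 3 g))" using bd2(1)[OF gc(1,2)] .
  then have cs2: "cell P p (Cmp 0 (Cmp 0 (e_c InC a b) (e_c InC b c)) (u_c c))" "cell P p (Cmp 0 (e_c InC a b) (e_c InC b c))"
    unfolding s by (simp_all add: cell_Cmp_iff)
  have qc: "qs (Cmp 0 (Cmp 0 (e_c InC a b) (e_c InC b c)) (u_c c)) ([w1, w2] @ [w3]) = qs (Cmp 0 (e_c InC a b) (e_c InC b c)) [w1, w2] \<otimes> qs (u_c c) [w3]"
    "qs (Cmp 0 (e_c InC a b) (e_c InC b c)) ([w1] @ [w2]) = qs (e_c InC a b) [w1] \<otimes> qs (e_c InC b c) [w2]"
    by (rule qs_Cmp(1)[OF cs2(1)]; use w(2-4) in simp) (rule qs_Cmp(1)[OF cs2(2)]; use w(2-4) in simp)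
  have Q0: "qs (src P (gsrc P 3 g)) ws = cmbC a q1 \<otimes> cmbC b q2 \<otimes> J (u_c c)"
    unfolding s w(1) using qc q q1(1) q2(1) w3 by (simp add: assoc)
  have E1: "E (gsrc P 3 g) ws = Q.PH a c (MC.B.A a q1 q2) \<bullet> Q.PHI a (q1 @ q2)"
    using 7(1) w(1) q1(1) q2(1) w3 u q by (simp add: src_P wcmp_def sm_gen_def K_gen_def E_gen_def Q.PH_def del: MC.B.A.simps MC.B.pth MC.B.A Q.PHI.simps)
  let ?F = "Q.PHI a q1 \<otimes> cmbD (f b) (map f q2)" and ?A = "J (u_c a) \<otimes> MD.B.A (f a) (map f q1) (map f q2)"
  let ?um = "J (u_c a) \<otimes> J (m_c InD (f a) (f b) (f c))"
  have E2: "E (gtgt P 3 g) ws = ((((cmbC a q1 \<otimes> Q.PHI b q2) \<odot> (J (phi_c a b) \<otimes> J (e_c InD (f b) (f c)))) \<bullet>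
      ((pthC a q1 \<otimes> Q.KK b q2) \<odot> ?F)) \<odot> ?um) \<bullet> (((pthC a q1 \<otimes> Q.KK b q2) \<odot> (Q.KK a q1 \<otimes> pthD (f b) (map f q2))) \<odot> ?A)"
    using 7(1) w(1) q1(1) q2(1) w3 q by (simp add: src_P wcmp_def sm_gen_def K_gen_def E_gen_def del: MC.B.A.simps MD.B.A.simps MC.B.pth MD.B.pth MC.B.A MD.B.A Q.PHI.simps Q.KK.simps Q.KK)
  have E3: "E (gtgt P 3 g) ws = Q.M' (pthC a q1) a b c (Q.PHI a q1) (Q.PHI b q2) \<bullet> (Q.KK a (q1 @ q2) \<odot> ?A)"
    unfolding E2 Q.M'_PHI_split[OF 7(2) q1(2) q2(2) q1(3) q2(3)] Q.M'_def Q.KK_append[OF 7(2) q1(2) q2(2) q1(3)] by (simp add: assoc)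
  show ?thesis unfolding Q0 E1 E3 coh.PHI_mu[OF 7(2) q1(2) q2(2) q1(3) q2(3)] using 7(1) by (simp add: Q.MU_def)
next
  case (8 a)
  then have w: "ws = [WU a]" using st by (auto simp: src_P wcmp_def list_all2_Cons2 elim!: vw_cases)
  have cs: "cell P p (u_c a)" "vw (WU a) (u_c a)" using 8 new_gens_simps(1) by (simp_all add: cell_Gen_iff One_nat_def)
  have u: "J (obj_c InC a) \<otimes> J (u_c a) = J (u_c a)" "J (u_c a) \<odot> J (nu_c a) = J (nu_c a)" 
     "((J (i_c InC a) \<otimes> J (u_c a)) \<odot> J (phi_c a a)) \<bullet> J (nu_c a) = J (nu_c a)" by (rule unit_l'; use 8 in simp)+
  have u': "J (nu_c a) \<bullet> (J (u_c a) \<otimes> J (i_c InD (f a))) = J (nu_c a)" by (rule unit_r'; use 8 in simp)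
  have Q0: "qs (src P (gsrc P 3 g)) ws = J (u_c a)"
    using 8(1) qs_Cmp(1)[of "Idt (obj_c InC a)" "u_c a" "[]" "[WU a]"] bd2(1)[OF gc(1,2)] w qs_one[OF cs(2,1)] 8(2) u(1)
    by (simp add: src_P wcmp_def) (simp add: qs_def)
  have E1: "E (gsrc P 3 g) ws = J (nu_c a)" using 8(1) w u qs_one[OF cs(2,1)] by (simp add: src_P wcmp_def sm_gen_def K_gen_def E_gen_def)
  have E2: "E (gtgt P 3 g) ws = J (u_c a) \<otimes> J (i_c InD (f a))"
    using 8(1) w qs_one[OF cs(2,1)] by (simp add: src_P wcmp_def E_gen_def)
  show ?thesis unfolding Q0 E1 E2 using u u' 8(1) by simp
  qed
qed

text \<open>The equation of the generator, composed with the whiskered inverse.\<close>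

lemma E_natural_inv: assumes g: "g \<in> gens P 3" "p < 3" and st: "st ws (atoms1 (src P (gsrc P 3 g)))"
  shows "(qs (src P (gtgt P 3 g)) ws \<odot> J (Inv 3 g)) \<bullet> E (gsrc P 3 g) ws = E (gtgt P 3 g) ws"
proof -
  have c: "cell P p (Gen 3 g)" "cdim (Gen 3 g :: ('c, 'd) pf_gen expr) = 3" using g by (simp_all add: cell_Gen_iff)
  have i: "cell P p (Inv 3 g)" "cdim (Inv 3 g :: ('c, 'd) pf_gen expr) = 3" using g by (simp_all add: cell_inv)
  note bg = bd3[OF c, simplified] and bi = bd3[OF i, simplified]
  have st': "st ws (atoms1 (src P (gtgt P 3 g)))" using st bg(10) by simp
  have ax: "cat_axiom P (Cmp 2 (Inv 3 g) (Gen 3 g)) (Idt (gtgt P 3 g))"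
    using cat_axiom.inverse_left[of P 2 g] by simp
  have cc: "cell P p (Cmp 2 (Inv 3 g) (Gen 3 g))"
    using c i bg(1) by (simp add: cell_Cmp_iff src_at_def tgt_at_def eqv_refl)
  have "ceqv (Cmp 2 (Inv 3 g) (Gen 3 g)) (Idt (gtgt P 3 g))"
    by (rule eqv_axiom[OF ax cc]) (use bg(2) in \<open>simp add: cell_Idt_iff\<close>)
  from ev_eqv[OF this] have IG: "J (Inv 3 g) \<bullet> J (Gen 3 g) = ev (gtgt P 3 g)" by simp
  note bt = bd2[OF bg(2,4)]
  note q = qs[OF bt(1,3) st'] and T = sqD[OF sq_cell[OF bg(2,4) st']]
  have iq: "idn 2 (qs (src P (gtgt P 3 g)) ws)" using q by (simp add: idn_def)
  have 1: "qs (src P (gtgt P 3 g)) ws \<odot> (J (Inv 3 g) \<bullet> J (Gen 3 g)) =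
    (qs (src P (gtgt P 3 g)) ws \<odot> J (Inv 3 g)) \<bullet> (qs (src P (gtgt P 3 g)) ws \<odot> J (Gen 3 g))"
    by (rule dist_l[OF _ _ iq]) (use bg bi q bt MC.B.bd1I[OF bi(6,7)] in simp_all)
  have "(qs (src P (gtgt P 3 g)) ws \<odot> J (Inv 3 g)) \<bullet> ((qs (src P (gtgt P 3 g)) ws \<odot> J (Gen 3 g)) \<bullet> E (gtgt P 3 g) ws)
     = (qs (src P (gtgt P 3 g)) ws \<odot> ev (gtgt P 3 g)) \<bullet> E (gtgt P 3 g) ws"
    using 1 unfolding IG by (simp add: assoc)
  also have "\<dots> = E (gtgt P 3 g) ws" by (rule unit_l') (use T in simp_all)
  finally show ?thesis using E_natural_gen[OF g(1) st] unfolding bg(12) by simp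
qed

lemma E_natural: "cell P p x \<Longrightarrow> cdim x = 3 \<Longrightarrow> st ws (atoms1 (src P (src P x))) \<Longrightarrow>
  (qs (src P (src P x)) ws \<odot> ev x) \<bullet> E (tgt P x) ws = E (src P x) ws"
proof (induction x arbitrary: ws)
  case (Gen k g)
  then show ?case using E_natural_gen[of g ws] by (simp add: cell_Gen_iff)
next
  case (Inv k g)
  have k: "k = 3" "g \<in> gens P 3" "p < 3" using Inv.prems by (auto elim: cell_InvE)
  then have "cell P p (Gen 3 g)" by (simp add: cell_Gen_iff)
  from bd3(10)[OF this] have "st ws (atoms1 (src P (gsrc P 3 g)))" using Inv.prems k by simp
  then show ?case using E_natural_inv[OF k(2,3)] k(1) by simp
next
  case (Idt x)
  have c: "cell P p x" "cdim x = 2" "st ws (atoms1 (src P x))" using Idt.prems by (simp_all add: cell_Idt_iff)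
  have "(qs (src P x) ws \<odot> ev x) \<bullet> E x ws = E x ws" by (rule unit_l') (use sqD[OF sq_cell[OF c]] in simp_all)
  then show ?case by simp
next
  case (Cmp i x y)
  have c: "cell P p x" "cell P p y" "cdim x = 3" "cdim y = 3" "i < 3" "ceqv (tgt_at P i x) (src_at P i y)"
    using Cmp.prems by (simp_all add: cell_Cmp_iff)
  note bx = bd3[OF c(1,3)] and b_y = bd3[OF c(2,4)]
  note bsx = bd2[OF bx(1,3)] and btx = bd2[OF bx(2,4)] and bsy = bd2[OF b_y(1,3)] and bty = bd2[OF b_y(2,4)]
  note b0 = bd20[OF bx(1,3)] bd20[OF bx(2,4)] bd20[OF b_y(1,3)] bd20[OF b_y(2,4)]
  have x1: "srq 1 (ev x) = ev (src P (src P x))" "tgq 1 (ev x) = ev (tgt P (src P x))"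
    "srq 0 (ev x) = ev (src P (src P (src P x)))" "tgq 0 (ev x) = ev (tgt P (src P (src P x)))"
    using MC.B.bd1I[OF bx(6,7)] bsx btx b0(1,2) bx(17) by simp_all
  have y1: "srq 1 (ev y) = ev (src P (src P y))" "tgq 1 (ev y) = ev (tgt P (src P y))"
    "srq 0 (ev y) = ev (src P (src P (src P y)))" "tgq 0 (ev y) = ev (tgt P (src P (src P y)))"
    using MC.B.bd1I[OF b_y(6,7)] bsy bty b0(5,6) b_y(17) by simp_all
  consider "i = 0" | "i = 1" | "i = 2" using c(5) by linarith
  then show ?case
  proof cases
    case 1
    have s: "src P (Cmp i x y) = Cmp 0 (src P x) (src P y)" "tgt P (Cmp i x y) = Cmp 0 (tgt P x) (tgt P y)" using 1 c by simp_all
    have cc: "cell P p (Cmp 0 (src P x) (src P y))" using bd_cell[OF Cmp.prems(1)] Cmp.prems(2) m3 s by simp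
    obtain us vs where w: "ws = us @ vs" "st us (atoms1 (src P (src P x)))" "st vs (atoms1 (src P (src P y)))" "length us = ln (src P x)"
      "cell P p (Cmp 0 (src P (src P x)) (src P (src P y)))" "ev (tgt P (src P (src P x))) = ev (src P (src P (src P y)))"
      using Cmp0_split[OF cc bx(3) Cmp.prems(3)[unfolded s]] by blast
    have wt: "st us (atoms1 (src P (tgt P x)))" "st vs (atoms1 (src P (tgt P y)))" using w bx(10) b_y(10) by simp_all
    have l: "ln (tgt P x) = ln (src P x)" using bx(10) by simp
    note q1 = qs[OF bsx(1,3) w(2)] and q2 = qs[OF bsy(1,3) w(3)]
    note sx = sqD[OF sq_cell[OF bx(2,4) wt(1)], unfolded bx(12)] and sy = sqD[OF sq_cell[OF b_y(2,4) wt(2)], unfolded b_y(12)]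
      and ox = sq0[OF bx(2,4) wt(1) sq_cell[OF bx(2,4) wt(1)]] and oy = sq0[OF b_y(2,4) wt(2) sq_cell[OF b_y(2,4) wt(2)]]
    have q: "qs (src P (src P (Cmp i x y))) ws = qs (src P (src P x)) us \<otimes> qs (src P (src P y)) vs"
      unfolding s w(1) using qs_Cmp(1)[OF w(5) bsx(3) w(2,3)] bx(3) by (simp add: bd2_simps)
    have 2: "(qs (src P (src P x)) us \<odot> ev x) \<otimes> (qs (src P (src P y)) vs \<odot> ev y) =
      (qs (src P (src P x)) us \<otimes> qs (src P (src P y)) vs) \<odot> (ev x \<otimes> ev y)"
      by (rule tens) (use q1 q2 bx b_y bsx bsy x1 y1 w(6) in simp_all)
    have t: "tgq 2 (qs (src P (src P x)) us) = qs (src P (src P x)) us" "tgq 2 (qs (src P (src P y)) vs) = qs (src P (src P y)) vs"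
      using q1 q2 idn_up[of 2 "qs (src P (src P x)) us" 2] idn_up[of 2 "qs (src P (src P y)) vs" 2] by (simp_all add: idn_def)
    have 3: "((qs (src P (src P x)) us \<odot> ev x) \<bullet> E (tgt P x) us) \<otimes> ((qs (src P (src P y)) vs \<odot> ev y) \<bullet> E (tgt P y) vs)
      = ((qs (src P (src P x)) us \<odot> ev x) \<otimes> (qs (src P (src P y)) vs \<odot> ev y)) \<bullet> (E (tgt P x) us \<otimes> E (tgt P y) vs)"
      by (rule exch) (use q1 q2 bx b_y bsx bsy x1 y1 w(6) sx sy b0 t in simp_all)
    show ?thesis unfolding q unfolding s
      using 1 2 3 w(1,4) l Cmp.IH(1)[OF c(1,3) w(2)] Cmp.IH(2)[OF c(2,4) w(3)] by simp
  next
    case 2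
    have s: "src P (Cmp i x y) = Cmp 1 (src P x) (src P y)" "tgt P (Cmp i x y) = Cmp 1 (tgt P x) (tgt P y)" using 2 c by simp_all
    have cc: "cell P p (Cmp 1 (src P x) (src P y))" "cell P p (Cmp 1 (tgt P x) (tgt P y))"
      using bd_cell[OF Cmp.prems(1)] Cmp.prems(2) m3 s by simp_all
    note ms = Cmp1_mid[OF cc(1) bx(3)] and mt = Cmp1_mid[OF cc(2) bx(4)]
    have wx: "st ws (atoms1 (src P (src P x)))" using Cmp.prems(3) bx(3) unfolding s by (simp add: bd2_simps)
    have wx': "st ws (atoms1 (src P (tgt P x)))" using wx bx(10) by simp
    let ?v = "sm (src P x) ws"
    \<comment> \<open>The square of \<open>y\<close> is formed on the list that \<open>x\<close> has
      produced. By \<open>sm_K_natural\<close> this list and the crossings are the same for source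
      and target of \<open>x\<close>.\<close>
    have k: "sm (tgt P x) ws = ?v" "K (tgt P x) ws = K (src P x) ws" using sm_K_natural[OF c(1,3) wx] by simp_all
    have wy: "st ?v (atoms1 (src P (src P y)))"
      using sqD(1)[OF sq_cell[OF bx(1,3) wx]] ms(5) by simp
    have wy': "st ?v (atoms1 (src P (tgt P y)))" using wy b_y(10) by simp
    note sx = sqD[OF sq_cell[OF bx(2,4) wx'], unfolded bx(12) k mt(6,7) b_y(12,13)] and sy = sqD[OF sq_cell[OF b_y(2,4) wy'], unfolded b_y(12)]
      and ox = sq0[OF bx(2,4) wx' sq_cell[OF bx(2,4) wx'], unfolded bx(13)] and oy = sq0[OF b_y(2,4) wy' sq_cell[OF b_y(2,4) wy'], unfolded b_y(13)]
    note q1 = qs[OF bsx(1,3) wx] and q2 = qs[OF bsy(1,3) wy]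
    let ?q = "qs (src P (src P x)) ws" and ?q' = "qs (src P (src P y)) ?v" and ?K = "K (src P x) ws"
    let ?Es = "E (tgt P x) ws" and ?Et = "E (tgt P y) ?v"
    have m: "ev (src P (src P y)) = ev (tgt P (src P x))" using ms(8) by simp
    have XY: "okq (ev x \<odot> ev y)" using bx b_y x1 y1 bsx bsy m by simp
    have t: "tgq 2 ?q = ?q" "tgq 2 ?q' = ?q'"
      using q1 q2 idn_up[of 2 ?q 2] idn_up[of 2 ?q' 2] by (simp_all add: idn_def)
    have 3: "((?q \<odot> ev x) \<bullet> ?Es) \<odot> ev (src P y) = ((?q \<odot> ev x) \<odot> ev (src P y)) \<bullet> (?Es \<odot> ev (src P y))"
      by (rule dist_r) (use q1 bx bsx bsy x1 sx ox m t in simp_all)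
    have 4: "?K \<odot> ((?q' \<odot> ev y) \<bullet> ?Et) = (?K \<odot> (?q' \<odot> ev y)) \<bullet> (?K \<odot> ?Et)"
      by (rule dist_l) (use q2 b_y bsx bsy y1 sx sy oy ms(7) t in simp_all)
    \<comment> \<open>\<open>ev y\<close> has to move in front of the square \<open>?Es\<close>: the
      equations 5 and 6 are the two orders in which these neighbours can act, and 7 merges
      \<open>ev x\<close> with \<open>ev y\<close>.\<close>
    have o5: "okq (?Es \<odot> ev y)" using sx ox b_y y1 bsy m bx(17) by simp
    have 5: "(?Es \<odot> ev (src P y)) \<bullet> ((?K \<odot> ?q') \<odot> ev y) = ?Es \<odot> ev y"
      using split_l[of 1 2 ?Es "ev y"] o5 b_y sx by simp
    have 6: "?Es \<odot> ev y = ((?q \<odot> ev (tgt P x)) \<odot> ev y) \<bullet> (?Es \<odot> ev (tgt P y))"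
      using split_r[of 1 2 ?Es "ev y"] o5 b_y sx by simp
    have o7: "okq ((?q \<odot> ev x) \<odot> ev y)" using q1 bx bsx x1 b_y bsy y1 m by simp
    have t7: "srq 2 (ev y) = ev (src P y)" "tgq 2 (?q \<odot> ev x) = ?q \<odot> ev (tgt P x)"
      using q1 bx bsx x1 b_y idn_up[of 2 ?q 2] by (simp_all add: idn_def)
    have 7: "((?q \<odot> ev x) \<odot> ev (src P y)) \<bullet> ((?q \<odot> ev (tgt P x)) \<odot> ev y) = (?q \<odot> ev x) \<odot> ev y"
      using split_l[OF _ _ o7, of 2] unfolding t7 by simp
    have IHx: "(?q \<odot> ev x) \<bullet> ?Es = E (src P x) ws" and IHy: "(?q' \<odot> ev y) \<bullet> ?Et = E (src P y) ?v"
      using Cmp.IH(1)[OF c(1,3) wx] Cmp.IH(2)[OF c(2,4) wy] by simp_all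
    have "E (src P (Cmp i x y)) ws = (((?q \<odot> ev x) \<odot> ev (src P y)) \<bullet> (?Es \<odot> ev (src P y))) \<bullet> ((?K \<odot> (?q' \<odot> ev y)) \<bullet> (?K \<odot> ?Et))"
      unfolding s 3[symmetric] 4[symmetric] IHx IHy by simp
    also have "\<dots> = ((?q \<odot> ev x) \<odot> ev (src P y)) \<bullet> ((?Es \<odot> ev (src P y)) \<bullet> ((?K \<odot> ?q') \<odot> ev y)) \<bullet> (?K \<odot> ?Et)"
      by (simp add: assoc)
    also have "\<dots> = (((?q \<odot> ev x) \<odot> ev (src P y)) \<bullet> ((?q \<odot> ev (tgt P x)) \<odot> ev y)) \<bullet> (?Es \<odot> ev (tgt P y)) \<bullet> (?K \<odot> ?Et)"
      unfolding 5 6 by (simp add: assoc)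
    also have "\<dots> = ((?q \<odot> ev x) \<odot> ev y) \<bullet> (?Es \<odot> ev (tgt P y)) \<bullet> (?K \<odot> ?Et)" unfolding 7 ..
    also have "\<dots> = (?q \<odot> (ev x \<odot> ev y)) \<bullet> E (tgt P (Cmp i x y)) ws" unfolding s using k by (simp add: assoc)
    finally show ?thesis using 2 bx(3) by (simp add: bd2_simps)
  next
    case 3
    have s: "src P (Cmp i x y) = src P x" "tgt P (Cmp i x y) = tgt P y" using 3 c by simp_all
    have e: "ceqv (tgt P x) (src P y)" using c 3 by (simp add: src_at_def tgt_at_def)
    have wx: "st ws (atoms1 (src P (src P x)))" using Cmp.prems(3) unfolding s .
    have wt: "st ws (atoms1 (src P (tgt P x)))" using wx bx(10) by simp
    have wy: "st ws (atoms1 (src P (src P y)))" using wt atoms_bd[OF e bx(4)] p2 m3 by simp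
    have "ceqv (src P (tgt P x)) (src P (src P y))" using good_eqvI[OF e] bx(4) m3 by (simp add: good_eqv_def)
    then have qe: "qs (src P (src P y)) ws = qs (src P (src P x)) ws" and ee: "ev (src P (src P y)) = ev (src P (src P x))"
      using qs_eqv(1)[of "src P (tgt P x)" "src P (src P y)" ws] ev_eqv[of "src P (tgt P x)" "src P (src P y)"] btx(3) bx(12,16) by simp_all
    have ety: "ev (tgt P x) = ev (src P y)" using ev_eqv[OF e] bx(4) by simp
    note q = qs[OF bsx(1,3) wx]
    have 4: "qs (src P (src P x)) ws \<odot> (ev x \<bullet> ev y) = (qs (src P (src P x)) ws \<odot> ev x) \<bullet> (qs (src P (src P x)) ws \<odot> ev y)"
      by (rule dist_l) (use q bx b_y bsx x1 ety in \<open>simp_all add: idn_def\<close>)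
    show ?thesis unfolding s
      using 3 4 Cmp.IH(1)[OF c(1,3) wx] Cmp.IH(2)[OF c(2,4) wy, unfolded qe] KE_eqv(2)[OF e bx(4) wt] by (simp add: assoc)
  qed
qed

end

context pf_model begin

section \<open>Evaluation on one-edge paths, and the resulting normal forms\<close>

primrec singleton_path :: "('c, 'd) pf_gen expr \<Rightarrow> ('c, 'd) word" where
  "singleton_path (Gen k g) = (case g of
     InC h \<Rightarrow> (case h of EG a b \<Rightarrow> WC a [b]) | InD h \<Rightarrow> (case h of EG a b \<Rightarrow> WD a [b]) | UG a \<Rightarrow> WU a)"

definition "init s = map singleton_path (atoms1 s)"

lemma init: "cell P p s \<Longrightarrow> cdim s = 1 \<Longrightarrow> st (init s) (atoms1 s) \<and> qs s (init s) = ev s"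
proof (induction s)
  case (Gen k g)
  then have k: "k = 1" "g \<in> gens P 1" by (simp_all add: cell_Gen_iff)
  from k(2) have "vw (singleton_path (Gen 1 g)) (Gen 1 g) \<and> qw (singleton_path (Gen 1 g)) = J (Gen 1 g)"
    by (cases rule: gens1_cases) auto
  then show ?case using qs_one[of "singleton_path (Gen 1 g)" g] k(1) Gen.prems by (simp add: init_def)
next
  case (Inv k g) then show ?case using p2 by (auto elim: cell_InvE)
next
  case (Idt x) then show ?case by (simp add: init_def qs_def)
next
  case (Cmp i x y)
  then have i: "i = 0" "cell P p x" "cell P p y" "cdim x = 1" "cdim y = 1" by (auto simp: cell_Cmp_iff)
  have "init (Cmp i x y) = init x @ init y" by (simp add: init_def)
  then show ?case using i qs_Cmp[of x y "init x" "init y"] Cmp by (simp add: list_all2_appendI)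
qed

text \<open>Both targets reduce to the same normal form.\<close>

lemma confluent_cells:
  assumes x: "cell P p x" "cdim x = 3" and y: "cell P p y" "cdim y = 3" and e: "ceqv (src P x) (src P y)"
  obtains x' y' where "cell P p x'" "cdim x' = 3" "ceqv (tgt P x) (src P x')"
    "cell P p y'" "cdim y' = 3" "ceqv (tgt P y) (src P y')" "ceqv (tgt P x') (tgt P y')"
proof -
  note bx = bd3[OF x] and b_y = bd3[OF y]
  define ws where "ws = init (src P (src P x))"
  have c1: "cell P p (src P (src P x))" "cdim (src P (src P x)) = 1" using bd2[OF bx(1,3)] by simp_all
  have e1: "ceqv (src P (src P x)) (src P (src P y))" "ceqv (tgt P (src P x)) (tgt P (src P y))"
    using good_eqvI[OF e] bx(3) m3 by (simp_all add: good_eqv_def)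
  have wx: "st ws (atoms1 (src P (src P x)))" and q: "qs (src P (src P x)) ws = ev (src P (src P x))"
    using init[OF c1] by (simp_all add: ws_def)
  have wy: "st ws (atoms1 (src P (src P y)))" using wx atoms_bd[OF e bx(3)] p2 m3 by simp
  \<comment> \<open>A representative of \<open>E (tgt P w) ws\<close> continues \<open>w\<close>,
    because \<open>qs\<close> is an identity on one-edge paths. By \<open>sm_K_natural\<close> its
    target depends on \<open>src P w\<close> only, which the two given 3-cells share.\<close>
  have nf: "\<exists>z. cell P p z \<and> cdim z = 3 \<and> ceqv (tgt P w) (src P z) \<and> ev (tgt P z) = K (src P w) ws \<odot> qs (tgt P (src P w)) (sm (src P w) ws)"
    if w: "cell P p w" "cdim w = 3" and ww: "st ws (atoms1 (src P (src P w)))" and ew: "ceqv (src P (src P x)) (src P (src P w))" for w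
  proof -
    note bw = bd3[OF w]
    have wt: "st ws (atoms1 (src P (tgt P w)))" using ww bw(10) by simp
    note s = sqD[OF sq_cell[OF bw(2,4) wt]] and b = bd2[OF bw(2,4)]
    have "qs (src P (src P w)) ws = ev (src P (src P w))"
      using q qs_eqv(1)[OF ew c1(2)] ev_eqv[OF ew] c1(2) by simp
    then have "qs (src P (tgt P w)) ws \<odot> ev (tgt P w) = ev (tgt P w)"
      using bw(12,16) b by (intro unit_l') simp_all
    then have "srq 2 (E (tgt P w) ws) = ev (tgt P w)" using s by simp
    moreover have "tgq 2 (E (tgt P w) ws) = K (src P w) ws \<odot> qs (tgt P (src P w)) (sm (src P w) ws)"
      using s(8) sm_K_natural[OF w ww] bw(14) by simp
    moreover obtain z where z: "E (tgt P w) ws = J z" "cell P p z" "cdim z = 3" using okE[OF s(6)] .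
    moreover note bd3[OF z(2,3)]
    ultimately have "ev (src P z) = ev (tgt P w)" "ev (tgt P z) = K (src P w) ws \<odot> qs (tgt P (src P w)) (sm (src P w) ws)"
      "cell P p (src P z)" "cdim (src P z) = 2" using J_ev[of z] by simp_all
    then show ?thesis using z ev_faithful[of "tgt P w" "src P z"] bw by auto
  qed
  obtain x' where x': "cell P p x'" "cdim x' = 3" "ceqv (tgt P x) (src P x')"
    "ev (tgt P x') = K (src P x) ws \<odot> qs (tgt P (src P x)) (sm (src P x) ws)"
    using nf[OF x wx eqv_refl[OF c1(1)]] by blast
  obtain y' where y': "cell P p y'" "cdim y' = 3" "ceqv (tgt P y) (src P y')"
    "ev (tgt P y') = K (src P y) ws \<odot> qs (tgt P (src P y)) (sm (src P y) ws)"
    using nf[OF y wy e1(1)] by blast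
  have "ev (tgt P x') = ev (tgt P y')"
    unfolding x'(4) y'(4) using KE_eqv(1)[OF e bx(3) wx] sm_eqv[OF e bx(3) wx] qs_eqv(1)[OF e1(2)] bd2(4)[OF bx(1,3)] bd2(3)[OF bx(1,3)]
      bd_cell[OF bx(1)] bx(3) m3 by simp
  then have "ceqv (tgt P x') (tgt P y')" using bd3(2,4)[OF x'(1,2)] bd3(2,4)[OF y'(1,2)] by (intro ev_faithful) simp_all
  then show thesis using that x' y' by blast
qed

end

context pf_coh_model begin

lemma coherent_cells:
  assumes x: "cell P p x" "cdim x = 3" and y: "cell P p y" "cdim y = 3" and e: "ceqv (src P x) (src P y)" "ceqv (tgt P x) (tgt P y)"
  shows "R x y"
proof -
  note bx = bd3[OF x] and b_y = bd3[OF y]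
  define ws where "ws = init (src P (src P x))"
  have c1: "cell P p (src P (src P x))" "cdim (src P (src P x)) = 1" using bd2[OF bx(1,3)] by simp_all
  have e1: "ceqv (src P (src P x)) (src P (src P y))"
    using good_eqvI[OF e(1)] bx(3) m3 by (simp add: good_eqv_def)
  have wx: "st ws (atoms1 (src P (src P x)))" and q: "qs (src P (src P x)) ws = ev (src P (src P x))"
    using init[OF c1] by (simp_all add: ws_def)
  have wy: "st ws (atoms1 (src P (src P y)))" using wx atoms_bd[OF e(1) bx(3)] p2 m3 by simp
  have wt: "st ws (atoms1 (src P (tgt P x)))" using wx bx(10) by simp
  have q': "qs (src P (src P y)) ws = ev (src P (src P y))"
    using q qs_eqv(1)[OF e1 c1(2)] ev_eqv[OF e1] c1(2) by simp
  have t: "E (tgt P y) ws = E (tgt P x) ws" "E (src P y) ws = E (src P x) ws"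
    using KE_eqv(2)[OF e(2) bx(4) wt] KE_eqv(2)[OF e(1) bx(3) wx] by simp_all
  have u: "ev (src P (src P x)) \<odot> ev x = ev x" "ev (src P (src P y)) \<odot> ev y = ev y"
    by (rule unit_l'; use bx b_y MC.B.bd1I[OF bx(6,7)] MC.B.bd1I[OF b_y(6,7)] bd2[OF bx(1,3)] bd2[OF b_y(1,3)] in simp)+
  \<comment> \<open>By naturality both composites are the square of the common source.\<close>
  have xy: "ev x \<bullet> E (tgt P x) ws = ev y \<bullet> E (tgt P x) ws"
    using E_natural[OF x wx] E_natural[OF y wy] unfolding q q' t u by simp
  note s = sqD[OF sq_cell[OF bx(2,4) wt]] and b = bd2[OF bx(2,4)]
  have "qs (src P (tgt P x)) ws \<odot> ev (tgt P x) = ev (tgt P x)"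
    using q bx(12,16) b by (intro unit_l') simp_all
  then have st: "srq 2 (E (tgt P x) ws) = ev (tgt P x)" using s by simp
  \<comment> \<open>An inverse of the square of the common target; it cancels on the right.\<close>
  obtain z where z: "okq z" "E (tgt P x) ws \<bullet> z = srq 2 (E (tgt P x) ws)" using invq[OF s(6)] by blast
  have "(ev x \<bullet> E (tgt P x) ws) \<bullet> z = (ev y \<bullet> E (tgt P x) ws) \<bullet> z" unfolding xy ..
  moreover have "ev (tgt P y) = ev (tgt P x)" using ev_eqv[OF e(2)] bx(4) by simp
  moreover have "ev x \<bullet> ev (tgt P x) = ev x" "ev y \<bullet> ev (tgt P y) = ev y" by (rule unit_r'; use bx b_y in simp)+
  ultimately have "ev x = ev y" unfolding st by (simp add: assoc z st)
  then show ?thesis using x y by (intro ev_R)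
qed

end

section \<open>Coherence and confluence\<close>

context typed_data begin

text \<open>Equality in the quotient by this relation means existence of a 4-cell. Coherence thus
  becomes an equation between parallel 3-cells.\<close>

definition link where
  "link x y \<longleftrightarrow> cell S p x \<and> cell S p y \<and> cdim x = 3 \<and> cdim y = 3 \<and>
     (\<exists>h. cell S p h \<and> cdim h = 4 \<and> ceqv (src S h) x \<and> ceqv (tgt S h) y)"

lemma linkI:
  assumes "cell S p h" "cdim h = 4" "ceqv (src S h) x" "ceqv (tgt S h) y" "4 \<le> m" shows "link x y"
  unfolding link_def using assms bd_cell[of h] eqv_dim[of "src S h" x] eqv_dim[of "tgt S h" y] eqv_cellD(2) by auto

lemma linkE:
  assumes "link x y" "4 \<le> m"
  obtains h where "cell S p x" "cell S p y" "cdim x = 3" "cdim y = 3" "cell S p h" "cdim h = 4" "ceqv (src S h) x" "ceqv (tgt S h) y"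
    "cell S p (src S h)" "cell S p (tgt S h)" "cdim (src S h) = 3" "cdim (tgt S h) = 3"
    "src_at S 3 h = src S h" "tgt_at S 3 h = tgt S h"
proof -
  obtain h where h: "cell S p x" "cell S p y" "cdim x = 3" "cdim y = 3" "cell S p h" "cdim h = 4" "ceqv (src S h) x" "ceqv (tgt S h) y"
    using assms(1) unfolding link_def by blast
  show thesis using that[OF h] bd_cell[OF h(5)] h(6) assms(2) by (simp add: src_at_def tgt_at_def)
qed

text \<open>The closure properties are operations on 4-cells: identities, inverses, composition
  along 3-cells, and composition along lower cells.\<close>

lemma link_cong3:
  assumes m: "4 \<le> m" and p: "p \<le> 3" shows "cong3 S p m link"
proof unfold_locales
  fix x y assume "link x y"
  then show "cell S p x \<and> cell S p y \<and> cdim x = 3 \<and> cdim y = 3" by (simp add: link_def)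
next
  fix x y assume e: "ceqv x y" and d: "cdim x = 3"
  have "link x y" by (rule linkI[of "Idt x"]) (use e d m eqv_cellD[OF e] in \<open>simp_all add: cell_Idt_iff eqv_refl\<close>)
  then show "link x y" .
next
  fix x y assume "link x y"
  then obtain h where h: "cell S p h" "cdim h = 4" "ceqv (src S h) x" "ceqv (tgt S h) y" 
    "src_at S 3 h = src S h" "tgt_at S 3 h = tgt S h" using linkE m by metis
  \<comment> \<open>4-cells are invertible because of \<open>p \<le> 3\<close>.\<close>
  obtain h' where i: "is_inverse 3 h h'" using inverse_exists[of h 3] h p m by auto
  then have c: "cell S p h'" "cdim h' = 4" "ceqv (tgt_at S 3 h) (src_at S 3 h')" "ceqv (tgt_at S 3 h') (src_at S 3 h)"
    using h(2) by (simp_all add: is_inverse_def cell_Cmp_iff)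
  have "src_at S 3 h' = src S h'" "tgt_at S 3 h' = tgt S h'" using c(2) by (simp_all add: src_at_def tgt_at_def)
  then have "ceqv (src S h') y" "ceqv (tgt S h') x" using c h by (metis eqv_sym eqv_trans)+
  then show "link y x" using linkI c m by blast
next
  fix x y z assume "link x y" "link y z"
  obtain h where h: "cell S p h" "cdim h = 4" "ceqv (src S h) x" "ceqv (tgt S h) y" 
    "src_at S 3 h = src S h" "tgt_at S 3 h = tgt S h" using linkE[OF \<open>link x y\<close>] m by metis
  obtain h' where h': "cell S p h'" "cdim h' = 4" "ceqv (src S h') y" "ceqv (tgt S h') z" 
    "src_at S 3 h' = src S h'" "tgt_at S 3 h' = tgt S h'" using linkE[OF \<open>link y z\<close>] m by metis
  have "ceqv (tgt S h) (src S h')" using h h' by (metis eqv_sym eqv_trans)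
  then have "cell S p (Cmp 3 h h')" using h h' by (simp add: cell_Cmp_iff)
  then show "link x z" by (rule linkI) (use h h' m in simp_all)
next
  fix x y assume "link x y"
  then obtain h where h: "cell S p h" "cdim h = 4" "ceqv (src S h) x" "ceqv (tgt S h) y" "cdim (src S h) = 3" "cdim (tgt S h) = 3"
    using linkE m by metis
  have "ceqv (src S (src S h)) (src S (tgt S h))" "ceqv (tgt S (src S h)) (tgt S (tgt S h))" using bd_glob[OF h(1)] h m by simp_all
  moreover have "ceqv (src S (src S h)) (src S x)" "ceqv (tgt S (src S h)) (tgt S x)"
     "ceqv (src S (tgt S h)) (src S y)" "ceqv (tgt S (tgt S h)) (tgt S y)"
    using good_eqvI[OF h(3)] good_eqvI[OF h(4)] h m by (simp_all add: good_eqv_def)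
  ultimately show "ceqv (src S x) (src S y) \<and> ceqv (tgt S x) (tgt S y)" by (metis eqv_sym eqv_trans)
next
  fix x x' y y' i assume "link x x'" "link y y'" and c: "cell S p (Cmp i x y)"
  obtain h where h: "cell S p x" "cell S p x'" "cdim x = 3" "cdim x' = 3" "cell S p h" "cdim h = 4" "ceqv (src S h) x" "ceqv (tgt S h) x'" 
    "cdim (src S h) = 3" "cdim (tgt S h) = 3" "src_at S 3 h = src S h" "tgt_at S 3 h = tgt S h" using linkE[OF \<open>link x x'\<close>] m by metis
  obtain k where k: "cell S p y" "cell S p y'" "cdim y = 3" "cdim y' = 3" "cell S p k" "cdim k = 4" "ceqv (src S k) y" "ceqv (tgt S k) y'" 
    "cdim (src S k) = 3" "cdim (tgt S k) = 3" "src_at S 3 k = src S k" "tgt_at S 3 k = tgt S k" using linkE[OF \<open>link y y'\<close>] m by metis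
  have i: "i < 3" "ceqv (tgt_at S i x) (src_at S i y)" using c h(3) by (simp_all add: cell_Cmp_iff)
  \<comment> \<open>A 4-cell has the same \<open>i\<close>-boundary as its source, so
    \<open>h\<close> and \<open>k\<close> can be composed where \<open>x\<close> and
    \<open>y\<close> can.\<close>
  have "ceqv (tgt_at S i (src S h)) (tgt_at S i h)" using at_glob[of i 3 h] h i m by simp
  moreover have "ceqv (tgt_at S i (src S h)) (tgt_at S i x)" "ceqv (src_at S i (src S k)) (src_at S i y)"
    using at_eqv[OF h(7), of i] at_eqv[OF k(7), of i] h k i m by simp_all
  moreover have "src_at S i k = src_at S i (src S k)" using at_Suc[OF k(5), of i] k i m by simp
  ultimately have "ceqv (tgt_at S i h) (src_at S i k)" using i(2) by (metis eqv_sym eqv_trans)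
  then have hk: "cell S p (Cmp i h k)" using h k i by (simp add: cell_Cmp_iff)
  have s: "src S (Cmp i h k) = Cmp i (src S h) (src S k)" "tgt S (Cmp i h k) = Cmp i (tgt S h) (tgt S k)" using h i by simp_all
  have b: "cell S p (Cmp i (src S h) (src S k))" "cell S p (Cmp i (tgt S h) (tgt S k))" using bd_cell[OF hk] h m unfolding s by simp_all
  show "link (Cmp i x y) (Cmp i x' y')"
    by (rule linkI[OF hk]) (use eqv_Cmp[OF h(7) k(7) b(1)] eqv_Cmp[OF h(8) k(8) b(2)] h m s in simp_all)
qed (rule m[THEN order_trans[rotated]], simp)

end

lemma coherent_PFonct:
  assumes "f \<in> C \<rightarrow> D" shows "three_coherent (free_npcat 4 2 (PFonct C D f))"
proof -
  interpret pf_typed C D f 2 by unfold_locales fact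
  interpret T: typed_data P 2 4 by unfold_locales (fact wt4 dims)+
  interpret M: cong3 P 2 4 T.link by (rule T.link_cong3) simp_all
  interpret M: pf_model C D f 2 4 T.link by unfold_locales simp
  interpret M: pf_coh_model C D f 2 4 T.link
  proof unfold_locales
    fix g assume "g \<in> gens P 4"
    then have "cell P 2 (Gen 4 g)" by (simp add: cell_Gen_iff)
    moreover from this have "cell P 2 (gsrc P 4 g)" "cell P 2 (gtgt P 4 g)" using T.bd_cell[of "Gen 4 g"] by simp_all
    ultimately show "T.link (gsrc P 4 g) (gtgt P 4 g)" by (intro T.linkI[of "Gen 4 g"]) (simp_all add: eqv_refl)
  next
    fix X assume "M.okq X"
    then obtain x where x: "X = M.J x" "cell P 2 x" "cdim x = 3" using M.okE by blast
    \<comment> \<open>With \<open>p = 2\<close> the 3-cells are invertible already before passing to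
      classes.\<close>
    then obtain y where i: "T.is_inverse 2 x y" using T.inverse_exists[of x 2] by auto
    then have c: "cell P 2 (Cmp 2 x y)" "cell P 2 (Cmp 2 y x)" by (simp_all add: T.is_inverse_def)
    then have y: "cell P 2 y" "cdim y = 3" using x by (simp_all add: cell_Cmp_iff)
    have b: "cdim (src P x) = 2" "cdim (tgt P x) = 2" using T.bd_cell[OF x(2)] x(3) by simp_all
    have "M.cpq 2 (M.J x) (M.J y) = M.J (Idt (src P x))" "M.cpq 2 (M.J y) (M.J x) = M.J (Idt (tgt P x))"
      using M.cp_J3[OF c(1) x(3)] M.cp_J3[OF c(2) y(2)] M.J_eqv[of "Cmp 2 x y" "Idt (src P x)"] M.J_eqv[of "Cmp 2 y x" "Idt (tgt P x)"] i x y
      by (simp_all add: T.is_inverse_def)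
    moreover have "M.srq 2 (M.J x) = M.J (src P x)" "M.tgq 2 (M.J x) = M.J (tgt P x)"
      using M.sr_J3[OF x(2,3), of 2] x(3) by (simp_all add: src_at_def tgt_at_def)
    ultimately show "\<exists>y. M.okq y \<and> M.cpq 2 X y = M.srq 2 X \<and> M.cpq 2 y X = M.tgq 2 X"
      using M.okJ[OF y(1)] y(2) b x(1) by (intro exI[of _ "M.J y"]) (simp add: M.J_Idt)
  qed
  show ?thesis unfolding three_coherent_def
  proof (intro ballI impI)
    fix X Y assume XY: "X \<in> cells T.F 3" "Y \<in> cells T.F 3" and e: "source T.F 2 X = source T.F 2 Y \<and> target T.F 2 X = target T.F 2 Y"
    then obtain x y where x: "X = T.cls x" "cell P 2 x" "cdim x = 3" and y: "Y = T.cls y" "cell P 2 y" "cdim y = 3"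
      unfolding T.cells_iff by blast
    have "eqv P 2 (src P x) (src P y)" "eqv P 2 (tgt P x) (tgt P y)"
      using e x y T.bd_cell[OF x(2)] by (simp_all add: T.source_cls T.target_cls T.cls_eq_iff)
    then have "T.link x y" by (rule M.coherent_cells[OF x(2,3) y(2,3)])
    then obtain h where h: "cell P 2 h" "cdim h = 4" "eqv P 2 (src P h) x" "eqv P 2 (tgt P h) y" unfolding T.link_def by blast
    show "\<exists>h \<in> cells T.F 4. source T.F 3 h = X \<and> target T.F 3 h = Y"
      by (rule bexI[of _ "T.cls h"]) (use h x y in \<open>auto simp: T.source_cls T.target_cls T.cls_eq T.cells_iff\<close>)
  qed
qed

lemma confluent_PFonct:
  assumes "f \<in> C \<rightarrow> D" shows "three_confluent (PFonct C D f)"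
proof -
  interpret pf_typed C D f 3 by unfold_locales fact
  interpret T: typed_data P 3 3 by unfold_locales (fact wt3 dims)+
  \<comment> \<open>In the free 3-category the congruence is equality of 3-cells.\<close>
  interpret M: cong3 P 3 3 "\<lambda>x y. eqv P 3 x y \<and> cdim x = 3"
  proof unfold_locales
    fix x x' y y' i assume a: "eqv P 3 x x' \<and> cdim x = 3" "eqv P 3 y y' \<and> cdim y = 3" "cell P 3 (Cmp i x y)"
    then show "eqv P 3 (Cmp i x y) (Cmp i x' y') \<and> cdim (Cmp i x y) = 3" using T.eqv_Cmp[of x x' y y' i] by simp
  qed (use T.eqv_dim T.good_eqvI eqv_cellD in \<open>auto simp: good_eqv_def intro: eqv_sym eqv_trans\<close>)
  interpret M: pf_model C D f 3 3 "\<lambda>x y. eqv P 3 x y \<and> cdim x = 3" by unfold_locales simp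
  show ?thesis unfolding three_confluent_def free_ncat_def Let_def
  proof (intro ballI impI)
    fix X Y assume XY: "X \<in> cells T.F 3" "Y \<in> cells T.F 3" and e: "source T.F 2 X = source T.F 2 Y"
    then obtain x y where x: "X = T.cls x" "cell P 3 x" "cdim x = 3" and y: "Y = T.cls y" "cell P 3 y" "cdim y = 3"
      unfolding T.cells_iff by blast
    have "eqv P 3 (src P x) (src P y)"
      using e x y T.bd_cell[OF x(2)] by (simp add: T.source_cls T.cls_eq_iff)
    then obtain x' y' where x': "cell P 3 x'" "cdim x' = 3" "eqv P 3 (tgt P x) (src P x')"
      and y': "cell P 3 y'" "cdim y' = 3" "eqv P 3 (tgt P y) (src P y')" and t: "eqv P 3 (tgt P x') (tgt P y')"
      using M.confluent_cells[OF x(2,3) y(2,3)] by metis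
    have c: "cell P 3 (Cmp 2 x x')" "cell P 3 (Cmp 2 y y')"
      using x y x' y' by (simp_all add: cell_Cmp_iff src_at_def tgt_at_def)
    show "\<exists>A' \<in> cells T.F 3. \<exists>B' \<in> cells T.F 3. composable T.F 3 2 X A' \<and> composable T.F 3 2 Y B' \<and>
       target T.F 2 (cmp T.F 3 2 X A') = target T.F 2 (cmp T.F 3 2 Y B')"
    proof (rule bexI[of _ "T.cls x'"], rule bexI[of _ "T.cls y'"], intro conjI)
      show "T.cls x' \<in> cells T.F 3" "T.cls y' \<in> cells T.F 3" using x' y' by (auto simp: T.cells_iff)
      show "composable T.F 3 2 X (T.cls x')" "composable T.F 3 2 Y (T.cls y')"
        unfolding T.composable_cls using c x y by auto
      show "target T.F 2 (cmp T.F 3 2 X (T.cls x')) = target T.F 2 (cmp T.F 3 2 Y (T.cls y'))"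
        using c x y t by (simp add: T.cmp_cls T.target_cls T.cls_eq)
    qed
  qed
qed

section \<open>Termination\<close>

abbreviation lle :: "nat list \<Rightarrow> nat list \<Rightarrow> bool" where "lle \<equiv> list_all2 (\<le>)"
abbreviation lpos :: "nat list \<Rightarrow> bool" where "lpos l \<equiv> \<forall>v\<in>set l. 1 \<le> v"

lemma lle_trans: "lle k l \<Longrightarrow> lle l m \<Longrightarrow> lle k m"
  by (rule list_all2_trans[of "(\<le>)" "(\<le>)" "(\<le>)"]) simp_all

lemma lle_antisym: "lle k l \<Longrightarrow> lle l k \<Longrightarrow> k = l"
  by (rule list_all2_antisym[of "(\<le>)" "(\<le>)"]) simp_all

lemma lle_sum: "lle k l \<Longrightarrow> k \<noteq> l \<Longrightarrow> sum_list k < sum_list l"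
proof -
  have "lle k l \<Longrightarrow> sum_list k \<le> sum_list l \<and> (k \<noteq> l \<longrightarrow> sum_list k < sum_list l)"
  proof (induction rule: list_all2_induct)
    case (Cons x xs y ys) then show ?case by (cases "x = y") auto
  qed simp
  then show "lle k l \<Longrightarrow> k \<noteq> l \<Longrightarrow> sum_list k < sum_list l" by blast
qed

lemma lle_refl: "lle l l" by (rule list_all2_refl) simp

lemma list_all2_split:
  assumes "list_all2 Q l l'" shows "list_all2 Q (take n l) (take n l')" "list_all2 Q (drop n l) (drop n l')"
  using assms by (auto simp: list_all2_conv_all_nth)

text \<open>Lists are compared entry by entry. \<open>G_mono\<close> and \<open>G_inj\<close>
  together are strict monotonicity. Generating 3-cells are required to decrease positive lists only:
  for \<alpha> the decrease is a multiple of the first entry.\<close>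

locale sem_order = sem_data S 3 3 G for S :: "'g polygraph_data" and G :: "'g \<Rightarrow> nat list \<Rightarrow> nat list" +
  assumes G_pos: "g \<in> gens S 2 \<Longrightarrow> length l = length (atoms1 (gsrc S 2 g)) \<Longrightarrow> lpos l \<Longrightarrow> lpos (G g l)"
    and G_mono: "g \<in> gens S 2 \<Longrightarrow> length l = length (atoms1 (gsrc S 2 g)) \<Longrightarrow> lle l l' \<Longrightarrow> lle (G g l) (G g l')"
    and G_inj: "g \<in> gens S 2 \<Longrightarrow> length l = length (atoms1 (gsrc S 2 g)) \<Longrightarrow> lle l l' \<Longrightarrow> G g l = G g l' \<Longrightarrow> l = l'"
    and G_decr: "g \<in> gens S 3 \<Longrightarrow> length l = length (atoms1 (src S (gsrc S 3 g))) \<Longrightarrow> lpos l \<Longrightarrow>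
      lle (sm (gtgt S 3 g) l) (sm (gsrc S 3 g) l) \<and> sm (gtgt S 3 g) l \<noteq> sm (gsrc S 3 g) l"
begin

lemma sm_pos: "cell S 3 x \<Longrightarrow> cdim x = 2 \<Longrightarrow> length l = length (atoms1 (src S x)) \<Longrightarrow> lpos l \<Longrightarrow> lpos (sm x l)"
proof (induction x arbitrary: l)
  case (Gen k g) then show ?case using G_pos[of g l] by (simp add: cell_Gen_iff)
next
  case (Inv k g) then show ?case by simp
next
  case (Idt x) then show ?case by simp
next
  case (Cmp i x y)
  have d: "cdim x = 2" using Cmp.prems by simp
  from Cmp.prems(1) d show ?case
  proof (cases rule: cmp1_cases)
    case 0
    have l: "length (take (length (atoms1 (src S x))) l) = length (atoms1 (src S x))"
      "length (drop (length (atoms1 (src S x))) l) = length (atoms1 (src S y))"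
      "lpos (take (length (atoms1 (src S x))) l)" "lpos (drop (length (atoms1 (src S x))) l)"
      using Cmp.prems(3,4) d 0 by (auto simp: bd2_simps dest: in_set_takeD in_set_dropD)
    show ?thesis using Cmp.IH(1)[OF 0(2) d l(1,3)] Cmp.IH(2)[OF 0(3,4) l(2,4)] 0 by auto
  next
    case 1
    have l: "length l = length (atoms1 (src S x))" using Cmp.prems(3) d 1(1) by (simp add: bd2_simps)
    have "length (sm x l) = length (atoms1 (src S y))" using sem_length[OF 1(2) d l] Cmp1_atoms[of x y] Cmp.prems(1) d 1(1) by simp
    then show ?thesis using Cmp.IH(2)[OF 1(3,4) _ Cmp.IH(1)[OF 1(2) d l Cmp.prems(4)]] 1(1) by simp
  qed
qed

lemma sm_mono: "cell S 3 x \<Longrightarrow> cdim x = 2 \<Longrightarrow> length l = length (atoms1 (src S x)) \<Longrightarrow> lle l l' \<Longrightarrow>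
  lle (sm x l) (sm x l') \<and> (sm x l = sm x l' \<longrightarrow> l = l')"
proof (induction x arbitrary: l l')
  case (Gen k g) then show ?case using G_mono[of g l l'] G_inj[of g l l'] by (simp add: cell_Gen_iff)
next
  case (Inv k g) then show ?case by (auto elim: cell_InvE)
next
  case (Idt x) then show ?case by simp
next
  case (Cmp i x y)
  have d: "cdim x = 2" using Cmp.prems by simp
  from Cmp.prems(1) d show ?case
  proof (cases rule: cmp1_cases)
    case 0
    let ?n = "length (atoms1 (src S x))"
    have l: "length (take ?n l) = ?n" "length (drop ?n l) = length (atoms1 (src S y))" "length l' = length l"
      using Cmp.prems(3) list_all2_lengthD[OF Cmp.prems(4)] d 0 by (simp_all add: bd2_simps)
    note s = list_all2_split[OF Cmp.prems(4), of ?n]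
    have "length (sm x (take ?n l)) = length (atoms1 (tgt S x))" "length (sm x (take ?n l')) = length (atoms1 (tgt S x))"
      using sem_length[OF 0(2) d l(1)] sem_length[OF 0(2) d, of "take ?n l'"] l by simp_all
    moreover have "take ?n l = take ?n l' \<and> drop ?n l = drop ?n l' \<Longrightarrow> l = l'" by (metis append_take_drop_id)
    ultimately show ?thesis using Cmp.IH(1)[OF 0(2) d l(1) s(1)] Cmp.IH(2)[OF 0(3,4) l(2) s(2)] 0 by (auto intro: list_all2_appendI)
  next
    case 1
    have l: "length l = length (atoms1 (src S x))" using Cmp.prems(3) d 1(1) by (simp add: bd2_simps)
    have "length (sm x l) = length (atoms1 (src S y))" using sem_length[OF 1(2) d l] Cmp1_atoms[of x y] Cmp.prems(1) d 1(1) by simp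
    then show ?thesis using Cmp.IH(1)[OF 1(2) d l Cmp.prems(4)] Cmp.IH(2)[OF 1(3,4), of "sm x l" "sm x l'"] 1(1) by simp
  qed
qed

text \<open>The decrease is demanded at every positive list, since inside a composite a 3-cell meets
  whatever the cells before it produce.\<close>

definition decr where
  "decr s t \<longleftrightarrow> (\<forall>l. length l = length (atoms1 (src S s)) \<longrightarrow> lpos l \<longrightarrow> lle (sm t l) (sm s l) \<and> sm t l \<noteq> sm s l)"

lemma decr_weak:
  assumes "ceqv s t \<or> decr s t" "cdim s = 2" "length l = length (atoms1 (src S s))" "lpos l"
  shows "lle (sm t l) (sm s l)"
  using assms sem_eqv[of s t l] lle_refl by (auto simp: decr_def)

lemma bd3: assumes "cell S 3 x" "cdim x = 3"
  shows "cell S 3 (src S x)" "cell S 3 (tgt S x)" "cdim (src S x) = 2" "cdim (tgt S x) = 2"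
    "length (atoms1 (src S (tgt S x))) = length (atoms1 (src S (src S x)))"
    "length (atoms1 (tgt S (tgt S x))) = length (atoms1 (tgt S (src S x)))"
proof -
  show c: "cell S 3 (src S x)" "cell S 3 (tgt S x)" "cdim (src S x) = 2" "cdim (tgt S x) = 2" using bd_cell[of x] assms by simp_all
  have "cdim (src S (src S x)) = 1" "cdim (tgt S (src S x)) = 1" using bd_cell[OF c(1)] c(3) by simp_all
  then show "length (atoms1 (src S (tgt S x))) = length (atoms1 (src S (src S x)))"
    "length (atoms1 (tgt S (tgt S x))) = length (atoms1 (tgt S (src S x)))"
    using bd_glob[of x] assms eqv1_atoms[of "src S (src S x)" "src S (tgt S x)"] eqv1_atoms[of "tgt S (src S x)" "tgt S (tgt S x)"] by simp_all
qed

text \<open>A composite of 3-cells decreases as soon as one factor does. The other factor decreases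
  weakly by \<open>decr_weak\<close>, and for composition along 1-cells strict monotonicity of the
  later 2-cell preserves an earlier decrease.\<close>

lemma cell3_decr: "cell S 3 x \<Longrightarrow> cdim x = 3 \<Longrightarrow> ceqv (src S x) (tgt S x) \<or> decr (src S x) (tgt S x)"
proof (induction x)
  case (Gen k g) then show ?case using G_decr[of g] by (simp add: cell_Gen_iff decr_def)
next
  case (Inv k g) then show ?case by (auto elim: cell_InvE)
next
  case (Idt x) then show ?case by (simp add: cell_Idt_iff eqv_refl)
next
  case (Cmp i x y)
  have c: "cell S 3 x" "cell S 3 y" "cdim x = 3" "cdim y = 3" "i < 3" "ceqv (tgt_at S i x) (src_at S i y)"
    using Cmp.prems by (simp_all add: cell_Cmp_iff)
  note bx = bd3[OF c(1,3)] and b_y = bd3[OF c(2,4)]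
  note X = Cmp.IH(1)[OF c(1,3)] and Y = Cmp.IH(2)[OF c(2,4)]
  note wX = decr_weak[OF X bx(3)] and wY = decr_weak[OF Y b_y(3)]
  consider "i = 0" | "i = 1" | "i = 2" using c(5) by linarith
  then show ?case
  proof cases
    case 1
    have s: "src S (Cmp i x y) = Cmp 0 (src S x) (src S y)" "tgt S (Cmp i x y) = Cmp 0 (tgt S x) (tgt S y)" using 1 c by simp_all
    have cc: "cell S 3 (Cmp 0 (src S x) (src S y))" using bd_cell[OF Cmp.prems(1)] Cmp.prems(2) s by simp
    show ?thesis
    proof (cases "ceqv (src S x) (tgt S x) \<and> ceqv (src S y) (tgt S y)")
      case True then show ?thesis unfolding s using eqv_Cmp[OF _ _ cc] bx(3) by simp
    next
      case False
      have "decr (Cmp 0 (src S x) (src S y)) (Cmp 0 (tgt S x) (tgt S y))"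
        unfolding decr_def
      proof (intro allI impI)
        fix l :: "nat list" assume l: "length l = length (atoms1 (src S (Cmp 0 (src S x) (src S y))))" "lpos l"
        let ?n = "length (atoms1 (src S (src S x)))"
        define k k' where "k = take ?n l" and "k' = drop ?n l"
        have k: "length k = ?n" "length k' = length (atoms1 (src S (src S y)))" "lpos k" "lpos k'"
          using l bx(3) by (auto simp: k_def k'_def bd2_simps dest: in_set_takeD in_set_dropD)
        have e: "sm (Cmp 0 (src S x) (src S y)) l = sm (src S x) k @ sm (src S y) k'"
          "sm (Cmp 0 (tgt S x) (tgt S y)) l = sm (tgt S x) k @ sm (tgt S y) k'" using bx(5) by (simp_all add: k_def k'_def)
        have "sm (tgt S x) k \<noteq> sm (src S x) k \<or> sm (tgt S y) k' \<noteq> sm (src S y) k'"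
          using False X Y k by (auto simp: decr_def)
        then show "lle (sm (Cmp 0 (tgt S x) (tgt S y)) l) (sm (Cmp 0 (src S x) (src S y)) l) \<and>
          sm (Cmp 0 (tgt S x) (tgt S y)) l \<noteq> sm (Cmp 0 (src S x) (src S y)) l"
          unfolding e using wX[OF k(1,3)] wY[OF k(2,4)] list_all2_lengthD[OF wX[OF k(1,3)]] by (auto intro: list_all2_appendI)
      qed
      then show ?thesis unfolding s by blast
    qed
  next
    case 2
    have s: "src S (Cmp i x y) = Cmp 1 (src S x) (src S y)" "tgt S (Cmp i x y) = Cmp 1 (tgt S x) (tgt S y)" using 2 c by simp_all
    have cc: "cell S 3 (Cmp 1 (src S x) (src S y))" using bd_cell[OF Cmp.prems(1)] Cmp.prems(2) s by simp
    have mid: "atoms1 (tgt S (src S x)) = atoms1 (src S (src S y))" using Cmp1_atoms[OF cc bx(3)] by simp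
    show ?thesis
    proof (cases "ceqv (src S x) (tgt S x) \<and> ceqv (src S y) (tgt S y)")
      case True then show ?thesis unfolding s using eqv_Cmp[OF _ _ cc] bx(3) by simp
    next
      case False
      have "decr (Cmp 1 (src S x) (src S y)) (Cmp 1 (tgt S x) (tgt S y))"
        unfolding decr_def
      proof (intro allI impI)
        fix l :: "nat list" assume l: "length l = length (atoms1 (src S (Cmp 1 (src S x) (src S y))))" "lpos l"
        then have l1: "length l = length (atoms1 (src S (src S x)))" using bx(3) by (simp add: bd2_simps)
        define k k' where "k = sm (src S x) l" and "k' = sm (tgt S x) l"
        have k: "length k' = length (atoms1 (src S (src S y)))" "lpos k'" "lle k' k"
          using sem_length[OF bx(2,4), of l] sm_pos[OF bx(2,4), of l] wX[OF l1 l(2)] l l1 bx(5,6) mid by (simp_all add: k_def k'_def)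
        note y = wY[OF k(1,2)] and m = sm_mono[OF b_y(1,3) k(1,3)]
        have e: "sm (Cmp 1 (src S x) (src S y)) l = sm (src S y) k"
          "sm (Cmp 1 (tgt S x) (tgt S y)) l = sm (tgt S y) k'" by (simp_all add: k_def k'_def)
        have n: "k' \<noteq> k \<or> sm (tgt S y) k' \<noteq> sm (src S y) k'"
          using False X Y l1 l(2) k by (auto simp: decr_def k_def k'_def)
        \<comment> \<open>The value of \<open>src S y\<close> at \<open>k'\<close> lies between the
          two. Were they equal, all three would coincide; strict monotonicity then gives
          \<open>k' = k\<close>, and neither \<open>x\<close> nor \<open>y\<close> would have
          decreased anything.\<close>
        have "sm (tgt S y) k' \<noteq> sm (src S y) k"
        proof
          assume "sm (tgt S y) k' = sm (src S y) k"
          then have "sm (src S y) k' = sm (src S y) k" using y m lle_antisym by metis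
          then show False using n m \<open>sm (tgt S y) k' = sm (src S y) k\<close> by auto
        qed
        then show "lle (sm (Cmp 1 (tgt S x) (tgt S y)) l) (sm (Cmp 1 (src S x) (src S y)) l) \<and>
          sm (Cmp 1 (tgt S x) (tgt S y)) l \<noteq> sm (Cmp 1 (src S x) (src S y)) l"
          unfolding e using lle_trans[OF y] m by blast
      qed
      then show ?thesis unfolding s by blast
    qed
  next
    case 3
    have s: "src S (Cmp i x y) = src S x" "tgt S (Cmp i x y) = tgt S y" using 3 c by simp_all
    have e: "ceqv (tgt S x) (src S y)" using c 3 by (simp add: src_at_def tgt_at_def)
    show ?thesis
    proof (cases "ceqv (src S x) (tgt S x) \<and> ceqv (src S y) (tgt S y)")
      case True then show ?thesis unfolding s using e by (metis eqv_trans)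
    next
      case False
      have "decr (src S x) (tgt S y)"
        unfolding decr_def
      proof (intro allI impI)
        fix l :: "nat list" assume l: "length l = length (atoms1 (src S (src S x)))" "lpos l"
        have l2: "length l = length (atoms1 (src S (src S y)))" "length l = length (atoms1 (src S (tgt S x)))"
          using l(1) bx(5) atoms_bd(1)[OF e] bx(4) by simp_all
        have "sm (tgt S x) l = sm (src S y) l" using sem_eqv[OF e] bx(4) l2 by simp
        moreover have "sm (tgt S x) l \<noteq> sm (src S x) l \<or> sm (tgt S y) l \<noteq> sm (src S y) l"
          using False X Y l l2 by (auto simp: decr_def)
        ultimately show "lle (sm (tgt S y) l) (sm (src S x) l) \<and> sm (tgt S y) l \<noteq> sm (src S x) l"
          using wX[OF l] wY[OF l2(1) l(2)] lle_trans lle_antisym by metis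
      qed
      then show ?thesis unfolding s by blast
    qed
  qed
qed

text \<open>\<open>decr\<close> holds at every positive list, so evaluation at the all-one list
  suffices to turn the order on functions into a number.\<close>

definition "wt_cell s = sum_list (sm s (replicate (length (atoms1 (src S s))) 1))"
definition "wt_cls X = wt_cell (SOME s. s \<in> X)"

lemma wt_cls: assumes "cell S 3 s" "cdim s = 2" shows "wt_cls (cls s) = wt_cell s"
proof -
  have "(SOME t. t \<in> cls s) \<in> cls s" by (rule someI[of "\<lambda>t. t \<in> cls s"]) (rule cls_self[OF assms(1)])
  then have "ceqv s (SOME t. t \<in> cls s)" by (simp add: eclass_def)
  then show ?thesis unfolding wt_cls_def wt_cell_def using atoms_bd(1)[of s] sem_eqv[of s] assms by simp
qed

lemma rewrites3_wt:
  assumes "(X, Y) \<in> rewrites3 S" shows "X = Y \<or> wt_cls Y < wt_cls X"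
proof -
  obtain A where A: "A \<in> cells F 3" "source F 2 A = X" "target F 2 A = Y"
    using assms by (auto simp: rewrites3_def free_ncat_def)
  then obtain x where x: "A = cls x" "cell S 3 x" "cdim x = 3" unfolding cells_iff by blast
  note b = bd3[OF x(2,3)]
  have e: "X = cls (src S x)" "Y = cls (tgt S x)" using A x by (auto simp: source_cls target_cls)
  let ?l = "replicate (length (atoms1 (src S (src S x)))) (1::nat)"
  from cell3_decr[OF x(2,3)] show ?thesis
  proof
    assume "ceqv (src S x) (tgt S x)" then show ?thesis unfolding e using cls_eq by blast
  next
    assume "decr (src S x) (tgt S x)"
    then have "lle (sm (tgt S x) ?l) (sm (src S x) ?l) \<and> sm (tgt S x) ?l \<noteq> sm (src S x) ?l" by (simp add: decr_def)
    then show ?thesis unfolding e wt_cls[OF b(1,3)] wt_cls[OF b(2,4)] wt_cell_def b(5) using lle_sum by blast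
  qed
qed

lemma rewrites3_refl: assumes "X \<in> cells F 2" shows "(X, X) \<in> rewrites3 S"
proof -
  obtain x where x: "X = cls x" "cell S 3 x" "cdim x = 2" using assms unfolding cells_iff by blast
  have "cls (Idt x) \<in> cells F 3" "source F 2 (cls (Idt x)) = X" "target F 2 (cls (Idt x)) = X"
    using x by (auto simp: cells_iff source_cls target_cls cell_id)
  then show ?thesis using assms by (auto simp: rewrites3_def free_ncat_def)
qed

lemma rewrites3_trans: assumes "(X, Y) \<in> rewrites3 S" "(Y, Z) \<in> rewrites3 S" shows "(X, Z) \<in> rewrites3 S"
proof -
  obtain A B where A: "A \<in> cells F 3" "source F 2 A = X" "target F 2 A = Y" and B: "B \<in> cells F 3" "source F 2 B = Y" "target F 2 B = Z"
    and XZ: "X \<in> cells F 2" "Z \<in> cells F 2"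
    using assms by (auto simp: rewrites3_def free_ncat_def)
  obtain x y where x: "A = cls x" "cell S 3 x" "cdim x = 3" and y: "B = cls y" "cell S 3 y" "cdim y = 3" using A B unfolding cells_iff by blast
  have "cls (tgt S x) = cls (src S y)" using A(3) B(2) x y by (simp add: source_cls target_cls)
  then have "ceqv (tgt S x) (src S y)" using cls_eq_iff[OF bd3(2)[OF x(2,3)]] by blast
  then have c: "cell S 3 (Cmp 2 x y)" using x y by (simp add: cell_Cmp_iff src_at_def tgt_at_def)
  have "cls (Cmp 2 x y) \<in> cells F 3" "source F 2 (cls (Cmp 2 x y)) = X" "target F 2 (cls (Cmp 2 x y)) = Z"
    using x y c A B by (auto simp: cells_iff source_cls target_cls)
  then show ?thesis using XZ by (auto simp: rewrites3_def free_ncat_def)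
qed

lemma terminating: "three_terminating S"
proof -
  \<comment> \<open>A rewrite between distinct classes lowers the weight, which rules out
    cycles.\<close>
  have "antisym ((rewrites3 S)\<inverse>)" using rewrites3_wt by (intro antisymI) (blast dest: less_asym)
  moreover have "refl_on (cells F 2) ((rewrites3 S)\<inverse>)" using rewrites3_refl by (auto simp: refl_on_def rewrites3_def free_ncat_def)
  moreover have "trans ((rewrites3 S)\<inverse>)" using rewrites3_trans by (intro transI) blast
  moreover have "(rewrites3 S)\<inverse> \<subseteq> cells F 2 \<times> cells F 2" by (auto simp: rewrites3_def free_ncat_def)
  moreover have "wf ((rewrites3 S)\<inverse> - Id)"
  proof (rule wf_subset[OF wf_measure[of wt_cls]], rule subrelI)
    fix X Y assume "(X, Y) \<in> (rewrites3 S)\<inverse> - Id"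
    then have "(Y, X) \<in> rewrites3 S" "X \<noteq> Y" by blast+
    then show "(X, Y) \<in> measure wt_cls" using rewrites3_wt[of Y X] by auto
  qed
  ultimately show ?thesis unfolding three_terminating_def partial_order_on_def preorder_on_def free_ncat_def by simp
qed

end

text \<open>The factor 2 makes left bracketing heavier: \<alpha> takes \<open>4 x + 2 y + z\<close>
  to \<open>2 x + 2 y + z\<close>. The exponential is due to \<mu>, which exchanges a product before
  one crossing for a product after two, so a crossing has to send \<open>2 x + y\<close> above the
  combination of the two images. For \<nu> it gives 3 against 1.\<close>

definition weight :: "('c, 'd) pf_gen \<Rightarrow> nat list \<Rightarrow> nat list" where
  "weight g l = (case g of
     InC h \<Rightarrow> (case h of MG a b c \<Rightarrow> [2 * l ! 0 + l ! 1] | IG a \<Rightarrow> [1] | _ \<Rightarrow> l)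
   | InD h \<Rightarrow> (case h of MG a b c \<Rightarrow> [2 * l ! 0 + l ! 1] | IG a \<Rightarrow> [1] | _ \<Rightarrow> l)
   | PhiG a b \<Rightarrow> [l ! 1, 3 ^ (l ! 0)] | _ \<Rightarrow> l)"

text \<open>With \<open>X = 3 ^ x\<close> and \<open>Y = 3 ^ y\<close> the claim is
  \<open>2 X + Y < X X Y\<close>. Both numbers are at least 3; after substituting
  \<open>X = 3 + a\<close> and \<open>Y = 3 + b\<close> each coefficient on the right dominates the
  one on the left.\<close>

lemma mu_decr: assumes "1 \<le> x" "1 \<le> (y::nat)" shows "2 * 3 ^ x + 3 ^ y < (3::nat) ^ (2 * x + y)"
proof -
  have "3 ^ 1 \<le> (3::nat) ^ x" "3 ^ 1 \<le> (3::nat) ^ y" using assms by (intro power_increasing; simp)+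
  then obtain a b where a: "(3::nat) ^ x = 3 + a" "(3::nat) ^ y = 3 + b" using le_Suc_ex by (metis power_one_right)
  have "(3::nat) ^ (2 * x + y) = 3 ^ x * 3 ^ x * 3 ^ y" by (simp add: power_add mult_2)
  then show ?thesis unfolding a by (simp add: algebra_simps)
qed

context pf_typed begin

lemma weight_gen2:
  assumes g: "g \<in> gens P 2" and l: "length l = length (atoms1 (gsrc P 2 g))"
  shows "length (weight g l) = length (atoms1 (gtgt P 2 g))" "lpos l \<Longrightarrow> lpos (weight g l)"
    "lle l l' \<Longrightarrow> lle (weight g l) (weight g l')" "lle l l' \<Longrightarrow> weight g l = weight g l' \<Longrightarrow> l = l'"
proof -
  show "length (weight g l) = length (atoms1 (gtgt P 2 g))"
    using g by (cases rule: gens2_cases) (simp_all add: weight_def src_P wcmp_def)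
  show "lpos (weight g l)" if "lpos l"
    using g by (cases rule: gens2_cases) (use l that in \<open>auto simp: weight_def src_P wcmp_def length_Suc_conv\<close>)
  show "lle (weight g l) (weight g l')" if "lle l l'"
    using g by (cases rule: gens2_cases)
      (use l that in \<open>auto simp: weight_def src_P wcmp_def length_Suc_conv list_all2_Cons1 intro!: add_mono power_increasing\<close>)
  show "l = l'" if "lle l l'" "weight g l = weight g l'"
    using g by (cases rule: gens2_cases)
      (use l that in \<open>auto simp: weight_def src_P wcmp_def length_Suc_conv list_all2_Cons1\<close>)
qed

lemma weight_gen3:
  assumes g: "g \<in> gens P 3" and l: "length l = length (atoms1 (src P (gsrc P 3 g)))" and pos: "lpos l"
  shows "lle (sem P weight (gtgt P 3 g) l) (sem P weight (gsrc P 3 g) l)" "sem P weight (gtgt P 3 g) l \<noteq> sem P weight (gsrc P 3 g) l"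
proof -
  have "lle (sem P weight (gtgt P 3 g) l) (sem P weight (gsrc P 3 g) l) \<and> sem P weight (gtgt P 3 g) l \<noteq> sem P weight (gsrc P 3 g) l"
    using g
  proof (cases rule: gens3_cases)
    case (7 a b c)
    then obtain x y u where "l = [x, y, u]" using l by (auto simp: src_P wcmp_def length_Suc_conv)
    then show ?thesis using 7 pos mu_decr[of x y] by (simp add: weight_def src_P wcmp_def)
  qed (use l pos in \<open>auto simp: weight_def src_P wcmp_def length_Suc_conv\<close>)
  then show "lle (sem P weight (gtgt P 3 g) l) (sem P weight (gsrc P 3 g) l)" "sem P weight (gtgt P 3 g) l \<noteq> sem P weight (gsrc P 3 g) l"
    by blast+
qed

end

lemma terminating_PFonct:
  assumes "f \<in> C \<rightarrow> D" shows "three_terminating (PFonct C D f)"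
proof -
  interpret pf_typed C D f 3 by unfold_locales fact
  interpret T: typed_data P 3 3 by unfold_locales (fact wt3 dims)+
  interpret O: sem_order P weight
    by unfold_locales (use weight_gen2 weight_gen3 in simp_all)
  show ?thesis by (rule O.terminating)
qed

theorem theorem3p2p7:
  fixes C :: "'c set" and D :: "'d set" and f :: "'c \<Rightarrow> 'd"
  assumes "f \<in> C \<rightarrow> D"
  shows "three_convergent (PFonct C D f) \<and>
    three_coherent (free_npcat 4 2 (PFonct C D f))"
  unfolding three_convergent_def
  using terminating_PFonct[OF assms] confluent_PFonct[OF assms] coherent_PFonct[OF assms] by blast

end
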